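(* For every integer $m\ge 2$ there exists a constant $C>0$, independent of the mesh size $h$ and of the polynomial degree $k$, such that for every integer $k\ge m-1$ (so that $2\le m\le k+1$), every mesh of the family, and every $f\in L^2(\Omega)$, the following holds. Let $u\in H^1_0(\Omega)$ be the solution of $(\nabla u,\nabla v)_\Omega=(f,v)_\Omega$ for all $v\in H^1_0(\Omega)$, and let $(u_h,\mu_h)\in\mathcal U_h^k\times\mathcal M_h^k$ be the HHO solution, i.e. $\underline a_h^k((u_h,\mu_h),(v_h,\nu_h))=(f,v_h)_\Omega$ for all $(v_h,\nu_h)\in\mathcal U_h^k\times\mathcal M_h^k$. If $u\in H^m(\mathcal T_h)$, then $$\|(u_h,\mu_h)-(\Pi_{\mathcal T_h}^k u,\Pi_{\mathcal F_h}^k u)\|_{\underline a_h^k}\le C\Big(\frac hk\Big)^{m-1}\|u\|_{m,h}.$$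
   Context: **Mesh.** $\Omega\subset\mathbb R^d$, $d\in\{2,3\}$, is a convex polytope; $h_X$ is the diameter of $X$. $(\mathcal T_h,\mathcal F_h)_h$ is a regular polytopal mesh sequence: $\mathcal T_h$ is a finite set of disjoint polytopes (elements) whose closures cover $\overline\Omega$; $\mathcal F_h$ is a finite set of disjoint planar faces whose closures cover $\bigcup_{T}\partial T$, each face being contained either in $\partial T_1\cap\partial T_2$ for two distinct elements or in $\partial T\cap\partial\Omega$ for one element; and there are $\rho\in(0,1)$ independent of $h$ and, for each $h$, a conforming simplicial submesh such that each simplex $S$ lies in a unique $T\in\mathcal T_h$, each simplicial face is either contained in or disjoint from any given $F\in\mathcal F_h$, $\rho h_S\le r_S$ ($r_S$ the inradius of $S$) and $\rho h_T\le h_S$ if $S\subseteq T$. Set $h=\max_T h_T$; the mesh is quasi-uniform: $h\le C_{qu}h_T$ for all $T$, with $C_{qu}$ independent of $h$. All elements are convex. $\mathcal F_T=\{F\in\mathcal F_h:F\subset\partial T\}$, $\Gamma_h=\bigcup_{F\in\mathcal F_h}\overline F$, and $\boldsymbol n_{\partial T}$ is the outward unit normal to $T$. **Notation.** $(\cdot,\cdot)_X,\|\cdot\|_X$ are the $L^2(X)$ inner product and norm, $\|\cdot\|_{m,X}$ the $H^m(X)$ norm; $H^m(\mathcal T_h)=\{v\in L^2(\Omega):v|_T\in H^m(T)\ \forall T\}$ with $\|v\|_{m,h}^2=\sum_T\|v\|_{m,T}^2$. $\mathbb P^k(X)$: polynomials of total degree $\le k$ on $X$; $\mathbb P^k(\mathcal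 T_h),\mathbb P^k(\mathcal F_h),\mathbb P^k(\mathcal F_T)$: the broken polynomial spaces on elements, on faces, and on the faces of $T$. $\Pi_T^k,\Pi_{\mathcal T_h}^k,\Pi_{\mathcal F_T}^k,\Pi_{\mathcal F_h}^k$: $L^2$-orthogonal projectors onto $\mathbb P^k(T),\mathbb P^k(\mathcal T_h),\mathbb P^k(\mathcal F_T),\mathbb P^k(\mathcal F_h)$. **HHO scheme** ($k\ge1$). $\mathcal U_h^k=\mathbb P^k(\mathcal T_h)$, $\mathcal M_h^k=\{\mu_h\in\mathbb P^k(\mathcal F_h):\mu_h|_F=0\text{ for all }F\subset\partial\Omega\}$, $\mathcal U_T^k=\mathbb P^k(T)$, $\mathcal M_T^k=\mathbb P^k(\mathcal F_T)$; $(v_T,\nu_T)$ is the restriction of $(v_h,\nu_h)$ to $T$ and its faces. The gradient reconstruction $\boldsymbol G_T^k:\mathcal U_T^k\times\mathcal M_T^k\to\mathbb P^k(T)^d$ is defined by $(\boldsymbol G_T^k(v_T,\nu_T),\boldsymbol\tau)_T=(\nabla v_T,\boldsymbol\tau)_T+(\nu_T-v_T,\boldsymbol\tau\cdot\boldsymbol n_{\partial T})_{\partial T}$ for all $\boldsymbol\tau\in\mathbb P^k(T)^d$. The potential reconstruction $p_T^{k+1}(v_T,\nu_T)\in\mathbb P^{k+1}(T)$ is defined by $(\nabla p_T^{k+1}(v_T,\nu_T),\nabla w)_T=(\boldsymbol G_T^k(v_T,\nu_T),\nabla w)_T$ for all $w\in\mathbb P^{k+1}(T)$ and $\int_Tp_T^{k+1}(v_T,\nu_T)=\int_Tv_T$.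 Put $(\delta_T^k,\delta_{\partial T}^k)(v_T,\nu_T)=(v_T,\nu_T)-(\Pi_T^kp,\Pi_{\mathcal F_T}^kp)$ with $p=p_T^{k+1}(v_T,\nu_T)$. For $\underline u=(u_T,\mu_T)$, $\underline v=(v_T,\nu_T)$, $$\underline s_T^k(\underline u,\underline v)=\tfrac{k}{h_T}\big(\delta_{\partial T}^k\underline u-\delta_T^k\underline u,\delta_{\partial T}^k\underline v-\delta_T^k\underline v\big)_{\partial T},\qquad \underline a_T^k(\underline u,\underline v)=(\boldsymbol G_T^k\underline u,\boldsymbol G_T^k\underline v)_T+\underline s_T^k(\underline u,\underline v),$$ $\underline a_h^k=\sum_{T}\underline a_T^k$ (applied to the restrictions), and $\|\cdot\|_{\underline a_h^k}=\underline a_h^k(\cdot,\cdot)^{1/2}$. **Standing assumptions** (constants independent of $h$, $T$ and $k$). (i) For $k\ge1$, $1\le m\le k+1$, $v\in H^m(T)$: $\|v-\Pi_T^kv\|_{\partial T}\lesssim (h_T/k)^{m-1/2}\|v\|_{m,T}$ and $\|v-\Pi_T^kv\|_{\partial T}\lesssim(h_T/k)^{1/2}\|\nabla v\|_T$. (ii) Elliptic regularity: for $D=\Omega$ or $D=T\in\mathcal T_h$ and $g\in L^2(D)$, the solution $w\in H_0^1(D)$ of $(\nabla w,\nabla v)_D=(g,v)_D$ for all $v\in H_0^1(D)$ is in $H^2(D)$ with $\|w\|_{2,D}\lesssim\|g\|_D$. Constants may depend on $d$, $\Omega$, the mesh regularity and quasi-uniformity parameters, the constants in the standing assumptions, and $m$.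 *)

theory Defs
  imports "HOL-Analysis.Analysis" "HOL-Library.Multiset"
begin

section \<open>Square-integrable functions and polynomials\<close>

definition square_integrable :: "'a measure \<Rightarrow> ('a \<Rightarrow> real) \<Rightarrow> bool" where
  "square_integrable M f \<longleftrightarrow> f \<in> borel_measurable M \<and> integrable M (\<lambda>x. (f x)\<^sup>2)"

definition l2_inner :: "'a measure \<Rightarrow> ('a \<Rightarrow> 'b::real_inner) \<Rightarrow> ('a \<Rightarrow> 'b) \<Rightarrow> real" where
  "l2_inner M f g = (\<integral>x. f x \<bullet> g x \<partial>M)"

definition l2_norm :: "'a measure \<Rightarrow> ('a \<Rightarrow> 'b::real_inner) \<Rightarrow> real" where
  "l2_norm M f = sqrt (l2_inner M f f)"

text \<open>A multi-index is a finite multiset of coordinate directions; its order is its size.\<close>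

definition multi_indices :: "nat \<Rightarrow> 'a::euclidean_space multiset set" where
  "multi_indices m = {\<alpha>. set_mset \<alpha> \<subseteq> Basis \<and> size \<alpha> \<le> m}"

text \<open>Polynomials of total degree at most \<open>k\<close>, as functions on the whole space. A polynomial on
  an element or on a planar face is represented by such a function; on a face only its values on
  the face matter, and every polynomial in the coordinates of the hyperplane arises in this way.\<close>

definition poly_space :: "nat \<Rightarrow> ('a::euclidean_space \<Rightarrow> real) set" where
  "poly_space k = {p. \<exists>c. p = (\<lambda>x. \<Sum>\<alpha>\<in>multi_indices k. c \<alpha> * (\<Prod>b\<in>#\<alpha>. x \<bullet> b))}"

definition vec_poly_space :: "nat \<Rightarrow> ('a::euclidean_space \<Rightarrow> 'a) set" where
  "vec_poly_space k = {\<tau>. \<forall>b\<in>Basis. (\<lambda>x. \<tau> x \<bullet> b) \<in> poly_space k}"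

text \<open>The projection of \<open>v\<close> is unique almost everywhere with respect to \<open>M\<close>. For a measure on a
  face it is not unique as a function on the whole space, whence the choice operator.\<close>

definition l2_proj :: "'a::euclidean_space measure \<Rightarrow> nat \<Rightarrow> ('a \<Rightarrow> real) \<Rightarrow> 'a \<Rightarrow> real" where
  "l2_proj M k v = (SOME p. p \<in> poly_space k \<and>
     (\<forall>q\<in>poly_space k. l2_inner M p q = l2_inner M v q))"

definition grad :: "('a::euclidean_space \<Rightarrow> real) \<Rightarrow> 'a \<Rightarrow> 'a" where
  "grad p x = (THE D. GDERIV p x :> D)"


section \<open>Surface measure on planar faces\<close>

text \<open>Lebesgue measure on an affine subspace \<open>H\<close>: the image of the product Lebesgue measure under
  orthonormal coordinates of \<open>H\<close> (compare \<open>lborel_def\<close>). By translation and rotation invariance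
  it does not depend on the chosen origin and orthonormal basis.\<close>

definition affine_lborel :: "'a::euclidean_space set \<Rightarrow> 'a measure" where
  "affine_lborel H =
     (let a = (SOME a. a \<in> H);
          B = (SOME B. pairwise orthogonal B \<and> (\<forall>b\<in>B. norm b = 1) \<and> span B = (\<lambda>x. x - a) ` H)
      in distr (\<Pi>\<^sub>M b\<in>B. lborel) borel (\<lambda>f. a + (\<Sum>b\<in>B. f b *\<^sub>R b)))"

definition face_measure :: "'a::euclidean_space set \<Rightarrow> 'a measure" where
  "face_measure F = restrict_space (completion (affine_lborel (affine hull F))) F"


section \<open>Sobolev spaces\<close>

primrec iter_deriv :: "'a::euclidean_space list \<Rightarrow> ('a \<Rightarrow> real) \<Rightarrow> 'a \<Rightarrow> real" where
  "iter_deriv [] \<phi> = \<phi>"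
| "iter_deriv (b # bs) \<phi> = (\<lambda>x. frechet_derivative (iter_deriv bs \<phi>) (at x) b)"

definition smooth_fun :: "('a::euclidean_space \<Rightarrow> real) \<Rightarrow> bool" where
  "smooth_fun \<phi> \<longleftrightarrow> (\<forall>bs x. set bs \<subseteq> Basis \<longrightarrow> iter_deriv bs \<phi> differentiable (at x))"

definition test_function :: "'a::euclidean_space set \<Rightarrow> ('a \<Rightarrow> real) \<Rightarrow> bool" where
  "test_function D \<phi> \<longleftrightarrow> smooth_fun \<phi> \<and>
     compact (closure {x. \<phi> x \<noteq> 0}) \<and> closure {x. \<phi> x \<noteq> 0} \<subseteq> D"

text \<open>Functions on an open set \<open>D\<close> are total functions of which only the values on \<open>D\<close> matter.
  The list \<open>bs\<close> ranges over the orderings of the multi-index \<open>\<alpha>\<close>; they all give the same derivative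
  of the smooth function \<open>\<phi>\<close>.\<close>

definition has_weak_deriv ::
  "'a::euclidean_space set \<Rightarrow> 'a multiset \<Rightarrow> ('a \<Rightarrow> real) \<Rightarrow> ('a \<Rightarrow> real) \<Rightarrow> bool" where
  "has_weak_deriv D \<alpha> v g \<longleftrightarrow> square_integrable (lebesgue_on D) g \<and>
     (\<forall>\<phi> bs. test_function D \<phi> \<and> mset bs = \<alpha> \<longrightarrow>
        l2_inner (lebesgue_on D) v (iter_deriv bs \<phi>) =
          (-1) ^ size \<alpha> * l2_inner (lebesgue_on D) g \<phi>)"

definition weak_deriv :: "'a::euclidean_space set \<Rightarrow> 'a multiset \<Rightarrow> ('a \<Rightarrow> real) \<Rightarrow> 'a \<Rightarrow> real" where
  "weak_deriv D \<alpha> v = (SOME g. has_weak_deriv D \<alpha> v g)"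

definition weak_grad :: "'a::euclidean_space set \<Rightarrow> ('a \<Rightarrow> real) \<Rightarrow> 'a \<Rightarrow> 'a" where
  "weak_grad D v x = (\<Sum>b\<in>Basis. weak_deriv D {#b#} v x *\<^sub>R b)"

definition sobolev :: "nat \<Rightarrow> 'a::euclidean_space set \<Rightarrow> ('a \<Rightarrow> real) set" where
  "sobolev m D = {v. square_integrable (lebesgue_on D) v \<and>
     (\<forall>\<alpha>\<in>multi_indices m. \<exists>g. has_weak_deriv D \<alpha> v g)}"

definition sobolev_norm :: "nat \<Rightarrow> 'a::euclidean_space set \<Rightarrow> ('a \<Rightarrow> real) \<Rightarrow> real" where
  "sobolev_norm m D v =
     sqrt (\<Sum>\<alpha>\<in>multi_indices m. (l2_norm (lebesgue_on D) (weak_deriv D \<alpha> v))\<^sup>2)"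

text \<open>\<open>H\<^sub>0\<^sup>1(D)\<close>: the closure of the test functions in \<open>H\<^sup>1(D)\<close>.\<close>

definition sobolev_10 :: "'a::euclidean_space set \<Rightarrow> ('a \<Rightarrow> real) set" where
  "sobolev_10 D = {v \<in> sobolev 1 D. \<exists>\<phi>. (\<forall>n. test_function D (\<phi> n)) \<and>
     (\<lambda>n. sobolev_norm 1 D (\<lambda>x. \<phi> n x - v x)) \<longlonglongrightarrow> 0}"

text \<open>The trace on \<open>F\<close>, a planar face contained in the closure of \<open>D\<close>, is the continuous extension
  of the restriction map from the functions smooth up to the boundary to \<open>H\<^sup>1(D)\<close>.\<close>

definition has_trace ::
  "'a::euclidean_space set \<Rightarrow> 'a set \<Rightarrow> ('a \<Rightarrow> real) \<Rightarrow> ('a \<Rightarrow> real) \<Rightarrow> bool" where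
  "has_trace D F v g \<longleftrightarrow> square_integrable (face_measure F) g \<and>
     (\<exists>\<phi>. (\<forall>n. smooth_fun (\<phi> n)) \<and>
       (\<lambda>n. sobolev_norm 1 D (\<lambda>x. \<phi> n x - v x)) \<longlonglongrightarrow> 0 \<and>
       (\<lambda>n. l2_norm (face_measure F) (\<lambda>x. \<phi> n x - g x)) \<longlonglongrightarrow> 0)"

definition trace :: "'a::euclidean_space set \<Rightarrow> 'a set \<Rightarrow> ('a \<Rightarrow> real) \<Rightarrow> 'a \<Rightarrow> real" where
  "trace D F v = (SOME g. has_trace D F v g)"

definition weak_solution :: "'a::euclidean_space set \<Rightarrow> ('a \<Rightarrow> real) \<Rightarrow> ('a \<Rightarrow> real) \<Rightarrow> bool" where
  "weak_solution D f u \<longleftrightarrow> u \<in> sobolev_10 D \<and>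
     (\<forall>v\<in>sobolev_10 D. l2_inner (lebesgue_on D) (weak_grad D u) (weak_grad D v) =
        l2_inner (lebesgue_on D) f v)"

definition elliptic_regularity :: "real \<Rightarrow> 'a::euclidean_space set \<Rightarrow> bool" where
  "elliptic_regularity C D \<longleftrightarrow>
     (\<forall>g w. square_integrable (lebesgue_on D) g \<and> weak_solution D g w \<longrightarrow>
        w \<in> sobolev 2 D \<and> sobolev_norm 2 D w \<le> C * l2_norm (lebesgue_on D) g)"


section \<open>Meshes\<close>

definition open_polytope :: "'a::euclidean_space set \<Rightarrow> bool" where
  "open_polytope X \<longleftrightarrow> X \<noteq> {} \<and> (\<exists>P. polytope P \<and> X = interior P)"

text \<open>A planar face is a relatively open, not necessarily convex, polytope in a hyperplane.\<close>

definition planar_face :: "'a::euclidean_space set \<Rightarrow> bool" where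
  "planar_face F \<longleftrightarrow> aff_dim F = int DIM('a) - 1 \<and> connected F \<and> F = rel_interior (closure F) \<and>
     (\<exists>Q. finite Q \<and> (\<forall>P\<in>Q. polytope P) \<and> closure F = \<Union>Q)"

definition polytopal_mesh ::
  "'a::euclidean_space set \<Rightarrow> 'a set set \<Rightarrow> 'a set set \<Rightarrow> bool" where
  "polytopal_mesh \<Omega> Th Fh \<longleftrightarrow>
     finite Th \<and> (\<forall>T\<in>Th. open_polytope T) \<and> disjoint Th \<and> (\<Union>T\<in>Th. closure T) = closure \<Omega> \<and>
     finite Fh \<and> (\<forall>F\<in>Fh. planar_face F) \<and> disjoint Fh \<and>
     (\<Union>T\<in>Th. frontier T) \<subseteq> (\<Union>F\<in>Fh. closure F) \<and>
     (\<forall>F\<in>Fh. (\<exists>T1\<in>Th. \<exists>T2\<in>Th. T1 \<noteq> T2 \<and> F \<subseteq> frontier T1 \<inter> frontier T2) \<or>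
             (\<exists>T\<in>Th. F \<subseteq> frontier T \<inter> frontier \<Omega>))"

definition inradius :: "'a::euclidean_space set \<Rightarrow> real" where
  "inradius S = Sup {r. 0 \<le> r \<and> (\<exists>x. cball x r \<subseteq> S)}"

text \<open>The simplices of the submesh are closed whereas the elements and faces of the mesh are
  relatively open; \<open>triangulation\<close> expresses that the submesh is conforming.\<close>

definition regular_mesh ::
  "real \<Rightarrow> 'a::euclidean_space set \<Rightarrow> 'a set set \<Rightarrow> 'a set set \<Rightarrow> bool" where
  "regular_mesh \<rho> \<Omega> Th Fh \<longleftrightarrow> polytopal_mesh \<Omega> Th Fh \<and>
     (\<exists>Sh. triangulation Sh \<and> (\<forall>S\<in>Sh. int DIM('a) simplex S) \<and> \<Union>Sh = closure \<Omega> \<and>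
       (\<forall>S\<in>Sh. \<exists>!T. T \<in> Th \<and> S \<subseteq> closure T) \<and>
       (\<forall>S\<in>Sh. \<forall>\<sigma>. \<sigma> facet_of S \<longrightarrow>
          (\<forall>F\<in>Fh. rel_interior \<sigma> \<subseteq> F \<or> rel_interior \<sigma> \<inter> F = {})) \<and>
       (\<forall>S\<in>Sh. \<rho> * diameter S \<le> inradius S) \<and>
       (\<forall>S\<in>Sh. \<forall>T\<in>Th. S \<subseteq> closure T \<longrightarrow> \<rho> * diameter T \<le> diameter S))"

definition mesh_size :: "'a::euclidean_space set set \<Rightarrow> real" where
  "mesh_size Th = Max (diameter ` Th)"

definition quasi_uniform :: "real \<Rightarrow> 'a::euclidean_space set set \<Rightarrow> bool" where
  "quasi_uniform C Th \<longleftrightarrow> (\<forall>T\<in>Th. mesh_size Th \<le> C * diameter T)"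

definition elem_faces :: "'a::euclidean_space set set \<Rightarrow> 'a set \<Rightarrow> 'a set set" where
  "elem_faces Fh T = {F\<in>Fh. F \<subseteq> frontier T}"

text \<open>The normal of a convex element \<open>T\<close> is constant along a planar face \<open>F\<close> of \<open>T\<close>.\<close>

definition outward_normal :: "'a::euclidean_space set \<Rightarrow> 'a set \<Rightarrow> 'a" where
  "outward_normal T F = (THE n. norm n = 1 \<and> (\<forall>x\<in>F. \<forall>y\<in>F. n \<bullet> (y - x) = 0) \<and>
     (\<forall>x\<in>F. \<forall>y\<in>T. n \<bullet> (y - x) \<le> 0))"

definition broken_sobolev ::
  "nat \<Rightarrow> 'a::euclidean_space set \<Rightarrow> 'a set set \<Rightarrow> ('a \<Rightarrow> real) set" where
  "broken_sobolev m \<Omega> Th =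
     {v. square_integrable (lebesgue_on \<Omega>) v \<and> (\<forall>T\<in>Th. v \<in> sobolev m T)}"

definition broken_norm :: "nat \<Rightarrow> 'a::euclidean_space set set \<Rightarrow> ('a \<Rightarrow> real) \<Rightarrow> real" where
  "broken_norm m Th v = sqrt (\<Sum>T\<in>Th. (sobolev_norm m T v)\<^sup>2)"

text \<open>\<open>bd_proj_error Fh T k v\<close> is the norm of \<open>v - \<Pi>\<^sub>T\<^sup>k v\<close> in \<open>L\<^sup>2\<close> of the boundary of \<open>T\<close>, which up
  to a null set is the disjoint union of the faces of \<open>T\<close>. The constant in the assumption may
  depend on \<open>m\<close>.\<close>

definition bd_proj_error ::
  "'a::euclidean_space set set \<Rightarrow> 'a set \<Rightarrow> nat \<Rightarrow> ('a \<Rightarrow> real) \<Rightarrow> real" where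
  "bd_proj_error Fh T k v = sqrt (\<Sum>F\<in>elem_faces Fh T.
     (l2_norm (face_measure F) (\<lambda>x. trace T F v x - l2_proj (lebesgue_on T) k v x))\<^sup>2)"

definition trace_approximation ::
  "(nat \<Rightarrow> real) \<Rightarrow> 'a::euclidean_space set set \<Rightarrow> 'a set \<Rightarrow> bool" where
  "trace_approximation C Fh T \<longleftrightarrow>
     (\<forall>k m v. 1 \<le> k \<and> 1 \<le> m \<and> m \<le> k + 1 \<and> v \<in> sobolev m T \<longrightarrow>
        bd_proj_error Fh T k v
          \<le> C m * (diameter T / real k) powr (real m - 1/2) * sobolev_norm m T v \<and>
        bd_proj_error Fh T k v
          \<le> C m * (diameter T / real k) powr (1/2) * l2_norm (lebesgue_on T) (weak_grad T v))"


section \<open>The HHO scheme\<close>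

text \<open>Broken polynomials are families of polynomials indexed by the elements, resp. by the faces.
  The local operators take the polynomial \<open>v\<close> on \<open>T\<close> and the whole face family \<open>\<nu>\<close>, of which they
  only use the members on the faces of \<open>T\<close>.\<close>

type_synonym 'a broken = "'a set \<Rightarrow> 'a \<Rightarrow> real"

definition elem_space :: "nat \<Rightarrow> 'a::euclidean_space set set \<Rightarrow> 'a broken set" where
  "elem_space k Th = {v. \<forall>T\<in>Th. v T \<in> poly_space k}"

definition face_space ::
  "nat \<Rightarrow> 'a::euclidean_space set \<Rightarrow> 'a set set \<Rightarrow> 'a broken set" where
  "face_space k \<Omega> Fh = {\<nu>. \<forall>F\<in>Fh. \<nu> F \<in> poly_space k \<and>
     (F \<subseteq> frontier \<Omega> \<longrightarrow> (\<forall>x\<in>F. \<nu> F x = 0))}"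

text \<open>The function on the domain given by a family indexed by the (disjoint) elements.\<close>

definition glue :: "'a::euclidean_space set set \<Rightarrow> 'a broken \<Rightarrow> 'a \<Rightarrow> real" where
  "glue Th v x = (\<Sum>T\<in>Th. indicat_real T x * v T x)"

definition grad_rec ::
  "nat \<Rightarrow> 'a::euclidean_space set set \<Rightarrow> 'a set \<Rightarrow> ('a \<Rightarrow> real) \<Rightarrow> 'a broken \<Rightarrow> 'a \<Rightarrow> 'a" where
  "grad_rec k Fh T v \<nu> = (THE G. G \<in> vec_poly_space k \<and>
     (\<forall>\<tau>\<in>vec_poly_space k.
        l2_inner (lebesgue_on T) G \<tau> = l2_inner (lebesgue_on T) (grad v) \<tau> +
          (\<Sum>F\<in>elem_faces Fh T. l2_inner (face_measure F)
             (\<lambda>x. \<nu> F x - v x) (\<lambda>x. \<tau> x \<bullet> outward_normal T F))))"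

definition pot_rec ::
  "nat \<Rightarrow> 'a::euclidean_space set set \<Rightarrow> 'a set \<Rightarrow> ('a \<Rightarrow> real) \<Rightarrow> 'a broken \<Rightarrow> 'a \<Rightarrow> real" where
  "pot_rec k Fh T v \<nu> = (THE p. p \<in> poly_space (k + 1) \<and>
     (\<forall>w\<in>poly_space (k + 1). l2_inner (lebesgue_on T) (grad p) (grad w) =
        l2_inner (lebesgue_on T) (grad_rec k Fh T v \<nu>) (grad w)) \<and>
     (\<integral>x. p x \<partial>lebesgue_on T) = (\<integral>x. v x \<partial>lebesgue_on T))"

definition delta_elem ::
  "nat \<Rightarrow> 'a::euclidean_space set set \<Rightarrow> 'a set \<Rightarrow> ('a \<Rightarrow> real) \<Rightarrow> 'a broken \<Rightarrow> 'a \<Rightarrow> real" where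
  "delta_elem k Fh T v \<nu> x = v x - l2_proj (lebesgue_on T) k (pot_rec k Fh T v \<nu>) x"

definition delta_face ::
  "nat \<Rightarrow> 'a::euclidean_space set set \<Rightarrow> 'a set \<Rightarrow> ('a \<Rightarrow> real) \<Rightarrow> 'a broken \<Rightarrow> 'a broken" where
  "delta_face k Fh T v \<nu> F x = \<nu> F x - l2_proj (face_measure F) k (pot_rec k Fh T v \<nu>) x"

definition stab ::
  "nat \<Rightarrow> 'a::euclidean_space set set \<Rightarrow> 'a set \<Rightarrow>
     ('a \<Rightarrow> real) \<Rightarrow> 'a broken \<Rightarrow> ('a \<Rightarrow> real) \<Rightarrow> 'a broken \<Rightarrow> real" where
  "stab k Fh T u \<mu> v \<nu> = real k / diameter T *
     (\<Sum>F\<in>elem_faces Fh T. l2_inner (face_measure F)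
        (\<lambda>x. delta_face k Fh T u \<mu> F x - delta_elem k Fh T u \<mu> x)
        (\<lambda>x. delta_face k Fh T v \<nu> F x - delta_elem k Fh T v \<nu> x))"

definition local_form ::
  "nat \<Rightarrow> 'a::euclidean_space set set \<Rightarrow> 'a set \<Rightarrow>
     ('a \<Rightarrow> real) \<Rightarrow> 'a broken \<Rightarrow> ('a \<Rightarrow> real) \<Rightarrow> 'a broken \<Rightarrow> real" where
  "local_form k Fh T u \<mu> v \<nu> =
     l2_inner (lebesgue_on T) (grad_rec k Fh T u \<mu>) (grad_rec k Fh T v \<nu>) + stab k Fh T u \<mu> v \<nu>"

definition hho_form ::
  "nat \<Rightarrow> 'a::euclidean_space set set \<Rightarrow> 'a set set \<Rightarrow>
     'a broken \<times> 'a broken \<Rightarrow> 'a broken \<times> 'a broken \<Rightarrow> real" where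
  "hho_form k Th Fh = (\<lambda>(u, \<mu>) (v, \<nu>). \<Sum>T\<in>Th. local_form k Fh T (u T) \<mu> (v T) \<nu>)"

definition hho_norm ::
  "nat \<Rightarrow> 'a::euclidean_space set set \<Rightarrow> 'a set set \<Rightarrow> 'a broken \<times> 'a broken \<Rightarrow> real" where
  "hho_norm k Th Fh w = sqrt (hho_form k Th Fh w w)"

definition hho_solution ::
  "nat \<Rightarrow> 'a::euclidean_space set \<Rightarrow> 'a set set \<Rightarrow> 'a set set \<Rightarrow> ('a \<Rightarrow> real) \<Rightarrow>
     'a broken \<Rightarrow> 'a broken \<Rightarrow> bool" where
  "hho_solution k \<Omega> Th Fh f u \<mu> \<longleftrightarrow> u \<in> elem_space k Th \<and> \<mu> \<in> face_space k \<Omega> Fh \<and>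
     (\<forall>v\<in>elem_space k Th. \<forall>\<nu>\<in>face_space k \<Omega> Fh.
        hho_form k Th Fh (u, \<mu>) (v, \<nu>) = l2_inner (lebesgue_on \<Omega>) f (glue Th v))"

definition proj_elems :: "nat \<Rightarrow> ('a::euclidean_space \<Rightarrow> real) \<Rightarrow> 'a broken" where
  "proj_elems k u T = l2_proj (lebesgue_on T) k u"

definition proj_faces ::
  "nat \<Rightarrow> 'a::euclidean_space set \<Rightarrow> ('a \<Rightarrow> real) \<Rightarrow> 'a broken" where
  "proj_faces k \<Omega> u F = l2_proj (face_measure F) k (trace \<Omega> F u)"

end

(* A Pohozaev-type identity on each convex element replaces approximation theory. For the vector
  polynomial t = Pi_k(grad u) - grad p, where p is the reconstructed potential of the interpolant, the
  divergence theorem with the multiplier x - a bounds t on the boundary, hence on T, by the boundary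
  projection errors of u and of grad u. The same multiplier and Euler's identity for homogeneous
  polynomials control p - Pi_k p, which is orthogonal to lower degrees. Consistency then
  only involves these boundary terms, because f = - Laplace u by elliptic regularity and the normal
  fluxes of u cancel across interior faces. *)

theory Submission
 imports Defs
begin

section \<open>Square-integrable functions\<close>

text \<open>The hypotheses control only boundary errors of the element projection, with scaling h/k.
  Inverse or discrete trace inequalities for general polynomials would lose powers of k, so volume
  quantities are expressed through boundary integrals. What makes this possible is that v - Pi_j v
  is orthogonal to the derivatives of polynomials of degree j + 1, so that Green's formula leaves
  only a boundary error (\<open>green_proj\<close>). The Hessians of u and p are symmetric, hence
  the curl of t is such a boundary term; t is orthogonal to gradients of polynomials of degree k +
  1, hence the divergence part of the identity drops out. Convexity and an inscribed ball of radius
  \<kappa> h, \<kappa> = \<rho>^2 / 2, keep the normal component of x - a between \<kappa> h and h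
  on the boundary. The scale is s = sqrt (h / k): errors of u have size s B and errors of grad u
  size B / s, where B is of order (h / k)^(m - 1) times the H^m norm of u, and s^2 k = h balances
  the two. Faces may be nonconvex pieces of facets, so the divergence theorem is proved by counting
  crossings of lines with faces; traces come from the same multiplier identity.\<close>

abbreviation (input) "L2 \<equiv> square_integrable"

abbreviation (input) l2_dist :: "'a measure => ('a => real) => ('a => real) => real" where
 "l2_dist M f g \<equiv> l2_norm M (\<lambda>x. f x - g x)"

abbreviation (input) "h1_dist D f g \<equiv> sobolev_norm 1 D (\<lambda>x. f x - g x)"

abbreviation (input) "l2_lim M f g \<equiv> (\<lambda>n. l2_dist M (f n) g) \<longlonglongrightarrow> 0"

abbreviation (input) "h1_lim D f g \<equiv> (\<lambda>n. h1_dist D (f n) g) \<longlonglongrightarrow> 0"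

lemma L2_measurable [measurable_dest]:
 "L2 M f ==> f \<in> borel_measurable M"
 by (simp add: square_integrable_def)

lemma L2_mult:
 assumes "L2 M f" "L2 M g"
 shows "integrable M (\<lambda>x. f x * g x)"
proof (rule Bochner_Integration.integrable_bound)
 show "integrable M (\<lambda>x. (f x)^2 + (g x)^2)"
  using assms by (auto simp: square_integrable_def)
 show "(\<lambda>x. f x * g x) \<in> borel_measurable M"
  using assms by (auto simp: square_integrable_def)
 have "\<bar>a * b\<bar> \<le> a^2 + b^2" for a b :: real
 proof -
  have "0 \<le> (\<bar>a\<bar> - \<bar>b\<bar>)^2" by simp
  then have "2 * (\<bar>a\<bar> * \<bar>b\<bar>) \<le> a^2 + b^2"
   by (simp add: power2_diff algebra_simps)
  moreover have "0 \<le> \<bar>a\<bar> * \<bar>b\<bar>" by simp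
  ultimately show ?thesis unfolding abs_mult by linarith
 qed
 then show "AE x in M. norm (f x * g x) \<le> norm ((f x)^2 + (g x)^2)"
  by (intro AE_I2) (auto simp: abs_mult)
qed

lemma L2_add:
 assumes "L2 M f" "L2 M g"
 shows "L2 M (\<lambda>x. f x + g x)"
proof -
 have "(\<lambda>x. (f x + g x)^2) = (\<lambda>x. (f x)^2 + (g x)^2 + 2 * (f x * g x))"
  by (simp add: power2_sum mult.assoc)
 then show ?thesis
  using assms L2_mult[OF assms] by (auto simp: square_integrable_def)
qed

lemma L2_cmult:
 "L2 M f ==> L2 M (\<lambda>x. c * f x)"
 by (auto simp: square_integrable_def power_mult_distrib)

lemma L2_minus:
 "L2 M f ==> L2 M (\<lambda>x. - f x)"
 by (auto simp: square_integrable_def)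

lemma L2_diff:
 assumes "L2 M f" "L2 M g"
 shows "L2 M (\<lambda>x. f x - g x)"
 using L2_add[OF assms(1) L2_minus[OF assms(2)]] by simp

lemma L2_zero [simp]: "L2 M (\<lambda>x. 0)"
 by (simp add: square_integrable_def)

lemma L2_sum:
 "(\<And>i. i \<in> I ==> L2 M (f i)) ==> L2 M (\<lambda>x. \<Sum>i\<in>I. f i x)"
 by (induction I rule: infinite_finite_induct) (auto intro: L2_add)

lemma L2_bounded_mult:
 assumes f: "L2 M f" and g: "g \<in> borel_measurable M"
  and le: "AE x in M. \<bar>g x\<bar> \<le> C"
 shows "L2 M (\<lambda>x. g x * f x)"
 unfolding square_integrable_def
proof
 show "(\<lambda>x. g x * f x) \<in> borel_measurable M" using f g by (auto simp: square_integrable_def)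
 show "integrable M (\<lambda>x. (g x * f x)^2)"
 proof (rule Bochner_Integration.integrable_bound)
  show "integrable M (\<lambda>x. C^2 * (f x)^2)" using f by (auto simp: square_integrable_def)
  show "(\<lambda>x. (g x * f x)^2) \<in> borel_measurable M"
   using f g by (auto simp: square_integrable_def)
  show "AE x in M. norm ((g x * f x)^2) \<le> norm (C^2 * (f x)^2)"
   using le
  proof eventually_elim
   case (elim x)
   have "(g x)^2 \<le> C^2" using elim abs_le_square_iff[of "g x" C] by simp
   then show ?case by (simp add: power_mult_distrib mult_right_mono)
  qed
 qed
qed

lemma L2_bounded:
 assumes "finite_measure M" "f \<in> borel_measurable M" "AE x in M. \<bar>f x\<bar> \<le> C"
 shows "L2 M f"
proof -
 interpret finite_measure M by fact
 have "L2 M (\<lambda>x. f x * 1)"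
  by (rule L2_bounded_mult[OF _ assms(2,3)]) (simp add: square_integrable_def)
 then show ?thesis by simp
qed

lemma l2_inner_real: "l2_inner M f g = (\<integral>x. f x * g x \<partial>M)" for f g :: "'a => real"
 by (simp add: l2_inner_def)

lemma l2_inner_commute: "l2_inner M f g = l2_inner M g f"
 by (simp add: l2_inner_def inner_commute)

lemma l2_inner_cong_AE:
 assumes "AE x in M. f x = f' x" "AE x in M. g x = g' x"
  "f \<in> borel_measurable M" "g \<in> borel_measurable M"
  "f' \<in> borel_measurable M" "g' \<in> borel_measurable M"
 shows "l2_inner M f g = l2_inner M f' (g' :: 'a => real)"
 unfolding l2_inner_real by (rule integral_cong_AE) (use assms in auto)

lemma l2_inner_add_left:
 assumes "L2 M f" "L2 M g" "L2 M h"
 shows "l2_inner M (\<lambda>x. f x + g x) h = l2_inner M f h + l2_inner M g h"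
 unfolding l2_inner_real distrib_right
 by (rule Bochner_Integration.integral_add) (auto intro: L2_mult assms)

lemma l2_inner_diff_left:
 assumes "L2 M f" "L2 M g" "L2 M h"
 shows "l2_inner M (\<lambda>x. f x - g x) h = l2_inner M f h - l2_inner M g h"
 unfolding l2_inner_real left_diff_distrib
 by (rule Bochner_Integration.integral_diff) (auto intro: L2_mult assms)

lemma l2_inner_add_right:
 assumes "L2 M f" "L2 M g" "L2 M h"
 shows "l2_inner M h (\<lambda>x. f x + g x) = l2_inner M h f + l2_inner M h g"
 using l2_inner_add_left[OF assms] by (simp add: l2_inner_commute)

lemma l2_inner_diff_right:
 assumes "L2 M f" "L2 M g" "L2 M h"
 shows "l2_inner M h (\<lambda>x. f x - g x) = l2_inner M h f - l2_inner M h g"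
 using l2_inner_diff_left[OF assms] by (simp add: l2_inner_commute)

lemma l2_inner_cmult_left: "l2_inner M (\<lambda>x. c * f x) g = c * l2_inner M f (g :: 'a => real)"
 by (simp add: l2_inner_real mult.assoc)

lemma l2_inner_cmult_right: "l2_inner M f (\<lambda>x. c * g x) = c * l2_inner M f (g :: 'a => real)"
 by (simp add: l2_inner_real mult.left_commute)

lemma l2_inner_zero_left [simp]: "l2_inner M (\<lambda>x. 0) g = 0"
 by (simp add: l2_inner_def)

lemma l2_inner_zero_right [simp]: "l2_inner M g (\<lambda>x. 0) = 0"
 by (simp add: l2_inner_def)

lemma l2_inner_minus_left [simp]: "l2_inner M (\<lambda>x. - f x) g = - l2_inner M f (g :: 'a => real)"
 using l2_inner_cmult_left[of M "-1" f g] by simp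

lemma l2_inner_sum_left:
 assumes "finite I" "\<And>i. i \<in> I ==> L2 M (f i)" "L2 M g"
 shows "l2_inner M (\<lambda>x. \<Sum>i\<in>I. f i x) g = (\<Sum>i\<in>I. l2_inner M (f i) g)"
 unfolding l2_inner_real sum_distrib_right
 by (rule Bochner_Integration.integral_sum) (auto intro: L2_mult assms)

lemma l2_inner_sum_right:
 assumes "finite I" "\<And>i. i \<in> I ==> L2 M (f i)" "L2 M g"
 shows "l2_inner M g (\<lambda>x. \<Sum>i\<in>I. f i x) = (\<Sum>i\<in>I. l2_inner M g (f i))"
 using l2_inner_sum_left[OF assms] by (simp add: l2_inner_commute)

lemma l2_inner_shift: "l2_inner M (\<lambda>x. w x * f x) g = l2_inner M f (\<lambda>x. w x * (g x :: real))"
 by (simp add: l2_inner_real mult_ac)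

lemma l2_inner_self_nonneg [simp]: "0 \<le> l2_inner M f f"
 by (simp add: l2_inner_def)

lemma l2_norm_nonneg [simp]: "0 \<le> l2_norm M f"
 by (simp add: l2_norm_def)

lemma l2_norm_sq: "(l2_norm M f)^2 = l2_inner M f f"
 by (simp add: l2_norm_def)

lemma l2_norm_zero [simp]: "l2_norm M (\<lambda>x. 0) = 0"
 by (simp add: l2_norm_def)

lemma l2_norm_minus [simp]: "l2_norm M (\<lambda>x. - f x) = l2_norm M f"
 by (simp add: l2_norm_def l2_inner_def)

lemma l2_norm_minus_commute: "l2_dist M f g = l2_norm M (\<lambda>x. g x - (f x :: real))"
 using l2_norm_minus[of M "\<lambda>x. f x - g x"] by simp

lemma l2_norm_cong_AE:
 assumes "AE x in M. f x = f' x" "f \<in> borel_measurable M" "f' \<in> borel_measurable M"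
 shows "l2_norm M f = l2_norm M (f' :: 'a => real)"
 unfolding l2_norm_def using l2_inner_cong_AE[where M=M and f=f and f'=f' and g=f and g'=f'] assms by simp

lemma l2_norm_cmult: "l2_norm M (\<lambda>x. c * f x) = \<bar>c\<bar> * l2_norm M (f :: 'a => real)"
 by (simp add: l2_norm_def l2_inner_cmult_left l2_inner_cmult_right real_sqrt_mult
   flip: mult.assoc power2_eq_square)

text \<open>Expand the square norm of \<open>c f - g\<close>, a nonnegative quadratic in \<open>c\<close>.\<close>

lemma cauchy_schwarz_quadratic:
 fixes a b c :: real
 assumes "\<And>t. 0 \<le> t^2 * a - 2 * t * b + c" and "0 \<le> a" "0 \<le> c"
 shows "b^2 \<le> a * c"
proof (cases "a = 0")
 case True
 have "b = 0"
 proof (rule ccontr)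
  assume "b \<noteq> 0"
  \<comment> \<open>For a = 0 the quadratic is affine in t, and this t gives it the value
    -1.\<close>
  then show False using assms(1)[of "(c + 1) / (2 * b)"] True by simp
 qed
 then show ?thesis using True by simp
next
 case False
 then have "0 < a" using assms by simp
 have "0 \<le> (b / a)^2 * a - 2 * (b / a) * b + c" by (rule assms)
 also have "... = c - b^2 / a" using False by (simp add: field_simps power2_eq_square)
 finally show ?thesis using \<open>0 < a\<close> by (simp add: field_simps)
qed

lemma l2_cauchy_schwarz:
 assumes f: "L2 M f" and g: "L2 M g"
 shows "\<bar>l2_inner M f g\<bar> \<le> l2_norm M f * l2_norm M g"
proof -
 have "(l2_inner M f g)^2 \<le> l2_inner M f f * l2_inner M g g"
 proof (rule cauchy_schwarz_quadratic)
  fix t :: real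
  have tf: "L2 M (\<lambda>x. t * f x)" by (rule L2_cmult[OF f])
  have "0 \<le> l2_inner M (\<lambda>x. t * f x - g x) (\<lambda>x. t * f x - g x)" by simp
  also have "... = t^2 * l2_inner M f f - 2 * t * l2_inner M f g + l2_inner M g g"
   by (simp add: l2_inner_diff_left l2_inner_diff_right tf f g L2_diff
     l2_inner_cmult_left l2_inner_cmult_right l2_inner_commute[of M g f]
     power2_eq_square algebra_simps)
  finally show "0 \<le> t^2 * l2_inner M f f - 2 * t * l2_inner M f g + l2_inner M g g" .
 qed simp_all
 then have "\<bar>l2_inner M f g\<bar>^2 \<le> (l2_norm M f * l2_norm M g)^2"
  by (simp add: power_mult_distrib l2_norm_sq)
 then show ?thesis by (rule power2_le_imp_le) simp
qed

lemma l2_triangle: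
 assumes f: "L2 M f" and g: "L2 M g"
 shows "l2_norm M (\<lambda>x. f x + g x) \<le> l2_norm M f + l2_norm M g"
proof (rule power2_le_imp_le)
 have "(l2_norm M (\<lambda>x. f x + g x))^2 = (l2_norm M f)^2 + (l2_norm M g)^2 + 2 * l2_inner M f g"
  by (simp add: l2_norm_sq l2_inner_add_left l2_inner_add_right f g L2_add
    l2_inner_commute[of M g f])
 then show "(l2_norm M (\<lambda>x. f x + g x))^2 \<le> (l2_norm M f + l2_norm M g)^2"
  using l2_cauchy_schwarz[OF f g] by (simp add: power2_sum)
qed simp

lemma l2_triangle_diff:
 assumes f: "L2 M f" and g: "L2 M g"
 shows "l2_dist M f g \<le> l2_norm M f + l2_norm M g"
 using l2_triangle[OF f L2_minus[OF g]] by simp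

lemma l2_triangle_through:
 assumes "L2 M f" "L2 M g" "L2 M h"
 shows "l2_dist M f h \<le> l2_dist M f g + l2_dist M g h"
 using l2_triangle[OF L2_diff[OF assms(1,2)] L2_diff[OF assms(2,3)]]
 by simp

lemma l2_norm_zero_AE:
 assumes f: "L2 M f" and "l2_norm M f = 0"
 shows "AE x in M. f x = 0"
proof -
 have "(\<integral>x. (f x)^2 \<partial>M) = 0"
  using assms(2) l2_norm_sq[of M f] by (simp add: l2_inner_real power2_eq_square)
 then have "AE x in M. (f x)^2 = 0"
  using f by (subst (asm) integral_nonneg_eq_0_iff_AE) (auto simp: square_integrable_def)
 then show ?thesis by simp
qed

lemma l2_norm_mono:
 assumes f: "L2 M f" and g: "L2 M g"
  and "AE x in M. \<bar>f x\<bar> \<le> \<bar>g x\<bar>"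
 shows "l2_norm M f \<le> l2_norm M g"
proof -
 have "(\<integral>x. (f x)^2 \<partial>M) \<le> (\<integral>x. (g x)^2 \<partial>M)"
  by (rule integral_mono_AE) (use assms in \<open>auto simp: square_integrable_def abs_le_square_iff\<close>)
 then show ?thesis by (simp add: l2_norm_def l2_inner_real power2_eq_square)
qed

lemma l2_norm_bounded_mult:
 assumes f: "L2 M f" and g: "g \<in> borel_measurable M"
  and le: "AE x in M. \<bar>g x\<bar> \<le> C" and "0 \<le> C"
 shows "l2_norm M (\<lambda>x. g x * f x) \<le> C * l2_norm M f"
proof -
 have "l2_norm M (\<lambda>x. g x * f x) \<le> l2_norm M (\<lambda>x. C * f x)"
 proof (rule l2_norm_mono)
  show "AE x in M. \<bar>g x * f x\<bar> \<le> \<bar>C * f x\<bar>"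
   using le by eventually_elim (use \<open>0 \<le> C\<close> in \<open>auto simp: abs_mult intro: mult_right_mono\<close>)
 qed (use L2_bounded_mult[OF f g le] L2_cmult[OF f] in auto)
 then show ?thesis using \<open>0 \<le> C\<close> by (simp add: l2_norm_cmult)
qed

lemma l2_inner_tendsto:
 assumes "\<And>n. L2 M (f n)" "L2 M f0" "L2 M g"
  and "l2_lim M f f0"
 shows "(\<lambda>n. l2_inner M (f n) g) \<longlonglongrightarrow> l2_inner M f0 g"
proof -
 have "(\<lambda>n. l2_inner M (f n) g - l2_inner M f0 g) \<longlonglongrightarrow> 0"
 proof (rule Lim_null_comparison)
  show "\<forall>\<^sub>F n in sequentially. norm (l2_inner M (f n) g - l2_inner M f0 g)
    \<le> l2_dist M (f n) f0 * l2_norm M g"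
   using l2_cauchy_schwarz[OF L2_diff[OF assms(1) assms(2)] assms(3)]
   by (auto simp: l2_inner_diff_left assms)
  show "(\<lambda>n. l2_dist M (f n) f0 * l2_norm M g) \<longlonglongrightarrow> 0"
   using tendsto_mult_right[OF assms(4), of "l2_norm M g"] by simp
 qed
 then show ?thesis by (simp add: LIM_zero_iff)
qed

lemma l2_limit_unique:
 assumes "\<And>n. L2 M (f n)" "L2 M g" "L2 M h"
  and "l2_lim M f g" "l2_lim M f h"
 shows "AE x in M. g x = h x"
proof -
 have "(\<lambda>n. l2_dist M (f n) g + l2_dist M (f n) h) \<longlonglongrightarrow> 0"
  using tendsto_add[OF assms(4,5)] by simp
 moreover have "l2_dist M g h \<le> l2_dist M (f n) g + l2_dist M (f n) h" for n
  using l2_triangle_through[OF assms(2,1,3), of n] l2_norm_minus_commute[of M g "f n"] by simp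
 ultimately have "l2_dist M g h \<le> 0"
  by (intro LIMSEQ_le_const[where X="\<lambda>n. l2_dist M (f n) g + l2_dist M (f n) h"]) auto
 then have "l2_dist M g h = 0"
  using l2_norm_nonneg[of M "\<lambda>x. g x - h x"] by linarith
 then have "AE x in M. g x - h x = 0"
  by (intro l2_norm_zero_AE L2_diff assms)
 then show ?thesis by simp
qed

text \<open>The limit is the pointwise one: the increments are absolutely summable almost everywhere, and
 Fatou's lemma bounds the distance of the tails.\<close>

lemma l2_norm_sum_le:
 assumes "finite I" "\<And>i. i \<in> I ==> L2 M (f i)"
 shows "l2_norm M (\<lambda>x. \<Sum>i\<in>I. f i x) \<le> (\<Sum>i\<in>I. l2_norm M (f i))"
 using assms
proof (induction I rule: finite_induct)
 case (insert i I)
 have "l2_norm M (\<lambda>x. f i x + (\<Sum>i\<in>I. f i x)) \<le> l2_norm M (f i) + l2_norm M (\<lambda>x. \<Sum>i\<in>I. f i x)"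
  by (intro l2_triangle L2_sum) (use insert in auto)
 then show ?case using insert by fastforce
qed simp

lemma nn_integral_l2: 
 assumes "L2 M f"
 shows "(\<integral>\<^sup>+x. ennreal ((f x)^2) \<partial>M) = ennreal ((l2_norm M f)^2)"
 using assms unfolding l2_norm_sq l2_inner_real square_integrable_def
 by (subst nn_integral_eq_integral) (auto simp: power2_eq_square)

lemma L2_nnI:
 assumes [measurable]: "f \<in> borel_measurable M"
  and le: "(\<integral>\<^sup>+x. ennreal ((f x)^2) \<partial>M) \<le> ennreal (C^2)" and "0 \<le> C"
 shows "L2 M f" "l2_norm M f \<le> C"
proof -
 have "integrable M (\<lambda>x. (f x)^2)"
  using le by (intro integrableI_bounded) (auto intro: le_less_trans simp: ennreal_less_top)
 then show *: "L2 M f" by (simp add: square_integrable_def)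
 have "ennreal ((l2_norm M f)^2) \<le> ennreal (C^2)"
  using le nn_integral_l2[OF *] by simp
 then have "(l2_norm M f)^2 \<le> C^2" by (simp add: ennreal_le_iff)
 then show "l2_norm M f \<le> C" using \<open>0 \<le> C\<close> by (rule power2_le_imp_le)
qed

lemma l2_fatou:
 assumes f: "\<And>n. L2 M (f n)" and [measurable]: "g \<in> borel_measurable M"
  and lim: "AE x in M. (\<lambda>n. f n x) \<longlonglongrightarrow> g x"
  and le: "\<forall>\<^sub>F n in sequentially. l2_norm M (f n) \<le> C" and "0 \<le> C"
 shows "L2 M g" "l2_norm M g \<le> C"
proof -
 have [measurable]: "f n \<in> borel_measurable M" for n using f by auto
 have "(\<integral>\<^sup>+x. ennreal ((g x)^2) \<partial>M) = (\<integral>\<^sup>+x. liminf (\<lambda>n. ennreal ((f n x)^2)) \<partial>M)"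
 proof (rule nn_integral_cong_AE, use lim in eventually_elim)
  case (elim x)
  have "(\<lambda>n. ennreal ((f n x)^2)) \<longlonglongrightarrow> ennreal ((g x)^2)"
   by (intro tendsto_intros elim) 
  then show ?case by (intro lim_imp_Liminf[symmetric]) simp_all
 qed
 also have "... \<le> liminf (\<lambda>n. \<integral>\<^sup>+x. ennreal ((f n x)^2) \<partial>M)"
  by (rule nn_integral_liminf) auto
 also have "... \<le> ennreal (C^2)"
 proof -
  have "\<forall>\<^sub>F n in sequentially. (\<integral>\<^sup>+x. ennreal ((f n x)^2) \<partial>M) \<le> ennreal (C^2)"
   using le by eventually_elim (auto simp: nn_integral_l2[OF f] intro!: ennreal_leI power_mono)
  then have "liminf (\<lambda>n. \<integral>\<^sup>+x. ennreal ((f n x)^2) \<partial>M) \<le> liminf (\<lambda>n::nat. ennreal (C^2))"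
   by (rule Liminf_mono)
  then show ?thesis by (simp add: Liminf_const)
 qed
 finally have *: "(\<integral>\<^sup>+x. ennreal ((g x)^2) \<partial>M) \<le> ennreal (C^2)" .
 show "L2 M g" "l2_norm M g \<le> C"
  using L2_nnI[OF _ * \<open>0 \<le> C\<close>] by auto
qed

text \<open>Summable increments instead of the Cauchy property: \<open>trace_cauchy\<close> passes
  to a subsequence with geometric errors, which is all the generality needed.\<close>

lemma l2_complete:
 assumes f: "\<And>n. L2 M (f n)"
  and summ: "summable (\<lambda>n. l2_dist M (f (Suc n)) (f n))"
 shows "\<exists>g. L2 M g \<and> l2_lim M f g"
proof -
 define d where "d n x = \<bar>f (Suc n) x - f n x\<bar>" for n x
 define a where "a n = l2_dist M (f (Suc n)) (f n)" for n
 have [measurable]: "f n \<in> borel_measurable M" for n using f by auto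
 have sd: "L2 M (d n)" for n
  using L2_diff[OF f f, of "Suc n" n]
  by (auto simp: square_integrable_def d_def[abs_def])
 have nd: "l2_norm M (d n) = a n" for n
  by (simp add: l2_norm_def l2_inner_real d_def a_def)
 have [measurable]: "d n \<in> borel_measurable M" for n using sd by auto
 have a0: "0 \<le> a n" for n by (simp add: a_def)
 have sa: "summable a" using summ by (simp add: a_def[abs_def])
 define S where "S n x = (\<Sum>i<n. d i x)" for n x
 have [measurable]: "S n \<in> borel_measurable M" for n by (simp add: S_def[abs_def])
 have sS: "L2 M (S n)" for n
  unfolding S_def[abs_def] by (intro L2_sum sd)
 have nS: "l2_norm M (S n) \<le> suminf a" for n
 proof -
  have "l2_norm M (S n) \<le> (\<Sum>i<n. a i)"
   unfolding S_def[abs_def] using l2_norm_sum_le[of "{..<n}" M d] sd nd by simp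
  also have "... \<le> suminf a" using sa a0 by (intro sum_le_suminf) auto
  finally show ?thesis .
 qed
 \<comment> \<open>Monotone convergence for the squares of the increasing partial sums
   \<open>S n\<close>: their norms stay below the sum of all increments, so their supremum is finite
   almost everywhere.\<close>
 have "AE x in M. summable (\<lambda>n. d n x)"
 proof -
  have "(\<integral>\<^sup>+x. (SUP n. ennreal ((S n x)^2)) \<partial>M) = (SUP n. \<integral>\<^sup>+x. ennreal ((S n x)^2) \<partial>M)"
  proof (rule nn_integral_monotone_convergence_SUP)
   show "incseq (\<lambda>n x. ennreal ((S n x)^2))"
   proof -
    have "S n x \<le> S n' x" "0 \<le> S n x" if "n \<le> n'" for n n' x
     unfolding S_def using that by (auto simp: d_def intro!: sum_mono2 sum_nonneg)
    then show ?thesis by (auto simp: incseq_def le_fun_def intro!: ennreal_leI power_mono)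
   qed
  qed auto
  also have "... \<le> ennreal ((suminf a)^2)"
   by (intro SUP_least) (auto simp: nn_integral_l2[OF sS] intro!: ennreal_leI power_mono nS)
  also have "... < \<infinity>" by simp
  finally have "AE x in M. (SUP n. ennreal ((S n x)^2)) \<noteq> \<infinity>"
   by (intro nn_integral_PInf_AE) auto
  then show ?thesis
  proof eventually_elim
   case (elim x)
   then obtain c where c: "(SUP n. ennreal ((S n x)^2)) = ennreal c" "0 \<le> c"
    by (cases "SUP n. ennreal ((S n x)^2)") auto
   have "S n x \<le> sqrt c" for n
   proof -
    have "ennreal ((S n x)^2) \<le> ennreal c" unfolding c(1)[symmetric] by (rule SUP_upper) simp
    then show ?thesis using c(2) by (intro real_le_rsqrt) (simp add: ennreal_le_iff)
   qed
   then show ?case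
    by (intro summableI_nonneg_bounded[where x="sqrt c"]) (simp_all add: d_def S_def)
  qed
 qed
 then have conv: "AE x in M. convergent (\<lambda>n. f n x)"
 proof (rule AE_mp, intro AE_I2 impI)
  fix x assume "summable (\<lambda>n. d n x)"
  then have "summable (\<lambda>n. f (Suc n) x - f n x)"
   unfolding d_def by (rule summable_rabs_cancel)
  then have "convergent (\<lambda>n. \<Sum>i<n. f (Suc i) x - f i x)"
   by (rule summable_iff_convergent[THEN iffD1])
  moreover have "(\<lambda>n. \<Sum>i<n. f (Suc i) x - f i x) = (\<lambda>n. f n x - f 0 x)"
   by (rule ext) (rule sum_lessThan_telescope)
  ultimately have "convergent (\<lambda>n. f n x - f 0 x)"
   by (rule back_subst)
  from convergent_add[OF this convergent_const[of "f 0 x"]] show "convergent (\<lambda>n. f n x)"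
   by (rule back_subst) (simp add: fun_eq_iff)
 qed
 define g where "g x = lim (\<lambda>n. f n x)" for x
 have [measurable]: "g \<in> borel_measurable M" by (simp add: g_def[abs_def])
 have lim: "AE x in M. (\<lambda>n. f n x) \<longlonglongrightarrow> g x"
  using conv by eventually_elim (simp add: g_def convergent_LIMSEQ_iff)
 have tail: "l2_dist M (f n') (f n) \<le> (\<Sum>i. a (i + n))" if "n \<le> n'" for n n'
 proof -
  have "(\<lambda>x. f n' x - f n x) = (\<lambda>x. \<Sum>i=n..<n'. f (Suc i) x - f i x)"
   using sum_Suc_diff'[OF that, of "\<lambda>i. f i _"] by (intro ext) simp
  then have "l2_dist M (f n') (f n) \<le> (\<Sum>i=n..<n'. a i)"
   using l2_norm_sum_le[of "{n..<n'}" M "\<lambda>i x. f (Suc i) x - f i x"]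
   by (simp add: a_def L2_diff f)
  also have "... = (\<Sum>i<n'-n. a (i + n))"
   using that sum.shift_bounds_nat_ivl[of a 0 n "n' - n"] by (simp add: atLeast0LessThan)
  also have "... \<le> (\<Sum>i. a (i + n))"
   using a0 sa by (intro sum_le_suminf) (auto simp: summable_iff_shift)
  finally show ?thesis .
 qed
 have fat: "L2 M (\<lambda>x. g x - f n x)" "l2_dist M g (f n) \<le> (\<Sum>i. a (i + n))" for n
 proof -
  have "AE x in M. (\<lambda>n'. f n' x - f n x) \<longlonglongrightarrow> g x - f n x"
   using lim by eventually_elim (intro tendsto_intros)
  moreover have "\<forall>\<^sub>F n' in sequentially. l2_dist M (f n') (f n) \<le> (\<Sum>i. a (i + n))"
   using tail[of n] by (auto simp: eventually_sequentially)
  moreover have "0 \<le> (\<Sum>i. a (i + n))" by (intro suminf_nonneg) (auto simp: sa summable_iff_shift a0)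
  ultimately show "L2 M (\<lambda>x. g x - f n x)" "l2_dist M g (f n) \<le> (\<Sum>i. a (i + n))"
   using l2_fatou[of M "\<lambda>n' x. f n' x - f n x" "\<lambda>x. g x - f n x"] L2_diff[OF f f] by auto
 qed
 have sg: "L2 M g"
  using L2_add[OF fat(1)[of 0] f[of 0]] by simp
 have "l2_lim M f g"
 proof (rule Lim_null_comparison)
  show "\<forall>\<^sub>F n in sequentially. norm (l2_dist M (f n) g) \<le> (\<Sum>i. a (i + n))"
   using fat(2) by (auto simp: l2_norm_minus_commute[of M "f _" g])
  show "(\<lambda>n. \<Sum>i. a (i + n)) \<longlonglongrightarrow> 0"
   using suminf_exist_split2[OF sa] by simp
 qed
 then show ?thesis using sg by blast
qed

section \<open>Smooth functions\<close>

definition partial :: "'a::euclidean_space => ('a => real) => 'a => real" where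
 "partial b f x = frechet_derivative f (at x) b"

lemma iter_deriv_Cons_partial: "iter_deriv (b # bs) f = partial b (iter_deriv bs f)"
 by (simp add: partial_def fun_eq_iff)

declare iter_deriv.simps(2) [simp del]
declare iter_deriv_Cons_partial [simp]

lemma iter_deriv_append: "iter_deriv (bs @ cs) f = iter_deriv bs (iter_deriv cs f)"
 by (induction bs) auto

text \<open>Coinduction for smoothness: products, compositions with affine maps and convolutions
  have partial derivatives of the same kind, so exhibiting a family closed under
  \<open>partial\<close> replaces explicit formulas for iterated derivatives.\<close>

lemma smooth_coinduct:
 assumes "f \<in> A" and "\<And>g x. g \<in> A ==> g differentiable (at x)"
  and "\<And>g b. g \<in> A ==> b \<in> Basis ==> partial b g \<in> A"
 shows "smooth_fun f"
proof -
 have "iter_deriv bs f \<in> A" if "set bs \<subseteq> Basis" for bs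
  using that by (induction bs) (use assms in auto)
 then show ?thesis using assms(2) by (auto simp: smooth_fun_def)
qed

lemma smooth_differentiable: "smooth_fun f ==> f differentiable (at x)"
 unfolding smooth_fun_def by (drule spec[of _ "[]"]) simp

lemma smooth_iter_deriv: "smooth_fun f ==> set cs \<subseteq> Basis ==> smooth_fun (iter_deriv cs f)"
 by (simp add: smooth_fun_def flip: iter_deriv_append)

lemma smooth_partial: "smooth_fun f ==> b \<in> Basis ==> smooth_fun (partial b f)"
 using smooth_iter_deriv[of f "[b]"] by simp

lemma smooth_continuous: "smooth_fun f ==> continuous_on S f"
 by (meson continuous_at_imp_continuous_on differentiable_imp_continuous_within smooth_differentiable)

lemma smooth_has_derivative:
 assumes "f differentiable (at x)"
 shows "(f has_derivative (\<lambda>v. \<Sum>b\<in>Basis. (v \<bullet> b) * partial b f x)) (at x)"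
proof -
 let ?D = "frechet_derivative f (at x)"
 have D: "(f has_derivative ?D) (at x)"
  using assms by (simp add: frechet_derivative_works)
 then have lin: "linear ?D" by (rule has_derivative_linear)
 have "?D v = (\<Sum>b\<in>Basis. (v \<bullet> b) * partial b f x)" for v
 proof -
  have "?D v = ?D (\<Sum>b\<in>Basis. (v \<bullet> b) *\<^sub>R b)" by (simp add: euclidean_representation)
  also have "... = (\<Sum>b\<in>Basis. (v \<bullet> b) * partial b f x)"
   using lin by (simp add: linear_sum linear_cmul partial_def)
  finally show ?thesis .
 qed
 then have "?D = (\<lambda>v. \<Sum>b\<in>Basis. (v \<bullet> b) * partial b f x)" by (rule ext)
 with D show ?thesis by simp
qed

lemma partial_eqI: "(f has_derivative D) (at x) ==> partial b f x = D b"
 by (simp add: partial_def frechet_derivative_at[symmetric])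

lemma differentiable_has_derivative:
 "f differentiable (at x) ==> (f has_derivative (\<lambda>v. partial v f x)) (at x)"
 by (simp add: partial_def[abs_def] frechet_derivative_works[symmetric])

lemma partial_const [simp]: "partial b (\<lambda>x. c) = (\<lambda>x. 0)"
 by (rule ext, rule partial_eqI[where D="\<lambda>v. 0"]) simp

lemma partial_add:
 assumes "f differentiable (at x)" "g differentiable (at x)"
 shows "partial b (\<lambda>x. f x + g x) x = partial b f x + partial b g x"
 by (rule partial_eqI[where D="\<lambda>v. partial v f x + partial v g x"])
   (intro derivative_intros differentiable_has_derivative assms)

lemma partial_diff:
 assumes "f differentiable (at x)" "g differentiable (at x)"
 shows "partial b (\<lambda>x. f x - g x) x = partial b f x - partial b g x"
 by (rule partial_eqI[where D="\<lambda>v. partial v f x - partial v g x"])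
   (intro derivative_intros differentiable_has_derivative assms)

lemma partial_mult:
 assumes "f differentiable (at x)" "g differentiable (at x)"
 shows "partial b (\<lambda>x. f x * g x) x = f x * partial b g x + partial b f x * g x"
 by (rule partial_eqI[where D="\<lambda>v. f x * partial v g x + partial v f x * g x"])
   (intro derivative_intros differentiable_has_derivative assms)

lemma partial_cmult:
 assumes "f differentiable (at x)"
 shows "partial b (\<lambda>x. c * f x) x = c * partial b f x"
 using partial_mult[of "\<lambda>x. c", OF _ assms] by simp

lemma partial_sum:
 assumes "finite I" "\<And>i. i \<in> I ==> f i differentiable (at x)"
 shows "partial b (\<lambda>x. \<Sum>i\<in>I. f i x) x = (\<Sum>i\<in>I. partial b (f i) x)"
 by (rule partial_eqI[where D="\<lambda>v. \<Sum>i\<in>I. partial v (f i) x"])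
   (intro has_derivative_sum differentiable_has_derivative assms)

lemma partial_coord: "partial b (\<lambda>x. x \<bullet> c) = (\<lambda>x. b \<bullet> c)"
 by (rule ext, rule partial_eqI[where D="\<lambda>v. v \<bullet> c"]) (auto intro!: derivative_eq_intros)

lemma partial_affine:
 assumes "f differentiable (at (a *\<^sub>R x + c))"
 shows "partial b (\<lambda>x. f (a *\<^sub>R x + c)) x = a * partial b f (a *\<^sub>R x + c)"
proof -
 have "((\<lambda>x. a *\<^sub>R x + c) has_derivative (\<lambda>v. a *\<^sub>R v)) (at x)"
  by (auto intro!: derivative_eq_intros)
 from diff_chain_at[OF this differentiable_has_derivative[OF assms]]
 have "((\<lambda>x. f (a *\<^sub>R x + c)) has_derivative (\<lambda>v. partial (a *\<^sub>R v) f (a *\<^sub>R x + c))) (at x)"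
  by (simp add: o_def)
 moreover have "partial (a *\<^sub>R v) f y = a * partial v f y" if "f differentiable (at y)" for y v
  using linear_cmul[OF has_derivative_linear[OF differentiable_has_derivative[OF that]], of a v] by simp
 ultimately show ?thesis using partial_eqI[of "\<lambda>x. f (a *\<^sub>R x + c)"] assms by simp
qed

lemma differentiable_affine:
 assumes "f differentiable (at (a *\<^sub>R x + c :: 'a::real_normed_vector))"
 shows "(\<lambda>x. f (a *\<^sub>R x + c)) differentiable (at x)"
proof -
 have "(\<lambda>x. a *\<^sub>R x + c) differentiable (at x)" by (intro derivative_intros)
 from differentiable_chain_at[OF this] assms show ?thesis by (simp add: o_def)
qed

lemma smooth_add:
 fixes f g :: "'a::euclidean_space => real"
 assumes "smooth_fun f" "smooth_fun g" shows "smooth_fun (\<lambda>x. f x + g x)"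
proof (rule smooth_coinduct[where A="{h. \<exists>f g. smooth_fun f \<and> smooth_fun g \<and> h = (\<lambda>x. f x + g x)}"])
 fix h :: "'a => real" and b :: 'a
 assume "h \<in> {h. \<exists>f g. smooth_fun f \<and> smooth_fun g \<and> h = (\<lambda>x. f x + g x)}" and b: "b \<in> Basis"
 then obtain f g where fg: "smooth_fun f" "smooth_fun g" "h = (\<lambda>x. f x + g x)" by blast
 have "partial b h = (\<lambda>x. partial b f x + partial b g x)"
  unfolding fg(3) using fg(1,2) by (simp add: fun_eq_iff partial_add smooth_differentiable)
 then show "partial b h \<in> {h. \<exists>f g. smooth_fun f \<and> smooth_fun g \<and> h = (\<lambda>x. f x + g x)}"
  using fg b smooth_partial by blast
qed (use assms in \<open>auto intro: differentiable_add[OF smooth_differentiable smooth_differentiable]\<close>)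

text \<open>By the Leibniz rule derivatives of a product leave the set of products but not the set
  of finite sums of products, which is the family handed to \<open>smooth_coinduct\<close>.\<close>

inductive_set product_sums :: "('a::euclidean_space => real) set" where
 prod: "smooth_fun f ==> smooth_fun g ==> (\<lambda>x. f x * g x) \<in> product_sums"
| add: "h1 \<in> product_sums ==> h2 \<in> product_sums ==> (\<lambda>x. h1 x + h2 x) \<in> product_sums"

lemma smooth_mult:
 fixes f g :: "'a::euclidean_space => real"
 assumes "smooth_fun f" "smooth_fun g" shows "smooth_fun (\<lambda>x. f x * g x)"
proof (rule smooth_coinduct[where A=product_sums])
 show diff: "h differentiable (at x)" if "h \<in> product_sums" for h :: "'a => real" and x
  using that by induction (auto intro!: differentiable_mult differentiable_add intro: smooth_differentiable)
 show "partial b h \<in> product_sums" if "h \<in> product_sums" "b \<in> Basis" for h :: "'a => real" and b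
  using that
 proof induction
  case (prod f g)
  have "partial b (\<lambda>x. f x * g x) = (\<lambda>x. f x * partial b g x + partial b f x * g x)"
   using prod by (simp add: fun_eq_iff partial_mult smooth_differentiable)
  then show ?case using prod by (auto intro!: product_sums.intros smooth_partial)
 next
  case (add h1 h2)
  have "partial b (\<lambda>x. h1 x + h2 x) = (\<lambda>x. partial b h1 x + partial b h2 x)"
   using add diff by (simp add: fun_eq_iff partial_add)
  then show ?case using add by (auto intro!: product_sums.intros)
 qed
qed (use assms in \<open>auto intro: product_sums.intros\<close>)

lemma smooth_const [simp]: "smooth_fun (\<lambda>x. c)"
 by (rule smooth_coinduct[where A="range (\<lambda>c x. c)"]) auto

lemma smooth_cmult: "smooth_fun f ==> smooth_fun (\<lambda>x. c * f x)"
 by (intro smooth_mult smooth_const)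

lemma smooth_diff:
 "smooth_fun f ==> smooth_fun g ==> smooth_fun (\<lambda>x. f x - g x)"
 using smooth_add[of f "\<lambda>x. (-1) * g x"] smooth_cmult[of g "-1"] by simp

lemma smooth_prod:
 "(\<And>i. i \<in> I ==> smooth_fun (f i)) ==> smooth_fun (\<lambda>x. \<Prod>i\<in>I. f i x)"
 by (induction I rule: infinite_finite_induct) (auto intro: smooth_mult)

lemma smooth_coord [simp]: "smooth_fun (\<lambda>x. x \<bullet> c)"
 by (rule smooth_coinduct[where A="insert (\<lambda>x. x \<bullet> c) (range (\<lambda>c x. c))"])
   (auto simp: partial_coord intro!: derivative_intros)

lemma smooth_affine:
 fixes f :: "'a::euclidean_space => real"
 assumes "smooth_fun f" shows "smooth_fun (\<lambda>x. f (a *\<^sub>R x + c))"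
\<comment> \<open>The scalar \<open>s\<close> collects the powers of \<open>a\<close> that the chain
  rule produces.\<close>
proof (rule smooth_coinduct[where A="{h. \<exists>s f. smooth_fun f \<and> h = (\<lambda>x. s * f (a *\<^sub>R x + c))}"])
 show "(\<lambda>x. f (a *\<^sub>R x + c)) \<in> {h. \<exists>s f. smooth_fun f \<and> h = (\<lambda>x. s * f (a *\<^sub>R x + c))}"
  using assms by (auto intro!: exI[of _ 1] exI[of _ f])
 show "h differentiable (at x)"
  if "h \<in> {h. \<exists>s f. smooth_fun f \<and> h = (\<lambda>x. s * f (a *\<^sub>R x + c))}" for h x
  using that differentiable_mult[OF differentiable_const differentiable_affine[OF smooth_differentiable]]
  by blast
 fix h :: "'a => real" and b :: 'a
 assume "h \<in> {h. \<exists>s f. smooth_fun f \<and> h = (\<lambda>x. s * f (a *\<^sub>R x + c))}" and b: "b \<in> Basis"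
 then obtain s f where f: "smooth_fun f" and h: "h = (\<lambda>x. s * f (a *\<^sub>R x + c))" by blast
 have "partial b h = (\<lambda>x. (s * a) * partial b f (a *\<^sub>R x + c))"
  unfolding h using f by (auto simp: fun_eq_iff smooth_differentiable differentiable_affine
    partial_cmult partial_affine)
 then show "partial b h \<in> {h. \<exists>s f. smooth_fun f \<and> h = (\<lambda>x. s * f (a *\<^sub>R x + c))}"
  using smooth_partial[OF f b] by blast
qed

text \<open>The functions \<open>t \<mapsto> t\<^sup>-\<^sup>n exp (-1/t)\<close>, extended by zero; differentiation maps
 them to linear combinations of each other.\<close>

definition flat :: "nat => real => real" where
 "flat n t = (if t \<le> 0 then 0 else inverse t ^ n * exp (- inverse t))"

lemma flat_tendsto: "((\<lambda>t. flat n t) \<longlongrightarrow> 0) (at 0)"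
proof -
 have "((\<lambda>s::real. s ^ n / exp s) \<longlongrightarrow> 0) at_top" by (rule tendsto_power_div_exp_0)
 then have "((\<lambda>t. inverse t ^ n / exp (inverse t)) \<longlongrightarrow> (0::real)) (at_right 0)"
  by (rule filterlim_compose) (rule filterlim_inverse_at_top_right)
 then have "(flat n \<longlongrightarrow> 0) (at_right 0)"
 proof (rule Lim_transform_eventually)
  show "\<forall>\<^sub>F t in at_right 0. inverse t ^ n / exp (inverse t) = flat n t"
   by (auto simp: eventually_at_right_field flat_def exp_minus divide_inverse intro!: exI[of _ 1])
 qed
 moreover have "(flat n \<longlongrightarrow> 0) (at_left 0)"
  by (rule Lim_transform_eventually[where f="\<lambda>_. 0"])
    (auto simp: eventually_at_left_field flat_def intro!: exI[of _ "-1"])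
 ultimately show ?thesis by (simp add: filterlim_split_at)
qed

lemma flat_has_derivative:
 "(flat n has_real_derivative (flat (n + 2) t - real n * flat (n + 1) t)) (at t)"
proof -
 consider "t < 0" | "t = 0" | "0 < t" by linarith
 then show ?thesis
 proof cases
  case 1
  have "((\<lambda>t. 0) has_real_derivative 0) (at t)" by simp
  then have "(flat n has_real_derivative 0) (at t)"
   by (rule has_field_derivative_transform_within_open[where S="{..<0}"]) (use 1 in \<open>auto simp: flat_def\<close>)
  then show ?thesis using 1 by (simp add: flat_def)
 next
  case 2
  \<comment> \<open>At zero the difference quotient is the next function of the family, whose limit
    is \<open>flat_tendsto\<close>.\<close>
  have "(\<lambda>h. (flat n (0 + h) - flat n 0) / h) = flat (Suc n)"
   by (auto simp: fun_eq_iff flat_def field_simps)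
  then have "(flat n has_real_derivative 0) (at 0)"
   using flat_tendsto[of "Suc n"] by (simp add: DERIV_def)
  then show ?thesis using 2 by (simp add: flat_def)
 next
  case 3
  have "((\<lambda>t. inverse t ^ n * exp (- inverse t)) has_real_derivative
    (flat (n + 2) t - real n * flat (n + 1) t)) (at t)"
  proof (cases n)
   case 0
   then show ?thesis using 3
    by (auto intro!: derivative_eq_intros simp: flat_def power2_eq_square field_simps)
  next
   case (Suc m)
   have "((\<lambda>t. inverse t) has_real_derivative - (inverse t * inverse t)) (at t)"
    using 3 by (auto intro!: derivative_eq_intros)
   from DERIV_power[OF this, of n] DERIV_fun_exp[OF DERIV_minus[OF this]]
   have "((\<lambda>t. inverse t ^ n * exp (- inverse t)) has_real_derivative
     (real n * (- (inverse t * inverse t) * inverse t ^ m)) * exp (- inverse t)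
     + (exp (- inverse t) * (inverse t * inverse t)) * inverse t ^ n) (at t)"
    using Suc by (intro DERIV_mult) simp_all
   then show ?thesis using 3 Suc by (simp add: flat_def algebra_simps)
  qed
  then show ?thesis
   by (rule has_field_derivative_transform_within_open[where S="{0<..}"]) (use 3 in \<open>auto simp: flat_def\<close>)
 qed
qed

text \<open>Finite linear combinations of the functions \<open>flat n\<close> composed with
  \<open>l\<close>; for affine \<open>l\<close> this family is closed under
  \<open>partial\<close>.\<close>

inductive_set flat_sums :: "('a::euclidean_space => real) => ('a => real) set" for l where
 base: "(\<lambda>x. c * flat n (l x)) \<in> flat_sums l"
| add: "h1 \<in> flat_sums l ==> h2 \<in> flat_sums l ==> (\<lambda>x. h1 x + h2 x) \<in> flat_sums l"

lemma smooth_flat: "smooth_fun (\<lambda>x. flat 0 (a + x \<bullet> w))"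
proof (rule smooth_coinduct[where A="flat_sums (\<lambda>x. a + x \<bullet> w)"])
 have der: "((\<lambda>x. c * flat n (a + x \<bullet> w)) has_derivative
   (\<lambda>v. c * ((v \<bullet> w) * (flat (n + 2) (a + x \<bullet> w) - real n * flat (n + 1) (a + x \<bullet> w))))) (at x)" for c n and x :: 'a
  by (auto intro!: derivative_eq_intros has_derivative_compose[OF _ flat_has_derivative[unfolded has_field_derivative_def], of "\<lambda>x. a + x \<bullet> w"])
 show diff: "h differentiable (at x)" if "h \<in> flat_sums (\<lambda>x. a + x \<bullet> w)" for h and x
  using that
 proof induction
  case (base c n)
  show ?case using der differentiable_def by blast
 qed auto
 show "partial b h \<in> flat_sums (\<lambda>x. a + x \<bullet> w)" if "h \<in> flat_sums (\<lambda>x. a + x \<bullet> w)" "b \<in> Basis" for h b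
  using that
 proof induction
  case (base c n)
  have "partial b (\<lambda>x. c * flat n (a + x \<bullet> w)) = (\<lambda>x. (c * (b \<bullet> w)) * flat (n + 2) (a + x \<bullet> w)
    + (- (c * (b \<bullet> w) * real n)) * flat (n + 1) (a + x \<bullet> w))"
   by (auto simp: fun_eq_iff partial_eqI[OF der] algebra_simps)
  then show ?case by (simp only:) (intro flat_sums.intros)
 next
  case (add h1 h2)
  have "partial b (\<lambda>x. h1 x + h2 x) = (\<lambda>x. partial b h1 x + partial b h2 x)"
   using add diff by (simp add: fun_eq_iff partial_add)
  then show ?case using add by (auto intro!: flat_sums.intros)
 qed
 show "(\<lambda>x. flat 0 (a + x \<bullet> w)) \<in> flat_sums (\<lambda>x. a + x \<bullet> w)"
  using flat_sums.base[of 1 0] by simp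
qed

lemma bump_exists:
 assumes "0 < r"
 obtains \<rho> :: "'a::euclidean_space => real" where "smooth_fun \<rho>" "\<And>x. 0 \<le> \<rho> x" "0 < \<rho> 0"
  "\<And>x. r \<le> norm x ==> \<rho> x = 0"
proof -
 \<comment> \<open>The norm is at most the sum of the moduli of the coordinates, so a point of norm
   at least r has a coordinate of modulus at least s, where one factor of the product
   vanishes.\<close>
 define s where "s = r / DIM('a)"
 have "0 < s" using assms by (simp add: s_def)
 define \<rho> :: "'a => real" where "\<rho> x = (\<Prod>b\<in>Basis. flat 0 (s + x \<bullet> b) * flat 0 (s + x \<bullet> (- b)))" for x
 have "smooth_fun \<rho>"
  unfolding \<rho>_def[abs_def] by (intro smooth_prod smooth_mult smooth_flat)
 moreover have "0 \<le> \<rho> x" for x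
  unfolding \<rho>_def by (intro prod_nonneg) (auto simp: flat_def)
 moreover have "0 < \<rho> 0"
  unfolding \<rho>_def using \<open>0 < s\<close> by (intro prod_pos) (auto simp: flat_def)
 moreover have "\<rho> x = 0" if "r \<le> norm x" for x
 proof -
  have "\<exists>b\<in>Basis. s \<le> \<bar>x \<bullet> b\<bar>"
  proof (rule ccontr)
   assume "\<not> ?thesis"
   then have "(\<Sum>b\<in>Basis. \<bar>x \<bullet> b\<bar>) < (\<Sum>b\<in>(Basis::'a set). s)"
    by (intro sum_strict_mono) auto
   then show False using that norm_le_l1[of x] by (simp add: s_def)
  qed
  then obtain b where "b \<in> Basis" "s \<le> \<bar>x \<bullet> b\<bar>" by blast
  then have "flat 0 (s + x \<bullet> b) * flat 0 (s + x \<bullet> (- b)) = 0"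
   by (auto simp: flat_def abs_if split: if_splits)
  then show ?thesis unfolding \<rho>_def using \<open>b \<in> Basis\<close> by (intro prod_zero) auto
 qed
 ultimately show ?thesis using that by blast
qed

section \<open>Test functions\<close>

lemma partial_eq_0_outside:
 assumes "x \<notin> closure {x. f x \<noteq> 0}" shows "partial b f x = 0"
proof -
 have "((\<lambda>x. 0) has_derivative (\<lambda>v. 0)) (at x)" by simp
 then have "(f has_derivative (\<lambda>v. 0)) (at x)"
  by (rule has_derivative_transform_within_open[where s="- closure {x. f x \<noteq> 0}"])
    (use assms closure_subset[of "{x. f x \<noteq> 0}"] in auto)
 then show ?thesis by (simp add: partial_eqI)
qed

lemma test_function_partial:
 assumes f: "test_function D f" and b: "b \<in> Basis"
 shows "test_function D (partial b f)"
proof -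
 have "{x. partial b f x \<noteq> 0} \<subseteq> closure {x. f x \<noteq> 0}"
  using partial_eq_0_outside by blast
 then have "closure {x. partial b f x \<noteq> 0} \<subseteq> closure {x. f x \<noteq> 0}"
  by (rule closure_minimal) simp
 moreover from this have "closure {x. partial b f x \<noteq> 0} = closure {x. f x \<noteq> 0} \<inter> closure {x. partial b f x \<noteq> 0}"
  by blast
 ultimately have "compact (closure {x. partial b f x \<noteq> 0}) \<and> closure {x. partial b f x \<noteq> 0} \<subseteq> D"
  using f compact_Int_closed[OF _ closed_closure, of "closure {x. f x \<noteq> 0}" "{x. partial b f x \<noteq> 0}"]
  by (auto simp: test_function_def)
 then show ?thesis
  using f smooth_partial[OF _ b] by (simp add: test_function_def)
qed

lemma test_function_iter_deriv:
 "test_function D f ==> set bs \<subseteq> Basis ==> test_function D (iter_deriv bs f)"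
 by (induction bs) (auto intro: test_function_partial)

lemma test_function_smooth: "test_function D f ==> smooth_fun f"
 by (simp add: test_function_def)

lemma test_function_mono: "test_function D f ==> D \<subseteq> E ==> test_function E f"
 by (auto simp: test_function_def)

lemma test_function_zero: "test_function D \<phi> ==> x \<notin> D ==> \<phi> x = 0"
 using closure_subset[of "{x. \<phi> x \<noteq> 0}"] by (auto simp: test_function_def)

lemma test_function_mult:
 assumes f: "smooth_fun f" and g: "test_function D g"
 shows "test_function D (\<lambda>x. f x * g x)"
proof -
 have "closure {x. f x * g x \<noteq> 0} \<subseteq> closure {x. g x \<noteq> 0}"
  by (intro closure_mono) auto
 moreover from this have "closure {x. f x * g x \<noteq> 0} = closure {x. g x \<noteq> 0} \<inter> closure {x. f x * g x \<noteq> 0}"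
  by blast
 ultimately have "compact (closure {x. f x * g x \<noteq> 0}) \<and> closure {x. f x * g x \<noteq> 0} \<subseteq> D"
  using g compact_Int_closed[OF _ closed_closure, of "closure {x. g x \<noteq> 0}" "{x. f x * g x \<noteq> 0}"]
  by (auto simp: test_function_def)
 then show ?thesis
  using g smooth_mult[OF f] by (simp add: test_function_def)
qed


section \<open>Polynomials\<close>

definition monomial :: "'a::euclidean_space multiset => 'a => real" where
 "monomial \<alpha> x = (\<Prod>b\<in>#\<alpha>. x \<bullet> b)"

lemma monomial_empty [simp]: "monomial {#} x = 1"
 by (simp add: monomial_def)

lemma monomial_add_mset [simp]: "monomial (add_mset b \<alpha>) x = (x \<bullet> b) * monomial \<alpha> x"
 by (simp add: monomial_def)

lemma monomial_union: "monomial (\<alpha> + \<beta>) x = monomial \<alpha> x * monomial \<beta> x"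
 by (simp add: monomial_def)

lemma poly_iff: "p \<in> poly_space k \<longleftrightarrow> (\<exists>c. p = (\<lambda>x. \<Sum>\<alpha>\<in>multi_indices k. c \<alpha> * monomial \<alpha> x))"
 by (simp add: poly_space_def monomial_def)

lemma finite_multi_indices [simp]: "finite (multi_indices k :: 'a::euclidean_space multiset set)"
proof (induction k)
 case 0
 have "multi_indices 0 \<subseteq> {{#}::'a multiset}" by (auto simp: multi_indices_def)
 then show ?case by (rule finite_subset) simp
next
 case (Suc k)
 have "multi_indices (Suc k) \<subseteq> insert {#} ((\<lambda>(b, \<alpha>). add_mset b \<alpha>) ` ((Basis::'a set) \<times> multi_indices k))"
 proof
  fix \<alpha> :: "'a multiset" assume \<alpha>: "\<alpha> \<in> multi_indices (Suc k)"
  show "\<alpha> \<in> insert {#} ((\<lambda>(b, \<alpha>). add_mset b \<alpha>) ` ((Basis::'a set) \<times> multi_indices k))"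
  proof (cases \<alpha>)
   case (add b \<beta>)
   then have "(b, \<beta>) \<in> Basis \<times> multi_indices k" using \<alpha> by (auto simp: multi_indices_def)
   then show ?thesis using add by (auto intro!: image_eqI[of _ _ "(b, \<beta>)"])
  qed simp
 qed
 then show ?case by (rule finite_subset) (use Suc in simp)
qed

lemma poly_add: "p \<in> poly_space k ==> q \<in> poly_space k ==> (\<lambda>x. p x + q x) \<in> poly_space k"
 unfolding poly_iff by (clarsimp, rule_tac x="\<lambda>\<alpha>. c \<alpha> + ca \<alpha>" in exI) (auto simp: sum.distrib algebra_simps)

lemma poly_cmult: "p \<in> poly_space k ==> (\<lambda>x. a * p x) \<in> poly_space k"
 unfolding poly_iff by (clarsimp, rule_tac x="\<lambda>\<alpha>. a * c \<alpha>" in exI) (auto simp: sum_distrib_left algebra_simps)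

lemma poly_zero [simp]: "(\<lambda>x. 0) \<in> poly_space k"
 unfolding poly_iff by (rule exI[of _ "\<lambda>_. 0"]) simp

lemma poly_minus: "p \<in> poly_space k ==> (\<lambda>x. - p x) \<in> poly_space k"
 using poly_cmult[of p k "-1"] by simp

lemma poly_diff: "p \<in> poly_space k ==> q \<in> poly_space k ==> (\<lambda>x. p x - q x) \<in> poly_space k"
 using poly_add[OF _ poly_minus, of p k q] by simp

lemma poly_sum:
 "(\<And>i. i \<in> I ==> p i \<in> poly_space k) ==> (\<lambda>x. \<Sum>i\<in>I. p i x) \<in> poly_space k"
 by (induction I rule: infinite_finite_induct) (auto intro: poly_add)

lemma poly_monomial: "\<alpha> \<in> multi_indices k ==> monomial \<alpha> \<in> poly_space k"
 unfolding poly_iff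
 by (rule exI[of _ "\<lambda>\<beta>. if \<beta> = \<alpha> then 1 else 0"]) (auto simp: if_distrib[of "\<lambda>c. c * _"] cong: if_cong)

lemma poly_induct [consumes 1, case_names monomial add cmult]:
 assumes "p \<in> poly_space k"
  and "\<And>\<alpha>. \<alpha> \<in> multi_indices k ==> Q (monomial \<alpha>)"
  and "\<And>p q. p \<in> poly_space k ==> q \<in> poly_space k ==> Q p ==> Q q ==> Q (\<lambda>x. p x + q x)"
  and "\<And>p a. p \<in> poly_space k ==> Q p ==> Q (\<lambda>x. a * p x)"
 shows "Q p"
proof -
 obtain c where p: "p = (\<lambda>x. \<Sum>\<alpha>\<in>multi_indices k. c \<alpha> * monomial \<alpha> x)"
  using assms(1) by (auto simp: poly_iff)
 have Q0: "Q (\<lambda>x. 0)"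
  using assms(4)[OF poly_monomial[of "{#}"] assms(2)[of "{#}"], of 0] by (simp add: multi_indices_def)
 have "Q (\<lambda>x. \<Sum>\<alpha>\<in>I. c \<alpha> * monomial \<alpha> x) \<and> (\<lambda>x. \<Sum>\<alpha>\<in>I. c \<alpha> * monomial \<alpha> x) \<in> poly_space k"
  if "finite I" "I \<subseteq> multi_indices k" for I
  using that
 proof (induction I rule: finite_induct)
  case (insert \<alpha> I)
  then show ?case
   using assms(3)[of "\<lambda>x. c \<alpha> * monomial \<alpha> x" "\<lambda>x. \<Sum>\<alpha>\<in>I. c \<alpha> * monomial \<alpha> x"] assms(2,4)
    poly_monomial[of \<alpha> k] poly_cmult[of "monomial \<alpha>" k "c \<alpha>"]
   by (auto intro!: poly_add)
 qed (simp add: Q0)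
 from this[of "multi_indices k"] show ?thesis by (simp add: p)
qed

lemma poly_const [simp]: "(\<lambda>x. c) \<in> poly_space k"
 using poly_cmult[OF poly_monomial[of "{#}" k], of c] by (simp add: multi_indices_def)

lemma poly_le: "p \<in> poly_space j ==> j \<le> k ==> p \<in> poly_space k"
 by (induction rule: poly_induct)
   (auto intro!: poly_monomial poly_add poly_cmult simp: multi_indices_def)

lemma poly_mult:
 assumes "p \<in> poly_space j" "q \<in> poly_space k" shows "(\<lambda>x. p x * q x) \<in> poly_space (j + k)"
 using assms(1)
proof (induction rule: poly_induct)
 case (monomial \<alpha>)
 from assms(2) show ?case
 proof (induction rule: poly_induct)
  case (monomial \<beta>)
  have "(\<lambda>x. monomial \<alpha> x * monomial \<beta> x) = monomial (\<alpha> + \<beta>)"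
   by (simp add: fun_eq_iff monomial_union)
  then show ?case using monomial \<open>\<alpha> \<in> multi_indices j\<close>
   by (auto intro!: poly_monomial simp: multi_indices_def)
 qed (auto simp: distrib_left mult.left_commute intro: poly_add poly_cmult)
qed (auto simp: distrib_right mult.assoc intro: poly_add poly_cmult)

lemma poly_coord: "(\<lambda>x. x \<bullet> w) \<in> poly_space (Suc 0)"
proof -
 have "(\<lambda>x. \<Sum>b\<in>Basis. (w \<bullet> b) * monomial {#b#} x) \<in> poly_space (Suc 0)"
  by (intro poly_sum poly_cmult poly_monomial) (auto simp: multi_indices_def)
 moreover have "(\<lambda>x. \<Sum>b\<in>Basis. (w \<bullet> b) * monomial {#b#} x) = (\<lambda>x. x \<bullet> w)"
  by (auto simp: fun_eq_iff euclidean_inner[of _ w] mult.commute)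
 ultimately show ?thesis by simp
qed

lemma poly_shifted_coord: "(\<lambda>x. (x - a) \<bullet> w) \<in> poly_space (Suc 0)"
 unfolding inner_diff_left by (intro poly_diff poly_coord poly_const)

lemma poly_coord_mult: "p \<in> poly_space k ==> (\<lambda>x. ((x - a) \<bullet> w) * p x) \<in> poly_space (Suc k)"
 using poly_mult[OF poly_shifted_coord, of p k] by simp

lemma monomial_differentiable: "monomial \<alpha> differentiable (at x)"
 unfolding monomial_def[abs_def]
 by (induction \<alpha>) (auto intro!: derivative_intros)

lemma poly_differentiable: "p \<in> poly_space k ==> p differentiable (at x)"
 by (induction rule: poly_induct) (auto intro: monomial_differentiable)

lemma partial_monomial_add:
 "partial b (monomial (add_mset c \<alpha>)) x = (x \<bullet> c) * partial b (monomial \<alpha>) x + (b \<bullet> c) * monomial \<alpha> x"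
 using partial_mult[of "\<lambda>x. x \<bullet> c" x "monomial \<alpha>" b] monomial_differentiable[of \<alpha> x]
 by (simp add: partial_coord monomial_def[abs_def])

lemma partial_monomial:
 "set_mset \<alpha> \<subseteq> Basis ==> partial b (monomial \<alpha>) \<in> poly_space (size \<alpha> - 1)"
proof (induction \<alpha>)
 case empty
 have "monomial {#} = (\<lambda>x::'a. 1)" by (simp add: fun_eq_iff)
 then show ?case by simp
next
 case (add c \<alpha>)
 have "monomial \<alpha> \<in> poly_space (size \<alpha>)"
  using add by (intro poly_monomial) (auto simp: multi_indices_def)
 moreover have "(\<lambda>x. (x \<bullet> c) * partial b (monomial \<alpha>) x) \<in> poly_space (size \<alpha>)"
 proof (cases "\<alpha> = {#}")
  case True
  have "monomial {#} = (\<lambda>x::'a. 1)" by (simp add: fun_eq_iff)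
  then show ?thesis using True by simp
 next
  case False
  then show ?thesis
   using poly_mult[OF poly_coord, of "partial b (monomial \<alpha>)" "size \<alpha> - 1" c] add by (auto simp: nonempty_has_size)
 qed
 moreover have "partial b (monomial (add_mset c \<alpha>))
   = (\<lambda>x. (x \<bullet> c) * partial b (monomial \<alpha>) x + (b \<bullet> c) * monomial \<alpha> x)"
  by (rule ext) (rule partial_monomial_add)
 ultimately show ?case using poly_add[OF _ poly_cmult] by (simp del: monomial_add_mset)
qed

text \<open>Truncated subtraction is harmless at degree zero: the derivative is then zero.\<close>

lemma poly_partial: "p \<in> poly_space k ==> partial b p \<in> poly_space (k - 1)"
proof (induction rule: poly_induct)
 case (monomial \<alpha>)
 then show ?case
  using partial_monomial[of \<alpha> b] by (auto simp: multi_indices_def intro: poly_le)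
next
 case (add p q)
 then have "partial b (\<lambda>x. p x + q x) = (\<lambda>x. partial b p x + partial b q x)"
  by (auto simp: fun_eq_iff partial_add poly_differentiable)
 then show ?case using add by (simp add: poly_add)
next
 case (cmult p a)
 then have "partial b (\<lambda>x. a * p x) = (\<lambda>x. a * partial b p x)"
  by (auto simp: fun_eq_iff partial_cmult poly_differentiable)
 then show ?case using cmult by (simp add: poly_cmult)
qed

lemma smooth_poly: "p \<in> poly_space k ==> smooth_fun p"
 by (rule smooth_coinduct[where A="\<Union>k. poly_space k"])
   (auto intro: poly_partial poly_differentiable)

lemma euler_monomial:
 "set_mset \<alpha> \<subseteq> Basis ==> (\<Sum>b\<in>Basis. (x \<bullet> b) * partial b (monomial \<alpha>) x) = size \<alpha> * monomial \<alpha> x"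
proof (induction \<alpha>)
 case empty
 have "monomial {#} = (\<lambda>x::'a. 1)" by (simp add: fun_eq_iff)
 then show ?case by simp
next
 case (add c \<alpha>)
 have "(\<Sum>b\<in>Basis. (x \<bullet> b) * partial b (monomial (add_mset c \<alpha>)) x)
   = (x \<bullet> c) * (\<Sum>b\<in>Basis. (x \<bullet> b) * partial b (monomial \<alpha>) x) + (\<Sum>b\<in>Basis. (x \<bullet> b) * (c \<bullet> b)) * monomial \<alpha> x"
  by (simp add: partial_monomial_add sum.distrib sum_distrib_left sum_distrib_right algebra_simps inner_commute)
 also have "... = real (size (add_mset c \<alpha>)) * monomial (add_mset c \<alpha>) x"
  using add by (simp add: euclidean_inner[symmetric] inner_commute[of c x] algebra_simps)
 finally show ?case .
qed

text \<open>The operator x . grad multiplies the homogeneous part of degree j by j, so subtracting k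
  p removes the top degree. Moving the origin to \<open>a\<close> only adds a directional derivative
  of p, which has lower degree already.\<close>

lemma euler_identity:
 assumes "p \<in> poly_space k"
 shows "(\<lambda>x. (\<Sum>b\<in>Basis. ((x - a) \<bullet> b) * partial b p x) - real k * p x) \<in> poly_space (k - 1)"
proof -
 have "(\<lambda>x. (\<Sum>b\<in>Basis. (x \<bullet> b) * partial b p x) - real k * p x) \<in> poly_space (k - 1)"
  using assms
 proof (induction rule: poly_induct)
  case (monomial \<alpha>)
  then have \<alpha>: "set_mset \<alpha> \<subseteq> Basis" "size \<alpha> \<le> k" by (auto simp: multi_indices_def)
  have "(\<lambda>x. (real (size \<alpha>) - real k) * monomial \<alpha> x) \<in> poly_space (k - 1)"
  proof (cases "size \<alpha> = k")
   case False
   then show ?thesis using \<alpha> by (intro poly_cmult poly_monomial) (auto simp: multi_indices_def)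
  qed simp
  then show ?case using \<alpha> by (simp add: euler_monomial algebra_simps)
 next
  case (add p q)
  have "(\<lambda>x. (\<Sum>b\<in>Basis. (x \<bullet> b) * partial b (\<lambda>x. p x + q x) x) - real k * (p x + q x))
   = (\<lambda>x. ((\<Sum>b\<in>Basis. (x \<bullet> b) * partial b p x) - real k * p x) + ((\<Sum>b\<in>Basis. (x \<bullet> b) * partial b q x) - real k * q x))"
   using add by (simp add: fun_eq_iff partial_add poly_differentiable[OF add(1)]
     poly_differentiable[OF add(2)] sum.distrib algebra_simps)
  then show ?case using add by (simp only: poly_add)
 next
  case (cmult p c)
  have "(\<lambda>x. (\<Sum>b\<in>Basis. (x \<bullet> b) * partial b (\<lambda>x. c * p x) x) - real k * (c * p x))
   = (\<lambda>x. c * ((\<Sum>b\<in>Basis. (x \<bullet> b) * partial b p x) - real k * p x))"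
   using cmult by (simp add: fun_eq_iff partial_cmult poly_differentiable[OF cmult(1)]
     sum_distrib_left algebra_simps)
  then show ?case using cmult by (simp only: poly_cmult)
 qed
 moreover have "(\<lambda>x. \<Sum>b\<in>Basis. (a \<bullet> b) * partial b p x) \<in> poly_space (k - 1)"
  by (intro poly_sum poly_cmult poly_partial assms)
 ultimately have "(\<lambda>x. (\<Sum>b\<in>Basis. (x \<bullet> b) * partial b p x) - real k * p x - (\<Sum>b\<in>Basis. (a \<bullet> b) * partial b p x))
   \<in> poly_space (k - 1)"
  by (rule poly_diff)
 moreover have "(\<lambda>x. (\<Sum>b\<in>Basis. (x \<bullet> b) * partial b p x) - real k * p x - (\<Sum>b\<in>Basis. (a \<bullet> b) * partial b p x))
   = (\<lambda>x. (\<Sum>b\<in>Basis. ((x - a) \<bullet> b) * partial b p x) - real k * p x)"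
  by (auto simp: fun_eq_iff algebra_simps inner_diff_left sum_subtractf)
 ultimately show ?thesis by simp
qed

lemma poly_line:
 assumes "p \<in> poly_space k"
 shows "real_polynomial_function (\<lambda>t. p (a + t *\<^sub>R v))"
 using assms
proof (induction rule: poly_induct)
 case (monomial \<alpha>)
 have "real_polynomial_function (\<lambda>t. monomial \<alpha> (a + t *\<^sub>R v))"
 proof (induction \<alpha>)
  case (add b \<alpha>)
  have "real_polynomial_function (\<lambda>t::real. (a + t *\<^sub>R v) \<bullet> b)"
   unfolding inner_add_left inner_scaleR_left
   by (intro real_polynomial_function.intros(2-4) real_polynomial_function.intros(1)) (rule bounded_linear_ident)
  then show ?case using add by (auto intro: real_polynomial_function.intros)
 qed (auto intro: real_polynomial_function.intros)
 then show ?case .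
qed (auto intro: real_polynomial_function.intros)

text \<open>On the line from the center of the ball to y the polynomial has one variable and
  infinitely many zeros, namely all parameters in an interval.\<close>

lemma poly_zero_on_ball:
 assumes p: "p \<in> poly_space k" and zero: "\<And>x. x \<in> ball a r ==> p x = 0" and "0 < r"
 shows "p y = 0"
proof -
 obtain c n where c: "(\<lambda>t. p (a + t *\<^sub>R (y - a))) = (\<lambda>t. \<Sum>i\<le>n. c i * t ^ i)"
  using poly_line[OF p, of a "y - a"] unfolding real_polynomial_function_iff_sum by blast
 define e where "e = r / (norm (y - a) + 1)"
 have e: "0 < e" "e * norm (y - a) < r"
  using \<open>0 < r\<close> by (auto simp: e_def field_simps add_pos_nonneg intro!: divide_pos_pos)
 have "(\<Sum>i\<le>n. c i * t ^ i) = 0" if "t \<in> {0..e}" for t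
 proof -
  have "t * norm (y - a) \<le> e * norm (y - a)" using that by (intro mult_right_mono) auto
  then have "a + t *\<^sub>R (y - a) \<in> ball a r"
   using that e by (simp add: dist_norm)
  then show ?thesis using zero fun_cong[OF c, of t] by simp
 qed
 then have "{0..e} \<subseteq> {t. (\<Sum>i\<le>n. c i * t ^ i) = 0}" by auto
 moreover have "infinite {0..e}" using e by (simp add: infinite_Icc)
 ultimately have "infinite {t. (\<Sum>i\<le>n. c i * t ^ i) = 0}" using finite_subset by blast
 then have "\<forall>i\<le>n. c i = 0" using polyfun_finite_roots[of c n] by blast
 then show ?thesis using fun_cong[OF c, of 1] by simp
qed

text \<open>Gram--Schmidt orthogonalization for a possibly degenerate form.\<close>

lemma riesz_span:
 fixes B :: "('a => real) => ('a => real) => real" and e :: "'i => 'a => real"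
 assumes I: "finite I" and e: "\<And>i. i \<in> I ==> e i \<in> W"
  and W: "\<And>p q. p \<in> W ==> q \<in> W ==> (\<lambda>x. p x + q x) \<in> W" "\<And>p a. p \<in> W ==> (\<lambda>x. a * p x) \<in> W"
   "(\<lambda>x. 0) \<in> W"
  and B: "\<And>p q. p \<in> W ==> q \<in> W ==> B p q = B q p"
   "\<And>p q r. p \<in> W ==> q \<in> W ==> r \<in> W ==> B (\<lambda>x. p x + q x) r = B p r + B q r"
   "\<And>p r a. p \<in> W ==> r \<in> W ==> B (\<lambda>x. a * p x) r = a * B p r" "\<And>p. p \<in> W ==> 0 \<le> B p p"
  and l: "\<And>p q. p \<in> W ==> q \<in> W ==> l (\<lambda>x. p x + q x) = l p + l q"
   "\<And>p a. p \<in> W ==> l (\<lambda>x. a * p x) = a * l p" "\<And>p. p \<in> W ==> B p p = 0 ==> l p = 0"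
 shows "\<exists>p\<in>{p. \<exists>c. p = (\<lambda>x. \<Sum>i\<in>I. c i * e i x)}. \<forall>q\<in>{p. \<exists>c. p = (\<lambda>x. \<Sum>i\<in>I. c i * e i x)}. B p q = l q"
 using I e l
proof (induction I arbitrary: l rule: finite_induct)
 case empty
 have "l (\<lambda>x. 0) = 0" "B (\<lambda>x. 0) (\<lambda>x. 0) = 0"
  using empty.prems(3)[of "\<lambda>x. 0" 0] B(3)[of "\<lambda>x. 0" "\<lambda>x. 0" 0] W(3) by simp_all
 then show ?case by simp
next
 case (insert j I)
 let ?V = "\<lambda>I. {p. \<exists>c. p = (\<lambda>x. \<Sum>i\<in>I. c i * e i x)}"
 have VW: "?V I \<subseteq> W"
 proof
  fix p assume "p \<in> ?V I"
  then obtain c where p: "p = (\<lambda>x. \<Sum>i\<in>I. c i * e i x)" by blast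
  have "(\<lambda>x. \<Sum>i\<in>J. c i * e i x) \<in> W" if "finite J" "J \<subseteq> I" for J
   using that by (induction J rule: finite_induct) (auto intro!: W insert.prems(1))
  then show "p \<in> W" unfolding p using insert.hyps by blast
 qed
 have ej: "e j \<in> W" using insert.prems by simp
 have Baddr: "B r (\<lambda>x. p x + q x) = B r p + B r q" if "p \<in> W" "q \<in> W" "r \<in> W" for p q r
  using that B(1)[of r "\<lambda>x. p x + q x"] B(1)[of r p] B(1)[of r q] B(2) W(1) by simp
 have Bcr: "B r (\<lambda>x. a * p x) = a * B r p" if "p \<in> W" "r \<in> W" for p r a
  using that B(1)[of r "\<lambda>x. a * p x"] B(1)[of r p] B(3) W(2) by simp
 \<comment> \<open>A null vector of the form is orthogonal to everything. This is what lets the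
   induction hypothesis be applied to the functional \<open>B (e j)\<close>, giving the projection
   \<open>P\<close> of the new vector on the span of the old ones.\<close>
 have CS: "B p q = 0" if "p \<in> W" "q \<in> W" "B q q = 0" for p q
 proof -
  have "(B p q)^2 \<le> B p p * B q q"
  proof (rule cauchy_schwarz_quadratic)
   fix t :: real
   define tp nq where "tp x = t * p x" and "nq x = (-1) * q x" for x
   have *: "tp \<in> W" "nq \<in> W" using that by (auto simp only: tp_def[abs_def] nq_def[abs_def] intro!: W(2))
   have "B tp r = t * B p r" "B nq r = (-1) * B q r" if "r \<in> W" for r
    unfolding tp_def[abs_def] nq_def[abs_def] by (rule B(3); fact)+
   moreover have "B p tp = t * B p p" "B q tp = t * B q p" "B p nq = (-1) * B p q" "B q nq = (-1) * B q q"
    unfolding tp_def[abs_def] nq_def[abs_def] by (rule Bcr; fact)+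
   moreover have "0 \<le> B (\<lambda>x. tp x + nq x) (\<lambda>x. tp x + nq x)"
    by (intro B(4) W(1) *)
   moreover have "B (\<lambda>x. tp x + nq x) (\<lambda>x. tp x + nq x) = B tp tp + B tp nq + (B nq tp + B nq nq)"
    using * by (simp add: B(2) Baddr W(1))
   ultimately have "0 \<le> t * (t * B p p) + t * (- B p q) + (- (t * B q p) + B q q)"
    using * by simp
   then show "0 \<le> t^2 * B p p - 2 * t * B p q + B q q"
    using B(1)[OF that(2,1)] by (simp add: power2_eq_square algebra_simps)
  qed (use that B(4) in auto)
  then show ?thesis using that by simp
 qed
 have IH: "\<exists>p\<in>?V I. \<forall>q\<in>?V I. B p q = m q"
  if "\<And>p q. p \<in> W ==> q \<in> W ==> m (\<lambda>x. p x + q x) = m p + m q"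
   "\<And>p a. p \<in> W ==> m (\<lambda>x. a * p x) = a * m p" "\<And>p. p \<in> W ==> B p p = 0 ==> m p = 0" for m
  by (rule insert.IH) (fact that | (rule insert.prems(1), erule insertI2))+
 have "\<exists>p\<in>?V I. \<forall>q\<in>?V I. B p q = B (e j) q"
  by (rule IH) (erule (1) Baddr[OF _ _ ej] | erule Bcr[OF _ ej] | erule (1) CS[OF ej])+
 then obtain P where P: "P \<in> ?V I" "\<forall>q\<in>?V I. B P q = B (e j) q" by (rule bexE)
 have "\<exists>p\<in>?V I. \<forall>q\<in>?V I. B p q = l q"
  by (rule IH) (fact insert.prems)+
 then obtain p0 where p0: "p0 \<in> ?V I" "\<forall>q\<in>?V I. B p0 q = l q" by (rule bexE)
 have Vadd: "(\<lambda>x. p x + a * q x) \<in> ?V I" if pq: "p \<in> ?V I" "q \<in> ?V I" for p q a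
 proof -
  obtain c d where "p = (\<lambda>x. \<Sum>i\<in>I. c i * e i x)" "q = (\<lambda>x. \<Sum>i\<in>I. d i * e i x)" using pq by blast
  then show ?thesis
   by (auto intro!: exI[of _ "\<lambda>i. c i + a * d i"] simp: sum.distrib sum_distrib_left algebra_simps)
 qed
 define s where "s x = e j x + (-1) * P x" for x
 have sW: "s \<in> W" unfolding s_def[abs_def] using ej P VW by (intro W) auto
 have s_orth: "B s q = 0" if "q \<in> ?V I" for q
 proof -
  have "q \<in> W" "P \<in> W" using that P VW by auto
  then show ?thesis unfolding s_def[abs_def]
   using bspec[OF P(2) that] ej by (simp only: B(2,3) W(2))
 qed
 have orth_s: "B q s = 0" if "q \<in> ?V I" for q
  using s_orth[OF that] B(1) sW VW that by auto
 \<comment> \<open>If the orthogonalized vector is null, \<open>l\<close> vanishes at it by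
   hypothesis and the coefficient is immaterial; otherwise it is the usual Fourier
   coefficient.\<close>
 define t where "t = (if B s s = 0 then 0 else l s / B s s)"
 define p where "p x = p0 x + t * s x" for x
 have insertV: "?V (insert j I) = {q. \<exists>q0 a. q0 \<in> ?V I \<and> q = (\<lambda>x. q0 x + a * s x)}" (is "?L = ?R")
 proof (rule set_eqI, rule iffI)
  fix q assume "q \<in> ?L"
  then obtain c where q: "q = (\<lambda>x. c j * e j x + (\<Sum>i\<in>I. c i * e i x))" using insert.hyps by auto
  have "(\<lambda>x. (\<Sum>i\<in>I. c i * e i x) + c j * P x) \<in> ?V I" by (rule Vadd) (use P in auto)
  then show "q \<in> ?R"
   by (auto intro!: exI[of _ "\<lambda>x. (\<Sum>i\<in>I. c i * e i x) + c j * P x"] exI[of _ "c j"] simp: q s_def fun_eq_iff algebra_simps)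
 next
  fix q assume "q \<in> ?R"
  then obtain q0 a where q: "q0 \<in> ?V I" "q = (\<lambda>x. q0 x + a * s x)" by blast
  have "(\<lambda>x. q0 x + (- a) * P x) \<in> ?V I" by (rule Vadd) (use P q in auto)
  then obtain c where c: "(\<lambda>x. q0 x + (- a) * P x) = (\<lambda>x. \<Sum>i\<in>I. c i * e i x)" by blast
  have "q x = (\<Sum>i\<in>insert j I. (c(j := a)) i * e i x)" for x
  proof -
   have "(\<Sum>i\<in>I. (c(j := a)) i * e i x) = (\<Sum>i\<in>I. c i * e i x)"
    using insert.hyps by (intro sum.cong) auto
   then show ?thesis using insert.hyps fun_cong[OF c, of x] by (simp add: q s_def algebra_simps)
  qed
  then have "q = (\<lambda>x. \<Sum>i\<in>insert j I. (c(j := a)) i * e i x)" by (rule ext)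
  then show "q \<in> ?L" by (intro CollectI exI)
 qed
 have pV: "p \<in> ?V (insert j I)" unfolding insertV p_def[abs_def] using p0(1) by blast
 have "B p q = l q" if "q \<in> ?V (insert j I)" for q
 proof -
  obtain q0 a where q0: "q0 \<in> ?V I" and q: "q = (\<lambda>x. q0 x + a * s x)" using \<open>q \<in> ?V (insert j I)\<close> unfolding insertV by blast
  have W': "p0 \<in> W" "q0 \<in> W" "(\<lambda>x. t * s x) \<in> W" "(\<lambda>x. a * s x) \<in> W" "(\<lambda>x. q0 x + a * s x) \<in> W"
   using p0 q0 VW sW by (auto intro!: W(1,2))
  have "B p q = B p0 q0 + a * B p0 s + t * (B s q0 + a * B s s)"
   unfolding p_def[abs_def] q
   using W' sW by (simp only: B(2,3) Baddr Bcr)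
  also have "... = l q0 + a * (t * B s s)"
   using bspec[OF p0(2) q0] orth_s[OF p0(1)] s_orth[OF q0] by simp
  also have "t * B s s = l s" using insert.prems(4)[OF sW] by (simp add: t_def)
  also have "l q0 + a * l s = l q"
   unfolding q using W' sW insert.prems(2,3) by simp
  finally show ?thesis .
 qed
 then show ?case by (intro bexI[OF _ pV] ballI)
qed

text \<open>The form may be degenerate, because a nonzero polynomial vanishing on the hyperplane of
  a face has norm zero there. Solvability then needs that the functional vanishes on null vectors;
  it comes from the Cauchy-Schwarz inequality in each application to a projection.\<close>

lemma poly_riesz:
 fixes B :: "('a::euclidean_space => real) => ('a => real) => real"
 assumes "\<And>p q. p \<in> poly_space k ==> q \<in> poly_space k ==> B p q = B q p"
   "\<And>p q r. p \<in> poly_space k ==> q \<in> poly_space k ==> r \<in> poly_space k ==> B (\<lambda>x. p x + q x) r = B p r + B q r"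
   "\<And>p r a. p \<in> poly_space k ==> r \<in> poly_space k ==> B (\<lambda>x. a * p x) r = a * B p r"
   "\<And>p. p \<in> poly_space k ==> 0 \<le> B p p"
   "\<And>p q. p \<in> poly_space k ==> q \<in> poly_space k ==> l (\<lambda>x. p x + q x) = l p + l q"
   "\<And>p a. p \<in> poly_space k ==> l (\<lambda>x. a * p x) = a * l p" "\<And>p. p \<in> poly_space k ==> B p p = 0 ==> l p = 0"
 shows "\<exists>p\<in>poly_space k. \<forall>q\<in>poly_space k. B p q = l q"
proof -
 have eq: "poly_space k = {p. \<exists>c. p = (\<lambda>x::'a. \<Sum>\<alpha>\<in>multi_indices k. c \<alpha> * monomial \<alpha> x)}"
  by (auto simp: poly_iff)
 have "\<exists>p\<in>{p. \<exists>c. p = (\<lambda>x::'a. \<Sum>\<alpha>\<in>multi_indices k. c \<alpha> * monomial \<alpha> x)}.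
   \<forall>q\<in>{p. \<exists>c. p = (\<lambda>x. \<Sum>\<alpha>\<in>multi_indices k. c \<alpha> * monomial \<alpha> x)}. B p q = l q"
  by (rule riesz_span[where W="poly_space k"])
    (rule finite_multi_indices poly_monomial poly_add poly_cmult poly_zero assms; assumption)+
 then show ?thesis unfolding eq .
qed

text \<open>The common ground of elements and faces for projections. It does not ask that the inner
  product be definite on polynomials, which fails on faces.\<close>

definition poly_measure :: "'a::euclidean_space measure => bool" where
 "poly_measure M \<longleftrightarrow> (\<forall>k. \<forall>p\<in>poly_space k. L2 M p)"

lemma poly_measureD: "poly_measure M ==> p \<in> poly_space k ==> L2 M p"
 by (auto simp: poly_measure_def)

lemma l2_proj_exists:
 assumes M: "poly_measure M" and v: "L2 M v"
 shows "\<exists>p. p \<in> poly_space k \<and> (\<forall>q\<in>poly_space k. l2_inner M p q = l2_inner M v q)"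
proof -
 have sq: "\<And>p. p \<in> poly_space k ==> L2 M p" using M by (rule poly_measureD)
 have "\<exists>p\<in>poly_space k. \<forall>q\<in>poly_space k. l2_inner M p q = l2_inner M v q"
 proof (rule poly_riesz)
  fix p assume p: "p \<in> poly_space k" "l2_inner M p p = 0"
  then show "l2_inner M v p = 0"
   using l2_cauchy_schwarz[OF v sq[OF p(1)]] by (simp add: l2_norm_def)
 qed (auto simp: l2_inner_add_left l2_inner_add_right l2_inner_cmult_left l2_inner_cmult_right sq v intro: l2_inner_commute)
 then show ?thesis by blast
qed

lemma
 assumes "poly_measure M" "L2 M v"
 shows l2_proj_poly: "l2_proj M k v \<in> poly_space k"
  and l2_proj_inner: "q \<in> poly_space k ==> l2_inner M (l2_proj M k v) q = l2_inner M v q"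
 using someI_ex[OF l2_proj_exists[OF assms, of k]] unfolding l2_proj_def by auto

lemma l2_proj_orth:
 assumes "poly_measure M" "L2 M v" "q \<in> poly_space k"
 shows "l2_inner M (\<lambda>x. v x - l2_proj M k v x) q = 0"
 by (simp add: l2_inner_diff_left[OF assms(2) poly_measureD[OF assms(1) l2_proj_poly[OF assms(1,2)]]
   poly_measureD[OF assms(1,3)]] l2_proj_inner[OF assms])

lemma l2_proj_unique:
 assumes M: "poly_measure M" and p: "p \<in> poly_space k" "q \<in> poly_space k"
  and eq: "\<And>r. r \<in> poly_space k ==> l2_inner M p r = l2_inner M q r"
 shows "AE x in M. p x = q x"
proof -
 have d: "(\<lambda>x. p x - q x) \<in> poly_space k" using p by (rule poly_diff)
 have "l2_inner M (\<lambda>x. p x - q x) (\<lambda>x. p x - q x) = 0"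
  using eq[OF d] poly_measureD[OF M] p d by (simp add: l2_inner_diff_left)
 then have "AE x in M. p x - q x = 0"
  using poly_measureD[OF M d] by (intro l2_norm_zero_AE) (auto simp: l2_norm_def)
 then show ?thesis by simp
qed

lemma l2_proj_norm_le:
 assumes M: "poly_measure M" and v: "L2 M v"
 shows "l2_norm M (l2_proj M k v) \<le> l2_norm M v"
proof (cases "l2_norm M (l2_proj M k v) = 0")
 case False
 have "(l2_norm M (l2_proj M k v))^2 = l2_inner M v (l2_proj M k v)"
  using l2_proj_inner[OF M v l2_proj_poly[OF M v]] by (simp add: l2_norm_sq)
 also have "... \<le> l2_norm M v * l2_norm M (l2_proj M k v)"
  using l2_cauchy_schwarz[OF v poly_measureD[OF M l2_proj_poly[OF M v]]] by (meson abs_le_D1)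
 finally show ?thesis using False l2_norm_nonneg[of M "l2_proj M k v"]
  by (simp add: power2_eq_square)
qed simp

text \<open>Linearity holds only almost everywhere: for a face measure the choice operator in
  \<open>l2_proj\<close> need not choose consistently off the face.\<close>

lemma l2_proj_diff_AE:
 assumes M: "poly_measure M" and v: "L2 M v" and w: "L2 M w"
 shows "AE x in M. l2_proj M k (\<lambda>x. v x - w x) x = l2_proj M k v x - l2_proj M k w x"
proof (rule l2_proj_unique[OF M])
 have vw: "L2 M (\<lambda>x. v x - w x)" using v w by (rule L2_diff)
 show "l2_proj M k (\<lambda>x. v x - w x) \<in> poly_space k"
  "(\<lambda>x. l2_proj M k v x - l2_proj M k w x) \<in> poly_space k"
  using M v w vw by (auto intro: l2_proj_poly poly_diff)
 show "l2_inner M (l2_proj M k (\<lambda>x. v x - w x)) q = l2_inner M (\<lambda>x. l2_proj M k v x - l2_proj M k w x) q"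
  if "q \<in> poly_space k" for q
  using that M v w vw poly_measureD[OF M l2_proj_poly[OF M v]] poly_measureD[OF M l2_proj_poly[OF M w]]
  by (simp add: l2_proj_inner l2_inner_diff_left poly_measureD[OF M that])
qed

lemma grad_poly:
 assumes "p differentiable (at x)"
 shows "grad p x = (\<Sum>b\<in>Basis. partial b p x *\<^sub>R b)"
 unfolding grad_def
proof (rule the_equality)
 have eq: "(\<lambda>v. \<Sum>b\<in>Basis. (v \<bullet> b) * partial b p x) = (\<lambda>v. v \<bullet> (\<Sum>b\<in>Basis. partial b p x *\<^sub>R b))"
  by (simp add: fun_eq_iff inner_sum_right mult.commute)
 show *: "GDERIV p x :> (\<Sum>b\<in>Basis. partial b p x *\<^sub>R b)"
  using smooth_has_derivative[OF assms] unfolding gderiv_def eq .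
 fix D assume "GDERIV p x :> D"
 with * show "D = (\<Sum>b\<in>Basis. partial b p x *\<^sub>R b)"
  unfolding gderiv_def using has_derivative_unique[of p "\<lambda>h. h \<bullet> D" x "\<lambda>h. h \<bullet> (\<Sum>b\<in>Basis. partial b p x *\<^sub>R b)"]
  by (metis (no_types, lifting) vector_eq_ldot)
qed

lemma grad_inner_poly: "p differentiable (at x) ==> b \<in> Basis ==> grad p x \<bullet> b = partial b p x"
 by (simp add: grad_poly inner_sum_left inner_Basis if_distrib cong: if_cong)

section \<open>Surface measure on hyperplanes\<close>

text \<open>Fubini applied to the indicator of \<open>{(x, y). x \<in> A, x + y \<in> B}\<close> in both orders.\<close>

lemma translation_invariant_measure_unique:
 fixes N :: "'a::euclidean_space measure"
 assumes sf: "sigma_finite_measure N" and s: "sets N = sets borel"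
  and inv: "\<And>v. distr N borel (\<lambda>x. x + v) = N"
  and A: "A \<in> sets borel" and B: "B \<in> sets borel"
 shows "emeasure N A * emeasure lborel B = emeasure N B * emeasure lborel A"
proof -
 interpret N: sigma_finite_measure N by fact
 interpret P: pair_sigma_finite N "lborel :: 'a measure"
  by (simp add: pair_sigma_finite_def sf sigma_finite_lborel)
 have [measurable_cong]: "sets N = sets borel" by (rule s)
 have [simp]: "space N = UNIV" using sets_eq_imp_space_eq[OF s] by simp
 note A[measurable] B[measurable]
 have lb: "(\<integral>\<^sup>+y. indicator B (x + y) \<partial>lborel) = emeasure lborel B" for x
 proof -
  have "(\<integral>\<^sup>+y. indicator B y \<partial>lborel) = (\<integral>\<^sup>+y. indicator B y \<partial>distr lborel borel ((+) x))"
   by (simp add: lborel_distr_plus)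
  also have "... = (\<integral>\<^sup>+y. indicator B (x + y) \<partial>lborel)" by (rule nn_integral_distr) auto
  finally show ?thesis by simp
 qed
 have lA: "(\<integral>\<^sup>+y. indicator A (x - y) \<partial>lborel) = emeasure lborel A" for x
 proof -
  have "(\<integral>\<^sup>+y. indicator A y \<partial>lborel) = (\<integral>\<^sup>+y. indicator A y \<partial>distr lborel borel (\<lambda>y. x + (- 1) *\<^sub>R y))"
   using lborel_affine[of "-1" x] by (simp add: density_1)
  also have "... = (\<integral>\<^sup>+y. indicator A (x + (- 1) *\<^sub>R y) \<partial>lborel)" by (rule nn_integral_distr) auto
  finally show ?thesis by simp
 qed
 have "emeasure N A * emeasure lborel B = (\<integral>\<^sup>+x. indicator A x * (\<integral>\<^sup>+y. indicator B (x + y) \<partial>lborel) \<partial>N)"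
  by (simp add: lb nn_integral_multc)
 also have "... = (\<integral>\<^sup>+x. \<integral>\<^sup>+y. indicator A x * indicator B (x + y) \<partial>lborel \<partial>N)"
  by (simp add: nn_integral_cmult)
 also have "... = (\<integral>\<^sup>+y. \<integral>\<^sup>+x. indicator A x * indicator B (x + y) \<partial>N \<partial>lborel)"
  by (rule P.Fubini'[symmetric]) measurable
 also have "... = (\<integral>\<^sup>+y. \<integral>\<^sup>+x. indicator A (x - y) * indicator B x \<partial>N \<partial>lborel)"
 proof (rule nn_integral_cong)
  fix y :: 'a
  have "(\<integral>\<^sup>+x. indicator A (x - y) * indicator B x \<partial>N)
    = (\<integral>\<^sup>+x. indicator A (x - y) * indicator B x \<partial>distr N borel (\<lambda>x. x + y))" by (simp add: inv)
  also have "... = (\<integral>\<^sup>+x. indicator A x * indicator B (x + y) \<partial>N)"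
   by (subst nn_integral_distr) auto
  finally show "(\<integral>\<^sup>+x. indicator A x * indicator B (x + y) \<partial>N) = (\<integral>\<^sup>+x. indicator A (x - y) * indicator B x \<partial>N)"
   by simp
 qed
 also have "... = (\<integral>\<^sup>+x. \<integral>\<^sup>+y. indicator A (x - y) * indicator B x \<partial>lborel \<partial>N)"
  by (rule P.Fubini') measurable
 also have "... = (\<integral>\<^sup>+x. emeasure lborel A * indicator B x \<partial>N)"
  by (simp add: nn_integral_multc lA)
 also have "... = emeasure N B * emeasure lborel A"
  by (subst nn_integral_cmult) (simp_all add: mult.commute)
 finally show ?thesis .
qed

text \<open>The coordinates in \<open>affine_lborel\<close> are indexed by the basis vectors
  themselves, so a change of orthonormal basis also renames the index set of the product
  measure.\<close>

lemma PiM_lborel_reindex: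
 assumes bij: "bij_betw \<pi> I J" and I: "finite I"
 shows "distr (\<Pi>\<^sub>M j\<in>J. lborel) (\<Pi>\<^sub>M i\<in>I. lborel) (\<lambda>f. \<lambda>i\<in>I. f (\<pi> i)) = (\<Pi>\<^sub>M i\<in>I. lborel :: real measure)"
proof -
 interpret product_sigma_finite "\<lambda>_. lborel :: real measure"
  by (simp add: product_sigma_finite_def sigma_finite_lborel)
 have J: "finite J" using bij I bij_betw_finite by blast
 have \<pi>: "\<pi> i \<in> J" if "i \<in> I" for i using bij that bij_betwE by blast
 define \<pi>' where "\<pi>' = inv_into I \<pi>"
 have \<pi>': "\<pi>' j \<in> I" "\<pi> (\<pi>' j) = j" if "j \<in> J" for j
  using bij that by (auto simp: \<pi>'_def bij_betw_def inv_into_into f_inv_into_f)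
 have \<pi>'\<pi>: "\<pi>' (\<pi> i) = i" if "i \<in> I" for i
  using bij that by (auto simp: \<pi>'_def bij_betw_def)
 have m: "(\<lambda>f. \<lambda>i\<in>I. f (\<pi> i)) \<in> (\<Pi>\<^sub>M j\<in>J. lborel) \<rightarrow>\<^sub>M (\<Pi>\<^sub>M i\<in>I. lborel :: real measure)"
  using \<pi> by (intro measurable_restrict measurable_component_singleton) auto
 show ?thesis
 proof (rule PiM_eqI[OF I])
  fix A assume A: "\<And>i. i \<in> I ==> A i \<in> sets (lborel :: real measure)"
  have "(\<lambda>f. \<lambda>i\<in>I. f (\<pi> i)) -` Pi\<^sub>E I A \<inter> space (\<Pi>\<^sub>M j\<in>J. lborel :: real measure) = (\<Pi>\<^sub>E j\<in>J. A (\<pi>' j))"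
   using \<pi> \<pi>' \<pi>'\<pi> by (fastforce simp: space_PiM PiE_iff Pi_iff extensional_def)
  then have "emeasure (distr (\<Pi>\<^sub>M j\<in>J. lborel) (\<Pi>\<^sub>M i\<in>I. lborel) (\<lambda>f. \<lambda>i\<in>I. f (\<pi> i))) (Pi\<^sub>E I A)
   = emeasure (\<Pi>\<^sub>M j\<in>J. lborel) (\<Pi>\<^sub>E j\<in>J. A (\<pi>' j))"
   using A I by (subst emeasure_distr[OF m]) auto
  also have "... = (\<Prod>j\<in>J. emeasure lborel (A (\<pi>' j)))"
   using A \<pi>' J by (intro emeasure_PiM) auto
  also have "... = (\<Prod>i\<in>I. emeasure lborel (A i))"
   using \<pi>'\<pi> prod.reindex_bij_betw[OF bij, of "\<lambda>j. emeasure lborel (A (\<pi>' j))"] by simp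
  finally show "emeasure (distr (\<Pi>\<^sub>M j\<in>J. lborel) (\<Pi>\<^sub>M i\<in>I. lborel) (\<lambda>f. \<lambda>i\<in>I. f (\<pi> i))) (Pi\<^sub>E I A)
   = (\<Prod>i\<in>I. emeasure lborel (A i))" .
 qed simp
qed

lemma orthonormal_sum_inner:
 assumes "finite U" "pairwise orthogonal U" "\<And>u. u \<in> U ==> norm u = 1" "v \<in> U"
 shows "(\<Sum>u\<in>U. c u *\<^sub>R u) \<bullet> v = c v"
proof -
 have "(\<Sum>u\<in>U. c u *\<^sub>R u) \<bullet> v = (\<Sum>u\<in>U. if u = v then c v else 0)"
  unfolding inner_sum_left
 proof (rule sum.cong)
  fix u assume u: "u \<in> U"
  show "(c u *\<^sub>R u) \<bullet> v = (if u = v then c v else 0)"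
  proof (cases "u = v")
   case True
   then show ?thesis using assms(3)[OF assms(4)] by (simp add: norm_eq_sqrt_inner)
  next
   case False
   then have "u \<bullet> v = 0" using assms(2,4) u by (auto simp: pairwise_def orthogonal_def)
   then show ?thesis using False by simp
  qed
 qed simp
 also have "... = c v" using assms(1,4) by simp
 finally show ?thesis .
qed

text \<open>The linear map L taking the standard basis to U is an isometry. The image of Lebesgue
  measure under L is translation invariant, hence proportional to Lebesgue measure, and the unit
  ball, which L preserves, shows that the factor is 1.\<close>

lemma lborel_orthonormal:
 fixes U :: "'a::euclidean_space set"
 assumes U: "finite U" "pairwise orthogonal U" "\<And>u. u \<in> U ==> norm u = 1" "card U = DIM('a)"
 shows "lborel = distr (\<Pi>\<^sub>M u\<in>U. lborel) borel (\<lambda>f. \<Sum>u\<in>U. f u *\<^sub>R u)"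
proof -
 obtain \<pi> where bij: "bij_betw \<pi> (Basis::'a set) U"
  using finite_same_card_bij[of "Basis::'a set" U] U(1,4) by (metis finite_Basis)
 then have \<pi>: "\<pi> b \<in> U" if "b \<in> Basis" for b using bij_betwE that by blast
 define L where "L x = (\<Sum>b\<in>Basis. (x \<bullet> b) *\<^sub>R \<pi> b)" for x
 have lin: "linear L" unfolding L_def[abs_def]
  by (intro linear_compose_sum) (auto simp: linear_iff inner_left_distrib scaleR_left_distrib)
 have Lsum: "L x = (\<Sum>u\<in>U. (x \<bullet> inv_into Basis \<pi> u) *\<^sub>R u)" for x
  unfolding L_def by (subst sum.reindex_bij_betw[OF bij, symmetric])
   (use bij in \<open>auto simp: bij_betw_def intro!: sum.cong\<close>)
 have Linner: "L x \<bullet> \<pi> b = x \<bullet> b" if "b \<in> Basis" for x b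
  using bij that unfolding Lsum by (subst orthonormal_sum_inner[OF U(1-3)])
   (auto simp: bij_betw_def \<pi>)
 have normL: "norm (L x) = norm x" for x
 proof -
  have "L x \<bullet> y = (\<Sum>b\<in>Basis. (x \<bullet> b) * (y \<bullet> \<pi> b))" for y
   by (simp add: L_def inner_sum_left inner_commute[of "\<pi> _" y])
  then have "L x \<bullet> L x = (\<Sum>b\<in>Basis. (x \<bullet> b) * (L x \<bullet> \<pi> b))" .
  also have "... = (\<Sum>b\<in>Basis. (x \<bullet> b) * (x \<bullet> b))" by (intro sum.cong) (auto simp: Linner)
  finally show ?thesis by (simp add: norm_eq_sqrt_inner euclidean_inner[of x x])
 qed
 have injL: "inj L" using linear_injective_0[OF lin] normL by (metis norm_eq_zero)
 have surjL: "surj L" using linear_inj_imp_surj[OF lin injL] .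
 have contL: "continuous_on UNIV L" using lin by (simp add: linear_continuous_on linear_conv_bounded_linear)
 have [measurable]: "L \<in> borel \<rightarrow>\<^sub>M borel" using contL by (rule borel_measurable_continuous_onI)
 define N where "N = distr lborel borel L"
 have [simp]: "sets N = sets borel" by (simp add: N_def)
 have ballN: "emeasure N (ball 0 r) = emeasure lborel (ball 0 r :: 'a set)" for r
 proof -
  have "L -` ball 0 r = (ball 0 r :: 'a set)" by (auto simp: normL)
  then show ?thesis by (simp add: N_def emeasure_distr)
 qed
 have ballfin: "emeasure lborel (ball 0 r :: 'a set) \<noteq> top" for r
  using emeasure_lborel_ball_finite[of "0::'a" r] by (simp add: less_top)
 have "sigma_finite_measure N"
 proof
  show "\<exists>A. countable A \<and> A \<subseteq> sets N \<and> \<Union>A = space N \<and> (\<forall>a\<in>A. emeasure N a \<noteq> \<infinity>)"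
  proof (rule exI[of _ "range (\<lambda>n::nat. ball 0 (real n))"], intro conjI)
   have "x \<in> (\<Union>n::nat. ball 0 (real n))" for x :: 'a
    using reals_Archimedean2[of "norm x"] by auto
   then show "\<Union>(range (\<lambda>n::nat. ball 0 (real n))) = space N" by (auto simp: N_def)
  qed (auto simp: ballN ballfin)
 qed
 moreover have "distr N borel (\<lambda>x. x + v) = N" for v
 proof -
  obtain w where w: "v = L w" using surjL by blast
  have "distr N borel (\<lambda>x. x + v) = distr lborel borel (\<lambda>x. L x + L w)"
   by (simp add: N_def distr_distr w o_def)
  also have "... = distr lborel borel (\<lambda>x. L (w + x))"
   by (simp add: linear_add[OF lin] add.commute)
  also have "... = distr (distr lborel borel ((+) w)) borel L"
   by (simp add: distr_distr o_def)
  also have "... = N" by (simp add: lborel_distr_plus N_def)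
  finally show ?thesis .
 qed
 ultimately have uniq: "emeasure N A * emeasure lborel (ball 0 1 :: 'a set) = emeasure N (ball 0 1) * emeasure lborel A"
  if "A \<in> sets borel" for A
  using that by (intro translation_invariant_measure_unique) auto
 have "lborel = N"
 proof (rule measure_eqI)
  fix A assume "A \<in> sets (lborel :: 'a measure)"
  then have eq: "emeasure lborel (ball 0 1 :: 'a set) * emeasure N A = emeasure lborel (ball 0 1 :: 'a set) * emeasure lborel A"
   using uniq[of A] by (simp add: ballN mult.commute)
  have "emeasure lborel (ball 0 1 :: 'a set) \<noteq> 0"
   using open_not_negligible[of "ball 0 1 :: 'a set"]
   by (auto simp: negligible_iff_null_sets null_sets_completion_iff)
  moreover have "emeasure lborel (ball 0 1 :: 'a set) \<noteq> top"
   by (rule ballfin)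
  ultimately show "emeasure lborel A = emeasure N A"
   using eq by (simp add: ennreal_mult_cancel_left)
 qed simp
 also have "... = distr (distr (\<Pi>\<^sub>M b\<in>Basis. lborel) borel (\<lambda>f. \<Sum>b\<in>Basis. f b *\<^sub>R b)) borel L"
  unfolding N_def by (subst lborel_eq) simp
 also have "... = distr (\<Pi>\<^sub>M b\<in>Basis. lborel) borel (\<lambda>f. \<Sum>b\<in>Basis. f b *\<^sub>R \<pi> b)"
 proof -
  have *: "L (\<Sum>b\<in>Basis. f b *\<^sub>R b) = (\<Sum>b\<in>Basis. f b *\<^sub>R \<pi> b)" for f
   unfolding L_def by (intro sum.cong) simp_all
  show ?thesis by (subst distr_distr) (auto simp: o_def *)
 qed
 also have "... = distr (distr (\<Pi>\<^sub>M u\<in>U. lborel) (\<Pi>\<^sub>M b\<in>Basis. lborel) (\<lambda>f. \<lambda>b\<in>Basis. f (\<pi> b))) borel (\<lambda>f. \<Sum>b\<in>Basis. f b *\<^sub>R \<pi> b)"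
  unfolding PiM_lborel_reindex[OF bij finite_Basis] ..
 also have "... = distr (\<Pi>\<^sub>M u\<in>U. lborel) borel (\<lambda>f. \<Sum>u\<in>U. f u *\<^sub>R u)"
 proof (subst distr_distr)
  show "(\<lambda>f. \<lambda>b\<in>Basis. f (\<pi> b)) \<in> (\<Pi>\<^sub>M u\<in>U. lborel) \<rightarrow>\<^sub>M (\<Pi>\<^sub>M b\<in>Basis. lborel :: real measure)"
   using \<pi> by (intro measurable_restrict measurable_component_singleton) auto
  have "(\<Sum>b\<in>Basis. f (\<pi> b) *\<^sub>R \<pi> b) = (\<Sum>u\<in>U. f u *\<^sub>R u)" for f :: "'a => real"
   by (rule sum.reindex_bij_betw[OF bij])
  then show "distr (\<Pi>\<^sub>M u\<in>U. lborel) borel ((\<lambda>f. \<Sum>b\<in>Basis. f b *\<^sub>R \<pi> b) \<circ> (\<lambda>f. \<lambda>b\<in>Basis. f (\<pi> b)))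
   = distr (\<Pi>\<^sub>M u\<in>U. lborel) borel (\<lambda>f. \<Sum>u\<in>U. f u *\<^sub>R u)"
   by (simp add: o_def)
 qed auto
 finally show ?thesis .
qed

definition hyperplane_data :: "'a::euclidean_space set => 'a => bool" where
 "hyperplane_data H n \<longleftrightarrow> norm n = 1 \<and> (\<exists>a. H = {x. n \<bullet> (x - a) = 0})"

text \<open>Resolves the two choices in \<open>affine_lborel\<close> once; the later lemmas use only
  the listed properties of the chosen origin and basis.\<close>

lemma affine_lborel_coordinates:
 fixes H :: "'a::euclidean_space set"
 assumes "hyperplane_data H n"
 obtains a B where "a \<in> H" "finite B" "pairwise orthogonal B" "\<And>b. b \<in> B ==> norm b = 1"
  "span B = {x. n \<bullet> x = 0}" "card B = DIM('a) - 1"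
  "affine_lborel H = distr (\<Pi>\<^sub>M b\<in>B. lborel) borel (\<lambda>f. a + (\<Sum>b\<in>B. f b *\<^sub>R b))"
proof -
 obtain a0 where n: "norm n = 1" and H: "H = {x. n \<bullet> (x - a0) = 0}"
  using assms by (auto simp: hyperplane_data_def)
 define a where "a = (SOME a. a \<in> H)"
 have a: "a \<in> H" unfolding a_def by (rule someI[of _ a0]) (simp add: H)
 have dir: "(\<lambda>x. x - a) ` H = {x. n \<bullet> x = 0}"
 proof (intro equalityI subsetI)
  fix x assume "x \<in> {x. n \<bullet> x = 0}"
  then have "x + a \<in> H" using a by (simp add: H inner_diff_right inner_add_right)
  then show "x \<in> (\<lambda>x. x - a) ` H" by (intro image_eqI[of _ _ "x + a"]) auto
 qed (use a in \<open>auto simp: H inner_diff_right\<close>)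
 have sub: "subspace {x. n \<bullet> x = 0}" by (rule subspace_hyperplane)
 let ?P = "\<lambda>B. pairwise orthogonal B \<and> (\<forall>b\<in>B. norm b = 1) \<and> span B = (\<lambda>x. x - a) ` H"
 define B where "B = (SOME B. ?P B)"
 obtain B0 where "pairwise orthogonal B0" "\<And>b. b \<in> B0 ==> norm b = 1" "span B0 = {x. n \<bullet> x = 0}"
  by (rule orthonormal_basis_subspace[OF sub]) auto
 then have "\<exists>B. ?P B" unfolding dir by blast
 then have B: "?P B" unfolding B_def by (rule someI_ex)
 have "0 \<notin> B" using B by auto
 then have ind: "independent B" using B pairwise_orthogonal_independent by blast
 have "card B = dim {x. n \<bullet> x = 0}"
  using B dir dim_span_eq_card_independent[OF ind] by simp
 also have "... = DIM('a) - 1" using n by (intro dim_hyperplane) auto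
 finally have "card B = DIM('a) - 1" .
 moreover have "affine_lborel H = distr (\<Pi>\<^sub>M b\<in>B. lborel) borel (\<lambda>f. a + (\<Sum>b\<in>B. f b *\<^sub>R b))"
  by (simp add: affine_lborel_def Let_def a_def B_def)
 ultimately show ?thesis
  using B dir by (intro that[of a B] a independent_imp_finite[OF ind]) auto
qed

lemma sets_affine_lborel [simp, measurable_cong]: "sets (affine_lborel H) = sets borel"
 by (simp add: affine_lborel_def Let_def)

lemma space_affine_lborel [simp]: "space (affine_lborel H) = UNIV"
 by (simp add: affine_lborel_def Let_def)

lemma AE_affine_lborel:
 assumes "hyperplane_data H n" shows "AE x in affine_lborel H. x \<in> H"
proof -
 obtain a B where *: "a \<in> H" "span B = {x. n \<bullet> x = 0}"
  "affine_lborel H = distr (\<Pi>\<^sub>M b\<in>B. lborel) borel (\<lambda>f. a + (\<Sum>b\<in>B. f b *\<^sub>R b))"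
  by (rule affine_lborel_coordinates[OF assms])
 obtain a0 where H: "H = {x. n \<bullet> (x - a0) = 0}" using assms by (auto simp: hyperplane_data_def)
 have [measurable]: "H \<in> sets borel"
  unfolding H by (intro borel_closed closed_Collect_eq continuous_intros)
 have "(\<Sum>b\<in>B. f b *\<^sub>R b) \<in> span B" for f
  by (intro span_sum span_scale span_base)
 then have "a + (\<Sum>b\<in>B. f b *\<^sub>R b) \<in> H" for f
  using *(1,2) by (auto simp: H algebra_simps inner_diff_right inner_add_right)
 then show ?thesis unfolding *(3) by (subst AE_distr_iff) auto
qed

text \<open>A basis of the direction space of H together with n is an orthonormal basis of the whole
  space; splitting off the coordinate of n in the product measure gives Fubini's theorem along
  normals.\<close>

lemma nn_integral_lborel_hyperplane:
 fixes H :: "'a::euclidean_space set"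
 assumes H: "hyperplane_data H n" and [measurable]: "g \<in> borel_measurable borel"
 shows "(\<integral>\<^sup>+y. g y \<partial>lborel) = (\<integral>\<^sup>+x. \<integral>\<^sup>+t. g (x + t *\<^sub>R n) \<partial>lborel \<partial>affine_lborel H)"
proof -
 obtain a B where a: "a \<in> H" and B: "finite B" "pairwise orthogonal B" "\<And>b. b \<in> B ==> norm b = 1"
  "span B = {x. n \<bullet> x = 0}" "card B = DIM('a) - 1"
  and eq: "affine_lborel H = distr (\<Pi>\<^sub>M b\<in>B. lborel) borel (\<lambda>f. a + (\<Sum>b\<in>B. f b *\<^sub>R b))"
  by (rule affine_lborel_coordinates[OF H]) (rule that)
 interpret product_sigma_finite "\<lambda>_. lborel :: real measure"
  by (simp add: product_sigma_finite_def sigma_finite_lborel)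
 have n: "norm n = 1" using H by (simp add: hyperplane_data_def)
 have nB: "n \<bullet> b = 0" if "b \<in> B" for b using B(4) span_base[OF that] by auto
 have "n \<notin> B" using nB[of n] n by (auto simp: norm_eq_sqrt_inner)
 have "lborel = distr (\<Pi>\<^sub>M u\<in>insert n B. lborel) borel (\<lambda>f. \<Sum>u\<in>insert n B. f u *\<^sub>R u)"
 proof (rule lborel_orthonormal)
  show "pairwise orthogonal (insert n B)"
   using B(2) nB by (auto simp: pairwise_insert orthogonal_def inner_commute)
  show "card (insert n B) = DIM('a)" using B \<open>n \<notin> B\<close> DIM_positive[where 'a='a] by simp
 qed (use B n in auto)
 moreover have "(\<integral>\<^sup>+y. g y \<partial>lborel) = (\<integral>\<^sup>+y. g (a + y) \<partial>lborel)"
  by (subst lborel_distr_plus[symmetric, of a]) (simp add: nn_integral_distr)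
 ultimately have "(\<integral>\<^sup>+y. g y \<partial>lborel)
   = (\<integral>\<^sup>+y. g (a + y) \<partial>distr (\<Pi>\<^sub>M u\<in>insert n B. lborel) borel (\<lambda>f. \<Sum>u\<in>insert n B. f u *\<^sub>R u))"
  by simp
 also have "... = (\<integral>\<^sup>+f. g (a + (\<Sum>u\<in>insert n B. f u *\<^sub>R u)) \<partial>(\<Pi>\<^sub>M u\<in>insert n B. lborel))"
  by (rule nn_integral_distr) auto
 also have "... = (\<integral>\<^sup>+f. \<integral>\<^sup>+t. g (a + (\<Sum>u\<in>insert n B. (f(n := t)) u *\<^sub>R u)) \<partial>lborel \<partial>(\<Pi>\<^sub>M u\<in>B. lborel))"
  using B(1) \<open>n \<notin> B\<close> by (intro product_nn_integral_insert) auto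
 also have "... = (\<integral>\<^sup>+f. \<integral>\<^sup>+t. g ((a + (\<Sum>u\<in>B. f u *\<^sub>R u)) + t *\<^sub>R n) \<partial>lborel \<partial>(\<Pi>\<^sub>M u\<in>B. lborel))"
 proof (intro nn_integral_cong)
  fix f :: "'a => real" and t
  have "(\<Sum>u\<in>B. (f(n := t)) u *\<^sub>R u) = (\<Sum>u\<in>B. f u *\<^sub>R u)" using \<open>n \<notin> B\<close> by (intro sum.cong) auto
  then show "g (a + (\<Sum>u\<in>insert n B. (f(n := t)) u *\<^sub>R u)) = g ((a + (\<Sum>u\<in>B. f u *\<^sub>R u)) + t *\<^sub>R n)"
   using B(1) \<open>n \<notin> B\<close> by (simp add: algebra_simps)
 qed
 also have "... = (\<integral>\<^sup>+x. \<integral>\<^sup>+t. g (x + t *\<^sub>R n) \<partial>lborel \<partial>affine_lborel H)"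
  unfolding eq by (subst nn_integral_distr) auto
 finally show ?thesis .
qed

text \<open>The invariance is inherited from Lebesgue measure: an integral over H is the volume
  integral over a slab of thickness one above H of the integrand made constant along
  normals.\<close>

lemma hyperplane_translate:
 assumes H: "hyperplane_data H n" and v: "n \<bullet> v = 0" and [measurable]: "h \<in> borel_measurable borel"
 shows "(\<integral>\<^sup>+x. h (x + v) \<partial>affine_lborel H) = (\<integral>\<^sup>+x. h x \<partial>affine_lborel H)"
proof -
 obtain a where n: "norm n = 1" and Heq: "H = {x. n \<bullet> (x - a) = 0}"
  using H by (auto simp: hyperplane_data_def)
 have nn: "n \<bullet> n = 1" using n by (simp add: norm_eq_1)
 \<comment> \<open>\<open>P\<close> is the orthogonal projection onto H and \<open>I\<close> the
   indicator of the slab; both commute with translations parallel to H.\<close>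
 define P where "P y = y - (n \<bullet> (y - a)) *\<^sub>R n" for y
 define I where "I y = (indicator {0..1} (n \<bullet> (y - a)) :: ennreal)" for y
 have [measurable]: "P \<in> borel \<rightarrow>\<^sub>M borel" "I \<in> borel_measurable borel"
  unfolding P_def[abs_def] I_def[abs_def] by measurable
 have key: "(\<integral>\<^sup>+x. k x \<partial>affine_lborel H) = (\<integral>\<^sup>+y. k (P y) * I y \<partial>lborel)"
  if [measurable]: "k \<in> borel_measurable borel" for k
 proof -
  have "(\<integral>\<^sup>+y. k (P y) * I y \<partial>lborel) = (\<integral>\<^sup>+x. \<integral>\<^sup>+t. k (P (x + t *\<^sub>R n)) * I (x + t *\<^sub>R n) \<partial>lborel \<partial>affine_lborel H)"
   by (rule nn_integral_lborel_hyperplane[OF H]) simp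
  also have "... = (\<integral>\<^sup>+x. k x \<partial>affine_lborel H)"
  proof (rule nn_integral_cong_AE, use AE_affine_lborel[OF H] in eventually_elim)
   case (elim x)
   then have t: "n \<bullet> (x + t *\<^sub>R n - a) = t" for t
    using nn by (simp add: Heq inner_diff_right inner_add_right)
   have "(\<integral>\<^sup>+t. k (P (x + t *\<^sub>R n)) * I (x + t *\<^sub>R n) \<partial>lborel) = (\<integral>\<^sup>+t. k x * indicator {0..1} (t::real) \<partial>lborel)"
    by (simp add: P_def I_def t)
   also have "... = k x" by (simp add: nn_integral_cmult)
   finally show ?case .
  qed
  finally show ?thesis by simp
 qed
 have "(\<integral>\<^sup>+x. h (x + v) \<partial>affine_lborel H) = (\<integral>\<^sup>+y. h (P y + v) * I y \<partial>lborel)"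
  by (rule key) simp
 also have "... = (\<integral>\<^sup>+y. h (P (v + y)) * I (v + y) \<partial>lborel)"
  using v by (simp add: P_def I_def algebra_simps inner_diff_right inner_add_right)
 also have "... = (\<integral>\<^sup>+y. h (P y) * I y \<partial>distr lborel borel ((+) v))"
  by (subst nn_integral_distr) auto
 also have "... = (\<integral>\<^sup>+x. h x \<partial>affine_lborel H)" by (simp add: lborel_distr_plus key)
 finally show ?thesis .
qed

text \<open>The slab argument again: each point of H in the ball, moved along n by a parameter in
  the unit interval, stays in the ball of radius r + 1, which has finite volume.\<close>

lemma emeasure_affine_lborel_ball:
 fixes H :: "'a::euclidean_space set"
 assumes H: "hyperplane_data H n"
 shows "emeasure (affine_lborel H) (ball 0 r) < \<infinity>"
proof -
 have n: "norm n = 1" using H by (simp add: hyperplane_data_def)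
 have "emeasure (affine_lborel H) (ball 0 r) = (\<integral>\<^sup>+x. indicator (ball 0 r) x * (\<integral>\<^sup>+t. indicator {0..1} (t::real) \<partial>lborel) \<partial>affine_lborel H)"
  by simp
 also have "... \<le> (\<integral>\<^sup>+x. \<integral>\<^sup>+t. indicator (ball 0 (r + 1)) (x + t *\<^sub>R n) \<partial>lborel \<partial>affine_lborel H)"
 proof (rule nn_integral_mono)
  fix x :: 'a
  have "indicator (ball 0 r) x * (\<integral>\<^sup>+t. indicator {0..1} (t::real) \<partial>lborel) = (\<integral>\<^sup>+t. indicator (ball 0 r) x * indicator {0..1} (t::real) \<partial>lborel)"
   by (simp add: nn_integral_cmult)
  also have "... \<le> (\<integral>\<^sup>+t. indicator (ball 0 (r + 1)) (x + t *\<^sub>R n) \<partial>lborel)"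
  proof (rule nn_integral_mono)
   fix t :: real
   have "norm (x + t *\<^sub>R n) < r + 1" if "norm x < r" "0 \<le> t" "t \<le> 1"
    using norm_triangle_ineq[of x "t *\<^sub>R n"] that n by simp
   then show "(indicator (ball 0 r) x * indicator {0..1} t :: ennreal) \<le> indicator (ball 0 (r + 1)) (x + t *\<^sub>R n)"
    by (auto split: split_indicator)
  qed
  finally show "(indicator (ball 0 r) x * (\<integral>\<^sup>+t. indicator {0..1} (t::real) \<partial>lborel) :: ennreal)
   \<le> (\<integral>\<^sup>+t. indicator (ball 0 (r + 1)) (x + t *\<^sub>R n) \<partial>lborel)" .
 qed
 also have "... = emeasure lborel (ball (0::'a) (r + 1))"
  by (subst nn_integral_lborel_hyperplane[OF H, symmetric]) (auto intro!: borel_measurable_indicator)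
 also have "... < \<infinity>" using emeasure_lborel_ball_finite by simp
 finally show ?thesis .
qed

lemma sigma_finite_affine_lborel:
 fixes H :: "'a::euclidean_space set"
 assumes H: "hyperplane_data H n"
 shows "sigma_finite_measure (affine_lborel H)"
proof
 show "\<exists>A. countable A \<and> A \<subseteq> sets (affine_lborel H) \<and> \<Union>A = space (affine_lborel H) \<and> (\<forall>a\<in>A. emeasure (affine_lborel H) a \<noteq> \<infinity>)"
 proof (rule exI[of _ "range (\<lambda>n::nat. ball 0 (real n))"], intro conjI)
  have "x \<in> (\<Union>n::nat. ball 0 (real n))" for x :: 'a
   using reals_Archimedean2[of "norm x"] by auto
  then show "\<Union>(range (\<lambda>n::nat. ball 0 (real n))) = space (affine_lborel H)" by auto
 qed (use emeasure_affine_lborel_ball[OF H] in \<open>auto simp: less_top[symmetric]\<close>)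
qed

text \<open>For fixed \<open>s\<close> the displacement \<open>t n - s b\<close> with \<open>t = - s (n \<bullet> b)\<close> is parallel to \<open>H\<close>.\<close>

lemma nn_integral_shear:
 fixes H :: "'a::euclidean_space set"
 assumes H: "hyperplane_data H n" and a: "a \<in> H" and b: "n \<bullet> b \<noteq> 0"
  and G[measurable]: "G \<in> borel_measurable (borel \<Otimes>\<^sub>M borel)"
 defines "s \<equiv> \<lambda>y. - (n \<bullet> (y - a)) / (n \<bullet> b)"
 shows "ennreal \<bar>n \<bullet> b\<bar> * (\<integral>\<^sup>+x. \<integral>\<^sup>+t. G (x, t) \<partial>lborel \<partial>affine_lborel H) = (\<integral>\<^sup>+y. G (y + s y *\<^sub>R b, s y) \<partial>lborel)"
proof -
 interpret sigma_finite_measure "affine_lborel H" by (rule sigma_finite_affine_lborel[OF H])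
 interpret P: pair_sigma_finite "affine_lborel H" "lborel :: real measure"
  by (simp add: pair_sigma_finite_def sigma_finite_affine_lborel[OF H] sigma_finite_lborel)
 define \<beta> where "\<beta> = n \<bullet> b"
 have \<beta>: "\<beta> \<noteq> 0" using b by (simp add: \<beta>_def)
 obtain a0 where n: "norm n = 1" and Heq: "H = {x. n \<bullet> (x - a0) = 0}"
  using H by (auto simp: hyperplane_data_def)
 have nn: "n \<bullet> n = 1" using n by (simp add: norm_eq_1)
 have contS: "continuous_on UNIV s" unfolding s_def using b by (intro continuous_intros) auto
 then have [measurable]: "s \<in> borel_measurable borel" by (rule borel_measurable_continuous_onI)
 have mG: "(\<lambda>y. G (y + s y *\<^sub>R b, s y)) \<in> borel_measurable borel"
  by (rule measurable_compose[OF _ G]) simp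
 have mG2: "(\<lambda>(x, t). G (x + (t *\<^sub>R n - (t / \<beta>) *\<^sub>R b), - t / \<beta>)) \<in> borel_measurable (affine_lborel H \<Otimes>\<^sub>M lborel)"
  unfolding split_beta' by (rule measurable_compose[OF _ G]) simp
 have "(\<integral>\<^sup>+y. G (y + s y *\<^sub>R b, s y) \<partial>lborel)
   = (\<integral>\<^sup>+x. \<integral>\<^sup>+t. G (x + t *\<^sub>R n + s (x + t *\<^sub>R n) *\<^sub>R b, s (x + t *\<^sub>R n)) \<partial>lborel \<partial>affine_lborel H)"
  by (rule nn_integral_lborel_hyperplane[OF H mG])
 also have "... = (\<integral>\<^sup>+x. \<integral>\<^sup>+t. G (x + (t *\<^sub>R n - (t / \<beta>) *\<^sub>R b), - t / \<beta>) \<partial>lborel \<partial>affine_lborel H)"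
 proof (rule nn_integral_cong_AE, use AE_affine_lborel[OF H] in eventually_elim)
  case (elim x)
  then have "n \<bullet> (x + t *\<^sub>R n - a) = t" for t
   using nn a by (simp add: Heq inner_diff_right inner_add_right)
  then have "s (x + t *\<^sub>R n) = - t / \<beta>" for t by (simp add: s_def \<beta>_def)
  then show ?case by (simp add: algebra_simps)
 qed
 also have "... = (\<integral>\<^sup>+t. \<integral>\<^sup>+x. G (x + (t *\<^sub>R n - (t / \<beta>) *\<^sub>R b), - t / \<beta>) \<partial>affine_lborel H \<partial>lborel)"
  by (rule P.Fubini'[OF mG2, symmetric])
 also have "... = (\<integral>\<^sup>+t. \<integral>\<^sup>+x. G (x, - t / \<beta>) \<partial>affine_lborel H \<partial>lborel)"
  using nn \<beta> by (intro nn_integral_cong hyperplane_translate[OF H]) (auto simp: inner_diff_right \<beta>_def[symmetric])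
 \<comment> \<open>The substitution t = - \<beta> s produces the Jacobian of the shear.\<close>
 also have "... = ennreal \<bar>- \<beta>\<bar> * (\<integral>\<^sup>+s. \<integral>\<^sup>+x. G (x, - (0 + (- \<beta>) * s) / \<beta>) \<partial>affine_lborel H \<partial>lborel)"
 proof (rule nn_integral_real_affine)
  show "- \<beta> \<noteq> 0" using \<beta> by simp
 qed measurable
 also have "(\<integral>\<^sup>+s. \<integral>\<^sup>+x. G (x, - (0 + (- \<beta>) * s) / \<beta>) \<partial>affine_lborel H \<partial>lborel) = (\<integral>\<^sup>+s. \<integral>\<^sup>+x. G (x, s) \<partial>affine_lborel H \<partial>lborel)"
  using \<beta> by simp
 also have "... = (\<integral>\<^sup>+x. \<integral>\<^sup>+s. G (x, s) \<partial>lborel \<partial>affine_lborel H)"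
  by (rule P.Fubini') measurable
 finally show ?thesis by (simp add: \<beta>_def)
qed

text \<open>The union of the rays that start at F and run in direction -b. Integrating a derivative
  in direction b over it returns the integral over F, with the factor of
  \<open>integral_shadow\<close>.\<close>

definition shadow :: "'a::euclidean_space set => 'a => 'a set" where
 "shadow F b = {y. \<exists>s>0. y + s *\<^sub>R b \<in> F}"

text \<open>The map (x, s) to x - s b sends F times the positive reals bijectively to the shadow,
  since a line transversal to H meets H once, and it has Jacobian |n . b|. The proof goes through an
  equality of measures, so that it covers integrands of either sign.\<close>

lemma integral_shadow:
 fixes H :: "'a::euclidean_space set" and g :: "'a => real"
 assumes H: "hyperplane_data H n" and FH: "F \<subseteq> H" and F[measurable]: "F \<in> sets borel"
  and "F \<noteq> {}" and b: "n \<bullet> b \<noteq> 0" and g[measurable]: "g \<in> borel_measurable borel" and int: "integrable lborel g"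
 shows "shadow F b \<in> sets borel"
  and "\<bar>n \<bullet> b\<bar> * (\<integral>x. indicator F x * (\<integral>s. indicator {0<..} s * g (x - s *\<^sub>R b) \<partial>lborel) \<partial>affine_lborel H)
   = (\<integral>y. indicator (shadow F b) y * g y \<partial>lborel)"
proof -
 interpret sigma_finite_measure "affine_lborel H" by (rule sigma_finite_affine_lborel[OF H])
 interpret P: pair_sigma_finite "affine_lborel H" "lborel :: real measure"
  by (simp add: pair_sigma_finite_def sigma_finite_affine_lborel[OF H] sigma_finite_lborel)
 obtain a where aF: "a \<in> F" using \<open>F \<noteq> {}\<close> by blast
 then have a: "a \<in> H" using FH by blast
 obtain a0 where Heq: "H = {x. n \<bullet> (x - a0) = 0}"
  using H by (auto simp: hyperplane_data_def)
 define s where "s y = - (n \<bullet> (y - a)) / (n \<bullet> b)" for y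
 have [measurable]: "s \<in> borel_measurable borel" unfolding s_def[abs_def] by measurable
 have s_unique: "t = s y" if "y + t *\<^sub>R b \<in> H" for y t
 proof -
  have "n \<bullet> (y + t *\<^sub>R b - a) = 0" using that a by (simp add: Heq inner_diff_right)
  then have "n \<bullet> (y - a) + t * (n \<bullet> b) = 0" by (simp add: inner_diff_right inner_add_right)
  then have "t * (n \<bullet> b) = - (n \<bullet> (y - a))" by linarith
  moreover have "t = t * (n \<bullet> b) / (n \<bullet> b)" using b by simp
  ultimately show ?thesis by (simp only: s_def)
 qed
 have sh: "shadow F b = {y. s y > 0 \<and> y + s y *\<^sub>R b \<in> F}"
  unfolding shadow_def using s_unique FH by blast
 show [measurable]: "shadow F b \<in> sets borel" unfolding sh by measurable
 have ind: "indicator (shadow F b) y = (indicator F (y + s y *\<^sub>R b) * indicator {0<..} (s y) :: 'c::semiring_1)" for y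
  by (auto simp: sh split: split_indicator)
 let ?\<mu> = "affine_lborel H \<Otimes>\<^sub>M (lborel :: real measure)"
 let ?D = "density ?\<mu> (\<lambda>(x, t). ennreal \<bar>n \<bullet> b\<bar> * (indicator F x * indicator {0<..} t))"
 have eq: "distr ?D borel (\<lambda>(x, t). x - t *\<^sub>R b) = density lborel (indicator (shadow F b))"
 proof (rule measure_eqI)
  fix A assume "A \<in> sets (distr ?D borel (\<lambda>(x, t). x - t *\<^sub>R b))"
  then have [measurable]: "A \<in> sets borel" by simp
  have "emeasure (distr ?D borel (\<lambda>(x, t). x - t *\<^sub>R b)) A = (\<integral>\<^sup>+z. indicator A z \<partial>distr ?D borel (\<lambda>(x, t). x - t *\<^sub>R b))"
   by simp
  also have "... = (\<integral>\<^sup>+z. indicator A (case z of (x, t) => x - t *\<^sub>R b) \<partial>?D)"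
   by (rule nn_integral_distr) measurable
  also have "... = (\<integral>\<^sup>+z. (case z of (x, t) => ennreal \<bar>n \<bullet> b\<bar> * (indicator F x * indicator {0<..} t)) * indicator A (case z of (x, t) => x - t *\<^sub>R b) \<partial>?\<mu>)"
   by (subst nn_integral_density) (auto simp: split_beta')
  also have "... = (\<integral>\<^sup>+x. \<integral>\<^sup>+t. ennreal \<bar>n \<bullet> b\<bar> * (indicator F x * indicator {0<..} t * indicator A (x - t *\<^sub>R b)) \<partial>lborel \<partial>affine_lborel H)"
   by (subst lborel.nn_integral_fst[symmetric]) (auto simp: split_beta' mult.assoc)
  also have "... = ennreal \<bar>n \<bullet> b\<bar> * (\<integral>\<^sup>+x. \<integral>\<^sup>+t. indicator F x * indicator {0<..} t * indicator A (x - t *\<^sub>R b) \<partial>lborel \<partial>affine_lborel H)"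
   by (simp add: nn_integral_cmult)
  also have "... = (\<integral>\<^sup>+y. indicator F (y + s y *\<^sub>R b) * indicator {0<..} (s y) * indicator A (y + s y *\<^sub>R b - s y *\<^sub>R b) \<partial>lborel)"
   using nn_integral_shear[OF H a b, of "\<lambda>z. indicator F (fst z) * indicator {0<..} (snd z) * indicator A (fst z - snd z *\<^sub>R b)"]
   by (simp add: s_def)
  also have "... = emeasure (density lborel (indicator (shadow F b))) A"
   by (simp add: emeasure_density ind)
  finally show "emeasure (distr ?D borel (\<lambda>(x, t). x - t *\<^sub>R b)) A = emeasure (density lborel (indicator (shadow F b))) A" .
 qed simp
 have dens: "density lborel (indicator (shadow F b)) = density lborel (\<lambda>y. ennreal (indicator (shadow F b) y))"
  by (intro density_cong) (auto split: split_indicator)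
 have densD: "?D = density ?\<mu> (\<lambda>z. ennreal (case z of (x, t) => \<bar>n \<bullet> b\<bar> * (indicator F x * indicator {0<..} t)))"
  by (intro density_cong) (auto split: split_indicator simp: split_beta')
 have "integrable (density lborel (indicator (shadow F b))) g"
  unfolding dens by (subst integrable_density) (auto intro!: integrable_real_mult_indicator[of _ lborel g, simplified mult.commute] int simp: real_scaleR_def mult.commute)
 then have "integrable ?D (\<lambda>z. g (case z of (x, t) => x - t *\<^sub>R b))"
  unfolding eq[symmetric] by (subst (asm) integrable_distr_eq) auto
 then have int2: "integrable ?\<mu> (\<lambda>z. (case z of (x, t) => \<bar>n \<bullet> b\<bar> * (indicator F x * indicator {0<..} t)) *\<^sub>R g (case z of (x, t) => x - t *\<^sub>R b))"
  unfolding densD by (subst (asm) integrable_density) (auto simp: split_beta')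
 have "(\<integral>y. indicator (shadow F b) y * g y \<partial>lborel) = (\<integral>y. g y \<partial>density lborel (indicator (shadow F b)))"
  unfolding dens by (subst integral_density) auto
 also have "... = (\<integral>z. g (case z of (x, t) => x - t *\<^sub>R b) \<partial>?D)"
  unfolding eq[symmetric] by (rule integral_distr) auto
 also have "... = (\<integral>z. (case z of (x, t) => \<bar>n \<bullet> b\<bar> * (indicator F x * indicator {0<..} t)) *\<^sub>R g (case z of (x, t) => x - t *\<^sub>R b) \<partial>?\<mu>)"
  unfolding densD by (subst integral_density) (auto simp: split_beta')
 also have "... = (\<integral>x. \<integral>t. \<bar>n \<bullet> b\<bar> * (indicator F x * indicator {0<..} t) * g (x - t *\<^sub>R b) \<partial>lborel \<partial>affine_lborel H)"
  using P.integral_fst'[OF int2] by simp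
 also have "... = \<bar>n \<bullet> b\<bar> * (\<integral>x. indicator F x * (\<integral>s. indicator {0<..} s * g (x - s *\<^sub>R b) \<partial>lborel) \<partial>affine_lborel H)"
  by (simp add: mult.assoc)
 finally show "\<bar>n \<bullet> b\<bar> * (\<integral>x. indicator F x * (\<integral>s. indicator {0<..} s * g (x - s *\<^sub>R b) \<partial>lborel) \<partial>affine_lborel H)
   = (\<integral>y. indicator (shadow F b) y * g y \<partial>lborel)" by simp
qed

section \<open>The divergence theorem on mesh elements\<close>

text \<open>A line in direction \<open>b\<close> leaves \<open>T\<close> through a face with positive and enters it through a face
 with negative \<open>n \<bullet> b\<close>, so that the signed number of faces ahead of \<open>y\<close> is the indicator of \<open>T\<close>.\<close>

lemma shadow_count:
 fixes T :: "'a::euclidean_space set" and nrm :: "'a set => 'a"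
 assumes T: "open T" "convex T" "bounded T" and Fs: "finite Fs" "disjoint Fs"
  and half: "\<And>F x. F \<in> Fs ==> x \<in> F ==> \<exists>d>0. ball x d \<inter> {y. nrm F \<bullet> (y - x) < 0} \<subseteq> T"
  and side: "\<And>F x y. F \<in> Fs ==> x \<in> F ==> y \<in> T ==> nrm F \<bullet> (y - x) < 0"
  and hit: "\<And>s. y + s *\<^sub>R b \<in> frontier T ==> \<exists>F\<in>Fs. y + s *\<^sub>R b \<in> F"
  and y0: "y \<notin> frontier T" and b: "b \<noteq> 0"
 shows "(\<Sum>F\<in>{F\<in>Fs. nrm F \<bullet> b \<noteq> 0}. sgn (nrm F \<bullet> b) * indicator (shadow F b) y) = (indicator T y :: real)"
proof -
 define J where "J = {s. y + s *\<^sub>R b \<in> T}"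
 define p where "p s = y + s *\<^sub>R b" for s
 have contp: "continuous_on A p" for A unfolding p_def by (intro continuous_intros)
 have Jp: "J = p -` T" by (auto simp: J_def p_def)
 \<comment> \<open>Close to a point of a face T is the open half ball on its inner side, so a short
   step along the line against the sign of n . b lands in T.\<close>
 have enter: "\<exists>e>0. \<forall>r. 0 < r \<and> r < e \<longrightarrow> s - sgn (nrm F \<bullet> b) * r \<in> J"
  if F: "F \<in> Fs" "p s \<in> F" "nrm F \<bullet> b \<noteq> 0" for F s
 proof -
  obtain d where d: "d > 0" "ball (p s) d \<inter> {z. nrm F \<bullet> (z - p s) < 0} \<subseteq> T" using half F by blast
  show ?thesis
  proof (intro exI[of _ "d / norm b"] conjI allI impI)
   show "0 < d / norm b" using d b by simp
   fix r assume r: "0 < r \<and> r < d / norm b"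
   have diff: "p (s - sgn (nrm F \<bullet> b) * r) - p s = (- (sgn (nrm F \<bullet> b) * r)) *\<^sub>R b"
    by (simp add: p_def algebra_simps)
   have "norm (p (s - sgn (nrm F \<bullet> b) * r) - p s) = r * norm b"
    unfolding diff using r F(3) by (simp add: abs_mult sgn_if)
   also have "... < d" using r b by (simp add: field_simps)
   finally have "p (s - sgn (nrm F \<bullet> b) * r) \<in> ball (p s) d" by (simp add: dist_norm norm_minus_commute)
   moreover have "nrm F \<bullet> (p (s - sgn (nrm F \<bullet> b) * r) - p s) = - (r * \<bar>nrm F \<bullet> b\<bar>)"
    unfolding diff by (simp add: abs_sgn mult_ac)
   ultimately show "s - sgn (nrm F \<bullet> b) * r \<in> J" using d(2) r F(3) unfolding Jp by auto
  qed
 qed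
 have T0: "indicator T y = (if 0 \<in> J then 1 else (0::real))" by (simp add: J_def indicator_def)
 show ?thesis
 proof (cases "J = {}")
  case True
  \<comment> \<open>A line that misses T crosses no face transversally, as it would enter T next to
    the crossing.\<close>
  have "y \<notin> shadow F b" if F: "F \<in> Fs" "nrm F \<bullet> b \<noteq> 0" for F
  proof
   assume "y \<in> shadow F b"
   then obtain s where s: "p s \<in> F" by (auto simp: shadow_def p_def)
   from enter[OF F(1) s F(2)] obtain e where e: "e > 0" "\<forall>r. 0 < r \<and> r < e \<longrightarrow> s - sgn (nrm F \<bullet> b) * r \<in> J" by blast
   have "0 < e / 2 \<and> e / 2 < e" using e(1) by simp
   then have "s - sgn (nrm F \<bullet> b) * (e / 2) \<in> J" using e(2) by blast
   then show False using True by simp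
  qed
  then show ?thesis using True T0 by simp
 next
  case False
  have openJ: "open J" unfolding Jp by (rule open_vimage[OF T(1) contp])
  have convJ: "s \<in> J" if "j1 \<in> J" "j2 \<in> J" "j1 \<le> s" "s \<le> j2" for j1 j2 s
  proof (cases "j1 = j2")
   case False
   define l where "l = (s - j1) / (j2 - j1)"
   have l: "0 \<le> l" "l \<le> 1" using that False by (auto simp: l_def field_simps)
   have "(1 - l) *\<^sub>R p j1 + l *\<^sub>R p j2 \<in> T"
    using that T(2) l by (intro convexD_alt) (auto simp: Jp)
   moreover have "(1 - l) *\<^sub>R p j1 + l *\<^sub>R p j2 = y + (j1 + l * (j2 - j1)) *\<^sub>R b"
    by (simp add: p_def algebra_simps)
   moreover have "j1 + l * (j2 - j1) = s" using False by (simp add: l_def)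
   ultimately show ?thesis by (simp add: J_def)
  qed (use that in auto)
  obtain R where R: "\<And>x. x \<in> T ==> norm x \<le> R" using T(3) by (auto simp: bounded_iff)
  have bJ: "\<bar>s\<bar> \<le> (R + norm y) / norm b" if "s \<in> J" for s
  proof -
   have "\<bar>s\<bar> * norm b = norm (p s - y)" by (simp add: p_def)
   also have "... \<le> R + norm y" using R[of "p s"] that norm_triangle_ineq4[of "p s" y] by (simp add: Jp)
   finally show ?thesis using b by (simp add: field_simps)
  qed
  have "s \<le> (R + norm y) / norm b \<and> - ((R + norm y) / norm b) \<le> s" if "s \<in> J" for s
   using bJ[OF that] by linarith
  then have bdd: "bdd_above J" "bdd_below J"
   by (meson bdd_aboveI bdd_belowI)+
  define s1 where "s1 = Inf J"
  define s2 where "s2 = Sup J"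
  have in_J: "s1 < s \<and> s < s2" if "s \<in> J" for s
  proof -
   obtain e where e: "e > 0" "ball s e \<subseteq> J" using openJ \<open>s \<in> J\<close> open_contains_ball by blast
   then have "s - e / 2 \<in> J" "s + e / 2 \<in> J" by (auto simp: dist_real_def)
   then have "s1 \<le> s - e / 2" "s + e / 2 \<le> s2"
    using bdd by (auto simp: s1_def s2_def intro: cInf_lower cSup_upper)
   then show ?thesis using e by simp
  qed
  have J_in: "s \<in> J" if s: "s1 < s" "s < s2" for s
  proof -
   obtain j1 where "j1 \<in> J" "j1 < s"
    using cInf_lessD[OF False s(1)[unfolded s1_def]] by blast
   moreover obtain j2 where "j2 \<in> J" "s < j2"
    using less_cSupD[OF False s(2)[unfolded s2_def]] by blast
   ultimately
   show ?thesis using convJ[of j1 j2 s] by simp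
  qed
  have J: "J = {s1<..<s2}" using in_J J_in by auto
  have s12: "s1 < s2" using False in_J by fastforce
  have fr: "p s1 \<in> frontier T" "p s2 \<in> frontier T"
  proof -
   have "p ` closure J \<subseteq> closure T"
    by (rule image_closure_subset[OF contp closed_closure]) (use closure_subset in \<open>auto simp: Jp\<close>)
   moreover have "closure J = {s1..s2}" using s12 by (simp add: J)
   ultimately have "p s1 \<in> closure T" "p s2 \<in> closure T" using s12 by auto
   moreover have "s1 \<notin> J" "s2 \<notin> J" by (auto simp: J)
   ultimately show "p s1 \<in> frontier T" "p s2 \<in> frontier T"
    using T(1) by (auto simp: frontier_def interior_open Jp)
  qed
  have nz: "s1 \<noteq> 0" "s2 \<noteq> 0" using fr y0 by (auto simp: p_def)
  \<comment> \<open>T lies strictly on one side of each face plane. Hence a line that meets T is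
    transversal to every face it hits, and the sign of n . b tells on which side of the hit the
    interval \<open>J\<close> lies.\<close>
  have sd: "(j - s) * (nrm F \<bullet> b) < 0" if "F \<in> Fs" "p s \<in> F" "j \<in> J" for F s j
   using side[OF that(1,2), of "p j"] that(3)
   by (simp add: Jp p_def inner_diff_right inner_add_right algebra_simps)
  have beta_nz: "nrm F \<bullet> b \<noteq> 0" if "F \<in> Fs" "p s \<in> F" for F s
   using sd[OF that] False by fastforce
  have pos: "s = s2" if F: "F \<in> Fs" "p s \<in> F" "nrm F \<bullet> b > 0" for F s
  proof (rule antisym)
   have "j < s" if "j \<in> J" for j using sd[OF F(1,2) that] F(3) by (simp add: mult_less_0_iff)
   then show "s2 \<le> s" unfolding s2_def using False by (intro cSup_least) (auto intro: less_imp_le)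
   show "s \<le> s2"
   proof (rule ccontr)
    assume "\<not> s \<le> s2"
    obtain e where e: "e > 0" "\<And>r. 0 < r ==> r < e ==> s - r \<in> J"
     using enter[OF F(1,2)] F(3) by auto
    define r where "r = min (e / 2) ((s - s2) / 2)"
    have "0 < r" "r < e" "s2 < s - r" using e(1) \<open>\<not> s \<le> s2\<close> by (auto simp: r_def min_def field_simps)
    then show False using e(2)[of r] in_J by fastforce
   qed
  qed
  have neg: "s = s1" if F: "F \<in> Fs" "p s \<in> F" "nrm F \<bullet> b < 0" for F s
  proof (rule antisym)
   have "s < j" if "j \<in> J" for j using sd[OF F(1,2) that] F(3) by (simp add: mult_less_0_iff)
   then show "s \<le> s1" unfolding s1_def using False by (intro cInf_greatest) (auto intro: less_imp_le)
   show "s1 \<le> s"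
   proof (rule ccontr)
    assume "\<not> s1 \<le> s"
    obtain e where e: "e > 0" "\<And>r. 0 < r ==> r < e ==> s + r \<in> J"
     using enter[OF F(1,2)] F(3) by auto
    define r where "r = min (e / 2) ((s1 - s) / 2)"
    have "0 < r" "r < e" "s + r < s1" using e(1) \<open>\<not> s1 \<le> s\<close> by (auto simp: r_def min_def field_simps)
    then show False using e(2)[of r] in_J by fastforce
   qed
  qed
  obtain F1 where F1: "F1 \<in> Fs" "p s1 \<in> F1" using hit fr(1) by (auto simp: p_def)
  obtain F2 where F2: "F2 \<in> Fs" "p s2 \<in> F2" using hit fr(2) by (auto simp: p_def)
  have n1: "nrm F1 \<bullet> b < 0"
   using pos[OF F1] beta_nz[OF F1] s12 by (cases "nrm F1 \<bullet> b > 0") auto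
  have n2: "nrm F2 \<bullet> b > 0"
   using neg[OF F2] beta_nz[OF F2] s12 by (cases "nrm F2 \<bullet> b < 0") auto
  have uniq: "F = G" if "F \<in> Fs" "G \<in> Fs" "x \<in> F" "x \<in> G" for F G x
   using Fs(2) that by (auto simp: disjoint_def)
  \<comment> \<open>Only the exit face \<open>F2\<close> and the entry face \<open>F1\<close> can be
    seen from y. Their contributions combine to 1 exactly when s1 < 0 < s2, that is when y lies in
    T; parameter 0 is no end point because y is off the frontier.\<close>
  have contrib: "sgn (nrm F \<bullet> b) * indicator (shadow F b) y
    = (if F = F2 then (if 0 < s2 then 1 else 0) else 0) - (if F = F1 then (if 0 < s1 then 1 else 0) else (0::real))"
   if F: "F \<in> Fs" "nrm F \<bullet> b \<noteq> 0" for F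
  proof (cases "nrm F \<bullet> b > 0")
   case True
   have "F \<noteq> F1" using True n1 by auto
   moreover have "y \<in> shadow F b \<longleftrightarrow> F = F2 \<and> 0 < s2"
   proof
    assume "y \<in> shadow F b"
    then obtain s where "s > 0" "p s \<in> F" by (auto simp: shadow_def p_def)
    then show "F = F2 \<and> 0 < s2" using pos[OF F(1) _ True, of s] uniq[OF F(1) F2(1) _ F2(2)] by auto
   qed (use F2 in \<open>auto simp: shadow_def p_def\<close>)
   ultimately show ?thesis using True by (auto simp: indicator_def)
  next
   case F_neg: False
   then have ng: "nrm F \<bullet> b < 0" using F by simp
   have "F \<noteq> F2" using ng n2 by auto
   moreover have "y \<in> shadow F b \<longleftrightarrow> F = F1 \<and> 0 < s1"
   proof
    assume "y \<in> shadow F b"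
    then obtain s where "s > 0" "p s \<in> F" by (auto simp: shadow_def p_def)
    then show "F = F1 \<and> 0 < s1" using neg[OF F(1) _ ng, of s] uniq[OF F(1) F1(1) _ F1(2)] by auto
   qed (use F1 in \<open>auto simp: shadow_def p_def\<close>)
   ultimately show ?thesis using ng by (auto simp: indicator_def)
  qed
  have "(\<Sum>F\<in>{F\<in>Fs. nrm F \<bullet> b \<noteq> 0}. sgn (nrm F \<bullet> b) * indicator (shadow F b) y)
   = (\<Sum>F\<in>{F\<in>Fs. nrm F \<bullet> b \<noteq> 0}. (if F = F2 then (if 0 < s2 then 1 else 0) else 0) - (if F = F1 then (if 0 < s1 then 1 else 0) else (0::real)))"
   using contrib by (intro sum.cong) auto
  also have "... = (if 0 < s2 then 1 else 0) - (if 0 < s1 then 1 else 0)"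
   using Fs(1) F1 F2 n1 n2 unfolding sum_subtractf by (subst (1 2) sum.delta) auto
  also have "... = indicator T y"
   using nz s12 unfolding T0 J by auto
  finally show ?thesis .
 qed
qed

text \<open>A continuously differentiable ramp. One derivative suffices for the cutoff, since the
  divergence theorem asks only for a continuous partial derivative.\<close>

lemma m2_has_derivative: "((\<lambda>s::real. (max 0 s)^2) has_real_derivative 2 * max 0 s) (at s)"
proof -
 consider "s < 0" | "s = 0" | "0 < s" by linarith
 then show ?thesis
 proof cases
  case 1
  have "((\<lambda>s::real. 0) has_real_derivative 2 * max 0 s) (at s)" using 1 by simp
  then show ?thesis
   by (rule has_field_derivative_transform_within_open[where S="{..<0}"]) (use 1 in auto)
 next
  case 2
  have eq: "((max 0 (0 + h))^2 - (max 0 0)^2) / h = max 0 h" for h :: real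
   by (cases "h \<le> 0") (auto simp: power2_eq_square)
  have "((\<lambda>h::real. max 0 h) \<longlongrightarrow> max 0 0) (at 0)" by (intro tendsto_max tendsto_const tendsto_ident_at)
  also have "max 0 0 = 2 * max 0 (0::real)" by simp
  finally show ?thesis unfolding 2 DERIV_def eq .
 next
  case 3
  have "((\<lambda>s::real. s^2) has_real_derivative 2 * max 0 s) (at s)"
   using 3 by (auto intro!: derivative_eq_intros)
  then show ?thesis
   by (rule has_field_derivative_transform_within_open[where S="{0<..}"]) (use 3 in auto)
 qed
qed

text \<open>Two ramps composed: the inner one vanishes while |x| is at most A, which keeps the outer
  argument at 1; once |x| reaches A + 1 the inner one is at least 1 and the outer ramp is
  zero.\<close>

lemma cutoff_exists:
 assumes "bounded T"
 obtains \<zeta> :: "'a::euclidean_space => real" and r where "\<And>x. \<zeta> differentiable (at x)"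
  "\<And>b. continuous_on UNIV (partial b \<zeta>)" "\<And>x. x \<in> T ==> \<zeta> x = 1" "\<And>x. x \<in> closure T ==> \<zeta> x = 1"
  "\<And>x b. x \<in> T ==> partial b \<zeta> x = 0" "\<And>x. r \<le> norm x ==> \<zeta> x = 0"
proof -
 have "bounded (closure T)" using assms by (rule bounded_closure)
 then obtain A where A: "0 < A" "\<And>x. x \<in> closure T ==> norm x \<le> A" by (metis bounded_pos)
 define m where "m s = (max 0 s)^2" for s :: real
 define \<zeta> where "\<zeta> x = m (1 - m (x \<bullet> x - A^2))" for x :: 'a
 have der: "(\<zeta> has_derivative (\<lambda>v. (2 * max 0 (1 - m (x \<bullet> x - A^2))) * (- (2 * max 0 (x \<bullet> x - A^2) * (2 * (x \<bullet> v)))))) (at x)" for x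
 proof -
  have m: "(m has_derivative (\<lambda>h. h * (2 * max 0 s))) (at s)" for s
   unfolding m_def[abs_def]
   by (rule has_derivative_eq_rhs[OF m2_has_derivative[unfolded has_field_derivative_def]]) (simp add: fun_eq_iff)
  have "((\<lambda>x. x \<bullet> x - A^2) has_derivative (\<lambda>v. 2 * (x \<bullet> v))) (at x)"
   by (auto intro!: derivative_eq_intros simp: inner_commute)
  from has_derivative_compose[OF this m] have "((\<lambda>x. 1 - m (x \<bullet> x - A^2)) has_derivative (\<lambda>v. - (2 * (x \<bullet> v) * (2 * max 0 (x \<bullet> x - A^2))))) (at x)"
   by (auto intro!: derivative_eq_intros)
  from has_derivative_compose[OF this m] show ?thesis by (simp add: \<zeta>_def[abs_def] mult_ac)
 qed
 have part: "partial b \<zeta> = (\<lambda>x. (2 * max 0 (1 - m (x \<bullet> x - A^2))) * (- (2 * max 0 (x \<bullet> x - A^2) * (2 * (x \<bullet> b)))))" for b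
  by (rule ext, rule partial_eqI[OF der])
 have in_T: "x \<bullet> x - A^2 \<le> 0" if "x \<in> closure T" for x
  using A that by (auto simp: dot_square_norm intro!: power_mono)
 show ?thesis
 proof (rule that[of \<zeta> "A + 1"])
  show "\<zeta> differentiable (at x)" for x using der differentiable_def by blast
  show "continuous_on UNIV (partial b \<zeta>)" for b
   unfolding part m_def by (intro continuous_intros)
  show 1: "\<zeta> x = 1" if "x \<in> closure T" for x using in_T[OF that] by (simp add: \<zeta>_def m_def max_def)
  then show "\<zeta> x = 1" if "x \<in> T" for x using that closure_subset by blast
  show "partial b \<zeta> x = 0" if "x \<in> T" for x b
   using in_T[of x] that closure_subset[of T] unfolding part by (auto simp: max_def dest: subsetD)
  show "\<zeta> x = 0" if "A + 1 \<le> norm x" for x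
  proof -
   have "(A + 1)^2 \<le> x \<bullet> x" unfolding dot_square_norm using that A by (intro power_mono) auto
   then have "1 \<le> x \<bullet> x - A^2" using A by (simp add: power2_sum)
   then have "1 \<le> (max 0 (x \<bullet> x - A^2))^2" by (simp add: max_def one_le_power)
   then show ?thesis by (simp add: \<zeta>_def m_def max_def)
  qed
 qed
qed

lemma integral_lebesgue_on:
 fixes f :: "'a::euclidean_space => real"
 assumes "T \<in> sets borel" "f \<in> borel_measurable borel"
 shows "(\<integral>x. f x \<partial>lebesgue_on T) = (\<integral>x. indicator T x * f x \<partial>lborel)"
proof -
 have "(\<integral>x. f x \<partial>lebesgue_on T) = (\<integral>x. indicator T x *\<^sub>R f x \<partial>lebesgue)"
  using assms by (intro integral_restrict_space) auto
 also have "... = (\<integral>x. indicator T x *\<^sub>R f x \<partial>lborel)"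
  using assms by (intro integral_completion) auto
 finally show ?thesis by simp
qed

lemma integral_face_measure:
 fixes f :: "'a::euclidean_space => real"
 assumes "F \<in> sets borel" "f \<in> borel_measurable borel"
 shows "(\<integral>x. f x \<partial>face_measure F) = (\<integral>x. indicator F x * f x \<partial>affine_lborel (affine hull F))"
proof -
 have "(\<integral>x. f x \<partial>face_measure F) = (\<integral>x. indicator F x *\<^sub>R f x \<partial>completion (affine_lborel (affine hull F)))"
  unfolding face_measure_def using assms by (intro integral_restrict_space) auto
 also have "... = (\<integral>x. indicator F x *\<^sub>R f x \<partial>affine_lborel (affine hull F))"
  using assms by (intro integral_completion) auto
 finally show ?thesis by simp
qed

text \<open>The fundamental theorem of calculus along the ray from x in direction -b, which ends
  outside the support.\<close>

lemma integral_ray: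
 fixes \<phi> :: "'a::euclidean_space => real"
 assumes d: "\<And>x. \<phi> differentiable (at x)" and c: "continuous_on UNIV (partial b \<phi>)"
  and supp: "\<And>x. r \<le> norm x ==> \<phi> x = 0" and b: "b \<noteq> 0"
 shows "(\<integral>s. indicator {0<..} s * partial b \<phi> (x - s *\<^sub>R b) \<partial>lborel) = \<phi> x"
proof -
 \<comment> \<open>Beyond this parameter the ray is at norm strictly larger than |r|, hence off the
   closure of the support, where the derivative vanishes as well.\<close>
 define S where "S = (\<bar>r\<bar> + 1 + norm x) / norm b"
 have S0: "0 \<le> S" by (simp add: S_def)
 have far: "\<phi> (x - s *\<^sub>R b) = 0 \<and> partial b \<phi> (x - s *\<^sub>R b) = 0" if "S \<le> s" for s
 proof -
  have "\<bar>r\<bar> + 1 + norm x \<le> s * norm b" using that b by (simp add: S_def field_simps)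
  also have "... \<le> \<bar>s\<bar> * norm b" by (simp add: mult_right_mono)
  also have "... \<le> norm (x - s *\<^sub>R b) + norm x"
   using norm_triangle_ineq4[of "x - s *\<^sub>R b" x] by simp
  finally have n: "\<bar>r\<bar> < norm (x - s *\<^sub>R b)" by simp
  have "x - s *\<^sub>R b \<notin> closure {z. \<phi> z \<noteq> 0}"
  proof
   assume "x - s *\<^sub>R b \<in> closure {z. \<phi> z \<noteq> 0}"
   moreover have "closure {z. \<phi> z \<noteq> 0} \<subseteq> cball 0 \<bar>r\<bar>"
    by (rule closure_minimal) (use supp in \<open>force simp: not_le\<close>)+
   ultimately show False using n by auto
  qed
  then show ?thesis using partial_eq_0_outside n supp by auto
 qed
 have der: "((\<lambda>s. - \<phi> (x - s *\<^sub>R b)) has_real_derivative partial b \<phi> (x - s *\<^sub>R b)) (at s)" for s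
 proof -
  have "((\<lambda>s. x - s *\<^sub>R b) has_derivative (\<lambda>h. - (h *\<^sub>R b))) (at s)"
   by (auto intro!: derivative_eq_intros)
  from has_derivative_compose[OF this smooth_has_derivative[OF d]]
  have "((\<lambda>s. \<phi> (x - s *\<^sub>R b)) has_derivative (\<lambda>h. \<Sum>c\<in>Basis. (- (h *\<^sub>R b) \<bullet> c) * partial c \<phi> (x - s *\<^sub>R b))) (at s)" .
  moreover have "(\<Sum>c\<in>Basis. (- (h *\<^sub>R b) \<bullet> c) * partial c \<phi> z) = - (h * partial b \<phi> z)" for h z
   using smooth_has_derivative[OF d, of z] partial_eqI[of \<phi> _ z b]
   by (simp add: sum_negf sum_distrib_left mult.assoc)
  ultimately have "((\<lambda>s. - \<phi> (x - s *\<^sub>R b)) has_derivative (\<lambda>h. - (- (h * partial b \<phi> (x - s *\<^sub>R b))))) (at s)"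
   by (intro has_derivative_minus) simp
  then show ?thesis unfolding has_field_derivative_def
   by (rule has_derivative_eq_rhs) (simp add: fun_eq_iff)
 qed
 have "(\<integral>s. indicator {0<..} s * partial b \<phi> (x - s *\<^sub>R b) \<partial>lborel)
   = (\<integral>s. indicator {0..S} s *\<^sub>R partial b \<phi> (x - s *\<^sub>R b) \<partial>lborel)"
 proof (rule integral_cong_AE)
  have m: "(\<lambda>s. partial b \<phi> (x - s *\<^sub>R b)) \<in> borel_measurable borel"
   by (intro borel_measurable_continuous_onI continuous_on_compose2[OF c] continuous_intros) auto
  then show "(\<lambda>s. indicator {0<..} s * partial b \<phi> (x - s *\<^sub>R b)) \<in> borel_measurable lborel"
   "(\<lambda>s. indicator {0..S} s *\<^sub>R partial b \<phi> (x - s *\<^sub>R b)) \<in> borel_measurable lborel" by auto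
  show "AE s in lborel. indicator {0<..} s * partial b \<phi> (x - s *\<^sub>R b) = indicator {0..S} s *\<^sub>R partial b \<phi> (x - s *\<^sub>R b)"
   using AE_lborel_singleton[of 0] by eventually_elim (use far in \<open>auto split: split_indicator\<close>)
 qed
 also have "... = - \<phi> (x - S *\<^sub>R b) - (- \<phi> (x - 0 *\<^sub>R b))"
 proof (rule integral_FTC_Icc[OF S0])
  show "((\<lambda>s. - \<phi> (x - s *\<^sub>R b)) has_vector_derivative partial b \<phi> (x - s *\<^sub>R b)) (at s within {0..S})" for s
   using der has_real_derivative_iff_has_vector_derivative has_field_derivative_at_within by blast
  show "continuous_on {0..S} (\<lambda>s. partial b \<phi> (x - s *\<^sub>R b))"
   by (intro continuous_on_compose2[OF c] continuous_intros) auto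
 qed
 also have "... = \<phi> x" using far[of S] by simp
 finally show ?thesis .
qed

text \<open>By \<open>integral_shadow\<close> and \<open>integral_ray\<close> the flux through a
  face is the signed integral of the derivative over its shadow, and by \<open>shadow_count\<close>
  the signed shadows add up to the indicator of T. Faces parallel to b have no shadow to integrate
  over, and their flux in direction b is zero.\<close>

lemma divergence_theorem_convex:
 fixes T :: "'a::euclidean_space set" and \<phi> :: "'a => real"
 assumes T: "open T" "convex T" "bounded T" and Fs: "finite Fs" "disjoint Fs"
  and F: "\<And>F. F \<in> Fs ==> F \<noteq> {} \<and> F \<in> sets borel \<and> hyperplane_data (affine hull F) (nrm F) \<and> F \<subseteq> frontier T"
  and half: "\<And>F x. F \<in> Fs ==> x \<in> F ==> \<exists>d>0. ball x d \<inter> {y. nrm F \<bullet> (y - x) < 0} \<subseteq> T"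
  and side: "\<And>F x y. F \<in> Fs ==> x \<in> F ==> y \<in> T ==> nrm F \<bullet> (y - x) < 0"
  and b: "b \<noteq> 0"
  and fr: "AE y in lebesgue. \<forall>s. y + s *\<^sub>R b \<in> frontier T \<longrightarrow> (\<exists>F\<in>Fs. y + s *\<^sub>R b \<in> F)"
  and d: "\<And>x. \<phi> differentiable (at x)" and c: "continuous_on UNIV (partial b \<phi>)"
 shows "(\<integral>x. partial b \<phi> x \<partial>lebesgue_on T) = (\<Sum>F\<in>Fs. (nrm F \<bullet> b) * (\<integral>x. \<phi> x \<partial>face_measure F))"
proof -
 obtain \<zeta> :: "'a => real" and r where \<zeta>: "\<And>x. \<zeta> differentiable (at x)"
  "\<And>b. continuous_on UNIV (partial b \<zeta>)" "\<And>x. x \<in> T ==> \<zeta> x = 1" "\<And>x. x \<in> closure T ==> \<zeta> x = 1"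
  "\<And>x b. x \<in> T ==> partial b \<zeta> x = 0" "\<And>x. r \<le> norm x ==> \<zeta> x = 0"
  by (rule cutoff_exists[OF T(3)]) (rule that)
 \<comment> \<open>The cutoff makes all backward rays end; it is 1 on the closure of T and has zero
   derivative in T, so neither side of the identity changes.\<close>
 define \<psi> where "\<psi> x = \<zeta> x * \<phi> x" for x
 have cont\<phi>: "continuous_on UNIV \<phi>" "continuous_on UNIV \<zeta>"
  using d \<zeta>(1) by (auto intro!: continuous_at_imp_continuous_on differentiable_imp_continuous_within)
 have part: "partial b \<psi> = (\<lambda>x. \<zeta> x * partial b \<phi> x + partial b \<zeta> x * \<phi> x)"
  unfolding \<psi>_def[abs_def] by (rule ext) (rule partial_mult[OF \<zeta>(1) d])
 have d\<psi>: "\<psi> differentiable (at x)" for x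
  unfolding \<psi>_def[abs_def] by (intro differentiable_mult \<zeta>(1) d)
 have c\<psi>: "continuous_on UNIV (partial b \<psi>)"
  unfolding part by (intro continuous_intros c cont\<phi> \<zeta>(2))
 have supp: "\<psi> x = 0" if "r \<le> norm x" for x using \<zeta>(6)[OF that] by (simp add: \<psi>_def)
 have [measurable]: "partial b \<psi> \<in> borel_measurable borel" "\<psi> \<in> borel_measurable borel"
  "partial b \<phi> \<in> borel_measurable borel" "\<phi> \<in> borel_measurable borel" "T \<in> sets borel"
  using c\<psi> c cont\<phi> T(1) by (auto intro!: borel_measurable_continuous_onI continuous_intros simp: \<psi>_def[abs_def])
 have psupp: "partial b \<psi> x = 0" if "x \<notin> cball 0 \<bar>r\<bar>" for x
 proof -
  have "closure {z. \<psi> z \<noteq> 0} \<subseteq> cball 0 \<bar>r\<bar>"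
   by (rule closure_minimal) (use supp in \<open>force simp: not_le\<close>)+
  then show ?thesis using that by (intro partial_eq_0_outside) blast
 qed
 have int: "integrable lborel (partial b \<psi>)"
 proof -
  have "integrable lborel (\<lambda>x. indicator (cball 0 \<bar>r\<bar>) x *\<^sub>R partial b \<psi> x)"
   by (rule borel_integrable_compact) (use c\<psi> in \<open>auto intro: continuous_on_subset\<close>)
  moreover have "(\<lambda>x. indicator (cball 0 \<bar>r\<bar>) x *\<^sub>R partial b \<psi> x) = partial b \<psi>"
   using psupp by (auto simp: fun_eq_iff split: split_indicator)
  ultimately show ?thesis by simp
 qed
 have ray: "(\<integral>s. indicator {0<..} s * partial b \<psi> (x - s *\<^sub>R b) \<partial>lborel) = \<zeta> x * \<phi> x" for x
  using integral_ray[of \<psi> b r x, OF d\<psi> c\<psi> supp b] by (simp add: \<psi>_def)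
 let ?Fb = "{F\<in>Fs. nrm F \<bullet> b \<noteq> 0}"
 have finb: "finite ?Fb" using Fs by simp
 have [measurable]: "shadow F b \<in> sets borel" if "F \<in> ?Fb" for F
  using that F[of F] hull_subset[of F affine] by (intro integral_shadow(1)[where g="\<lambda>_. 0"]) auto
 have sh: "\<bar>nrm F \<bullet> b\<bar> * (\<integral>x. \<phi> x \<partial>face_measure F) = (\<integral>y. indicator (shadow F b) y * partial b \<psi> y \<partial>lborel)"
  if "F \<in> ?Fb" for F
 proof -
  have "(\<integral>x. \<phi> x \<partial>face_measure F) = (\<integral>x. indicator F x * \<phi> x \<partial>affine_lborel (affine hull F))"
   using F[of F] that by (intro integral_face_measure) auto
  also have "... = (\<integral>x. indicator F x * (\<integral>s. indicator {0<..} s * partial b \<psi> (x - s *\<^sub>R b) \<partial>lborel) \<partial>affine_lborel (affine hull F))"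
  proof (rule Bochner_Integration.integral_cong[OF refl])
   fix x
   show "indicator F x * \<phi> x = indicator F x * (\<integral>s. indicator {0<..} s * partial b \<psi> (x - s *\<^sub>R b) \<partial>lborel)"
    using F[of F] that \<zeta>(4)[of x] ray[of x]
    by (auto simp: frontier_def split: split_indicator)
  qed
  finally show ?thesis
   using integral_shadow(2)[of "affine hull F" "nrm F" F b "partial b \<psi>"] F[of F] that hull_subset[of F affine] int
   by auto
 qed
 have intsh: "integrable lborel (\<lambda>y. sgn (nrm F \<bullet> b) * (indicator (shadow F b) y * partial b \<psi> y))" if "F \<in> ?Fb" for F
  using integrable_real_mult_indicator[of "shadow F b" lborel "partial b \<psi>"] int that by (simp add: mult.commute)
 have "(\<integral>x. partial b \<phi> x \<partial>lebesgue_on T) = (\<integral>x. indicator T x * partial b \<phi> x \<partial>lborel)"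
  by (rule integral_lebesgue_on) auto
 also have "... = (\<integral>x. indicator T x * partial b \<psi> x \<partial>lborel)"
  by (rule Bochner_Integration.integral_cong) (auto simp: part \<zeta> split: split_indicator)
 also have "... = (\<integral>x. indicator T x * partial b \<psi> x \<partial>lebesgue)"
  by (rule integral_completion[symmetric]) simp
 also have "... = (\<integral>y. (\<Sum>F\<in>?Fb. sgn (nrm F \<bullet> b) * (indicator (shadow F b) y * partial b \<psi> y)) \<partial>lebesgue)"
 proof (rule integral_cong_AE)
  show "(\<lambda>x. indicator T x * partial b \<psi> x) \<in> borel_measurable lebesgue" by (intro measurable_completion) simp
  show "(\<lambda>y. \<Sum>F\<in>?Fb. sgn (nrm F \<bullet> b) * (indicator (shadow F b) y * partial b \<psi> y)) \<in> borel_measurable lebesgue"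
   by (intro measurable_completion borel_measurable_sum) simp
  have "AE y in lebesgue. y \<notin> frontier T"
   using negligible_convex_frontier[OF T(2)] by (intro AE_not_in) (simp add: negligible_iff_null_sets)
  then show "AE y in lebesgue. indicator T y * partial b \<psi> y = (\<Sum>F\<in>?Fb. sgn (nrm F \<bullet> b) * (indicator (shadow F b) y * partial b \<psi> y))"
   using fr
  proof eventually_elim
   case (elim y)
   then have "(\<Sum>F\<in>?Fb. sgn (nrm F \<bullet> b) * indicator (shadow F b) y) = indicator T y"
    by (intro shadow_count[OF T Fs half side _ _ b]) auto
   then show ?case by (simp add: sum_distrib_right mult.assoc flip: \<open>_ = indicator T y\<close>)
  qed
 qed
 also have "... = (\<integral>y. (\<Sum>F\<in>?Fb. sgn (nrm F \<bullet> b) * (indicator (shadow F b) y * partial b \<psi> y)) \<partial>lborel)"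
  by (rule integral_completion) simp
 also have "... = (\<Sum>F\<in>?Fb. \<integral>y. sgn (nrm F \<bullet> b) * (indicator (shadow F b) y * partial b \<psi> y) \<partial>lborel)"
  by (rule Bochner_Integration.integral_sum[OF intsh])
 also have "... = (\<Sum>F\<in>?Fb. sgn (nrm F \<bullet> b) * (\<bar>nrm F \<bullet> b\<bar> * (\<integral>x. \<phi> x \<partial>face_measure F)))"
  by (intro sum.cong) (simp_all add: sh)
 also have "... = (\<Sum>F\<in>?Fb. (nrm F \<bullet> b) * (\<integral>x. \<phi> x \<partial>face_measure F))"
  by (intro sum.cong) (simp_all add: sgn_mult_abs flip: mult.assoc)
 also have "... = (\<Sum>F\<in>Fs. (nrm F \<bullet> b) * (\<integral>x. \<phi> x \<partial>face_measure F))"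
  using Fs(1) by (intro sum.mono_neutral_left) auto
 finally show ?thesis .
qed

section \<open>Geometry of polytopal meshes\<close>

lemma open_polytopeD:
 assumes "open_polytope T"
 shows "open T" "convex T" "bounded T" "T \<noteq> {}"
 using assms bounded_subset[OF polytope_imp_bounded interior_subset]
 by (auto simp: open_polytope_def polytope_imp_convex)

text \<open>The last two clauses say that near any of its points the face separates an open half
  ball filled by T from one that misses T. The crossing count and the uniqueness of the neighbours
  of a face rest on this.\<close>

definition face_normal :: "'a::euclidean_space set => 'a set => 'a => bool" where
 "face_normal T F n \<longleftrightarrow> norm n = 1 \<and> hyperplane_data (affine hull F) n \<and>
   (\<forall>x\<in>F. \<forall>y\<in>affine hull F. n \<bullet> (y - x) = 0) \<and> (\<forall>x\<in>F. \<forall>y\<in>T. n \<bullet> (y - x) < 0) \<and>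
   (\<forall>x\<in>F. \<exists>d>0. ball x d \<inter> {y. n \<bullet> (y - x) < 0} \<subseteq> T)"

lemma planar_face_hyperplane:
 fixes F :: "'a::euclidean_space set"
 assumes "planar_face F"
 obtains n where "hyperplane_data (affine hull F) n"
proof -
 have "aff_dim F = int DIM('a) - 1" using assms by (simp add: planar_face_def)
 then obtain a b where a: "a \<noteq> 0" and H: "affine hull F = {x. a \<bullet> x = b}"
  using aff_dim_eq_hyperplane[of F] by auto
 have "hyperplane_data (affine hull F) ((1 / norm a) *\<^sub>R a)"
  unfolding hyperplane_data_def
 proof (intro conjI exI[of _ "(b / (a \<bullet> a)) *\<^sub>R a"])
  show "norm ((1 / norm a) *\<^sub>R a) = 1" using a by simp
  have "a \<bullet> (b / (a \<bullet> a)) *\<^sub>R a = b" using a by simp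
  then show "affine hull F = {x. (1 / norm a) *\<^sub>R a \<bullet> (x - (b / (a \<bullet> a)) *\<^sub>R a) = 0}"
   using a unfolding H by (auto simp: inner_diff_right)
 qed
 then show ?thesis by (rule that)
qed

lemma planar_face_rel_open:
 assumes "planar_face F" "x \<in> F"
 obtains e where "e > 0" "ball x e \<inter> affine hull F \<subseteq> F"
proof -
 have F: "F = rel_interior (closure F)" using assms by (simp add: planar_face_def)
 have "openin (top_of_set (affine hull F)) F"
  using openin_rel_interior[of "closure F"] F by simp
 then show ?thesis using that assms(2) by (auto simp: openin_contains_ball)
qed

lemma planar_face_props:
 assumes "planar_face F"
 shows "F \<noteq> {}" "bounded F" "F \<in> sets borel"
proof -
 show "F \<noteq> {}" using assms by (auto simp: planar_face_def)
 obtain Q where Q: "finite Q" "\<And>P. P \<in> Q ==> polytope P" "closure F = \<Union>Q"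
  using assms by (auto simp: planar_face_def)
 have "bounded (closure F)" unfolding Q(3) using Q(1,2) polytope_imp_bounded by (intro bounded_Union) auto
 then show "bounded F" using bounded_subset closure_subset by blast
 have "openin (top_of_set (affine hull closure F)) (rel_interior (closure F))"
  by (rule openin_rel_interior)
 then obtain U where "open U" "rel_interior (closure F) = affine hull closure F \<inter> U"
  by (auto simp: openin_open)
 moreover have "F = rel_interior (closure F)" using assms by (simp add: planar_face_def)
 ultimately have "F = affine hull closure F \<inter> U" "open U" by auto
 moreover have "closed (affine hull closure F)" by (simp add: closed_affine_hull)
 ultimately show "F \<in> sets borel" by (metis borel_closed borel_open sets.Int)
qed

lemma unit_normals_parallel:
 fixes n n' :: "'a::real_inner"
 assumes n: "norm n = 1" "norm n' = 1" and orth: "\<And>v. n \<bullet> v = 0 ==> n' \<bullet> v = 0"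
 shows "n' = n \<or> n' = - n"
proof -
 define c where "c = n \<bullet> n'"
 define v where "v = n' - c *\<^sub>R n"
 have nn: "n \<bullet> n = 1" "n' \<bullet> n' = 1" using n by (simp_all add: norm_eq_1)
 have nv: "n \<bullet> v = 0" by (simp add: v_def inner_diff_right nn c_def)
 then have n'v: "n' \<bullet> v = 0" by (rule orth)
 have "v \<bullet> v = n' \<bullet> v - c * (n \<bullet> v)" by (simp add: v_def inner_diff_left)
 then have "v = 0" using nv n'v by simp
 then have eq: "n' = c *\<^sub>R n" by (simp add: v_def)
 have "1 = c * c" using nn unfolding eq by simp
 then have "c = 1 \<or> c = -1" by (metis square_eq_1_iff)
 then show ?thesis using eq by auto
qed

text \<open>If y in T lay in the plane of F, the segment from y to a point x of F could be prolonged
  within F to some z in the closure of T. Then x would lie strictly between an interior point and a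
  point of the closure, hence in T.\<close>

lemma convex_disjoint_face_hyperplane:
 assumes T: "open T" "convex T" and F: "planar_face F" "F \<subseteq> frontier T"
 shows "T \<inter> affine hull F = {}"
proof (rule ccontr)
 assume "T \<inter> affine hull F \<noteq> {}"
 then obtain y where y: "y \<in> T" "y \<in> affine hull F" by blast
 obtain x where x: "x \<in> F" using planar_face_props(1)[OF F(1)] by blast
 obtain e where e: "e > 0" "ball x e \<inter> affine hull F \<subseteq> F" by (rule planar_face_rel_open[OF F(1) x])
 have xT: "x \<notin> T" using x F(2) T(1) by (auto simp: frontier_def interior_open)
 then have "x \<noteq> y" using y by auto
 define t where "t = e / (2 * norm (x - y))"
 have t: "t > 0" "t * norm (x - y) < e" using e \<open>x \<noteq> y\<close> by (auto simp: t_def)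
 define z where "z = x + t *\<^sub>R (x - y)"
 have "z = (1 + t) *\<^sub>R x + (- t) *\<^sub>R y" by (simp add: z_def algebra_simps)
 moreover have "(1 + t) *\<^sub>R x + (- t) *\<^sub>R y \<in> affine hull F"
  using hull_inc[OF x, of affine] y(2) by (intro mem_affine) auto
 moreover have "z \<in> ball x e" using t by (simp add: z_def dist_norm)
 ultimately have "z \<in> F" using e(2) by blast
 then have zc: "z \<in> closure T" using F(2) by (auto simp: frontier_def)
 define l where "l = t / (1 + t)"
 have l: "0 < l" "l \<le> 1" using t by (auto simp: l_def)
 have "z - l *\<^sub>R (z - y) \<in> interior T"
  using y(1) T zc l by (intro mem_interior_closure_convex_shrink) (auto simp: interior_open)
 moreover have "z - l *\<^sub>R (z - y) = x"
 proof -
  have "z - y = (1 + t) *\<^sub>R (x - y)" by (simp add: z_def algebra_simps)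
  then have "l *\<^sub>R (z - y) = t *\<^sub>R (x - y)" using t by (simp add: l_def)
  then show ?thesis by (simp add: z_def)
 qed
 ultimately show False using xT interior_subset by blast
qed

text \<open>The sign of a unit normal is fixed by one point of T. For the half ball, a point y just
  below the face lies on a segment from t0 in T to a point w of F, and convexity puts y in
  T.\<close>

lemma face_normal_exists:
 assumes T: "open T" "convex T" "T \<noteq> {}" and F: "planar_face F" "F \<subseteq> frontier T"
 shows "\<exists>n. face_normal T F n"
proof -
 obtain n0 where n0: "hyperplane_data (affine hull F) n0" by (rule planar_face_hyperplane[OF F(1)])
 then obtain a where H0: "affine hull F = {x. n0 \<bullet> (x - a) = 0}" and nn0: "norm n0 = 1"
  by (auto simp: hyperplane_data_def)
 have ne: "n0 \<bullet> (y - a) \<noteq> 0" if "y \<in> T" for y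
  using convex_disjoint_face_hyperplane[OF T(1,2) F] that by (auto simp: H0)
 obtain t0 where t0: "t0 \<in> T" using T(3) by blast
 define n where "n = (if n0 \<bullet> (t0 - a) < 0 then n0 else - n0)"
 have nH: "affine hull F = {x. n \<bullet> (x - a) = 0}" "norm n = 1"
  using H0 nn0 by (auto simp: n_def)
 have t0n: "n \<bullet> (t0 - a) < 0" using ne[OF t0] by (auto simp: n_def)
 \<comment> \<open>If two points of T lay on different closed sides of the plane, their segment
   would meet the plane inside T.\<close>
 have nneg: "n \<bullet> (y - a) < 0" if y: "y \<in> T" for y
 proof (rule ccontr)
  assume "\<not> n \<bullet> (y - a) < 0"
  define \<alpha> \<beta> where "\<alpha> = n \<bullet> (y - a)" and "\<beta> = - (n \<bullet> (t0 - a))"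
  have \<alpha>: "\<alpha> \<ge> 0" "\<beta> > 0" using \<open>\<not> n \<bullet> (y - a) < 0\<close> t0n by (auto simp: \<alpha>_def \<beta>_def)
  define l where "l = \<alpha> / (\<alpha> + \<beta>)"
  have l: "0 \<le> l" "l \<le> 1" using \<alpha> by (auto simp: l_def)
  have "(1 - l) *\<^sub>R y + l *\<^sub>R t0 \<in> T" using T(2) y t0 l by (rule convexD_alt)
  moreover have "n \<bullet> ((1 - l) *\<^sub>R y + l *\<^sub>R t0 - a) = (1 - l) * \<alpha> - l * \<beta>"
   by (simp add: \<alpha>_def \<beta>_def inner_diff_right inner_add_right algebra_simps)
  moreover have "(1 - l) * \<alpha> - l * \<beta> = 0" using \<alpha> by (simp add: l_def field_simps)
  ultimately have "(1 - l) *\<^sub>R y + l *\<^sub>R t0 \<in> T \<inter> affine hull F" by (simp add: nH(1))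
  then show False using convex_disjoint_face_hyperplane[OF T(1,2) F] by blast
 qed
 have Fa: "n \<bullet> x = n \<bullet> a" if "x \<in> affine hull F" for x using that by (simp add: nH(1) inner_diff_right)
 have FH: "x \<in> affine hull F" if "x \<in> F" for x using that by (rule hull_inc)
 have orth: "n \<bullet> (y - x) = 0" if "x \<in> F" "y \<in> affine hull F" for x y
  using Fa[OF FH[OF that(1)]] Fa[OF that(2)] by (simp add: inner_diff_right)
 have side: "n \<bullet> (y - x) < 0" if "x \<in> F" "y \<in> T" for x y
  using Fa[OF FH[OF that(1)]] nneg[OF that(2)] by (simp add: inner_diff_right)
 have half: "\<exists>d>0. ball x d \<inter> {y. n \<bullet> (y - x) < 0} \<subseteq> T" if x: "x \<in> F" for x
 proof -
  obtain e where e: "e > 0" "ball x e \<inter> affine hull F \<subseteq> F" by (rule planar_face_rel_open[OF F(1) x])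
  define \<beta> where "\<beta> = - (n \<bullet> (t0 - x))"
  have \<beta>: "\<beta> > 0" using side[OF x t0] by (simp add: \<beta>_def)
  \<comment> \<open>Seen from t0, a point y below the plane is projected to w with |w - x| at most 2
    M |y - x|. The radius d below keeps this under e and keeps the weight l of t0 at most
    1/2.\<close>
  define M where "M = 1 + norm (t0 - x) / \<beta>"
  have M: "M \<ge> 1" using \<beta> by (simp add: M_def)
  define d where "d = min (\<beta> / 2) (e / (2 * M))"
  have d: "d > 0" "d \<le> \<beta> / 2" "d \<le> e / (2 * M)" using \<beta> e M by (auto simp: d_def)
  show ?thesis
  proof (intro exI[of _ d] conjI d(1) subsetI)
   fix y assume "y \<in> ball x d \<inter> {y. n \<bullet> (y - x) < 0}"
   then have y: "norm (y - x) < d" "n \<bullet> (y - x) < 0" by (auto simp: dist_norm norm_minus_commute)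
   define l where "l = - (n \<bullet> (y - x)) / \<beta>"
   have "- (n \<bullet> (y - x)) \<le> norm (y - x)"
    using Cauchy_Schwarz_ineq2[of n "y - x"] nH(2) by simp
   then have ln: "l \<le> norm (y - x) / \<beta>" unfolding l_def by (rule divide_right_mono) (use \<beta> in simp)
   also have "... \<le> 1 / 2" using y(1) d(2) \<beta> by (simp add: field_simps)
   finally have "l \<le> 1 / 2" .
   moreover have "0 < l" unfolding l_def using y(2) \<beta> by (intro divide_pos_pos) auto
   ultimately have l: "0 < l" "l \<le> 1 / 2" by auto
   \<comment> \<open>The point where the ray from t0 through y meets the plane, solved from y = (1 -
     l) w + l t0.\<close>
   define w where "w = x + (1 / (1 - l)) *\<^sub>R ((y - x) - l *\<^sub>R (t0 - x))"
   have yw: "y = w - l *\<^sub>R (w - t0)"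
   proof -
    have "w - l *\<^sub>R (w - t0) = (1 - l) *\<^sub>R (w - x) + (x + l *\<^sub>R (t0 - x))" by (simp add: algebra_simps)
    also have "(1 - l) *\<^sub>R (w - x) = (y - x) - l *\<^sub>R (t0 - x)" using l by (simp add: w_def)
    finally show ?thesis by simp
   qed
   have lb: "l * \<beta> = - (n \<bullet> (y - x))" using \<beta> by (simp add: l_def)
   have "n \<bullet> (w - x) = (1 / (1 - l)) * (n \<bullet> (y - x) - l * (n \<bullet> (t0 - x)))"
    by (simp add: w_def inner_diff_right)
   also have "... = 0" using lb by (simp add: \<beta>_def)
   finally have "n \<bullet> (w - a) = 0" using Fa[OF FH[OF x]] by (simp add: inner_diff_right)
   then have wH: "w \<in> affine hull F" by (simp add: nH(1))
   have "norm (w - x) = (1 / (1 - l)) * norm ((y - x) - l *\<^sub>R (t0 - x))" using l by (simp add: w_def)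
   also have "... \<le> 2 * (norm (y - x) + l * norm (t0 - x))"
   proof (rule mult_mono)
    show "1 / (1 - l) \<le> 2" using l by (simp add: field_simps)
    show "norm ((y - x) - l *\<^sub>R (t0 - x)) \<le> norm (y - x) + l * norm (t0 - x)"
     using norm_triangle_ineq4[of "y - x" "l *\<^sub>R (t0 - x)"] l by simp
   qed (use l in auto)
   also have "... \<le> 2 * (norm (y - x) + norm (y - x) / \<beta> * norm (t0 - x))"
    by (intro mult_left_mono add_left_mono mult_right_mono ln) auto
   also have "... = norm (y - x) * (2 * M)" by (simp add: M_def algebra_simps)
   also have "... < d * (2 * M)" using y(1) M by (intro mult_strict_right_mono) auto
   also have "... \<le> e" using d(3) M by (simp add: field_simps)
   finally have "w \<in> ball x e" by (simp add: dist_norm norm_minus_commute)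
   then have "w \<in> closure T" using wH e(2) F(2) by (auto simp: frontier_def)
   then have "w - l *\<^sub>R (w - t0) \<in> interior T"
    using T t0 l by (intro mem_interior_closure_convex_shrink) (auto simp: interior_open)
   then show "y \<in> T" using yw interior_subset by auto
  qed
 qed
 have "hyperplane_data (affine hull F) n" using nH by (auto simp: hyperplane_data_def)
 then show ?thesis using nH(2) orth side half unfolding face_normal_def by blast
qed

text \<open>F is relatively open in its plane, so every tangent vector of the plane, scaled down, is
  a difference of two points of F; thus n' is orthogonal to the whole plane.\<close>

lemma face_normal_parallel:
 assumes F: "planar_face F" and n: "face_normal T F n" and n': "norm n' = 1" "\<And>x y. x \<in> F ==> y \<in> F ==> n' \<bullet> (y - x) = 0"
 shows "n' = n \<or> n' = - n"
proof (rule unit_normals_parallel)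
 show "norm n = 1" using n by (simp add: face_normal_def)
 fix v assume v: "n \<bullet> v = 0"
 obtain x where x: "x \<in> F" using planar_face_props(1)[OF F] by blast
 obtain e where e: "e > 0" "ball x e \<inter> affine hull F \<subseteq> F" by (rule planar_face_rel_open[OF F x])
 obtain a where H: "affine hull F = {x. n \<bullet> (x - a) = 0}" using n by (auto simp: face_normal_def hyperplane_data_def)
 define t where "t = e / (2 * (norm v + 1))"
 have t: "t > 0" using e by (simp add: t_def add_nonneg_pos)
 have "t * norm v \<le> t * (norm v + 1)" using t by simp
 also have "... = e / 2"
 proof -
  have "norm v + 1 \<noteq> 0" using norm_ge_zero[of v] by linarith
  moreover have "e / (2 * w) * w = e / 2" if "w \<noteq> 0" for w using that by simp
  ultimately show ?thesis unfolding t_def by blast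
 qed
 also have "... < e" using e by simp
 finally have "x + t *\<^sub>R v \<in> ball x e" using t by (simp add: dist_norm)
 moreover have "x + t *\<^sub>R v \<in> affine hull F"
  using hull_inc[OF x, of affine] v by (simp add: H inner_diff_right inner_add_right)
 ultimately have "x + t *\<^sub>R v \<in> F" using e(2) by blast
 then have "n' \<bullet> (t *\<^sub>R v) = 0" using n'(2)[OF x, of "x + t *\<^sub>R v"] by simp
 then show "n' \<bullet> v = 0" using t by simp
qed (rule n'(1))

lemma face_normal_outward:
 assumes T: "open T" "convex T" "T \<noteq> {}" and F: "planar_face F" "F \<subseteq> frontier T"
 shows "face_normal T F (outward_normal T F)"
proof -
 obtain n where n: "face_normal T F n" using face_normal_exists[OF assms] by blast
 have "outward_normal T F = n"
  unfolding outward_normal_def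
 proof (rule the_equality)
  show "norm n = 1 \<and> (\<forall>x\<in>F. \<forall>y\<in>F. n \<bullet> (y - x) = 0) \<and> (\<forall>x\<in>F. \<forall>y\<in>T. n \<bullet> (y - x) \<le> 0)"
   using n by (auto simp: face_normal_def hull_inc intro: less_imp_le)
  fix n' assume n': "norm n' = 1 \<and> (\<forall>x\<in>F. \<forall>y\<in>F. n' \<bullet> (y - x) = 0) \<and> (\<forall>x\<in>F. \<forall>y\<in>T. n' \<bullet> (y - x) \<le> 0)"
  then have "n' = n \<or> n' = - n" using face_normal_parallel[OF F(1) n, of n'] by blast
  moreover have "n' \<noteq> - n"
  proof
   assume "n' = - n"
   obtain x t where x: "x \<in> F" "t \<in> T" using planar_face_props(1)[OF F(1)] T(3) by blast
   then have "n \<bullet> (t - x) < 0" "n' \<bullet> (t - x) \<le> 0" using n n' by (auto simp: face_normal_def)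
   then show False using \<open>n' = - n\<close> by simp
  qed
  ultimately show "n' = n" by simp
 qed
 then show ?thesis using n by simp
qed

lemma ball_half_space_nonempty:
 fixes n x :: "'a::real_inner"
 assumes "norm n = 1" "d > 0"
 shows "x - (d / 2) *\<^sub>R n \<in> ball x d \<inter> {y. n \<bullet> (y - x) < 0}"
proof -
 have "n \<bullet> n = 1" using assms(1) by (simp add: norm_eq_1)
 then show ?thesis using assms by (simp add: dist_norm)
qed

text \<open>With equal normals both elements would contain a common half ball.\<close>

lemma face_normals_opposite:
 assumes F: "planar_face F" and n: "face_normal T1 F n1" "face_normal T2 F n2" and disj: "T1 \<inter> T2 = {}"
 shows "n2 = - n1"
proof -
 have "n2 = n1 \<or> n2 = - n1"
  by (rule face_normal_parallel[OF F n(1)]) (use n(2) in \<open>auto simp: face_normal_def hull_inc\<close>)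
 moreover have "n2 \<noteq> n1"
 proof
  assume eq: "n2 = n1"
  obtain x where x: "x \<in> F" using planar_face_props(1)[OF F] by blast
  obtain d1 d2 where d: "d1 > 0" "ball x d1 \<inter> {y. n1 \<bullet> (y - x) < 0} \<subseteq> T1"
   "d2 > 0" "ball x d2 \<inter> {y. n1 \<bullet> (y - x) < 0} \<subseteq> T2"
   using n x eq unfolding face_normal_def by meson
  have "x - (min d1 d2 / 2) *\<^sub>R n1 \<in> ball x (min d1 d2) \<inter> {y. n1 \<bullet> (y - x) < 0}"
   using n d by (intro ball_half_space_nonempty) (auto simp: face_normal_def)
  then have "x - (min d1 d2 / 2) *\<^sub>R n1 \<in> T1 \<inter> T2" using d(2,4) by auto
  then show False using disj by simp
 qed
 ultimately show ?thesis by simp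
qed

text \<open>If the nearby point of T happens to lie on the hyperplane, a small step along n leaves
  the hyperplane and stays in T.\<close>

lemma open_meets_off_hyperplane:
 fixes n x :: "'a::real_inner"
 assumes T: "open T" "x \<in> closure T" and n: "norm n = 1" and d: "d > 0"
 obtains y where "y \<in> T" "y \<in> ball x d" "n \<bullet> (y - x) \<noteq> 0"
proof -
 obtain y where y: "y \<in> T" "dist y x < d" using T(2) d closure_approachable by blast
 obtain e where e: "e > 0" "ball y e \<subseteq> T" using T(1) y(1) open_contains_ball by blast
 define r where "r = min (e / 2) ((d - dist y x) / 2)"
 have r: "r > 0" "r < e" "r < d - dist y x" using e y by (auto simp: r_def min_def field_simps)
 have nn: "n \<bullet> n = 1" using n by (simp add: norm_eq_1)
 show ?thesis
 proof (cases "n \<bullet> (y - x) = 0")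
  case True
  show ?thesis
  proof (rule that[of "y + r *\<^sub>R n"])
   have "dist y (y + r *\<^sub>R n) = r" using r n by (simp add: dist_norm)
   then show "y + r *\<^sub>R n \<in> T" using e r by auto
   show "y + r *\<^sub>R n \<in> ball x d"
    using dist_triangle[of x "y + r *\<^sub>R n" y] \<open>dist y (y + r *\<^sub>R n) = r\<close> r by (simp add: dist_commute)
   have "n \<bullet> (y + r *\<^sub>R n - x) = r" using True nn by (simp add: inner_diff_right inner_add_right)
   then show "n \<bullet> (y + r *\<^sub>R n - x) \<noteq> 0" using r by simp
  qed
 next
  case False
  then show ?thesis using that y by (auto simp: dist_commute)
 qed
qed

locale mesh =
 fixes \<Omega> :: "'a::euclidean_space set" and Th Fh :: "'a set set"
 assumes \<Omega>: "open_polytope \<Omega>" and mesh: "polytopal_mesh \<Omega> Th Fh"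
begin

lemma finite_Th: "finite Th" and finite_Fh: "finite Fh"
 and disjoint_Th: "disjoint Th" and disjoint_Fh: "disjoint Fh"
 and planar: "F \<in> Fh ==> planar_face F"
 and cover: "(\<Union>T\<in>Th. closure T) = closure \<Omega>"
 using mesh by (auto simp: polytopal_mesh_def)

lemma elem_polytope: "T \<in> Th ==> open_polytope T"
 using mesh by (auto simp: polytopal_mesh_def)

lemmas elem = open_polytopeD[OF elem_polytope]

lemma elem_faces_iff: "F \<in> elem_faces Fh T \<longleftrightarrow> F \<in> Fh \<and> F \<subseteq> frontier T"
 by (simp add: elem_faces_def)

lemma finite_elem_faces: "finite (elem_faces Fh T)"
 using finite_Fh by (simp add: elem_faces_def)

lemma normal: "T \<in> Th ==> F \<in> elem_faces Fh T ==> face_normal T F (outward_normal T F)"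
 using elem planar by (intro face_normal_outward) (auto simp: elem_faces_def)

lemma elem_subset: "T \<in> Th ==> T \<subseteq> \<Omega>"
proof -
 assume T: "T \<in> Th"
 have "T \<subseteq> closure \<Omega>" using cover T closure_subset by fastforce
 then have "T \<subseteq> interior (closure \<Omega>)" using elem(1)[OF T] by (rule interior_maximal)
 also have "... = \<Omega>" using open_polytopeD[OF \<Omega>] by (simp add: convex_interior_closure interior_open)
 finally show "T \<subseteq> \<Omega>" .
qed

lemma elem_disjoint: "T \<in> Th ==> T' \<in> Th ==> T \<noteq> T' ==> T \<inter> T' = {}"
 using disjoint_Th by (auto simp: disjoint_def)

text \<open>The two neighbours fill both half balls around x, so a further element touching x would
  have a point in one of them.\<close>

lemma face_interior_elements:
 assumes T: "T1 \<in> Th" "T2 \<in> Th" "T1 \<noteq> T2" and F: "F \<in> Fh" "F \<subseteq> frontier T1" "F \<subseteq> frontier T2"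
  and x: "x \<in> F" "x \<in> closure T" "T \<in> Th"
 shows "T = T1 \<or> T = T2"
proof (rule ccontr)
 assume neq: "\<not> (T = T1 \<or> T = T2)"
 let ?n = "outward_normal T1 F"
 have n: "face_normal T1 F ?n" "face_normal T2 F (outward_normal T2 F)"
  using normal F T by (auto simp: elem_faces_iff)
 have opp: "outward_normal T2 F = - ?n"
  by (rule face_normals_opposite[OF planar[OF F(1)] n elem_disjoint[OF T]])
 obtain d1 d2 where d: "d1 > 0" "ball x d1 \<inter> {y. ?n \<bullet> (y - x) < 0} \<subseteq> T1"
  "d2 > 0" "ball x d2 \<inter> {y. (- ?n) \<bullet> (y - x) < 0} \<subseteq> T2"
  using n x(1) unfolding face_normal_def opp by meson
 have "norm ?n = 1" "0 < min d1 d2" using n d by (auto simp: face_normal_def)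
 from open_meets_off_hyperplane[OF elem(1)[OF x(3)] x(2) this]
 obtain y where y: "y \<in> T" "y \<in> ball x (min d1 d2)" "?n \<bullet> (y - x) \<noteq> 0" by blast
 then have "y \<in> T1 \<union> T2" using d(2,4) by (cases "?n \<bullet> (y - x) < 0") auto
 then show False using y(1) elem_disjoint[OF x(3)] T neq by blast
qed

text \<open>The outward normals of T1 and of \<Omega> agree along F because T1 lies in \<Omega>.
  Every element is on the inner side, and near x that side is filled by T1.\<close>

lemma face_boundary_element:
 assumes T: "T1 \<in> Th" and F: "F \<in> Fh" "F \<subseteq> frontier T1" "F \<subseteq> frontier \<Omega>"
  and x: "x \<in> F" "x \<in> closure T" "T \<in> Th"
 shows "T = T1"
proof (rule ccontr)
 assume neq: "T \<noteq> T1"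
 let ?n = "outward_normal T1 F"
 have n: "face_normal T1 F ?n" using normal F T by (auto simp: elem_faces_iff)
 have m: "face_normal \<Omega> F (outward_normal \<Omega> F)"
  using open_polytopeD[OF \<Omega>] planar F by (intro face_normal_outward) auto
 have "outward_normal \<Omega> F = ?n \<or> outward_normal \<Omega> F = - ?n"
  by (rule face_normal_parallel[OF planar[OF F(1)] n]) (use m in \<open>auto simp: face_normal_def hull_inc\<close>)
 moreover have "outward_normal \<Omega> F \<noteq> - ?n"
 proof
  assume eq: "outward_normal \<Omega> F = - ?n"
  obtain t where "t \<in> T1" using elem(4)[OF T] by blast
  then have "?n \<bullet> (t - x) < 0" "(- ?n) \<bullet> (t - x) < 0"
   using n m x(1) elem_subset[OF T] unfolding eq face_normal_def by blast+
  then show False by simp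
 qed
 ultimately have eq: "outward_normal \<Omega> F = ?n" by simp
 obtain d where d: "d > 0" "ball x d \<inter> {y. ?n \<bullet> (y - x) < 0} \<subseteq> T1"
  using n x(1) unfolding face_normal_def by meson
 obtain y where y: "y \<in> T" "y \<in> ball x d"
  using x(2) d(1) by (auto simp: closure_approachable dist_commute)
 have "?n \<bullet> (y - x) < 0"
  using m x(1) y(1) elem_subset[OF x(3)] unfolding eq face_normal_def by blast
 then have "y \<in> T1" using d(2) y(2) by blast
 then show False using y(1) elem_disjoint[OF x(3) T neq] by blast
qed

lemma frontier_cover: "(\<Union>T\<in>Th. frontier T) \<subseteq> (\<Union>F\<in>Fh. closure F)"
 by (rule mesh[unfolded polytopal_mesh_def, THEN conjunct2, THEN conjunct2, THEN conjunct2, THEN conjunct2, THEN conjunct2, THEN conjunct2, THEN conjunct2, THEN conjunct1])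

lemma face_alternatives:
 assumes "F \<in> Fh"
 shows "(\<exists>T1\<in>Th. \<exists>T2\<in>Th. T1 \<noteq> T2 \<and> F \<subseteq> frontier T1 \<and> F \<subseteq> frontier T2)
  \<or> (\<exists>T\<in>Th. F \<subseteq> frontier T \<and> F \<subseteq> frontier \<Omega>)"
 by (rule mesh[unfolded polytopal_mesh_def Int_subset_iff, THEN conjunct2, THEN conjunct2, THEN conjunct2, THEN conjunct2, THEN conjunct2, THEN conjunct2, THEN conjunct2, THEN conjunct2, rule_format, OF assms])

text \<open>The complete list of neighbours, not mere existence: \<open>normal_flux_cancel\<close>
  turns a sum over elements into a sum over faces.\<close>

lemma face_cases:
 assumes "F \<in> Fh"
 obtains (interior) T1 T2 where "T1 \<in> Th" "T2 \<in> Th" "T1 \<noteq> T2" "{T\<in>Th. F \<in> elem_faces Fh T} = {T1, T2}"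
   "outward_normal T2 F = - outward_normal T1 F"
  | (boundary) T1 where "T1 \<in> Th" "{T\<in>Th. F \<in> elem_faces Fh T} = {T1}" "F \<subseteq> frontier \<Omega>"
proof -
 obtain x where x: "x \<in> F" using planar_face_props(1)[OF planar[OF assms]] by blast
 consider T1 T2 where "T1 \<in> Th" "T2 \<in> Th" "T1 \<noteq> T2" "F \<subseteq> frontier T1" "F \<subseteq> frontier T2"
  | T1 where "T1 \<in> Th" "F \<subseteq> frontier T1" "F \<subseteq> frontier \<Omega>"
  using face_alternatives[OF assms] by (elim disjE bexE conjE) (rule that(1) that(2); assumption)+
 then show ?thesis
 proof cases
  case 1
  have "T = T1 \<or> T = T2" if "T \<in> Th" "F \<in> elem_faces Fh T" for T
  proof (rule face_interior_elements[OF 1(1-3) assms 1(4,5) x _ that(1)])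
   show "x \<in> closure T" using that(2) x by (auto simp: elem_faces_iff frontier_def)
  qed
  moreover have "F \<in> elem_faces Fh T1" "F \<in> elem_faces Fh T2" using 1 assms by (auto simp: elem_faces_iff)
  ultimately have "{T\<in>Th. F \<in> elem_faces Fh T} = {T1, T2}" using 1(1,2) by blast
  moreover have "outward_normal T2 F = - outward_normal T1 F"
   using 1 assms by (intro face_normals_opposite[OF planar[OF assms] normal normal elem_disjoint]) (auto simp: elem_faces_iff)
  ultimately show ?thesis by (intro interior[OF 1(1-3)])
 next
  case 2
  have "T = T1" if "T \<in> Th" "F \<in> elem_faces Fh T" for T
  proof (rule face_boundary_element[OF 2(1) assms 2(2,3) x _ that(1)])
   show "x \<in> closure T" using that(2) x by (auto simp: elem_faces_iff frontier_def)
  qed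
  moreover have "F \<in> elem_faces Fh T1" using 2 assms by (auto simp: elem_faces_iff)
  ultimately have "{T\<in>Th. F \<in> elem_faces Fh T} = {T1}" using 2(1) by blast
  then show ?thesis by (intro boundary[OF 2(1) _ 2(3)])
 qed
qed

text \<open>The mesh relates whole faces to their neighbours; by the two preceding characterizations
  one common point already forces F into the frontier of T.\<close>

lemma face_meets_frontier:
 assumes "F \<in> Fh" "x \<in> F" "x \<in> frontier T" "T \<in> Th"
 shows "F \<in> elem_faces Fh T"
proof -
 have xT: "x \<in> closure T" using assms(3) by (simp add: frontier_def)
 consider T1 T2 where "T1 \<in> Th" "T2 \<in> Th" "T1 \<noteq> T2" "F \<subseteq> frontier T1" "F \<subseteq> frontier T2"
  | T1 where "T1 \<in> Th" "F \<subseteq> frontier T1" "F \<subseteq> frontier \<Omega>"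
  using face_alternatives[OF assms(1)] by (elim disjE bexE conjE) (rule that(1) that(2); assumption)+
 then show ?thesis
 proof cases
  case 1
  then show ?thesis
   using face_interior_elements[OF 1(1-3) assms(1) 1(4,5) assms(2) xT assms(4)] assms(1)
   by (auto simp: elem_faces_iff)
 next
  case 2
  then show ?thesis
   using face_boundary_element[OF 2(1) assms(1) 2(2,3) assms(2) xT assms(4)] assms(1)
   by (auto simp: elem_faces_iff)
 qed
qed

end

text \<open>Sweeping a set of dimension at most d - 2 along a line raises its dimension by at most
  one, so it stays within a proper affine subspace.\<close>

lemma negligible_tube:
 fixes S :: "'a::euclidean_space set"
 assumes "aff_dim S \<le> int DIM('a) - 2"
 shows "negligible {y. \<exists>s. y + s *\<^sub>R b \<in> S}"
proof (cases "S = {}")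
 case False
 then obtain a where a: "a \<in> S" by blast
 let ?D = "insert b ((+) (- a) ` S)"
 have "aff_dim S = int (dim ((+) (- a) ` S))"
  by (rule aff_dim_eq_dim[OF hull_inc[OF a]])
 moreover have "dim ?D \<le> dim ((+) (- a) ` S) + 1" unfolding dim_insert by simp
 ultimately have "dim ?D < DIM('a)" using assms by linarith
 then have "dim (span ?D) < DIM('a)" by (simp only: dim_span)
 then have "negligible (span ?D)" by (rule negligible_lowdim)
 then have "negligible ((+) a ` span ?D)" by (rule negligible_translation)
 moreover have "{y. \<exists>s. y + s *\<^sub>R b \<in> S} \<subseteq> (+) a ` span ?D"
 proof
  fix y assume "y \<in> {y. \<exists>s. y + s *\<^sub>R b \<in> S}"
  then obtain s where "y + s *\<^sub>R b \<in> S" by blast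
  then have "- a + (y + s *\<^sub>R b) \<in> span ?D" by (intro span_base insertI2 imageI)
  moreover have "s *\<^sub>R b \<in> span ?D" by (intro span_scale span_base insertI1)
  ultimately have "(- a + (y + s *\<^sub>R b)) - s *\<^sub>R b \<in> span ?D" by (rule span_diff)
  moreover have "y = a + ((- a + (y + s *\<^sub>R b)) - s *\<^sub>R b)" by simp
  ultimately show "y \<in> (+) a ` span ?D" by (rule rev_image_eqI)
 qed
 ultimately show ?thesis by (rule negligible_subset)
qed simp

text \<open>F is the relative interior of its closure, so a point of the closure outside F lies in
  the relative frontier of every full-dimensional piece that contains it. The relative boundary is
  thus covered by finitely many sets of dimension at most d - 2.\<close>

lemma planar_face_boundary_tube:
 fixes F :: "'a::euclidean_space set"
 assumes "planar_face F"
 shows "negligible {y. \<exists>s. y + s *\<^sub>R b \<in> closure F - F}"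
proof -
 obtain Q where Q: "finite Q" "\<And>P. P \<in> Q ==> polytope P" "closure F = \<Union>Q"
  using assms by (auto simp: planar_face_def)
 have dimF: "aff_dim F = int DIM('a) - 1" and F: "F = rel_interior (closure F)"
  using assms by (auto simp: planar_face_def)
 \<comment> \<open>Pieces of lower dimension are kept whole, the others are replaced by their
   facets.\<close>
 define N where "N P = (if aff_dim P \<le> int DIM('a) - 2 then {P} else {f. f facet_of P})" for P :: "'a set"
 have finN: "finite (\<Union>P\<in>Q. N P)"
  using Q(1,2) finite_polytope_facets by (auto simp: N_def)
 have dimP: "aff_dim P \<le> int DIM('a) - 1" if "P \<in> Q" for P
 proof -
  have "aff_dim P \<le> aff_dim (affine hull (closure F))"
   using that Q(3) by (intro aff_dim_subset) (auto intro: hull_inc)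
  then show ?thesis using dimF by simp
 qed
 have dimN: "aff_dim S \<le> int DIM('a) - 2" if S: "S \<in> (\<Union>P\<in>Q. N P)" for S
 proof -
  obtain P where P: "P \<in> Q" "S \<in> N P" using S by blast
  then show ?thesis using dimP[OF P(1)] by (auto simp: N_def facet_of_def split: if_splits)
 qed
 have sub: "closure F - F \<subseteq> \<Union>(\<Union>P\<in>Q. N P)"
 proof
  fix x assume x: "x \<in> closure F - F"
  then obtain P where P: "P \<in> Q" "x \<in> P" using Q(3) by blast
  show "x \<in> \<Union>(\<Union>P\<in>Q. N P)"
  proof (cases "aff_dim P \<le> int DIM('a) - 2")
   case True
   then show ?thesis using P by (auto simp: N_def)
  next
   case False
   moreover have "aff_dim (closure F) = aff_dim F"
    using aff_dim_affine_hull[of "closure F"] by simp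
   ultimately have "aff_dim P = aff_dim (closure F)" using dimP[OF P(1)] dimF by simp
   moreover have PF: "P \<subseteq> closure F" using P Q(3) by blast
   ultimately have "affine hull P = affine hull (closure F)"
    using aff_dim_eq_full_gen by blast
   then have "rel_interior P \<subseteq> F" using F subset_rel_interior[OF PF] by simp
   then have "x \<in> rel_frontier P" using x P(2) closure_subset by (auto simp: rel_frontier_def)
   moreover have "rel_frontier P = \<Union>{f. f facet_of P}"
    using Q(2)[OF P(1)] by (intro rel_frontier_of_polyhedron polytope_imp_polyhedron)
   ultimately show ?thesis using P False by (auto simp: N_def)
  qed
 qed
 have "negligible (\<Union>S\<in>(\<Union>P\<in>Q. N P). {y. \<exists>s. y + s *\<^sub>R b \<in> S})"
  by (rule negligible_Union[OF finite_imageI[OF finN]]) (erule imageE, simp only:, rule negligible_tube, rule dimN)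
 moreover have "{y. \<exists>s. y + s *\<^sub>R b \<in> closure F - F} \<subseteq> (\<Union>S\<in>(\<Union>P\<in>Q. N P). {y. \<exists>s. y + s *\<^sub>R b \<in> S})"
 proof
  fix y assume "y \<in> {y. \<exists>s. y + s *\<^sub>R b \<in> closure F - F}"
  then obtain s where "y + s *\<^sub>R b \<in> closure F - F" by (elim CollectE exE)
  with sub have "y + s *\<^sub>R b \<in> \<Union>(\<Union>P\<in>Q. N P)" by (rule subsetD)
  then obtain S where S: "S \<in> (\<Union>P\<in>Q. N P)" "y + s *\<^sub>R b \<in> S" by (rule UnionE)
  then show "y \<in> (\<Union>S\<in>(\<Union>P\<in>Q. N P). {y. \<exists>s. y + s *\<^sub>R b \<in> S})"
   by (intro UN_I[OF S(1)] CollectI exI) (rule S(2))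
 qed
 ultimately show ?thesis by (rule negligible_subset)
qed

context mesh
begin

text \<open>Almost every line in direction b avoids the relative boundaries of all faces, so
  wherever it meets the frontier of T it meets an open face, which belongs to T by
  \<open>face_meets_frontier\<close>.\<close>

theorem divergence_theorem:
 assumes T: "T \<in> Th" and b: "b \<noteq> 0"
  and d: "\<And>x. \<phi> differentiable (at x)" and c: "continuous_on UNIV (partial b \<phi>)"
 shows "(\<integral>x. partial b \<phi> x \<partial>lebesgue_on T)
  = (\<Sum>F\<in>elem_faces Fh T. (outward_normal T F \<bullet> b) * (\<integral>x. \<phi> x \<partial>face_measure F))"
proof (rule divergence_theorem_convex[OF elem(1-3)[OF T] finite_elem_faces])
 show "disjoint (elem_faces Fh T)" using disjoint_Fh by (auto simp: elem_faces_def disjoint_def)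
 show "F \<noteq> {} \<and> F \<in> sets borel \<and> hyperplane_data (affine hull F) (outward_normal T F) \<and> F \<subseteq> frontier T"
  if "F \<in> elem_faces Fh T" for F
  using planar_face_props[OF planar, of F] that normal[OF T that] by (auto simp: elem_faces_iff face_normal_def)
 show "\<exists>d>0. ball x d \<inter> {y. outward_normal T F \<bullet> (y - x) < 0} \<subseteq> T" if "F \<in> elem_faces Fh T" "x \<in> F" for F x
  using normal[OF T that(1)] that(2) unfolding face_normal_def by blast
 show "outward_normal T F \<bullet> (y - x) < 0" if "F \<in> elem_faces Fh T" "x \<in> F" "y \<in> T" for F x y
  using normal[OF T that(1)] that unfolding face_normal_def by blast
 have "negligible (\<Union>F\<in>Fh. {y. \<exists>s. y + s *\<^sub>R b \<in> closure F - F})"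
  by (rule negligible_Union[OF finite_imageI[OF finite_Fh]])
    (erule imageE, simp only:, rule planar_face_boundary_tube, rule planar)
 then have "AE y in lebesgue. y \<notin> (\<Union>F\<in>Fh. {y. \<exists>s. y + s *\<^sub>R b \<in> closure F - F})"
  by (intro AE_not_in) (simp add: negligible_iff_null_sets)
 then show "AE y in lebesgue. \<forall>s. y + s *\<^sub>R b \<in> frontier T \<longrightarrow> (\<exists>F\<in>elem_faces Fh T. y + s *\<^sub>R b \<in> F)"
 proof eventually_elim
  case (elim y)
  show ?case
  proof (intro allI impI)
   fix s assume s: "y + s *\<^sub>R b \<in> frontier T"
   then have "y + s *\<^sub>R b \<in> (\<Union>F\<in>Fh. closure F)"
    using frontier_cover T by blast
   then obtain F where F: "F \<in> Fh" "y + s *\<^sub>R b \<in> closure F" by blast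
   then have "y + s *\<^sub>R b \<in> F" using elim by blast
   then show "\<exists>F\<in>elem_faces Fh T. y + s *\<^sub>R b \<in> F" using face_meets_frontier[OF F(1) _ s T] by blast
  qed
 qed
qed (fact b d c)+

end

section \<open>Mollification and Sobolev functions\<close>

text \<open>A hyperplane H beyond the support plays the role of a face: its shadow contains the
  support, and the function vanishes on H.\<close>

lemma integral_partial_compact_support:
 fixes f :: "'a::euclidean_space => real"
 assumes d: "\<And>x. f differentiable (at x)" and c: "continuous_on UNIV (partial b f)"
  and supp: "\<And>x. r \<le> norm x ==> f x = 0" and b: "b \<in> Basis"
 shows "(\<integral>x. partial b f x \<partial>lborel) = 0"
proof -
 define a where "a = (\<bar>r\<bar> + 1) *\<^sub>R b"
 define H where "H = {x. b \<bullet> (x - a) = 0}"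
 have n: "norm b = 1" "b \<bullet> b = 1" using b by (auto simp: inner_same_Basis)
 have HD: "hyperplane_data H b" using n by (auto simp: hyperplane_data_def H_def)
 have Hc: "closed H" unfolding H_def by (intro closed_Collect_eq continuous_intros)
 have aH: "a \<in> H" by (simp add: H_def)
 have [measurable]: "partial b f \<in> borel_measurable borel" using c by (rule borel_measurable_continuous_onI)
 have psupp: "partial b f x = 0" if "\<bar>r\<bar> < norm x" for x
 proof -
  have "closure {z. f z \<noteq> 0} \<subseteq> cball 0 \<bar>r\<bar>"
   by (rule closure_minimal) (use supp in \<open>force simp: not_le\<close>)+
  then show ?thesis using that by (intro partial_eq_0_outside) auto
 qed
 have "integrable lborel (\<lambda>x. indicator (cball 0 \<bar>r\<bar>) x *\<^sub>R partial b f x)"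
  by (rule borel_integrable_compact) (use c in \<open>auto intro: continuous_on_subset\<close>)
 moreover have "(\<lambda>x. indicator (cball 0 \<bar>r\<bar>) x *\<^sub>R partial b f x) = partial b f"
  using psupp by (auto simp: fun_eq_iff not_le split: split_indicator)
 ultimately have int: "integrable lborel (partial b f)" by simp
 have far: "f x = 0" if "x \<in> H" for x
 proof (rule supp)
  have "b \<bullet> x = \<bar>r\<bar> + 1" using that n by (simp add: H_def a_def inner_diff_right)
  then show "r \<le> norm x" using Cauchy_Schwarz_ineq2[of b x] n by simp
 qed
 have sh: "indicator (shadow H b) y * partial b f y = partial b f y" for y
 proof (cases "y \<in> shadow H b")
  case False
  have "y + (\<bar>r\<bar> + 1 - b \<bullet> y) *\<^sub>R b \<in> H" using n by (simp add: H_def a_def inner_diff_right inner_add_right)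
  then have "\<not> 0 < \<bar>r\<bar> + 1 - b \<bullet> y" using False by (auto simp: shadow_def)
  then have "\<bar>r\<bar> < norm y" using Cauchy_Schwarz_ineq2[of b y] n by simp
  then show ?thesis by (simp add: psupp)
 qed simp
 have ray: "(\<integral>s. indicator {0<..} s * partial b f (x - s *\<^sub>R b) \<partial>lborel) = f x" for x
  by (rule integral_ray[OF d c supp]) (use n in auto)
 have "(\<integral>x. partial b f x \<partial>lborel) = (\<integral>y. indicator (shadow H b) y * partial b f y \<partial>lborel)"
  by (simp add: sh)
 also have "... = \<bar>b \<bullet> b\<bar> * (\<integral>x. indicator H x * (\<integral>s. indicator {0<..} s * partial b f (x - s *\<^sub>R b) \<partial>lborel) \<partial>affine_lborel H)"
  by (rule integral_shadow(2)[symmetric, OF HD subset_refl]) (use Hc aH n int in auto)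
 also have "(\<lambda>x. indicator H x * (\<integral>s. indicator {0<..} s * partial b f (x - s *\<^sub>R b) \<partial>lborel)) = (\<lambda>x. 0)"
  unfolding ray using far by (auto simp: fun_eq_iff split: split_indicator)
 finally show ?thesis by simp
qed

section \<open>Square integrability, differentiation under the integral sign and density of
  continuous functions\<close>

lemma continuous_L2:
 fixes f :: "'a::euclidean_space => real"
 assumes D: "bounded D" "D \<in> sets lebesgue" and f: "continuous_on UNIV f"
 shows "L2 (lebesgue_on D) f"
proof -
 have "compact (closure D)" using D(1) by (simp add: compact_closure)
 then have "bounded (f ` closure D)"
  using f by (intro compact_imp_bounded compact_continuous_image) (auto intro: continuous_on_subset)
 then obtain B where B: "\<And>x. x \<in> closure D ==> \<bar>f x\<bar> \<le> B" by (auto simp: bounded_iff)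
 show ?thesis
 proof (rule L2_bounded)
  show "finite_measure (lebesgue_on D)"
   using D by (intro finite_measure_lebesgue_on bounded_set_imp_lmeasurable)
  show "f \<in> borel_measurable (lebesgue_on D)"
   using borel_measurable_continuous_onI[OF f] by (intro measurable_restrict_space1 measurable_completion) simp
  show "AE x in lebesgue_on D. \<bar>f x\<bar> \<le> B"
   using B closure_subset by (intro AE_I2) auto
 qed
qed

lemma test_function_bounded:
 fixes \<sigma> :: "'a::euclidean_space => real"
 assumes "test_function D \<sigma>"
 obtains B where "0 \<le> B" "\<And>x. \<bar>\<sigma> x\<bar> \<le> B"
proof -
 let ?S = "closure {x. \<sigma> x \<noteq> 0}"
 have "bounded (\<sigma> ` ?S)"
  using assms by (intro compact_imp_bounded compact_continuous_image smooth_continuous) (auto simp: test_function_def)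
 then obtain B where B: "\<And>x. x \<in> ?S ==> \<bar>\<sigma> x\<bar> \<le> B" by (auto simp: bounded_iff)
 have "\<bar>\<sigma> x\<bar> \<le> \<bar>B\<bar>" for x
 proof (cases "\<sigma> x = 0")
  case False
  then have "x \<in> ?S" using closure_subset[of "{x. \<sigma> x \<noteq> 0}"] by auto
  then show ?thesis using B[of x] by linarith
 qed simp
 then show ?thesis using that[of "\<bar>B\<bar>"] by simp
qed

lemma test_function_lipschitz:
 fixes \<sigma> :: "'a::euclidean_space => real"
 assumes "test_function D \<sigma>"
 obtains L where "0 \<le> L" "\<And>x y. \<bar>\<sigma> x - \<sigma> y\<bar> \<le> L * norm (x - y)"
  "\<And>x v. \<bar>\<Sum>b\<in>Basis. (v \<bullet> b) * partial b \<sigma> x\<bar> \<le> L * norm v"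
proof -
 have "\<forall>b\<in>Basis. \<exists>B. 0 \<le> B \<and> (\<forall>x. \<bar>partial b \<sigma> x\<bar> \<le> B)"
  using test_function_bounded[OF test_function_partial[OF assms]] by metis
 then obtain B where B: "\<And>b x. b \<in> Basis ==> 0 \<le> B b \<and> \<bar>partial b \<sigma> x\<bar> \<le> B b" by metis
 define L where "L = (\<Sum>b\<in>Basis. B b)"
 have L0: "0 \<le> L" unfolding L_def using B by (intro sum_nonneg) auto
 have bd: "\<bar>\<Sum>b\<in>Basis. (v \<bullet> b) * partial b \<sigma> x\<bar> \<le> L * norm v" for x v
 proof -
  have "\<bar>\<Sum>b\<in>Basis. (v \<bullet> b) * partial b \<sigma> x\<bar> \<le> (\<Sum>b\<in>Basis. \<bar>(v \<bullet> b) * partial b \<sigma> x\<bar>)" by (rule sum_abs)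
  also have "... \<le> (\<Sum>b\<in>Basis. norm v * B b)"
   unfolding abs_mult using B by (intro sum_mono mult_mono Basis_le_norm) auto
  also have "... = L * norm v" by (simp add: L_def sum_distrib_left mult.commute)
  finally show ?thesis .
 qed
 have "\<bar>\<sigma> x - \<sigma> y\<bar> \<le> L * norm (x - y)" for x y
 proof -
  have "norm (\<sigma> x - \<sigma> y) \<le> L * norm (x - y)"
  proof (rule differentiable_bound[of UNIV \<sigma> "\<lambda>x v. \<Sum>b\<in>Basis. (v \<bullet> b) * partial b \<sigma> x"])
   show "(\<sigma> has_derivative (\<lambda>v. \<Sum>b\<in>Basis. (v \<bullet> b) * partial b \<sigma> x)) (at x within UNIV)" for x
    using smooth_has_derivative smooth_differentiable test_function_smooth[OF assms] by auto
   show "onorm (\<lambda>v. \<Sum>b\<in>Basis. (v \<bullet> b) * partial b \<sigma> x) \<le> L" for x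
    by (rule onorm_le) (use bd in simp)
  qed auto
  then show ?thesis by simp
 qed
 then show ?thesis using that L0 bd by blast
qed

text \<open>The argument is affine in both variables with independent factors, because the mollifier
  contracts the domain besides averaging. Differentiation under the integral is justified by
  dominated convergence.\<close>

lemma convolution_has_derivative:
 fixes h :: "'a::euclidean_space => real"
 assumes h: "integrable M h" and M: "\<And>f :: 'a => real. f \<in> borel_measurable borel ==> f \<in> borel_measurable M"
  and \<sigma>: "test_function UNIV \<sigma>"
 shows "((\<lambda>x. \<integral>z. h z * \<sigma> (a *\<^sub>R x + e *\<^sub>R z + c) \<partial>M) has_derivative
   (\<lambda>v. \<Sum>b\<in>Basis. (v \<bullet> b) * (a * (\<integral>z. h z * partial b \<sigma> (a *\<^sub>R x + e *\<^sub>R z + c) \<partial>M)))) (at x)"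
proof -
 have meas: "(\<lambda>z. \<tau> (a *\<^sub>R y + e *\<^sub>R z + c)) \<in> borel_measurable M" if "smooth_fun \<tau>" for \<tau> :: "'a => real" and y
  by (intro M borel_measurable_continuous_onI continuous_on_compose2[OF smooth_continuous[OF that], of UNIV] continuous_intros) auto
 have int: "integrable M (\<lambda>z. h z * \<tau> (a *\<^sub>R y + e *\<^sub>R z + c))" if \<tau>: "test_function UNIV \<tau>" for \<tau> :: "'a => real" and y
 proof -
  obtain B where B: "0 \<le> B" "\<And>x. \<bar>\<tau> x\<bar> \<le> B" by (rule test_function_bounded[OF \<tau>]) blast
  show ?thesis
  proof (rule Bochner_Integration.integrable_bound[of M "\<lambda>z. B * h z"])
   show "AE z in M. norm (h z * \<tau> (a *\<^sub>R y + e *\<^sub>R z + c)) \<le> norm (B * h z)"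
    using B by (intro AE_I2) (auto simp: abs_mult mult.commute[of B] intro!: mult_left_mono)
  qed (use h meas[OF test_function_smooth[OF \<tau>]] in auto)
 qed
 obtain L where L: "0 \<le> L" "\<And>x y. \<bar>\<sigma> x - \<sigma> y\<bar> \<le> L * norm (x - y)"
  "\<And>x v. \<bar>\<Sum>b\<in>Basis. (v \<bullet> b) * partial b \<sigma> x\<bar> \<le> L * norm v"
  by (rule test_function_lipschitz[OF \<sigma>]) blast
 have s\<sigma>: "smooth_fun \<sigma>" using \<sigma> by (rule test_function_smooth)
 define F where "F y = (\<integral>z. h z * \<sigma> (a *\<^sub>R y + e *\<^sub>R z + c) \<partial>M)" for y
 define G where "G v = (\<Sum>b\<in>Basis. (v \<bullet> b) * (a * (\<integral>z. h z * partial b \<sigma> (a *\<^sub>R x + e *\<^sub>R z + c) \<partial>M)))" for v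
 \<comment> \<open>The first-order remainder of the integrand divided by |y - x|. The difference and
   the linear part are each Lipschitz with constant |a| L, which gives an integrable bound; at y = x
   division by zero yields 0.\<close>
 define q where "q y z = (1 / norm (y - x)) * (\<sigma> (a *\<^sub>R y + e *\<^sub>R z + c) - \<sigma> (a *\<^sub>R x + e *\<^sub>R z + c)
   - (\<Sum>b\<in>Basis. ((a *\<^sub>R (y - x)) \<bullet> b) * partial b \<sigma> (a *\<^sub>R x + e *\<^sub>R z + c)))" for y z
 have mq: "q y \<in> borel_measurable M" for y
  unfolding q_def[abs_def] using meas s\<sigma> smooth_partial[OF s\<sigma>]
  by (intro borel_measurable_times borel_measurable_diff borel_measurable_sum borel_measurable_const) auto
 have eq: "(1 / norm (y - x)) *\<^sub>R (F y - (F x + G (y - x))) = (\<integral>z. h z * q y z \<partial>M)" for y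
 proof -
  have G': "G (y - x) = (\<integral>z. (\<Sum>b\<in>Basis. ((a *\<^sub>R (y - x)) \<bullet> b) * (h z * partial b \<sigma> (a *\<^sub>R x + e *\<^sub>R z + c))) \<partial>M)"
   unfolding G_def
   by (subst Bochner_Integration.integral_sum)
     (auto intro!: integrable_mult_right int test_function_partial[OF \<sigma>] sum.cong)
  have "F y - F x - G (y - x) = (\<integral>z. h z * \<sigma> (a *\<^sub>R y + e *\<^sub>R z + c) - h z * \<sigma> (a *\<^sub>R x + e *\<^sub>R z + c)
    - (\<Sum>b\<in>Basis. ((a *\<^sub>R (y - x)) \<bullet> b) * (h z * partial b \<sigma> (a *\<^sub>R x + e *\<^sub>R z + c))) \<partial>M)"
   unfolding G' F_def
   by (subst Bochner_Integration.integral_diff, (intro Bochner_Integration.integrable_diff int \<sigma>)[1],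
     (intro Bochner_Integration.integrable_sum integrable_mult_right int test_function_partial[OF \<sigma>], assumption)[1],
     subst Bochner_Integration.integral_diff, (intro int \<sigma>)+, rule refl)
  then have "(1 / norm (y - x)) * (F y - F x - G (y - x)) = (\<integral>z. (1 / norm (y - x)) * (h z * \<sigma> (a *\<^sub>R y + e *\<^sub>R z + c) - h z * \<sigma> (a *\<^sub>R x + e *\<^sub>R z + c)
    - (\<Sum>b\<in>Basis. ((a *\<^sub>R (y - x)) \<bullet> b) * (h z * partial b \<sigma> (a *\<^sub>R x + e *\<^sub>R z + c)))) \<partial>M)"
   by simp
  also have "... = (\<integral>z. h z * q y z \<partial>M)"
   by (rule Bochner_Integration.integral_cong) (simp_all add: q_def algebra_simps sum_distrib_left)
  finally show ?thesis by (simp add: diff_diff_eq)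
 qed
 have qb: "\<bar>q y z\<bar> \<le> 2 * \<bar>a\<bar> * L" for y z
 proof (cases "y = x")
  case False
  have "\<bar>\<sigma> (a *\<^sub>R y + e *\<^sub>R z + c) - \<sigma> (a *\<^sub>R x + e *\<^sub>R z + c)\<bar> \<le> L * norm (a *\<^sub>R y + e *\<^sub>R z + c - (a *\<^sub>R x + e *\<^sub>R z + c))"
   by (rule L(2))
  also have "a *\<^sub>R y + e *\<^sub>R z + c - (a *\<^sub>R x + e *\<^sub>R z + c) = a *\<^sub>R (y - x)" by (simp add: algebra_simps)
  finally have "\<bar>\<sigma> (a *\<^sub>R y + e *\<^sub>R z + c) - \<sigma> (a *\<^sub>R x + e *\<^sub>R z + c)
   - (\<Sum>b\<in>Basis. ((a *\<^sub>R (y - x)) \<bullet> b) * partial b \<sigma> (a *\<^sub>R x + e *\<^sub>R z + c))\<bar> \<le> L * norm (a *\<^sub>R (y - x)) + L * norm (a *\<^sub>R (y - x))"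
   using L(3)[of "a *\<^sub>R (y - x)" "a *\<^sub>R x + e *\<^sub>R z + c"] by linarith
  then have "\<bar>q y z\<bar> \<le> (1 / norm (y - x)) * (L * norm (a *\<^sub>R (y - x)) + L * norm (a *\<^sub>R (y - x)))"
   unfolding q_def abs_mult by (intro mult_mono) auto
  also have "... = 2 * \<bar>a\<bar> * L" unfolding norm_scaleR using False by (simp add: field_simps)
  finally show ?thesis .
 qed (use L in \<open>simp add: q_def\<close>)
 have "((\<lambda>y. (1 / norm (y - x)) *\<^sub>R (F y - (F x + G (y - x)))) \<longlongrightarrow> 0) (at x within UNIV)"
  unfolding tendsto_at_iff_sequentially o_def eq
 proof (intro allI impI)
  fix X assume X: "\<forall>i. X i \<in> UNIV - {x}" "X \<longlonglongrightarrow> x"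
  have "(\<lambda>i. \<integral>z. h z * q (X i) z \<partial>M) \<longlonglongrightarrow> (\<integral>z. 0 \<partial>M)"
  proof (rule integral_dominated_convergence[where w="\<lambda>z. \<bar>h z\<bar> * (2 * \<bar>a\<bar> * L)"])
   show "AE z in M. (\<lambda>i. h z * q (X i) z) \<longlonglongrightarrow> 0"
   proof (rule AE_I2)
    fix z
    have "((\<lambda>y. a *\<^sub>R y + e *\<^sub>R z + c) has_derivative (\<lambda>v. a *\<^sub>R v)) (at x)"
     by (auto intro!: derivative_eq_intros)
    from has_derivative_compose[OF this smooth_has_derivative[OF smooth_differentiable[OF s\<sigma>]]]
    have "((\<lambda>y. \<sigma> (a *\<^sub>R y + e *\<^sub>R z + c)) has_derivative (\<lambda>v. \<Sum>b\<in>Basis. ((a *\<^sub>R v) \<bullet> b) * partial b \<sigma> (a *\<^sub>R x + e *\<^sub>R z + c))) (at x)" .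
    then have "((\<lambda>y. q y z) \<longlongrightarrow> 0) (at x within UNIV)"
     unfolding has_derivative_within q_def by (simp add: diff_diff_eq)
    then have "(\<lambda>i. q (X i) z) \<longlonglongrightarrow> 0"
     unfolding tendsto_at_iff_sequentially o_def using X by blast
    from tendsto_mult_left[OF this, of "h z"] show "(\<lambda>i. h z * q (X i) z) \<longlonglongrightarrow> 0" by simp
   qed
   show "AE z in M. norm (h z * q (X i) z) \<le> \<bar>h z\<bar> * (2 * \<bar>a\<bar> * L)" for i
    using qb by (intro AE_I2) (auto simp: abs_mult intro!: mult_left_mono)
   show "(\<lambda>z. h z * q (X i) z) \<in> borel_measurable M" for i using mq h by auto
   show "integrable M (\<lambda>z. \<bar>h z\<bar> * (2 * \<bar>a\<bar> * L))" using h by auto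
  qed simp
  then show "(\<lambda>i. \<integral>z. h z * q (X i) z \<partial>M) \<longlonglongrightarrow> 0" by simp
 qed
 moreover have "bounded_linear G"
  unfolding G_def[abs_def] by (intro bounded_linear_sum bounded_linear_mult_left bounded_linear_compose[OF bounded_linear_mult_left bounded_linear_inner_left])
 ultimately have "(F has_derivative G) (at x within UNIV)"
  unfolding has_derivative_within by blast
 then show ?thesis by (simp add: F_def[abs_def] G_def[abs_def])
qed

lemma convolution_smooth:
 fixes h :: "'a::euclidean_space => real"
 assumes h: "integrable M h" and M: "\<And>f :: 'a => real. f \<in> borel_measurable borel ==> f \<in> borel_measurable M"
  and \<sigma>: "test_function UNIV \<sigma>"
 shows "smooth_fun (\<lambda>x. \<integral>z. h z * \<sigma> (a *\<^sub>R x + e *\<^sub>R z + c) \<partial>M)"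
proof (rule smooth_coinduct)
 let ?A = "{g. \<exists>s \<sigma>. test_function UNIV \<sigma> \<and> g = (\<lambda>x. s * (\<integral>z. h z * \<sigma> (a *\<^sub>R x + e *\<^sub>R z + c) \<partial>M))}"
 show "(\<lambda>x. \<integral>z. h z * \<sigma> (a *\<^sub>R x + e *\<^sub>R z + c) \<partial>M) \<in> ?A"
  using \<sigma> by (auto intro!: exI[of _ 1] exI[of _ \<sigma>])
 fix g assume "g \<in> ?A"
 then obtain s \<tau> where \<tau>: "test_function UNIV \<tau>" and g: "g = (\<lambda>x. s * (\<integral>z. h z * \<tau> (a *\<^sub>R x + e *\<^sub>R z + c) \<partial>M))"
  by blast
 have der: "(g has_derivative (\<lambda>v. s * (\<Sum>b\<in>Basis. (v \<bullet> b) * (a * (\<integral>z. h z * partial b \<tau> (a *\<^sub>R x + e *\<^sub>R z + c) \<partial>M))))) (at x)" for x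
  unfolding g by (intro has_derivative_mult_right convolution_has_derivative h M \<tau>)
 show "g differentiable (at x)" for x using der differentiable_def by blast
 fix b :: 'a assume b: "b \<in> Basis"
 have "partial b g = (\<lambda>x. (s * a) * (\<integral>z. h z * partial b \<tau> (a *\<^sub>R x + e *\<^sub>R z + c) \<partial>M))"
  using b by (auto simp: fun_eq_iff partial_eqI[OF der] inner_Basis if_distrib[of "\<lambda>c. c * _"] cong: if_cong)
 then show "partial b g \<in> ?A" using test_function_partial[OF \<tau> b] by blast
qed

lemma convolution_partial:
 fixes h :: "'a::euclidean_space => real"
 assumes h: "integrable M h" and M: "\<And>f :: 'a => real. f \<in> borel_measurable borel ==> f \<in> borel_measurable M"
  and \<sigma>: "test_function UNIV \<sigma>" and b: "b \<in> Basis"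
 shows "partial b (\<lambda>x. \<integral>z. h z * \<sigma> (a *\<^sub>R x + e *\<^sub>R z + c) \<partial>M) x
  = a * (\<integral>z. h z * partial b \<sigma> (a *\<^sub>R x + e *\<^sub>R z + c) \<partial>M)"
 using b by (simp add: partial_eqI[OF convolution_has_derivative[OF h M \<sigma>]] inner_Basis if_distrib[of "\<lambda>c. c * _"] cong: if_cong)

lemma lebesgue_on_measurable_borel:
 fixes f :: "'a::euclidean_space => real"
 shows "f \<in> borel_measurable borel ==> f \<in> borel_measurable (lebesgue_on D)"
 by (intro measurable_restrict_space1 measurable_completion) simp

lemma l2_norm_less:
 assumes "(\<integral>x. (f x)^2 \<partial>M) < e^2" "0 < e" shows "l2_norm M f < (e::real)"
proof -
 have "l2_norm M f = sqrt (\<integral>x. (f x)^2 \<partial>M)"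
  by (simp add: l2_norm_def l2_inner_real power2_eq_square)
 also have "... < e" using assms by (intro real_less_lsqrt) auto
 finally show ?thesis .
qed

text \<open>Measurability yields continuous functions converging almost everywhere. Clipping h
  first, and then the approximants at the same level, provides the bounds for two applications of
  dominated convergence.\<close>

lemma continuous_l2_dense:
 fixes h :: "'a::euclidean_space => real"
 assumes D: "bounded D" "D \<in> sets lebesgue" and h: "L2 (lebesgue_on D) h" and "0 < e"
 obtains g B where "continuous_on UNIV g" "\<And>x. \<bar>g x\<bar> \<le> B" "l2_dist (lebesgue_on D) h g < e"
proof -
 let ?M = "lebesgue_on D"
 interpret finite_measure ?M
  using D by (intro finite_measure_lebesgue_on bounded_set_imp_lmeasurable)
 have [measurable]: "h \<in> borel_measurable ?M" using h by auto
 define clip where "clip n t = max (- real n) (min (real n) t)" for n t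
 have contclip: "continuous_on UNIV (clip n)" for n unfolding clip_def by (intro continuous_intros)
 have [measurable]: "clip n \<in> borel_measurable borel" for n by (rule borel_measurable_continuous_onI[OF contclip])
 have clipb: "\<bar>clip n t\<bar> \<le> real n" for n t by (simp add: clip_def max_def min_def abs_if)
 have sqclip: "L2 ?M (\<lambda>x. clip n (h x))" for n
  by (rule L2_bounded[where C="real n"]) (auto simp: clipb finite_measure_axioms)
 have "(\<lambda>n. \<integral>x. (h x - clip n (h x))^2 \<partial>?M) \<longlonglongrightarrow> (\<integral>x. 0 \<partial>?M)"
 proof (rule integral_dominated_convergence[where w="\<lambda>x. (h x)^2"])
  show "integrable ?M (\<lambda>x. (h x)^2)" using h by (simp add: square_integrable_def)
  show "AE x in ?M. (\<lambda>n. (h x - clip n (h x))^2) \<longlonglongrightarrow> 0"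
  proof (rule AE_I2, rule tendsto_eventually)
   fix x
   obtain N where "\<bar>h x\<bar> \<le> real N" using real_arch_simple by blast
   then have "clip n (h x) = h x" if "N \<le> n" for n using that by (auto simp: clip_def abs_le_iff)
   then show "\<forall>\<^sub>F n in sequentially. (h x - clip n (h x))^2 = 0"
    unfolding eventually_sequentially by (intro exI[of _ N]) auto
  qed
  have "\<bar>t - clip n t\<bar> \<le> \<bar>t\<bar>" for n t by (simp add: clip_def max_def min_def abs_if)
  then show "AE x in ?M. norm ((h x - clip n (h x))^2) \<le> (h x)^2" for n
   by (intro AE_I2) (simp add: abs_le_square_iff)
 qed simp_all
 then have "(\<lambda>n. \<integral>x. (h x - clip n (h x))^2 \<partial>?M) \<longlonglongrightarrow> 0" by simp
 moreover have "0 < (e / 2)^2" using \<open>0 < e\<close> by simp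
 ultimately have "\<forall>\<^sub>F n in sequentially. (\<integral>x. (h x - clip n (h x))^2 \<partial>?M) < (e / 2)^2" by (rule order_tendstoD(2))
 then obtain n where n: "(\<integral>x. (h x - clip n (h x))^2 \<partial>?M) < (e / 2)^2" by (auto simp: eventually_sequentially)
 then have n': "l2_norm ?M (\<lambda>x. h x - clip n (h x)) < e / 2"
  by (rule l2_norm_less) (use \<open>0 < e\<close> in simp)
 have "h measurable_on D" using measurable_on_iff_borel_measurable[OF D(2), of h] by simp
 then obtain N g where Ng: "negligible N \<and> (\<forall>m. continuous_on UNIV (g m)) \<and>
   (\<forall>x. x \<notin> N \<longrightarrow> (\<lambda>m. g m x) \<longlonglongrightarrow> (if x \<in> D then h x else 0))"
  unfolding measurable_on_def by (elim exE)
 then have N: "negligible N" and g: "\<And>m. continuous_on UNIV (g m)"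
  and lim: "\<And>x. x \<notin> N ==> (\<lambda>m. g m x) \<longlonglongrightarrow> (if x \<in> D then h x else 0)"
  by simp_all
 have [measurable]: "g m \<in> borel_measurable ?M" for m
  by (rule lebesgue_on_measurable_borel[OF borel_measurable_continuous_onI[OF g]])
 have "AE x in lebesgue. x \<notin> N" using N by (intro AE_not_in) (simp add: negligible_iff_null_sets)
 then have "AE x in lebesgue. x \<in> D \<longrightarrow> x \<notin> N" by (rule eventually_mono) (rule impI)
 moreover have "D \<inter> space lebesgue \<in> sets lebesgue" using D(2) by simp
 ultimately have AEN: "AE x in ?M. x \<notin> N" by (simp only: AE_restrict_space_iff)
 have "(\<lambda>m. \<integral>x. (clip n (h x) - clip n (g m x))^2 \<partial>?M) \<longlonglongrightarrow> (\<integral>x. 0 \<partial>?M)"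
 proof (rule integral_dominated_convergence[where w="\<lambda>x. (2 * real n)^2"])
  have limD: "(\<lambda>m. (clip n (h x) - clip n (g m x))^2) \<longlonglongrightarrow> 0" if x: "x \<notin> N" "x \<in> D" for x
  proof -
   have "(\<lambda>m. g m x) \<longlonglongrightarrow> h x" using lim[OF x(1)] x(2) by (simp only: if_True)
   moreover have "isCont (clip n) (h x)" using contclip by (simp add: continuous_on_eq_continuous_at)
   ultimately have "(\<lambda>m. clip n (g m x)) \<longlonglongrightarrow> clip n (h x)" by (rule isCont_tendsto_compose[rotated])
   then have "(\<lambda>m. (clip n (h x) - clip n (g m x))^2) \<longlonglongrightarrow> (clip n (h x) - clip n (h x))^2"
    by (intro tendsto_power tendsto_diff tendsto_const)
   then show ?thesis by simp
  qed
  show "AE x in ?M. (\<lambda>m. (clip n (h x) - clip n (g m x))^2) \<longlonglongrightarrow> 0"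
   by (rule AE_mp[OF AEN], rule AE_I2, rule impI, erule limD) simp
  have "\<bar>clip n s - clip n t\<bar> \<le> \<bar>2 * real n\<bar>" for s t using clipb[of n s] clipb[of n t] by linarith
  then show "AE x in ?M. norm ((clip n (h x) - clip n (g m x))^2) \<le> (2 * real n)^2" for m
   by (intro AE_I2) (simp only: real_norm_def abs_power2 abs_le_square_iff[symmetric])
 qed simp_all
 then have "(\<lambda>m. \<integral>x. (clip n (h x) - clip n (g m x))^2 \<partial>?M) \<longlonglongrightarrow> 0" by simp
 then have "\<forall>\<^sub>F m in sequentially. (\<integral>x. (clip n (h x) - clip n (g m x))^2 \<partial>?M) < (e / 2)^2"
  using \<open>0 < (e / 2)^2\<close> by (rule order_tendstoD(2))
 then obtain m where "(\<integral>x. (clip n (h x) - clip n (g m x))^2 \<partial>?M) < (e / 2)^2" by (auto simp: eventually_sequentially)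
 then have m': "l2_norm ?M (\<lambda>x. clip n (h x) - clip n (g m x)) < e / 2"
  by (rule l2_norm_less) (use \<open>0 < e\<close> in simp)
 have sqg: "L2 ?M (\<lambda>x. clip n (g m x))"
  by (rule L2_bounded[where C="real n"]) (auto simp: clipb finite_measure_axioms)
 have "l2_norm ?M (\<lambda>x. h x - clip n (g m x)) < e"
  using l2_triangle_through[OF h sqclip[of n] sqg] n' m' by linarith
 moreover have "continuous_on UNIV (\<lambda>x. clip n (g m x))"
  by (rule continuous_on_compose2[OF contclip g]) simp
 ultimately show ?thesis using clipb by (intro that)
qed


lemma nn_integral_lebesgue_on_le:
 fixes f :: "'a::euclidean_space => ennreal"
 assumes "D \<in> sets lebesgue"
 shows "(\<integral>\<^sup>+x. f x \<partial>lebesgue_on D) \<le> (\<integral>\<^sup>+x. f x \<partial>lborel)"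
proof -
 have "(\<integral>\<^sup>+x. f x \<partial>lebesgue_on D) = (\<integral>\<^sup>+x. f x * indicator D x \<partial>lebesgue)"
  using assms by (intro nn_integral_restrict_space) simp
 also have "... \<le> (\<integral>\<^sup>+x. f x \<partial>lebesgue)"
  by (intro nn_integral_mono) (auto split: split_indicator)
 finally show ?thesis by (simp add: nn_integral_completion)
qed

text \<open>The kernel contracts \<open>D\<close> towards \<open>x0\<close> by the factor \<open>1 - 1/N\<close> before averaging over a ball of
 radius \<open>r/N\<close>, so that the average only involves points of \<open>D\<close>.\<close>

lemma has_weak_deriv_single:
 assumes "has_weak_deriv D {#b#} v g" "test_function D \<phi>"
 shows "l2_inner (lebesgue_on D) v (partial b \<phi>) = - l2_inner (lebesgue_on D) g \<phi>"
proof -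
 have "\<forall>\<phi> bs. test_function D \<phi> \<and> mset bs = {#b#} \<longrightarrow>
   l2_inner (lebesgue_on D) v (iter_deriv bs \<phi>) = (-1) ^ size {#b#} * l2_inner (lebesgue_on D) g \<phi>"
  using assms(1) unfolding has_weak_deriv_def by (rule conjunct2)
 from this[rule_format, of \<phi> "[b]"] assms(2) show ?thesis by simp
qed

locale mollifier =
 fixes D :: "'a::euclidean_space set" and x0 :: 'a and r :: real and \<rho> :: "'a => real"
 assumes D: "open D" "convex D" "bounded D" and r: "0 < r" and ball: "ball x0 (2 * r) \<subseteq> D"
  and \<rho>: "test_function UNIV \<rho>" "\<And>x. 0 \<le> \<rho> x" "(\<integral>\<^sup>+x. ennreal (\<rho> x) \<partial>lborel) = 1"
   "\<And>x. r \<le> norm x ==> \<rho> x = 0"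
begin

abbreviation "M \<equiv> lebesgue_on D"

text \<open>The shift keeps N n - 1 at least half of N n, which is used when the kernel is
  integrated in its first variable.\<close>

definition N :: "nat => real" where "N n = real n + 2"

abbreviation "W n x y \<equiv> (N n - 1) *\<^sub>R x + (- N n) *\<^sub>R y + x0"

text \<open>The same point as \<open>W\<close>, arranged as an affine function of y for
  \<open>smooth_affine\<close> and \<open>partial_affine\<close>.\<close>

abbreviation "V n x y \<equiv> (- N n) *\<^sub>R y + ((N n - 1) *\<^sub>R x + x0)"

definition K :: "nat => 'a => 'a => real" where
 "K n x y = N n ^ DIM('a) * \<rho> (W n x y)"

definition A :: "nat => ('a => real) => 'a => real" where
 "A n h x = (\<integral>y. h y * K n x y \<partial>M)"

lemma N2: "2 \<le> N n" by (simp add: N_def)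

lemma Dl: "D \<in> sets lebesgue" using D(1) by simp

sublocale finite_measure M
 using D Dl by (intro finite_measure_lebesgue_on bounded_set_imp_lmeasurable)

lemma cont\<rho>: "continuous_on S \<rho>"
 by (rule smooth_continuous[OF test_function_smooth[OF \<rho>(1)]])

lemma K_nonneg: "0 \<le> K n x y" using \<rho>(2) N2[of n] by (simp add: K_def)

lemma K_measurable: "(\<lambda>z. K n (fst z) (snd z)) \<in> borel_measurable (M \<Otimes>\<^sub>M M)"
proof -
 have 1: "(\<lambda>z::'a \<times> 'a. K n (fst z) (snd z)) \<in> borel_measurable (borel \<Otimes>\<^sub>M borel)"
  unfolding K_def borel_prod
  by (intro borel_measurable_continuous_onI continuous_intros continuous_on_compose2[OF cont\<rho>[of UNIV]]) auto
 have "(\<lambda>x. x) \<in> M \<rightarrow>\<^sub>M borel"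
  by (intro measurable_restrict_space1 measurable_completion) simp
 then have "(\<lambda>z. (fst z, snd z)) \<in> (M \<Otimes>\<^sub>M M) \<rightarrow>\<^sub>M (borel \<Otimes>\<^sub>M borel)"
  by (intro measurable_Pair measurable_compose[OF measurable_fst] measurable_compose[OF measurable_snd])
 from measurable_compose[OF this 1] show ?thesis by simp
qed

lemma K_cont: "continuous_on UNIV (K n x)" "continuous_on UNIV (\<lambda>x. K n x y)"
 unfolding K_def[abs_def]
 by (intro continuous_intros continuous_on_compose2[OF cont\<rho>[of UNIV]]; auto)+

lemma K_meas: "K n x \<in> borel_measurable M"
 by (rule lebesgue_on_measurable_borel[OF borel_measurable_continuous_onI[OF K_cont(1)]])

lemma nn_integral_affine:
 assumes "c \<noteq> 0"
 shows "(\<integral>\<^sup>+y. ennreal (\<rho> (t + c *\<^sub>R y)) \<partial>lborel) * ennreal (\<bar>c\<bar> ^ DIM('a)) = 1"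
proof -
 have [measurable]: "\<rho> \<in> borel_measurable borel" by (rule borel_measurable_continuous_onI[OF cont\<rho>])
 have "1 = (\<integral>\<^sup>+x. ennreal (\<rho> x) \<partial>lborel)" by (simp add: \<rho>(3))
 also have "... = (\<integral>\<^sup>+x. ennreal (\<rho> x) \<partial>density (distr lborel borel (\<lambda>x. t + c *\<^sub>R x)) (\<lambda>_. \<bar>c\<bar> ^ DIM('a)))"
  by (subst lborel_affine[OF assms]) simp
 also have "... = (\<integral>\<^sup>+x. ennreal (\<bar>c\<bar> ^ DIM('a)) * ennreal (\<rho> x) \<partial>distr lborel borel (\<lambda>x. t + c *\<^sub>R x))"
  by (subst nn_integral_density) auto
 also have "... = (\<integral>\<^sup>+y. ennreal (\<bar>c\<bar> ^ DIM('a)) * ennreal (\<rho> (t + c *\<^sub>R y)) \<partial>lborel)"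
  by (subst nn_integral_distr) auto
 also have "... = (\<integral>\<^sup>+y. ennreal (\<rho> (t + c *\<^sub>R y)) \<partial>lborel) * ennreal (\<bar>c\<bar> ^ DIM('a))"
  by (subst nn_integral_cmult) (auto simp: mult.commute)
 finally show ?thesis by simp
qed

lemma K_nn_integral: "(\<integral>\<^sup>+y. ennreal (K n x y) \<partial>lborel) = 1"
proof -
 have [measurable]: "\<rho> \<in> borel_measurable borel" by (rule borel_measurable_continuous_onI[OF cont\<rho>])
 have "(\<integral>\<^sup>+y. ennreal (K n x y) \<partial>lborel)
   = (\<integral>\<^sup>+y. ennreal (\<bar>- N n\<bar> ^ DIM('a)) * ennreal (\<rho> (((N n - 1) *\<^sub>R x + x0) + (- N n) *\<^sub>R y)) \<partial>lborel)"
  using N2[of n] \<rho>(2) by (intro nn_integral_cong) (simp add: K_def ennreal_mult algebra_simps)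
 also have "... = ennreal (\<bar>- N n\<bar> ^ DIM('a)) * (\<integral>\<^sup>+y. ennreal (\<rho> (((N n - 1) *\<^sub>R x + x0) + (- N n) *\<^sub>R y)) \<partial>lborel)"
  by (rule nn_integral_cmult) auto
 also have "... = 1"
  using nn_integral_affine[of "- N n"] N2[of n] by (subst mult.commute) auto
 finally show ?thesis .
qed

text \<open>In the first variable the kernel is scaled by N - 1 although it is normalized by the
  power of N; the mismatch (N / (N - 1))^d is at most 2^d.\<close>

lemma K_nn_integral_fst: "(\<integral>\<^sup>+x. ennreal (K n x y) \<partial>lborel) \<le> 2 ^ DIM('a)"
proof -
 have [measurable]: "\<rho> \<in> borel_measurable borel" by (rule borel_measurable_continuous_onI[OF cont\<rho>])
 have "(\<integral>\<^sup>+x. ennreal (K n x y) \<partial>lborel)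
   \<le> (\<integral>\<^sup>+x. 2 ^ DIM('a) * (ennreal (\<bar>N n - 1\<bar> ^ DIM('a)) * ennreal (\<rho> ((x0 + (- N n) *\<^sub>R y) + (N n - 1) *\<^sub>R x))) \<partial>lborel)"
 proof (rule nn_integral_mono)
  fix x
  have pw: "N n ^ DIM('a) \<le> (2 * (N n - 1)) ^ DIM('a)" using N2[of n] by (intro power_mono) auto
  have "N n ^ DIM('a) * \<rho> ((x0 + (- N n) *\<^sub>R y) + (N n - 1) *\<^sub>R x)
    \<le> 2 ^ DIM('a) * (\<bar>N n - 1\<bar> ^ DIM('a) * \<rho> ((x0 + (- N n) *\<^sub>R y) + (N n - 1) *\<^sub>R x))"
   using mult_right_mono[OF pw \<rho>(2)[of "(x0 + (- N n) *\<^sub>R y) + (N n - 1) *\<^sub>R x"]] N2[of n]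
   unfolding power_mult_distrib by (simp only: mult.assoc abs_of_nonneg)
  moreover have "(2::ennreal) ^ DIM('a) = ennreal (2 ^ DIM('a))" by (simp flip: ennreal_power)
  ultimately show "ennreal (K n x y) \<le> 2 ^ DIM('a) * (ennreal (\<bar>N n - 1\<bar> ^ DIM('a)) * ennreal (\<rho> ((x0 + (- N n) *\<^sub>R y) + (N n - 1) *\<^sub>R x)))"
   using \<rho>(2) by (simp add: K_def algebra_simps ennreal_leI flip: ennreal_mult)
 qed
 also have "... = 2 ^ DIM('a) * (ennreal (\<bar>N n - 1\<bar> ^ DIM('a)) * (\<integral>\<^sup>+x. ennreal (\<rho> ((x0 + (- N n) *\<^sub>R y) + (N n - 1) *\<^sub>R x)) \<partial>lborel))"
  by (subst nn_integral_cmult, simp, subst nn_integral_cmult) auto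
 also have "ennreal (\<bar>N n - 1\<bar> ^ DIM('a)) * (\<integral>\<^sup>+x. ennreal (\<rho> ((x0 + (- N n) *\<^sub>R y) + (N n - 1) *\<^sub>R x)) \<partial>lborel) = 1"
  using nn_integral_affine[of "N n - 1"] N2[of n] by (subst mult.commute) auto
 finally show ?thesis by simp
qed

text \<open>Solving W n x y = w for y gives y = (1 - 1/N) x + (1/N) (x0 - w). This is a convex
  combination of points of D, and its distance from x is of order 1/N.\<close>

lemma K_support:
 assumes x: "x \<in> D" and w: "norm (W n x y) \<le> r"
 shows "y \<in> D" "norm (y - x) \<le> (norm (x - x0) + r) / N n"
proof -
 define w where "w = W n x y"
 have Npos: "N n > 0" using N2[of n] by simp
 have Ny: "N n *\<^sub>R y = (N n - 1) *\<^sub>R x + (x0 - w)" by (simp add: w_def algebra_simps)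
 have nw: "norm w \<le> r" using assms(2) by (simp only: w_def)
 then have "x0 - w \<in> ball x0 (2 * r)" using r by (simp add: dist_norm)
 then have "x0 - w \<in> D" using ball by blast
 moreover have "y = (1 - 1 / N n) *\<^sub>R x + (1 / N n) *\<^sub>R (x0 - w)"
 proof -
  have "y = (1 / N n) *\<^sub>R (N n *\<^sub>R y)" using Npos by simp
  also have "... = ((N n - 1) / N n) *\<^sub>R x + (1 / N n) *\<^sub>R (x0 - w)"
   unfolding Ny by (simp add: scaleR_add_right)
  also have "(N n - 1) / N n = 1 - 1 / N n" using Npos by (simp add: field_simps)
  finally show ?thesis .
 qed
 ultimately show "y \<in> D" using convexD_alt[OF D(2) x, of "x0 - w" "1 / N n"] Npos N2[of n] by simp
 have "N n *\<^sub>R (y - x) = (x0 - x) - w" unfolding scaleR_diff_right Ny by (simp add: algebra_simps)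
 then have "N n * norm (y - x) = norm ((x0 - x) - w)" using Npos by (metis norm_scaleR abs_of_pos)
 also have "... \<le> norm (x - x0) + r" using norm_triangle_ineq4[of "x0 - x" w] nw by (simp add: norm_minus_commute)
 finally show "norm (y - x) \<le> (norm (x - x0) + r) / N n" using Npos by (simp add: field_simps)
qed

lemma K_nonzero: "K n x y \<noteq> 0 ==> norm (W n x y) \<le> r"
proof (rule ccontr)
 assume nz: "K n x y \<noteq> 0" and "\<not> norm (W n x y) \<le> r"
 then have "\<rho> (W n x y) = 0" by (intro \<rho>(4)) linarith
 then have "K n x y = 0" by (simp only: K_def mult_zero_right)
 then show False using nz by simp
qed

lemma K_zero: "x \<in> D ==> y \<notin> D ==> K n x y = 0"
 using K_support(1)[OF _ K_nonzero] by blast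

lemma A_alt: "A n h x = N n ^ DIM('a) * (\<integral>z. h z * \<rho> (W n x z) \<partial>M)"
 unfolding A_def K_def mult.left_commute[of "h _" "N n ^ DIM('a)"] by (rule integral_mult_right_zero)

lemma K_integral: "x \<in> D ==> (\<integral>y. K n x y \<partial>M) = 1"
proof -
 assume x: "x \<in> D"
 have m: "K n x \<in> borel_measurable borel" by (rule borel_measurable_continuous_onI[OF K_cont(1)])
 have "(\<integral>y. K n x y \<partial>M) = (\<integral>y. indicator D y * K n x y \<partial>lborel)"
  using D(1) m by (intro integral_lebesgue_on) auto
 also have "... = (\<integral>y. K n x y \<partial>lborel)"
  by (rule Bochner_Integration.integral_cong) (use K_zero[OF x] in \<open>auto split: split_indicator\<close>)
 also have "... = 1"
  using m K_nonneg K_nn_integral by (subst integral_eq_nn_integral) auto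
 finally show ?thesis .
qed

lemma K_bounded: obtains B where "0 \<le> B" "\<And>x y. \<bar>K n x y\<bar> \<le> B"
proof -
 obtain B where "0 \<le> B" "\<And>x. \<bar>\<rho> x\<bar> \<le> B" by (rule test_function_bounded[OF \<rho>(1)]) blast
 then show ?thesis using that[of "N n ^ DIM('a) * B"] N2[of n]
  by (auto simp: K_def abs_mult intro!: mult_left_mono)
qed

lemma hK_integrable:
 assumes h: "integrable M h" shows "integrable M (\<lambda>y. h y * K n x y)"
proof -
 obtain B where B: "0 \<le> B" "\<And>x y. \<bar>K n x y\<bar> \<le> B" by (rule K_bounded[of n]) blast
 show ?thesis
 proof (rule Bochner_Integration.integrable_bound[of M "\<lambda>z. B * h z"])
  show "AE z in M. norm (h z * K n x z) \<le> norm (B * h z)"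
   using B by (intro AE_I2) (auto simp: abs_mult mult.commute[of B] intro!: mult_left_mono)
 qed (use h K_meas in auto)
qed

lemma sq_integrable: "L2 M h ==> integrable M h"
 by (rule square_integrable_imp_integrable) (auto simp: square_integrable_def)

lemma A_smooth:
 assumes "L2 M h" shows "smooth_fun (A n h)"
proof -
 have "A n h = (\<lambda>x. N n ^ DIM('a) * (\<integral>z. h z * \<rho> (W n x z) \<partial>M))"
  by (rule ext) (rule A_alt)
 then show ?thesis
  using convolution_smooth[OF sq_integrable[OF assms] lebesgue_on_measurable_borel \<rho>(1)]
  by (simp only: smooth_cmult)
qed

lemma kernel_test_function:
 assumes x: "x \<in> D"
 shows "test_function D (\<lambda>y. \<rho> (V n x y))"
proof -
 let ?\<phi> = "\<lambda>y. \<rho> (V n x y)"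
 let ?S = "{y. norm (W n x y) \<le> r}"
 have cl: "closed ?S" by (intro closed_Collect_le continuous_intros)
 have "{y. ?\<phi> y \<noteq> 0} \<subseteq> ?S"
 proof
  fix y assume "y \<in> {y. ?\<phi> y \<noteq> 0}"
  then have "norm (V n x y) \<le> r"
   using \<rho>(4)[of "V n x y"] by (meson mem_Collect_eq linear)
  moreover have "V n x y = W n x y"
   by (simp add: algebra_simps)
  ultimately show "y \<in> ?S" by (simp only: mem_Collect_eq)
 qed
 then have sub: "closure {y. ?\<phi> y \<noteq> 0} \<subseteq> ?S" using cl by (rule closure_minimal)
 moreover have SD: "?S \<subseteq> D" using K_support(1)[OF x] by blast
 ultimately have "closure {y. ?\<phi> y \<noteq> 0} \<subseteq> D" by (rule order_trans)
 moreover from this have "compact (closure {y. ?\<phi> y \<noteq> 0})"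
  using bounded_subset[OF D(3)] by (simp add: compact_eq_bounded_closed)
 moreover have "smooth_fun ?\<phi>" by (rule smooth_affine[OF test_function_smooth[OF \<rho>(1)]])
 ultimately show ?thesis by (simp add: test_function_def)
qed

lemma A_zero:
 assumes "\<And>\<phi>. test_function D \<phi> ==> l2_inner M h \<phi> = 0" and x: "x \<in> D"
 shows "A n h x = 0"
proof -
 have arg: "W n x z = V n x z" for z
  by (simp add: algebra_simps)
 have "A n h x = N n ^ DIM('a) * l2_inner M h (\<lambda>y. \<rho> (V n x y))"
  unfolding A_alt l2_inner_real arg ..
 then show ?thesis using assms(1)[OF kernel_test_function[OF x]] by simp
qed

text \<open>The kernel depends on (N - 1) x - N y, so a derivative in x is -(N - 1)/N times the
  derivative in y; the latter is moved to the weak derivative, the kernel being a test function on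
  D.\<close>

lemma A_partial:
 assumes h: "L2 M h" and g: "has_weak_deriv D {#b#} h g" and b: "b \<in> Basis" and x: "x \<in> D"
 shows "partial b (A n h) x = ((N n - 1) / N n) * A n g x"
proof -
 let ?\<phi> = "\<lambda>y. \<rho> (V n x y)"
 have s\<rho>: "smooth_fun \<rho>" by (rule test_function_smooth[OF \<rho>(1)])
 have arg: "W n x z = V n x z" for z
  by (simp add: algebra_simps)
 have "A n h = (\<lambda>x. N n ^ DIM('a) * (\<integral>z. h z * \<rho> (W n x z) \<partial>M))"
  by (rule ext) (rule A_alt)
 moreover have "smooth_fun (\<lambda>x. \<integral>z. h z * \<rho> (W n x z) \<partial>M)"
  by (rule convolution_smooth[OF sq_integrable[OF h] lebesgue_on_measurable_borel \<rho>(1)])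
 ultimately have "partial b (A n h) x = N n ^ DIM('a) * partial b (\<lambda>x. \<integral>z. h z * \<rho> (W n x z) \<partial>M) x"
  by (simp only: partial_cmult smooth_differentiable)
 also have "... = N n ^ DIM('a) * ((N n - 1) * (\<integral>z. h z * partial b \<rho> (W n x z) \<partial>M))"
  by (simp only: convolution_partial[OF sq_integrable[OF h] lebesgue_on_measurable_borel \<rho>(1) b])
 finally have 1: "partial b (A n h) x = N n ^ DIM('a) * ((N n - 1) * (\<integral>z. h z * partial b \<rho> (V n x z) \<partial>M))"
  unfolding arg .
 have der: "partial b ?\<phi> = (\<lambda>y. - N n * partial b \<rho> (V n x y))"
  by (rule ext) (rule partial_affine[OF smooth_differentiable[OF s\<rho>]])
 have "l2_inner M h (partial b ?\<phi>) = - N n * (\<integral>z. h z * partial b \<rho> (V n x z) \<partial>M)"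
  unfolding der l2_inner_real mult.left_commute[of "h _" "- N n"] by (rule integral_mult_right_zero)
 then have "- N n * (\<integral>z. h z * partial b \<rho> (V n x z) \<partial>M) = - l2_inner M g ?\<phi>"
  using has_weak_deriv_single[OF g kernel_test_function[OF x]] by (simp only:)
 then have 2: "(\<integral>z. h z * partial b \<rho> (V n x z) \<partial>M) = l2_inner M g ?\<phi> / N n"
  using N2[of n] by (simp add: field_simps)
 have "A n g x = N n ^ DIM('a) * l2_inner M g ?\<phi>"
  unfolding A_alt l2_inner_real arg ..
 then show ?thesis unfolding 1 2 by simp
qed

text \<open>Schur's test: write K as sqrt K times sqrt K, apply the Cauchy-Schwarz inequality in y,
  then exchange the integrals. The integral of K is at most 1 in y and at most 2^d in x.\<close>

lemma A_bounded:
 assumes h: "L2 M h"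
 shows "l2_norm M (A n h) \<le> sqrt (2 ^ DIM('a)) * l2_norm M h"
proof -
 interpret P: pair_sigma_finite M M by (simp add: pair_sigma_finite_def sigma_finite_measure_axioms)
 have [measurable]: "h \<in> borel_measurable M" using h by auto
 note K_measurable[measurable] K_meas[measurable]
 have point: "ennreal ((A n h x)^2) \<le> (\<integral>\<^sup>+y. ennreal ((h y)^2 * K n x y) \<partial>M)" for x
 proof -
  obtain B where B: "0 \<le> B" "\<And>x y. \<bar>K n x y\<bar> \<le> B" by (rule K_bounded[of n]) blast
  have sK: "\<bar>sqrt (K n x y)\<bar> \<le> sqrt B" for y using B(2)[of x y] K_nonneg[of n x y] by simp
  have 1: "L2 M (\<lambda>y. sqrt (K n x y) * h y)"
   by (rule L2_bounded_mult[OF h _ AE_I2[OF sK]]) simp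
  have 2: "L2 M (\<lambda>y. sqrt (K n x y))"
   by (rule L2_bounded[OF finite_measure_axioms _ AE_I2[OF sK]]) simp
  have "A n h x = l2_inner M (\<lambda>y. sqrt (K n x y) * h y) (\<lambda>y. sqrt (K n x y))"
  proof -
   have sq: "sqrt (K n x y) * h y * sqrt (K n x y) = h y * K n x y" for y
   proof -
    have "sqrt (K n x y) * sqrt (K n x y) = K n x y" using K_nonneg[of n x y] by simp
    then show ?thesis by (metis mult.assoc mult.commute)
   qed
   show ?thesis unfolding A_def l2_inner_real sq ..
  qed
  then have "\<bar>A n h x\<bar> \<le> l2_norm M (\<lambda>y. sqrt (K n x y) * h y) * l2_norm M (\<lambda>y. sqrt (K n x y))"
   using l2_cauchy_schwarz[OF 1 2] by simp
  then have "(A n h x)^2 \<le> (l2_norm M (\<lambda>y. sqrt (K n x y) * h y) * l2_norm M (\<lambda>y. sqrt (K n x y)))^2"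
   by (rule power2_le_iff_abs_le[THEN iffD2, rotated]) simp
  then have "ennreal ((A n h x)^2) \<le> ennreal ((l2_norm M (\<lambda>y. sqrt (K n x y) * h y))^2) * ennreal ((l2_norm M (\<lambda>y. sqrt (K n x y)))^2)"
   by (simp add: power_mult_distrib ennreal_leI flip: ennreal_mult)
  also have "ennreal ((l2_norm M (\<lambda>y. sqrt (K n x y)))^2) \<le> 1"
  proof -
   have "ennreal ((l2_norm M (\<lambda>y. sqrt (K n x y)))^2) = (\<integral>\<^sup>+y. ennreal (K n x y) \<partial>M)"
    using K_nonneg by (simp add: nn_integral_l2[OF 2, symmetric])
   also have "... \<le> 1" using nn_integral_lebesgue_on_le[OF Dl, of "\<lambda>y. ennreal (K n x y)"] K_nn_integral[of n x] by simp
   finally show ?thesis .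
  qed
  also have "ennreal ((l2_norm M (\<lambda>y. sqrt (K n x y) * h y))^2) = (\<integral>\<^sup>+y. ennreal ((h y)^2 * K n x y) \<partial>M)"
   unfolding nn_integral_l2[OF 1, symmetric]
   by (intro nn_integral_cong) (simp add: power_mult_distrib K_nonneg mult.commute)
  finally show ?thesis by (simp add: mult_left_mono)
 qed
 have mA: "A n h \<in> borel_measurable M"
  using smooth_continuous[OF A_smooth[OF h]] by (intro lebesgue_on_measurable_borel borel_measurable_continuous_onI)
 have "(\<integral>\<^sup>+x. ennreal ((A n h x)^2) \<partial>M) \<le> (\<integral>\<^sup>+x. \<integral>\<^sup>+y. ennreal ((h y)^2 * K n x y) \<partial>M \<partial>M)"
  by (rule nn_integral_mono) (rule point)
 also have "... = (\<integral>\<^sup>+y. \<integral>\<^sup>+x. ennreal ((h y)^2 * K n x y) \<partial>M \<partial>M)"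
  by (rule P.Fubini'[symmetric]) (simp add: split_beta')
 also have "... \<le> (\<integral>\<^sup>+y. ennreal ((h y)^2) * 2 ^ DIM('a) \<partial>M)"
 proof (rule nn_integral_mono)
  fix y
  have [measurable]: "(\<lambda>x. K n x y) \<in> borel_measurable M"
   by (rule lebesgue_on_measurable_borel[OF borel_measurable_continuous_onI[OF K_cont(2)]])
  have "(\<integral>\<^sup>+x. ennreal ((h y)^2 * K n x y) \<partial>M) = ennreal ((h y)^2) * (\<integral>\<^sup>+x. ennreal (K n x y) \<partial>M)"
   using K_nonneg by (simp add: ennreal_mult nn_integral_cmult)
  also have "... \<le> ennreal ((h y)^2) * 2 ^ DIM('a)"
   using order_trans[OF nn_integral_lebesgue_on_le[OF Dl] K_nn_integral_fst] by (intro mult_left_mono) auto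
  finally show "(\<integral>\<^sup>+x. ennreal ((h y)^2 * K n x y) \<partial>M) \<le> ennreal ((h y)^2) * 2 ^ DIM('a)" .
 qed
 also have "... = ennreal ((l2_norm M h)^2) * 2 ^ DIM('a)"
  by (simp add: nn_integral_multc nn_integral_l2[OF h])
 also have "... = ennreal ((l2_norm M h)^2) * ennreal (2 ^ DIM('a))"
  by (simp flip: ennreal_power)
 also have "... = ennreal ((sqrt (2 ^ DIM('a)) * l2_norm M h)^2)"
  by (simp add: power_mult_distrib mult.commute flip: ennreal_mult)
 finally show ?thesis using mA by (intro L2_nnI(2)) auto
qed

lemma A_L2: "L2 M h ==> L2 M (A n h)"
 using smooth_continuous[OF A_smooth] continuous_L2[OF D(3) Dl] by blast

lemma A_diff:
 assumes "L2 M h" "L2 M g"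
 shows "A n (\<lambda>x. h x - g x) x = A n h x - A n g x"
 unfolding A_def left_diff_distrib
 by (intro Bochner_Integration.integral_diff hK_integrable sq_integrable assms)

lemma A_continuous_tendsto:
 assumes g: "continuous_on UNIV g" and B: "\<And>x. \<bar>g x\<bar> \<le> B"
 shows "(\<lambda>n. l2_dist M (A n g) g) \<longlonglongrightarrow> 0"
proof -
 have sg: "L2 M g" by (rule continuous_L2[OF D(3) Dl g])
 have [measurable]: "g \<in> borel_measurable M" using sg by auto
 have Kint: "integrable M (\<lambda>y. c * K n x y)" for c n x
  by (rule hK_integrable) simp
 have diff: "A n g x - g x = (\<integral>y. (g y - g x) * K n x y \<partial>M)" if "x \<in> D" for n x
 proof -
  have "(\<integral>y. (g y - g x) * K n x y \<partial>M) = A n g x - (\<integral>y. g x * K n x y \<partial>M)"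
   unfolding left_diff_distrib A_def
   by (rule Bochner_Integration.integral_diff[OF hK_integrable[OF sq_integrable[OF sg]] Kint])
  then show ?thesis using K_integral[OF that] by simp
 qed
 have close: "\<bar>A n g x - g x\<bar> \<le> e" if x: "x \<in> D" and e: "\<And>y. K n x y \<noteq> 0 ==> \<bar>g y - g x\<bar> \<le> e" for n x e
 proof -
  have "\<bar>A n g x - g x\<bar> \<le> (\<integral>y. \<bar>(g y - g x) * K n x y\<bar> \<partial>M)"
   unfolding diff[OF x] by (rule integral_abs_bound)
  also have "... \<le> (\<integral>y. e * K n x y \<partial>M)"
  proof (rule integral_mono)
   show "integrable M (\<lambda>y. \<bar>(g y - g x) * K n x y\<bar>)"
    using sq_integrable[OF sg] by (intro integrable_abs hK_integrable) simp
   show "\<bar>(g y - g x) * K n x y\<bar> \<le> e * K n x y" for y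
    using e[of y] K_nonneg[of n x y] by (cases "K n x y = 0") (auto simp: abs_mult intro!: mult_right_mono)
  qed (rule Kint)
  also have "... = e" using K_integral[OF x] by simp
  finally show ?thesis .
 qed
 have lim: "(\<lambda>n. A n g x - g x) \<longlonglongrightarrow> 0" if x: "x \<in> D" for x
 proof (rule LIMSEQ_I)
  fix e :: real assume "0 < e"
  have "isCont g x" using g by (simp add: continuous_on_eq_continuous_at)
  then obtain d where d: "0 < d" "\<And>y. norm (y - x) < d ==> \<bar>g y - g x\<bar> < e / 2"
   using \<open>0 < e\<close> unfolding continuous_at_eps_delta dist_norm by (metis half_gt_zero real_norm_def)
  obtain m :: nat where m: "(norm (x - x0) + r) / d < real m" using reals_Archimedean2 by blast
  have "norm (A n g x - g x - 0) < e" if "m \<le> n" for n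
  proof -
   have "norm (y - x) < d" if "K n x y \<noteq> 0" for y
   proof -
    have "norm (W n x y) \<le> r"
     using that by (rule K_nonzero)
    then have "norm (y - x) \<le> (norm (x - x0) + r) / N n" by (rule K_support(2)[OF x])
    also have "... < d"
    proof -
     have "(norm (x - x0) + r) / d < N n" using m \<open>m \<le> n\<close> by (simp add: N_def)
     then show ?thesis using d(1) N2[of n] by (simp add: field_simps)
    qed
    finally show ?thesis .
   qed
   then have "\<bar>A n g x - g x\<bar> \<le> e / 2" using d(2) by (intro close x) (auto intro: less_imp_le)
   then show ?thesis using \<open>0 < e\<close> by simp
  qed
  then show "\<exists>no. \<forall>n\<ge>no. norm (A n g x - g x - 0) < e" by blast
 qed
 have B2: "\<bar>A n g x - g x\<bar> \<le> 2 * B" if "x \<in> D" for n x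
 proof (rule close[OF that])
  show "\<bar>g y - g x\<bar> \<le> 2 * B" for y using B[of x] B[of y] by linarith
 qed
 have mA: "A n g \<in> borel_measurable M" for n using A_L2[OF sg] by auto
 have inD: "AE x in M. x \<in> D" by (rule AE_I2) simp
 have "(\<lambda>n. \<integral>x. (A n g x - g x)^2 \<partial>M) \<longlonglongrightarrow> (\<integral>x. 0 \<partial>M)"
 proof (rule integral_dominated_convergence[where w="\<lambda>x. (2 * B)^2"])
  show "AE x in M. (\<lambda>n. (A n g x - g x)^2) \<longlonglongrightarrow> 0"
   using inD by eventually_elim (use lim tendsto_power[of "\<lambda>n. A n g _ - g _" 0 _ 2] in simp)
  have "0 \<le> B" using B[of x0] by linarith
  show "AE x in M. norm ((A n g x - g x)^2) \<le> (2 * B)^2" for n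
   using inD
  proof eventually_elim
   case (elim x)
   have "\<bar>A n g x - g x\<bar>^2 \<le> (2 * B)^2" using B2[OF elim, of n] by (intro power_mono) auto
   then show ?case by simp
  qed
 qed (use mA in simp_all)
 then have "(\<lambda>n. sqrt (\<integral>x. (A n g x - g x)^2 \<partial>M)) \<longlonglongrightarrow> sqrt 0" by (intro tendsto_real_sqrt) simp
 then show ?thesis by (simp add: l2_norm_def l2_inner_real power2_eq_square)
qed

lemma A_tendsto:
 assumes h: "L2 M h"
 shows "(\<lambda>n. l2_dist M (A n h) h) \<longlonglongrightarrow> 0"
proof (rule LIMSEQ_I)
 fix e :: real assume "0 < e"
 define C where "C = sqrt (2 ^ DIM('a))"
 have C: "0 \<le> C" by (simp add: C_def)
 \<comment> \<open>Replacing h by g costs at most (C + 1) times the norm of h - g, which this choice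
   keeps below e/2.\<close>
 define \<eta> where "\<eta> = e / (2 * (C + 1))"
 have \<eta>: "0 < \<eta>" using C \<open>0 < e\<close> by (simp add: \<eta>_def)
 obtain g B where g: "continuous_on UNIV g" "\<And>x. \<bar>g x\<bar> \<le> B" "l2_dist M h g < \<eta>"
  by (rule continuous_l2_dense[OF D(3) Dl h \<eta>]) blast
 have sg: "L2 M g" by (rule continuous_L2[OF D(3) Dl g(1)])
 have hg: "L2 M (\<lambda>x. h x - g x)" by (rule L2_diff[OF h sg])
 obtain m where m: "\<And>n. m \<le> n ==> l2_dist M (A n g) g < e / 2"
  using LIMSEQ_D[OF A_continuous_tendsto[OF g(1,2)], of "e / 2"] \<open>0 < e\<close> by auto
 have "norm (l2_dist M (A n h) h - 0) < e" if "m \<le> n" for n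
 proof -
  have eq: "(\<lambda>x. A n h x - h x) = (\<lambda>x. (A n (\<lambda>x. h x - g x) x - (h x - g x)) + (A n g x - g x))"
   by (simp add: fun_eq_iff A_diff[OF h sg])
  have "l2_dist M (A n h) h \<le> l2_norm M (\<lambda>x. A n (\<lambda>x. h x - g x) x - (h x - g x)) + l2_dist M (A n g) g"
   unfolding eq by (intro l2_triangle L2_diff A_L2 h sg)
  also have "l2_norm M (\<lambda>x. A n (\<lambda>x. h x - g x) x - (h x - g x)) \<le> l2_norm M (A n (\<lambda>x. h x - g x)) + l2_dist M h g"
   by (intro l2_triangle_diff A_L2 hg)
  also have "... \<le> C * l2_dist M h g + l2_dist M h g"
   using A_bounded[OF hg, of n] by (simp add: C_def)
  also have "... = (C + 1) * l2_dist M h g" by (simp add: algebra_simps)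
  also have "... \<le> (C + 1) * \<eta>" using g(3) C by (intro mult_left_mono) auto
  also have "... = e / 2" using C by (simp add: \<eta>_def field_simps)
  finally show ?thesis using m[OF that] by simp
 qed
 then show "\<exists>no. \<forall>n\<ge>no. norm (l2_dist M (A n h) h - 0) < e" by blast
qed

end

lemma mollifier_exists:
 fixes D :: "'a::euclidean_space set"
 assumes "open D" "convex D" "bounded D" "D \<noteq> {}"
 shows "\<exists>x0 r \<rho>. mollifier D x0 r \<rho>"
proof -
 obtain x0 where "x0 \<in> D" using assms(4) by blast
 then obtain e where e: "0 < e" "ball x0 e \<subseteq> D" using assms(1) open_contains_ball by blast
 define r where "r = e / 2"
 have r: "0 < r" "ball x0 (2 * r) \<subseteq> D" using e by (auto simp: r_def)
 obtain \<sigma> :: "'a => real" where \<sigma>: "smooth_fun \<sigma>" "\<And>x. 0 \<le> \<sigma> x" "0 < \<sigma> 0" "\<And>x. r \<le> norm x ==> \<sigma> x = 0"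
  by (rule bump_exists[OF r(1)]) blast
 have cont: "continuous_on S \<sigma>" for S by (rule smooth_continuous[OF \<sigma>(1)])
 have [measurable]: "\<sigma> \<in> borel_measurable borel" by (rule borel_measurable_continuous_onI[OF cont])
 have sub: "closure {x. \<sigma> x \<noteq> 0} \<subseteq> cball 0 r"
  by (rule closure_minimal) (use \<sigma>(4) in \<open>force simp: not_le\<close>)+
 then have comp: "compact (closure {x. \<sigma> x \<noteq> 0})"
  using bounded_subset[OF bounded_cball] by (simp add: compact_eq_bounded_closed)
 have "integrable lborel (\<lambda>x. indicator (cball 0 r) x *\<^sub>R \<sigma> x)"
  by (rule borel_integrable_compact) (auto intro: cont)
 moreover have "(\<lambda>x. indicator (cball 0 r) x *\<^sub>R \<sigma> x) = \<sigma>"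
  using \<sigma>(4) by (force simp: fun_eq_iff split: split_indicator)
 ultimately have int: "integrable lborel \<sigma>" by simp
 define c where "c = (\<integral>x. \<sigma> x \<partial>lborel)"
 have "c \<noteq> 0"
 proof
  assume "c = 0"
  then have AE0: "AE x in lborel. \<sigma> x = 0"
   using integral_nonneg_eq_0_iff_AE[OF int] \<sigma>(2) by (simp add: c_def)
  have op: "open {x. 0 < \<sigma> x}" using cont by (intro open_Collect_less) auto
  have "AE x in lborel. x \<notin> {x. 0 < \<sigma> x}" using AE0 by eventually_elim simp
  then have "{x. 0 < \<sigma> x} \<in> null_sets lborel"
   using op by (subst (asm) AE_iff_null_sets[symmetric]) auto
  then have "negligible {x. 0 < \<sigma> x}" by (simp add: negligible_iff_null_sets null_sets_completionI)
  then show False using open_not_negligible[OF op] \<sigma>(3) by auto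
 qed
 moreover have "0 \<le> c" unfolding c_def using \<sigma>(2) by (intro integral_nonneg_AE) auto
 ultimately have c: "0 < c" by simp
 define \<rho> where "\<rho> x = (1 / c) * \<sigma> x" for x
 have "mollifier D x0 r \<rho>"
 proof
  have "{x. \<rho> x \<noteq> 0} = {x. \<sigma> x \<noteq> 0}" using c by (auto simp: \<rho>_def)
  moreover have "smooth_fun \<rho>" unfolding \<rho>_def[abs_def] by (rule smooth_cmult[OF \<sigma>(1)])
  ultimately show "test_function UNIV \<rho>" using comp by (simp only: test_function_def) simp
  have "(\<integral>\<^sup>+x. ennreal (\<rho> x) \<partial>lborel) = ennreal (\<integral>x. \<rho> x \<partial>lborel)"
   using int c \<sigma>(2) by (intro nn_integral_eq_integral) (auto simp: \<rho>_def)
  also have "(\<integral>x. \<rho> x \<partial>lborel) = 1" using c by (simp add: \<rho>_def[abs_def] c_def)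
  finally show "(\<integral>\<^sup>+x. ennreal (\<rho> x) \<partial>lborel) = 1" by simp
 qed (use assms r c \<sigma> in \<open>auto simp: \<rho>_def\<close>)
 then show ?thesis by blast
qed

section \<open>Sobolev functions on convex domains\<close>

lemma l2_inner_subdomain:
 fixes f :: "'a::euclidean_space => real"
 assumes "E \<subseteq> D" "D \<in> sets lebesgue" "E \<in> sets lebesgue" and f: "\<And>x. x \<notin> E ==> f x = 0"
 shows "l2_inner (lebesgue_on D) g f = l2_inner (lebesgue_on E) g f"
proof -
 have "l2_inner (lebesgue_on D) g f = (\<integral>x. indicator D x *\<^sub>R (g x * f x) \<partial>lebesgue)"
  unfolding l2_inner_real using assms by (intro integral_restrict_space) simp
 also have "(\<lambda>x. indicator D x *\<^sub>R (g x * f x)) = (\<lambda>x. indicator E x *\<^sub>R (g x * f x))"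
  using assms(1) f by (auto simp: fun_eq_iff split: split_indicator)
 also have "(\<integral>x. indicator E x *\<^sub>R (g x * f x) \<partial>lebesgue) = l2_inner (lebesgue_on E) g f"
  unfolding l2_inner_real using assms by (intro integral_restrict_space[symmetric]) simp
 finally show ?thesis .
qed

lemma L2_subdomain:
 fixes g :: "'a::euclidean_space => real"
 assumes "E \<subseteq> D" "D \<in> sets lebesgue" "E \<in> sets lebesgue" and g: "L2 (lebesgue_on D) g"
 shows "L2 (lebesgue_on E) g" "l2_norm (lebesgue_on E) g \<le> l2_norm (lebesgue_on D) g"
proof -
 have m: "g \<in> borel_measurable (lebesgue_on E)"
  by (rule measurable_restrict_mono[OF _ assms(1)]) (use g in auto)
 have "(\<integral>\<^sup>+x. ennreal ((g x)^2) \<partial>lebesgue_on E) = (\<integral>\<^sup>+x. ennreal ((g x)^2) * indicator E x \<partial>lebesgue)"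
  using assms by (intro nn_integral_restrict_space) simp
 also have "... \<le> (\<integral>\<^sup>+x. ennreal ((g x)^2) * indicator D x \<partial>lebesgue)"
  using assms(1) by (intro nn_integral_mono) (auto split: split_indicator)
 also have "... = (\<integral>\<^sup>+x. ennreal ((g x)^2) \<partial>lebesgue_on D)"
  using assms by (intro nn_integral_restrict_space[symmetric]) simp
 also have "... = ennreal ((l2_norm (lebesgue_on D) g)^2)" by (rule nn_integral_l2[OF g])
 finally have "(\<integral>\<^sup>+x. ennreal ((g x)^2) \<partial>lebesgue_on E) \<le> ennreal ((l2_norm (lebesgue_on D) g)^2)" .
 from L2_nnI[OF m this] show "L2 (lebesgue_on E) g"
  "l2_norm (lebesgue_on E) g \<le> l2_norm (lebesgue_on D) g" by auto
qed

lemma AE_subdomain: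
 assumes "E \<subseteq> D" "D \<in> sets lebesgue" "E \<in> sets lebesgue" "AE x in lebesgue_on D. P x"
 shows "AE x in lebesgue_on E. P x"
proof -
 have "D \<inter> space lebesgue \<in> sets lebesgue" "E \<inter> space lebesgue \<in> sets lebesgue" using assms by auto
 note * = AE_restrict_space_iff[OF this(1)] AE_restrict_space_iff[OF this(2)]
 have "AE x in lebesgue. x \<in> D \<longrightarrow> P x" using assms(4) unfolding * .
 then have "AE x in lebesgue. x \<in> E \<longrightarrow> P x" by (rule eventually_mono) (use assms(1) in blast)
 then show ?thesis unfolding * .
qed

lemma has_weak_derivD:
 assumes "has_weak_deriv D \<alpha> v g"
 shows "L2 (lebesgue_on D) g"
  and "test_function D \<phi> ==> mset bs = \<alpha> ==>
   l2_inner (lebesgue_on D) v (iter_deriv bs \<phi>) = (-1) ^ size \<alpha> * l2_inner (lebesgue_on D) g \<phi>"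
 using assms unfolding has_weak_deriv_def by blast+

lemma has_weak_deriv_subdomain:
 fixes D :: "'a::euclidean_space set"
 assumes "E \<subseteq> D" "D \<in> sets lebesgue" "E \<in> sets lebesgue" and v: "has_weak_deriv D \<alpha> v g" and \<alpha>: "set_mset \<alpha> \<subseteq> Basis"
 shows "has_weak_deriv E \<alpha> v g"
 unfolding has_weak_deriv_def
proof (intro conjI allI impI)
 show "L2 (lebesgue_on E) g"
  by (rule L2_subdomain(1)[OF assms(1-3) has_weak_derivD(1)[OF v]])
 fix \<phi> bs assume "test_function E \<phi> \<and> mset bs = \<alpha>"
 then have \<phi>: "test_function E \<phi>" and bs: "mset bs = \<alpha>" by auto
 have "set bs \<subseteq> Basis" using \<alpha> bs by (metis set_mset_mset)
 then have E: "test_function E (iter_deriv bs \<phi>)" by (rule test_function_iter_deriv[OF \<phi>])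
 have "l2_inner (lebesgue_on E) v (iter_deriv bs \<phi>) = l2_inner (lebesgue_on D) v (iter_deriv bs \<phi>)"
  by (rule l2_inner_subdomain[OF assms(1-3), symmetric]) (rule test_function_zero[OF E])
 also have "... = (-1) ^ size \<alpha> * l2_inner (lebesgue_on D) g \<phi>"
  by (rule has_weak_derivD(2)[OF v test_function_mono[OF \<phi> assms(1)] bs])
 also have "l2_inner (lebesgue_on D) g \<phi> = l2_inner (lebesgue_on E) g \<phi>"
  by (rule l2_inner_subdomain[OF assms(1-3)]) (rule test_function_zero[OF \<phi>])
 finally show "l2_inner (lebesgue_on E) v (iter_deriv bs \<phi>) = (-1) ^ size \<alpha> * l2_inner (lebesgue_on E) g \<phi>" .
qed

lemma multi_indices_1: "multi_indices 1 = insert {#} ((\<lambda>b::'a::euclidean_space. {#b#}) ` Basis)"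
proof (intro equalityI subsetI)
 fix \<alpha> :: "'a multiset" assume "\<alpha> \<in> multi_indices 1"
 then have \<alpha>: "set_mset \<alpha> \<subseteq> Basis" "size \<alpha> \<le> 1" by (auto simp: multi_indices_def)
 show "\<alpha> \<in> insert {#} ((\<lambda>b::'a. {#b#}) ` Basis)"
 proof (cases "\<alpha> = {#}")
  case False
  then have "size \<alpha> = 1" using \<alpha>(2) by (metis One_nat_def le_SucE le_zero_eq size_eq_0_iff_empty)
  then obtain b where "\<alpha> = {#b#}" using size_1_singleton_mset by blast
  then show ?thesis using \<alpha>(1) by auto
 qed simp
qed (auto simp: multi_indices_def)

locale convex_domain =
 fixes D :: "'a::euclidean_space set"
 assumes dom: "open D" "convex D" "bounded D" "D \<noteq> {}"
begin

abbreviation "L \<equiv> lebesgue_on D"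

lemma Dl: "D \<in> sets lebesgue" using dom(1) by simp

sublocale finite_measure L
 using dom Dl by (intro finite_measure_lebesgue_on bounded_set_imp_lmeasurable)

lemma smooth_L2: "smooth_fun f ==> L2 L f"
 by (rule continuous_L2[OF dom(3) Dl smooth_continuous])

lemma poly_measure_domain: "poly_measure L"
 unfolding poly_measure_def by (auto intro: smooth_L2 smooth_poly)

text \<open>Each average A n h at a point of D is h integrated against a test function, hence zero,
  while the averages converge to h. The contraction towards x0 avoids an exceptional layer along the
  boundary.\<close>

lemma fundamental_lemma:
 assumes h: "L2 L h" and z: "\<And>\<phi>. test_function D \<phi> ==> l2_inner L h \<phi> = 0"
 shows "AE x in L. h x = 0"
proof -
 obtain x0 r \<rho> where m: "mollifier D x0 r \<rho>" using mollifier_exists[OF dom] by blast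
 interpret mollifier D x0 r \<rho> by (rule m)
 have "l2_dist L (A n h) h = l2_norm L (\<lambda>x. - h x)" for n
 proof (rule l2_norm_cong_AE)
  show "AE x in L. A n h x - h x = - h x"
   by (rule AE_I2) (use A_zero[OF z] in simp)
  show "(\<lambda>x. A n h x - h x) \<in> borel_measurable L" "(\<lambda>x. - h x) \<in> borel_measurable L"
   using L2_measurable[OF A_L2[OF h]] L2_measurable[OF h] by auto
 qed
 then have "(\<lambda>n::nat. l2_norm L h) \<longlonglongrightarrow> 0" using A_tendsto[OF h] by simp
 then have "l2_norm L h = 0" using LIMSEQ_unique[OF tendsto_const] by blast
 then show ?thesis by (rule l2_norm_zero_AE[OF h])
qed

lemma test_L2: "test_function D \<phi> ==> L2 L \<phi>"
 by (intro smooth_L2 test_function_smooth)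

lemma weak_deriv_unique:
 assumes "has_weak_deriv D \<alpha> v g" "has_weak_deriv D \<alpha> v g'"
 shows "AE x in L. g x = g' x"
proof -
 obtain bs where bs: "mset bs = \<alpha>" using ex_mset by blast
 note g = has_weak_derivD[OF assms(1)] has_weak_derivD[OF assms(2)]
 have "AE x in L. g x - g' x = 0"
 proof (rule fundamental_lemma)
  show "L2 L (\<lambda>x. g x - g' x)" by (rule L2_diff[OF g(1,3)])
  fix \<phi> assume \<phi>: "test_function D \<phi>"
  have "(-1) ^ size \<alpha> * l2_inner L g \<phi> = (-1) ^ size \<alpha> * l2_inner L g' \<phi>"
   using g(2)[OF \<phi> bs] g(4)[OF \<phi> bs] by simp
  then have "l2_inner L g \<phi> = l2_inner L g' \<phi>" by simp
  then show "l2_inner L (\<lambda>x. g x - g' x) \<phi> = 0"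
   by (simp add: l2_inner_diff_left g test_L2[OF \<phi>])
 qed
 then show ?thesis by simp
qed

lemma has_weak_deriv_weak_deriv: "has_weak_deriv D \<alpha> v g ==> has_weak_deriv D \<alpha> v (weak_deriv D \<alpha> v)"
 unfolding weak_deriv_def by (rule someI[of "has_weak_deriv D \<alpha> v"])

lemma weak_deriv_AE: "has_weak_deriv D \<alpha> v g ==> AE x in L. weak_deriv D \<alpha> v x = g x"
 using weak_deriv_unique has_weak_deriv_weak_deriv by blast

lemma weak_deriv_L2: "has_weak_deriv D \<alpha> v g ==> L2 L (weak_deriv D \<alpha> v)"
 by (rule has_weak_derivD(1)[OF has_weak_deriv_weak_deriv])

lemma weak_deriv_norm: "has_weak_deriv D \<alpha> v g ==> l2_norm L (weak_deriv D \<alpha> v) = l2_norm L g"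
 by (rule l2_norm_cong_AE[OF weak_deriv_AE])
   (auto dest: weak_deriv_L2 has_weak_derivD(1))

lemma has_weak_deriv_diff:
 assumes v: "L2 L v" "L2 L w" and g: "has_weak_deriv D \<alpha> v g" "has_weak_deriv D \<alpha> w h"
  and \<alpha>: "set_mset \<alpha> \<subseteq> Basis"
 shows "has_weak_deriv D \<alpha> (\<lambda>x. v x - w x) (\<lambda>x. g x - h x)"
 unfolding has_weak_deriv_def
proof (intro conjI allI impI)
 note d = has_weak_derivD[OF g(1)] has_weak_derivD[OF g(2)]
 show "L2 L (\<lambda>x. g x - h x)" by (rule L2_diff[OF d(1,3)])
 fix \<phi> bs assume "test_function D \<phi> \<and> mset bs = \<alpha>"
 then have \<phi>: "test_function D \<phi>" and bs: "mset bs = \<alpha>" by auto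
 have "set bs \<subseteq> Basis" using \<alpha> bs by (metis set_mset_mset)
 then have E: "L2 L (iter_deriv bs \<phi>)"
  by (intro test_L2 test_function_iter_deriv[OF \<phi>])
 show "l2_inner L (\<lambda>x. v x - w x) (iter_deriv bs \<phi>) = (-1) ^ size \<alpha> * l2_inner L (\<lambda>x. g x - h x) \<phi>"
  unfolding l2_inner_diff_left[OF v E] l2_inner_diff_left[OF d(1,3) test_L2[OF \<phi>]]
   d(2)[OF \<phi> bs] d(4)[OF \<phi> bs] by (simp add: right_diff_distrib)
qed

lemma has_weak_deriv_empty: "L2 L v ==> has_weak_deriv D {#} v v"
 by (auto simp: has_weak_deriv_def)

lemma has_weak_deriv_smooth:
 assumes f: "smooth_fun f" and b: "b \<in> Basis"
 shows "has_weak_deriv D {#b#} f (partial b f)"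
 unfolding has_weak_deriv_def
proof (intro conjI allI impI)
 show "L2 L (partial b f)"
  by (rule smooth_L2[OF smooth_partial[OF f b]])
 fix \<phi> bs assume "test_function D \<phi> \<and> mset bs = {#b#}"
 then have \<phi>: "test_function D \<phi>" and bs: "bs = [b]" by (auto simp: mset_single_iff_right)
 note s\<phi> = test_function_smooth[OF \<phi>]
 have prod: "test_function D (\<lambda>x. f x * \<phi> x)" by (rule test_function_mult[OF f \<phi>])
 note sprod = test_function_smooth[OF prod]
 obtain R where R: "\<And>x. x \<in> D ==> norm x < R" using dom(3) by (metis bounded_pos_less)
 have meas: "h \<in> borel_measurable borel" if "smooth_fun h" for h :: "'a => real"
  by (rule borel_measurable_continuous_onI[OF smooth_continuous[OF that]])
 have part: "partial b (\<lambda>x. f x * \<phi> x) x = f x * partial b \<phi> x + partial b f x * \<phi> x" for x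
  by (rule partial_mult[OF smooth_differentiable[OF f] smooth_differentiable[OF s\<phi>]])
 have "l2_inner L f (partial b \<phi>) + l2_inner L (partial b f) \<phi> = (\<integral>x. f x * partial b \<phi> x + partial b f x * \<phi> x \<partial>L)"
  unfolding l2_inner_real
  by (rule Bochner_Integration.integral_add[symmetric]; intro L2_mult smooth_L2 smooth_partial f s\<phi> b)
 also have "... = (\<integral>x. partial b (\<lambda>x. f x * \<phi> x) x \<partial>L)" by (simp only: part)
 also have "... = (\<integral>x. indicator D x * partial b (\<lambda>x. f x * \<phi> x) x \<partial>lborel)"
  using dom(1) meas[OF smooth_partial[OF sprod b]] by (intro integral_lebesgue_on) auto
 also have "... = (\<integral>x. partial b (\<lambda>x. f x * \<phi> x) x \<partial>lborel)"
  by (rule Bochner_Integration.integral_cong)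
    (use test_function_zero[OF test_function_partial[OF prod b]] in \<open>auto split: split_indicator\<close>)
 also have "... = 0"
 proof (rule integral_partial_compact_support[where r=R])
  show "f x * \<phi> x = 0" if "R \<le> norm x" for x
   using test_function_zero[OF prod] R[of x] that by (meson not_le)
 qed (use sprod b in \<open>auto intro: smooth_differentiable smooth_continuous smooth_partial\<close>)
 finally show "l2_inner L f (iter_deriv bs \<phi>) = (-1) ^ size {#b#} * l2_inner L (partial b f) \<phi>"
  unfolding bs by simp
qed

lemma sobolev_1_iff:
 "v \<in> sobolev 1 D \<longleftrightarrow> L2 L v \<and> (\<forall>b\<in>Basis. \<exists>g. has_weak_deriv D {#b#} v g)"
 unfolding sobolev_def multi_indices_1 using has_weak_deriv_empty by blast

lemma sobolev_1D:
 assumes "v \<in> sobolev 1 D"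
 shows "L2 L v" "b \<in> Basis ==> has_weak_deriv D {#b#} v (weak_deriv D {#b#} v)"
 using assms has_weak_deriv_weak_deriv unfolding sobolev_1_iff by blast+

lemma smooth_sobolev: "smooth_fun f ==> f \<in> sobolev 1 D"
 unfolding sobolev_1_iff using smooth_L2 has_weak_deriv_smooth by blast

lemma sobolev_norm_1:
 assumes v: "L2 L v" and g: "\<And>b. b \<in> Basis ==> has_weak_deriv D {#b#} v (g b)"
 shows "sobolev_norm 1 D v = sqrt ((l2_norm L v)^2 + (\<Sum>b\<in>Basis. (l2_norm L (g b))^2))"
proof -
 have inj: "inj_on (\<lambda>b::'a. {#b#}) Basis" by (rule inj_onI) simp
 have ne: "{#} \<notin> (\<lambda>b::'a. {#b#}) ` Basis" by auto
 have "(\<Sum>\<alpha>\<in>multi_indices 1. (l2_norm L (weak_deriv D \<alpha> v))^2)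
  = (l2_norm L (weak_deriv D {#} v))^2 + (\<Sum>b\<in>Basis. (l2_norm L (weak_deriv D {#b#} v))^2)"
  unfolding multi_indices_1 by (simp only: sum.insert finite_imageI finite_Basis ne not_False_eq_True sum.reindex[OF inj] o_def)
 also have "... = (l2_norm L v)^2 + (\<Sum>b\<in>Basis. (l2_norm L (g b))^2)"
  by (simp add: weak_deriv_norm[OF has_weak_deriv_empty[OF v]] weak_deriv_norm[OF g])
 finally show ?thesis unfolding sobolev_norm_def by simp
qed

lemma sobolev_norm_diff:
 assumes v: "v \<in> sobolev 1 D" and f: "smooth_fun f"
 shows "h1_dist D f v
  = sqrt ((l2_dist L f v)^2 + (\<Sum>b\<in>Basis. (l2_dist L (partial b f) (weak_deriv D {#b#} v))^2))"
proof (rule sobolev_norm_1)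
 show "L2 L (\<lambda>x. f x - v x)"
  by (rule L2_diff[OF smooth_L2[OF f] sobolev_1D(1)[OF v]])
 show "has_weak_deriv D {#b#} (\<lambda>x. f x - v x) (\<lambda>x. partial b f x - weak_deriv D {#b#} v x)" if "b \<in> Basis" for b
  using that by (intro has_weak_deriv_diff smooth_L2[OF f] sobolev_1D[OF v] has_weak_deriv_smooth[OF f]) auto
qed

lemma sobolev_norm_diff_ge:
 assumes v: "v \<in> sobolev 1 D" and f: "smooth_fun f"
 shows "l2_dist L f v \<le> h1_dist D f v"
  "b \<in> Basis ==> l2_dist L (partial b f) (weak_deriv D {#b#} v) \<le> h1_dist D f v"
proof -
 show "l2_dist L f v \<le> h1_dist D f v"
  unfolding sobolev_norm_diff[OF v f] by (intro real_le_rsqrt) (simp add: sum_nonneg)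
 assume b: "b \<in> Basis"
 have "(l2_dist L (partial b f) (weak_deriv D {#b#} v))^2 \<le> (\<Sum>b\<in>Basis. (l2_dist L (partial b f) (weak_deriv D {#b#} v))^2)"
  by (rule member_le_sum[OF b]) auto
 then show "l2_dist L (partial b f) (weak_deriv D {#b#} v) \<le> h1_dist D f v"
  unfolding sobolev_norm_diff[OF v f] by (intro real_le_rsqrt) (simp add: add_increasing)
qed

lemma sobolev_convergence:
 assumes v: "v \<in> sobolev 1 D" and f: "\<And>n. smooth_fun (f n)"
  and lim: "h1_lim D f v"
 shows "l2_lim L f v"
  and "b \<in> Basis ==> (\<lambda>n. l2_dist L (partial b (f n)) (weak_deriv D {#b#} v)) \<longlonglongrightarrow> 0"
proof -
 show "l2_lim L f v"
  by (rule Lim_null_comparison[OF _ lim]) (use sobolev_norm_diff_ge(1)[OF v f] in simp)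
 show "b \<in> Basis ==> (\<lambda>n. l2_dist L (partial b (f n)) (weak_deriv D {#b#} v)) \<longlonglongrightarrow> 0"
  by (rule Lim_null_comparison[OF _ lim]) (use sobolev_norm_diff_ge(2)[OF v f] in simp)
qed

text \<open>The averages are smooth on the whole space and use values of v in D only, so no
  extension of v is needed. Their derivatives are the averages of the weak derivative up to a term
  of size 1/N.\<close>

lemma smooth_dense:
 assumes v: "v \<in> sobolev 1 D"
 shows "\<exists>f. (\<forall>n. smooth_fun (f n)) \<and> h1_lim D f v"
proof -
 obtain x0 r \<rho> where m: "mollifier D x0 r \<rho>" using mollifier_exists[OF dom] by blast
 interpret mollifier D x0 r \<rho> by (rule m)
 have sv: "L2 L v" by (rule sobolev_1D(1)[OF v])
 have sA: "smooth_fun (A n v)" for n by (rule A_smooth[OF sv])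
 have part: "(\<lambda>n. l2_dist L (partial b (A n v)) (weak_deriv D {#b#} v)) \<longlonglongrightarrow> 0" if b: "b \<in> Basis" for b
 proof -
  let ?g = "weak_deriv D {#b#} v"
  have hg: "has_weak_deriv D {#b#} v ?g" by (rule sobolev_1D(2)[OF v b])
  have sg: "L2 L ?g" by (rule has_weak_derivD(1)[OF hg])
  have le: "l2_dist L (partial b (A n v)) ?g \<le> l2_dist L (A n ?g) ?g + (1 / N n) * (sqrt (2 ^ DIM('a)) * l2_norm L ?g)" for n
  proof -
   have eq: "partial b (A n v) x - ?g x = (A n ?g x - ?g x) - (1 / N n) * A n ?g x" if "x \<in> D" for x
    unfolding A_partial[OF sv hg b that] using N2[of n] by (simp add: field_simps)
   have s1: "L2 L (\<lambda>x. A n ?g x - ?g x)" "L2 L (\<lambda>x. (1 / N n) * A n ?g x)"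
    by (intro L2_diff L2_cmult A_L2 sg)+
   have "l2_dist L (partial b (A n v)) ?g = l2_norm L (\<lambda>x. (A n ?g x - ?g x) - (1 / N n) * A n ?g x)"
   proof (rule l2_norm_cong_AE)
    show "AE x in L. partial b (A n v) x - ?g x = (A n ?g x - ?g x) - (1 / N n) * A n ?g x"
     by (rule AE_I2) (use eq in simp)
    show "(\<lambda>x. partial b (A n v) x - ?g x) \<in> borel_measurable L"
     using L2_diff[OF smooth_L2[OF smooth_partial[OF sA b]] sg] by auto
    show "(\<lambda>x. (A n ?g x - ?g x) - (1 / N n) * A n ?g x) \<in> borel_measurable L"
     using L2_diff[OF s1] by auto
   qed
   also have "... \<le> l2_dist L (A n ?g) ?g + l2_norm L (\<lambda>x. (1 / N n) * A n ?g x)"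
    by (rule l2_triangle_diff[OF s1])
   also have "l2_norm L (\<lambda>x. (1 / N n) * A n ?g x) = (1 / N n) * l2_norm L (A n ?g)"
    unfolding l2_norm_cmult using N2[of n] by simp
   also have "... \<le> (1 / N n) * (sqrt (2 ^ DIM('a)) * l2_norm L ?g)"
    using N2[of n] by (intro mult_left_mono A_bounded[OF sg]) auto
   finally show ?thesis by simp
  qed
  have "(\<lambda>n. 1 / N n) \<longlonglongrightarrow> 0"
   using LIMSEQ_ignore_initial_segment[OF LIMSEQ_inverse_real_of_nat, of 1]
   by (simp add: N_def inverse_eq_divide add.commute)
  then have "(\<lambda>n. l2_dist L (A n ?g) ?g + (1 / N n) * (sqrt (2 ^ DIM('a)) * l2_norm L ?g)) \<longlonglongrightarrow> 0 + 0 * (sqrt (2 ^ DIM('a)) * l2_norm L ?g)"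
   by (intro tendsto_add tendsto_mult A_tendsto[OF sg] tendsto_const)
  then have lim0: "(\<lambda>n. l2_dist L (A n ?g) ?g + (1 / N n) * (sqrt (2 ^ DIM('a)) * l2_norm L ?g)) \<longlonglongrightarrow> 0" by simp
  show ?thesis
   by (rule Lim_null_comparison[OF _ lim0]) (use le in simp)
 qed
 have "(\<lambda>n. h1_dist D (A n v) v) \<longlonglongrightarrow> sqrt (0^2 + (\<Sum>b\<in>(Basis::'a set). 0^2))"
  unfolding sobolev_norm_diff[OF v sA]
  by (intro tendsto_real_sqrt tendsto_add tendsto_power tendsto_sum A_tendsto[OF sv] part)
 then show ?thesis using sA by (intro exI[of _ "\<lambda>n. A n v"]) simp
qed

lemma weak_deriv_deriv:
 assumes v: "has_weak_deriv D (add_mset b \<alpha>) v g" and w: "has_weak_deriv D {#b#} v w" and b: "b \<in> Basis"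
  and \<alpha>: "set_mset \<alpha> \<subseteq> Basis"
 shows "has_weak_deriv D \<alpha> w g"
 unfolding has_weak_deriv_def
proof (intro conjI allI impI)
 show "L2 L g" by (rule has_weak_derivD(1)[OF v])
 fix \<phi> bs assume "test_function D \<phi> \<and> mset bs = \<alpha>"
 then have \<phi>: "test_function D \<phi>" and bs: "mset bs = \<alpha>" by auto
 have "set bs \<subseteq> Basis" using \<alpha> bs by (metis set_mset_mset)
 then have E: "test_function D (iter_deriv bs \<phi>)" by (rule test_function_iter_deriv[OF \<phi>])
 have "l2_inner L w (iter_deriv bs \<phi>) = - l2_inner L v (partial b (iter_deriv bs \<phi>))"
  using has_weak_deriv_single[OF w E] by simp
 also have "... = - l2_inner L v (iter_deriv (b # bs) \<phi>)" by simp
 also have "l2_inner L v (iter_deriv (b # bs) \<phi>) = (-1) ^ size (add_mset b \<alpha>) * l2_inner L g \<phi>"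
  using bs by (intro has_weak_derivD(2)[OF v \<phi>]) simp
 finally show "l2_inner L w (iter_deriv bs \<phi>) = (-1) ^ size \<alpha> * l2_inner L g \<phi>" by simp
qed

text \<open>Moves regularity from u to the components of its gradient, whose boundary errors are
  estimated with m - 1 in place of m.\<close>

lemma sobolev_partial:
 assumes v: "v \<in> sobolev (Suc m) D" and w: "has_weak_deriv D {#b#} v w" and b: "b \<in> Basis"
 shows "w \<in> sobolev m D" "sobolev_norm m D w \<le> sobolev_norm (Suc m) D v"
proof -
 have add: "add_mset b \<alpha> \<in> multi_indices (Suc m)" if "\<alpha> \<in> multi_indices m" for \<alpha>
  using that b by (auto simp: multi_indices_def)
 have hw: "has_weak_deriv D \<alpha> w (weak_deriv D (add_mset b \<alpha>) v)" if \<alpha>: "\<alpha> \<in> multi_indices m" for \<alpha>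
 proof -
  obtain g where "has_weak_deriv D (add_mset b \<alpha>) v g" using v add[OF \<alpha>] unfolding sobolev_def by blast
  then show ?thesis
   using \<alpha> by (intro weak_deriv_deriv[OF has_weak_deriv_weak_deriv w b]) (auto simp: multi_indices_def)
 qed
 then show "w \<in> sobolev m D" using has_weak_derivD(1)[OF w] by (auto simp: sobolev_def)
 have inj: "inj_on (add_mset b) (multi_indices m)" by (rule inj_onI) simp
 have "(\<Sum>\<alpha>\<in>multi_indices m. (l2_norm L (weak_deriv D \<alpha> w))^2)
  = (\<Sum>\<alpha>\<in>multi_indices m. (l2_norm L (weak_deriv D (add_mset b \<alpha>) v))^2)"
  by (rule sum.cong) (simp_all add: weak_deriv_norm[OF hw])
 also have "... = (\<Sum>\<alpha>\<in>add_mset b ` multi_indices m. (l2_norm L (weak_deriv D \<alpha> v))^2)"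
  by (simp add: sum.reindex[OF inj])
 also have "... \<le> (\<Sum>\<alpha>\<in>multi_indices (Suc m). (l2_norm L (weak_deriv D \<alpha> v))^2)"
  by (rule sum_mono2) (use add in auto)
 finally show "sobolev_norm m D w \<le> sobolev_norm (Suc m) D v" by (simp add: sobolev_norm_def)
qed

end

section \<open>Traces on mesh faces\<close>

lemma space_face_measure [simp]: "space (face_measure F) = F"
 by (simp add: face_measure_def space_restrict_space)

lemma face_measure_measurable:
 "f \<in> borel_measurable borel ==> f \<in> borel_measurable (face_measure F)" for f :: "'a::euclidean_space => real"
 unfolding face_measure_def by (intro measurable_restrict_space1 measurable_completion) simp

lemma finite_measure_face:
 assumes F: "planar_face F"
 shows "finite_measure (face_measure F)"
proof (rule finite_measureI)
 obtain n where n: "hyperplane_data (affine hull F) n" by (rule planar_face_hyperplane[OF F])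
 obtain R where R: "\<And>x. x \<in> F ==> norm x < R" using planar_face_props(2)[OF F] by (metis bounded_pos_less)
 let ?C = "completion (affine_lborel (affine hull F))"
 have Fb: "F \<in> sets borel" by (rule planar_face_props(3)[OF F])
 then have FC: "F \<in> sets ?C" by (intro sets_completionI_sets) simp
 have "emeasure (face_measure F) F = emeasure ?C F"
  unfolding face_measure_def using FC by (intro emeasure_restrict_space) auto
 also have "... = emeasure (affine_lborel (affine hull F)) F"
  using Fb by (simp add: emeasure_completion main_part_sets)
 also have "... \<le> emeasure (affine_lborel (affine hull F)) (ball 0 R)"
  using R by (intro emeasure_mono) auto
 also have "... < \<infinity>" by (rule emeasure_affine_lborel_ball[OF n])
 finally show "emeasure (face_measure F) (space (face_measure F)) \<noteq> \<infinity>" by simp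
qed

lemma continuous_face_L2:
 fixes f :: "'a::euclidean_space => real"
 assumes F: "planar_face F" and f: "continuous_on UNIV f"
 shows "L2 (face_measure F) f"
proof -
 have "compact (closure F)" using planar_face_props(2)[OF F] by (simp add: compact_closure)
 then have "bounded (f ` closure F)"
  using f by (intro compact_imp_bounded compact_continuous_image) (auto intro: continuous_on_subset)
 then obtain B where B: "\<And>x. x \<in> closure F ==> \<bar>f x\<bar> \<le> B" by (auto simp: bounded_iff)
 show ?thesis
  by (rule L2_bounded[OF finite_measure_face[OF F] face_measure_measurable[OF borel_measurable_continuous_onI[OF f]]])
    (use B closure_subset in \<open>intro AE_I2, auto\<close>)
qed

lemma convex_domain_subdomain:
 assumes D: "convex_domain D" and E: "convex_domain E" and sub: "E \<subseteq> D" and v: "v \<in> sobolev 1 D"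
 shows "v \<in> sobolev 1 E"
  and "b \<in> Basis ==> AE x in lebesgue_on E. weak_deriv E {#b#} v x = weak_deriv D {#b#} v x"
  and "smooth_fun f ==> h1_dist E f v \<le> h1_dist D f v"
proof -
 interpret D: convex_domain D by fact
 interpret E: convex_domain E by fact
 note sub' = sub D.Dl E.Dl
 have hw: "has_weak_deriv E {#b#} v (weak_deriv D {#b#} v)" if "b \<in> Basis" for b
  using that by (intro has_weak_deriv_subdomain[OF sub' D.sobolev_1D(2)[OF v]]) auto
 have sv: "L2 E.L v"
  by (rule L2_subdomain(1)[OF sub' D.sobolev_1D(1)[OF v]])
 show vE: "v \<in> sobolev 1 E" unfolding E.sobolev_1_iff using sv hw by blast
 show "b \<in> Basis ==> AE x in lebesgue_on E. weak_deriv E {#b#} v x = weak_deriv D {#b#} v x"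
  by (rule E.weak_deriv_AE[OF hw])
 assume f: "smooth_fun f"
 have 1: "h1_dist E f v
   = sqrt ((l2_dist E.L f v)^2 + (\<Sum>b\<in>Basis. (l2_dist E.L (partial b f) (weak_deriv D {#b#} v))^2))"
  by (rule E.sobolev_norm_1)
    (auto intro!: L2_diff E.smooth_L2[OF f] sv E.has_weak_deriv_diff hw E.has_weak_deriv_smooth[OF f])
 have "l2_dist E.L f v \<le> l2_dist D.L f v"
  by (rule L2_subdomain(2)[OF sub' L2_diff[OF D.smooth_L2[OF f] D.sobolev_1D(1)[OF v]]])
 moreover have "l2_dist E.L (partial b f) (weak_deriv D {#b#} v) \<le> l2_dist D.L (partial b f) (weak_deriv D {#b#} v)"
  if b: "b \<in> Basis" for b
  by (rule L2_subdomain(2)[OF sub' L2_diff[OF D.smooth_L2[OF smooth_partial[OF f b]] has_weak_derivD(1)[OF D.sobolev_1D(2)[OF v b]]]])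
 ultimately show "h1_dist E f v \<le> h1_dist D f v"
  unfolding 1 D.sobolev_norm_diff[OF v f]
  by (intro real_sqrt_le_mono add_mono sum_mono power_mono) auto
qed

lemma has_traceE:
 assumes "has_trace D F v g"
 obtains f where "\<And>n. smooth_fun (f n)" "h1_lim D f v"
  "l2_lim (face_measure F) f g" "L2 (face_measure F) g"
proof -
 note tr = assms[unfolded has_trace_def]
 obtain f where "(\<forall>n. smooth_fun (f n)) \<and> h1_lim D f v \<and>
   l2_lim (face_measure F) f g"
  using tr[THEN conjunct2] ..
 then show thesis using tr[THEN conjunct1] by (intro that[of f]) (elim conjE, erule spec, (elim conjE, assumption)+)
qed

lemma has_trace_subdomain:
 assumes "convex_domain D" "convex_domain E" "E \<subseteq> D" "v \<in> sobolev 1 D" and tr: "has_trace D F v g"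
 shows "has_trace E F v g"
proof -
 obtain \<phi> where \<phi>: "\<And>n. smooth_fun (\<phi> n)" and l1: "h1_lim D \<phi> v"
  and l2: "l2_lim (face_measure F) \<phi> g" and g: "L2 (face_measure F) g"
  by (rule has_traceE[OF tr]) (rule that; assumption)
 have "h1_lim E \<phi> v"
 proof (rule Lim_null_comparison[OF _ l1])
  have "0 \<le> sobolev_norm 1 E w" for w by (simp add: sobolev_norm_def sum_nonneg)
  then show "\<forall>\<^sub>F n in sequentially. norm (h1_dist E (\<phi> n) v) \<le> h1_dist D (\<phi> n) v"
   using convex_domain_subdomain(3)[OF assms(1-4) \<phi>] by simp
 qed
 then show ?thesis unfolding has_trace_def using \<phi> l2 g by blast
qed

text \<open>The points of the ball farthest in direction n are still behind the face plane. This
  bounds the weight of the multiplier from below on the boundary.\<close>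

lemma face_normal_bounds:
 assumes n: "face_normal T F n" and ball: "ball a r \<subseteq> T" and r: "0 < r" and x: "x \<in> F"
 shows "r \<le> (x - a) \<bullet> n" "\<bar>(x - a) \<bullet> n\<bar> \<le> norm (x - a)"
proof -
 have n1: "norm n = 1" "n \<bullet> n = 1" using n by (auto simp: face_normal_def norm_eq_1)
 show "r \<le> (x - a) \<bullet> n"
 proof (rule dense_le_bounded[OF r])
  fix t assume "0 < t" "t < r"
  then have "a + t *\<^sub>R n \<in> T" using ball n1 by (auto simp: dist_norm)
  then have "n \<bullet> (a + t *\<^sub>R n - x) < 0" using n x by (auto simp: face_normal_def)
  then show "t \<le> (x - a) \<bullet> n" using n1 by (simp add: inner_diff_right inner_add_right inner_commute)
 qed
 show "\<bar>(x - a) \<bullet> n\<bar> \<le> norm (x - a)" using Cauchy_Schwarz_ineq2[of "x - a" n] n1 by simp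
qed

lemma (in convex_domain) sobolev_norm_diff_self:
 assumes f: "smooth_fun f"
 shows "h1_dist D f f = 0"
proof -
 have "h1_dist D f f = sqrt ((l2_norm L (\<lambda>x. 0))^2 + (\<Sum>b\<in>(Basis::'a set). (l2_norm L (\<lambda>x. 0))^2))"
 proof (rule sobolev_norm_1[THEN trans])
  show "has_weak_deriv D {#b#} (\<lambda>x. f x - f x) (\<lambda>x. 0)" if "b \<in> Basis" for b
   using has_weak_deriv_smooth[OF smooth_const[of 0] that] by (simp del: zero_eq_add_iff_both_eq_0)
 qed simp_all
 then show ?thesis by simp
qed

text \<open>Symmetry of the Hessian of the polynomial p, by which its second derivatives cancel in
  \<open>tau_curl\<close>.\<close>

lemma partial_partial_commute:
 assumes "p \<in> poly_space k"
 shows "partial b (partial c p) = partial c (partial b p)"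
 using assms
proof (induction rule: poly_induct)
 case (monomial \<alpha>)
 then have "set_mset \<alpha> \<subseteq> Basis" by (auto simp: multi_indices_def)
 then show ?case
 proof (induction \<alpha>)
  case empty
  have "monomial {#} = (\<lambda>x::'a. 1)" by (simp add: fun_eq_iff)
  then show ?case by simp
 next
  case (add e \<alpha>)
  have \<alpha>: "set_mset \<alpha> \<subseteq> Basis" using add by auto
  have d: "partial c (monomial \<alpha>) differentiable (at x)" for c x
   by (rule poly_differentiable[OF partial_monomial[OF \<alpha>]])
  have eq: "partial c (monomial (add_mset e \<alpha>)) = (\<lambda>x. (x \<bullet> e) * partial c (monomial \<alpha>) x + (c \<bullet> e) * monomial \<alpha> x)" for c
   by (rule ext) (rule partial_monomial_add)
  have cd: "(\<lambda>x. x \<bullet> e) differentiable (at x)" for x by (rule smooth_differentiable[OF smooth_coord])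
  have "partial b (partial c (monomial (add_mset e \<alpha>))) x = (x \<bullet> e) * partial b (partial c (monomial \<alpha>)) x
    + (b \<bullet> e) * partial c (monomial \<alpha>) x + (c \<bullet> e) * partial b (monomial \<alpha>) x" for b c x
   unfolding eq
   by (subst partial_add) (auto simp: partial_mult partial_cmult partial_coord d cd monomial_differentiable intro!: derivative_intros)
  then show ?case using add.IH[OF \<alpha>] unfolding fun_eq_iff by (metis add.assoc add.commute)
 qed
next
 case (add p q)
 have "partial b (partial c (\<lambda>x. p x + q x)) = (\<lambda>x. partial b (partial c p) x + partial b (partial c q) x)" for b c
  using add(1,2)[THEN poly_differentiable] add(1,2)[THEN poly_partial, THEN poly_differentiable]
  by (simp add: fun_eq_iff partial_add ext[OF partial_add])
 then show ?case using add by simp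
next
 case (cmult p a)
 have "partial b (partial c (\<lambda>x. a * p x)) = (\<lambda>x. a * partial b (partial c p) x)" for b c
  using cmult(1)[THEN poly_differentiable] cmult(1)[THEN poly_partial, THEN poly_differentiable]
  by (simp add: fun_eq_iff partial_cmult ext[OF partial_cmult])
 then show ?case using cmult by simp
qed

section \<open>Inner products on the boundary of an element and the multiplier x - a\<close>

context mesh
begin

lemma domain_elem: "T \<in> Th ==> convex_domain T"
 using elem by unfold_locales auto

lemma domain_\<Omega>: "convex_domain \<Omega>"
 using open_polytopeD[OF \<Omega>] by unfold_locales auto

lemma planar_elem_face: "F \<in> elem_faces Fh T ==> planar_face F"
 by (rule planar) (simp add: elem_faces_iff)

lemma face_L2:
 "F \<in> elem_faces Fh T ==> smooth_fun f ==> L2 (face_measure F) f"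
 by (rule continuous_face_L2[OF planar_elem_face smooth_continuous])

lemma poly_measure_face: "F \<in> elem_faces Fh T ==> poly_measure (face_measure F)"
 unfolding poly_measure_def by (auto intro: face_L2 smooth_poly)

lemma normal_sum_inner:
 "(\<Sum>b\<in>Basis. (w \<bullet> b) * (v \<bullet> b)) = v \<bullet> w" for v w :: 'a
 using euclidean_inner[of v w] by (simp add: mult.commute)

end

locale element = mesh \<Omega> Th Fh for \<Omega> :: "'a::euclidean_space set" and Th Fh +
 fixes T assumes T: "T \<in> Th"
begin

sublocale convex_domain T by (rule domain_elem[OF T])

abbreviation "faces \<equiv> elem_faces Fh T"
abbreviation "nrm \<equiv> outward_normal T"

text \<open>A function on the boundary is a family indexed by the faces of T. Membership in L2 of
  the boundary is \<open>bsq\<close>, its inner product is \<open>bi\<close> and its norm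
  \<open>bn\<close>.\<close>

definition bsq :: "('a set => 'a => real) => bool" where
 "bsq \<phi> \<longleftrightarrow> (\<forall>F\<in>faces. L2 (face_measure F) (\<phi> F))"

definition bi :: "('a set => 'a => real) => ('a set => 'a => real) => real" where
 "bi \<phi> \<psi> = (\<Sum>F\<in>faces. l2_inner (face_measure F) (\<phi> F) (\<psi> F))"

definition bn :: "('a set => 'a => real) => real" where
 "bn \<phi> = sqrt (\<Sum>F\<in>faces. (l2_norm (face_measure F) (\<phi> F))^2)"

lemma bsqD: "bsq \<phi> ==> F \<in> faces ==> L2 (face_measure F) (\<phi> F)"
 by (simp add: bsq_def)

lemma bsq_diff: "bsq \<phi> ==> bsq \<psi> ==> bsq (\<lambda>F x. \<phi> F x - \<psi> F x)"
 and bsq_cmult: "bsq \<phi> ==> bsq (\<lambda>F x. c F * \<phi> F x)"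
 and bsq_smooth: "smooth_fun f ==> bsq (\<lambda>F. f)"
 by (auto simp: bsq_def face_L2 intro!: L2_diff L2_cmult)

lemma bsq_poly: "p \<in> poly_space j ==> bsq (\<lambda>F. p)"
 by (rule bsq_smooth[OF smooth_poly])

lemma bi_commute: "bi \<phi> \<psi> = bi \<psi> \<phi>"
 unfolding bi_def by (intro sum.cong refl l2_inner_commute)

lemma bi_diff_left: "bsq \<phi> ==> bsq \<phi>' ==> bsq \<psi> ==> bi (\<lambda>F x. \<phi> F x - \<phi>' F x) \<psi> = bi \<phi> \<psi> - bi \<phi>' \<psi>"
 and bi_add_left: "bsq \<phi> ==> bsq \<phi>' ==> bsq \<psi> ==> bi (\<lambda>F x. \<phi> F x + \<phi>' F x) \<psi> = bi \<phi> \<psi> + bi \<phi>' \<psi>"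
 unfolding bi_def sum_subtractf[symmetric] sum.distrib[symmetric]
 by (intro sum.cong refl l2_inner_diff_left l2_inner_add_left; simp add: bsqD)+

lemma bi_cmult_left: "bi (\<lambda>F x. c * \<phi> F x) \<psi> = c * bi \<phi> \<psi>"
 unfolding bi_def by (simp add: l2_inner_cmult_left sum_distrib_left)

lemma bi_sum_left:
 assumes "finite I" "\<And>i. i \<in> I ==> bsq (\<xi> i)" "bsq \<psi>"
 shows "bi (\<lambda>F x. \<Sum>i\<in>I. \<xi> i F x) \<psi> = (\<Sum>i\<in>I. bi (\<xi> i) \<psi>)"
proof -
 have "bi (\<lambda>F x. \<Sum>i\<in>I. \<xi> i F x) \<psi> = (\<Sum>F\<in>faces. \<Sum>i\<in>I. l2_inner (face_measure F) (\<xi> i F) (\<psi> F))"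
  unfolding bi_def by (intro sum.cong refl l2_inner_sum_left bsqD assms)
 then show ?thesis unfolding bi_def by (simp add: sum.swap[of _ I])
qed

lemma bi_shift: "bi (\<lambda>F x. c F x * \<phi> F x) \<psi> = bi \<phi> (\<lambda>F x. c F x * \<psi> F x)"
 unfolding bi_def by (intro sum.cong refl l2_inner_shift)

lemma bi_cong_AE:
 assumes "\<And>F. F \<in> faces ==> AE x in face_measure F. \<phi> F x = \<phi>' F x" "bsq \<phi>" "bsq \<phi>'" "bsq \<psi>"
 shows "bi \<phi> \<psi> = bi \<phi>' \<psi>"
 unfolding bi_def
 by (intro sum.cong refl l2_inner_cong_AE; use assms in \<open>auto dest: bsqD L2_measurable\<close>)

lemma bn_nonneg [simp]: "0 \<le> bn \<phi>"
 by (simp add: bn_def sum_nonneg)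

lemma bn_sq: "(bn \<phi>)^2 = bi \<phi> \<phi>"
 by (simp add: bn_def bi_def sum_nonneg l2_norm_sq)

lemma bi_cs:
 assumes "bsq \<phi>" "bsq \<psi>"
 shows "\<bar>bi \<phi> \<psi>\<bar> \<le> bn \<phi> * bn \<psi>"
proof -
 have "\<bar>bi \<phi> \<psi>\<bar> \<le> (\<Sum>F\<in>faces. \<bar>l2_norm (face_measure F) (\<phi> F)\<bar> * \<bar>l2_norm (face_measure F) (\<psi> F)\<bar>)"
  unfolding bi_def by (rule order_trans[OF sum_abs sum_mono]) (use assms in \<open>simp add: l2_cauchy_schwarz bsqD\<close>)
 also have "... \<le> bn \<phi> * bn \<psi>" unfolding bn_def L2_set_def[symmetric] by (rule L2_set_mult_ineq)
 finally show ?thesis .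
qed

lemma bn_mono:
 "(\<And>F. F \<in> faces ==> l2_norm (face_measure F) (\<phi> F) \<le> l2_norm (face_measure F) (\<psi> F)) ==> bn \<phi> \<le> bn \<psi>"
 unfolding bn_def by (intro real_sqrt_le_mono sum_mono power_mono) auto

lemma bn_add:
 assumes "bsq \<phi>" "bsq \<psi>"
 shows "bn (\<lambda>F x. \<phi> F x + \<psi> F x) \<le> bn \<phi> + bn \<psi>"
proof -
 have "bn (\<lambda>F x. \<phi> F x + \<psi> F x) \<le> sqrt (\<Sum>F\<in>faces. (l2_norm (face_measure F) (\<phi> F) + l2_norm (face_measure F) (\<psi> F))^2)"
  unfolding bn_def by (intro real_sqrt_le_mono sum_mono power_mono l2_triangle bsqD assms) auto
 also have "... \<le> bn \<phi> + bn \<psi>" unfolding bn_def L2_set_def[symmetric] by (rule L2_set_triangle_ineq)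
 finally show ?thesis .
qed

lemma bn_diff:
 assumes "bsq \<phi>" "bsq \<psi>"
 shows "bn (\<lambda>F x. \<phi> F x - \<psi> F x) \<le> bn \<phi> + bn \<psi>"
 using bn_add[OF assms(1) bsq_cmult[OF assms(2), of "\<lambda>_. -1"]] by (simp add: bn_def)

lemma weight:
 assumes "bsq \<phi>" "\<And>F. F \<in> faces ==> continuous_on UNIV (c F)" "\<And>F x. F \<in> faces ==> x \<in> F ==> \<bar>c F x\<bar> \<le> C" "0 \<le> C"
 shows "bsq (\<lambda>F x. c F x * \<phi> F x)" "bn (\<lambda>F x. c F x * \<phi> F x) \<le> C * bn \<phi>"
proof -
 note m = bsqD[OF assms(1)] face_measure_measurable[OF borel_measurable_continuous_onI[OF assms(2)]] AE_I2
 show "bsq (\<lambda>F x. c F x * \<phi> F x)"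
  unfolding bsq_def by (intro ballI L2_bounded_mult m) (use assms(3) in auto)
 have "bn (\<lambda>F x. c F x * \<phi> F x) \<le> bn (\<lambda>F x. C * \<phi> F x)"
 proof (rule bn_mono)
  fix F assume F: "F \<in> faces"
  have "l2_norm (face_measure F) (\<lambda>x. c F x * \<phi> F x) \<le> C * l2_norm (face_measure F) (\<phi> F)"
   using assms(3)[OF F] by (intro l2_norm_bounded_mult m F assms(4)) simp
  then show "l2_norm (face_measure F) (\<lambda>x. c F x * \<phi> F x) \<le> l2_norm (face_measure F) (\<lambda>x. C * \<phi> F x)"
   using assms(4) by (simp add: l2_norm_cmult)
 qed
 also have "... = C * bn \<phi>"
  using assms(4) by (simp add: bn_def l2_norm_cmult power_mult_distrib sum_distrib_left[symmetric] real_sqrt_mult)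
 finally show "bn (\<lambda>F x. c F x * \<phi> F x) \<le> C * bn \<phi>" .
qed

abbreviation "nt b \<phi> \<equiv> \<lambda>F x. (nrm F \<bullet> b) * \<phi> F x"

lemma normal_weight:
 assumes "bsq \<phi>" "b \<in> Basis"
 shows "bsq (nt b \<phi>)" "bn (nt b \<phi>) \<le> bn \<phi>"
proof -
 have "\<bar>nrm F \<bullet> b\<bar> \<le> 1" if "F \<in> faces" for F
  using Basis_le_norm[OF assms(2), of "nrm F"] normal[OF T that] by (simp add: face_normal_def)
 then show "bsq (nt b \<phi>)" "bn (nt b \<phi>) \<le> bn \<phi>"
  using weight[OF assms(1), of "\<lambda>F x. nrm F \<bullet> b" 1] by auto
qed

lemma elem_ball:
 obtains a r where "0 < r" "ball a r \<subseteq> T"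
 using elem(1,4)[OF T] by (metis all_not_in_conv open_contains_ball)

lemma diameter_pos: "0 < diameter T"
proof -
 obtain c r where r: "0 < r" "ball c r \<subseteq> T" by (rule elem_ball)
 obtain e :: 'a where e: "e \<in> Basis" using nonempty_Basis by blast
 have "c \<in> T" "c + (r/2) *\<^sub>R e \<in> T" using r e by (auto simp: dist_norm subset_iff)
 then have "dist c (c + (r/2) *\<^sub>R e) \<le> diameter T" using elem(3)[OF T] diameter_bounded_bound by blast
 then show ?thesis using r e by (simp add: dist_norm)
qed

lemma ibp_smooth:
 assumes f: "smooth_fun f" "smooth_fun g" and b: "b \<in> Basis"
 shows "l2_inner L (partial b f) g = - l2_inner L f (partial b g) + bi (nt b (\<lambda>F. f)) (\<lambda>F. g)"
proof -
 have part: "partial b (\<lambda>x. f x * g x) x = f x * partial b g x + partial b f x * g x" for x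
  by (rule partial_mult[OF smooth_differentiable[OF f(1)] smooth_differentiable[OF f(2)]])
 have s: "smooth_fun (\<lambda>x. f x * g x)" by (rule smooth_mult[OF f])
 have "l2_inner L f (partial b g) + l2_inner L (partial b f) g = (\<integral>x. partial b (\<lambda>x. f x * g x) x \<partial>L)"
  unfolding l2_inner_real part
  by (rule Bochner_Integration.integral_add[symmetric]; intro L2_mult smooth_L2 smooth_partial f b)
 also have "... = (\<Sum>F\<in>faces. (nrm F \<bullet> b) * (\<integral>x. f x * g x \<partial>face_measure F))"
  using nonzero_Basis[OF b]
  by (intro divergence_theorem[OF T] smooth_differentiable[OF s] smooth_continuous[OF smooth_partial[OF s b]])
 finally show ?thesis by (simp add: bi_def l2_inner_cmult_left) (simp add: l2_inner_real)
qed

end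

text \<open>Center and relative radius of an inscribed ball. The existence of traces allows any
  ball, with a constant depending on T; the error estimate needs a value of \<kappa> common to all
  elements.\<close>

locale pointed_element = element +
 fixes a and \<kappa> :: real
 assumes \<kappa>: "0 < \<kappa>" and ball: "ball a (\<kappa> * diameter T) \<subseteq> T"
begin

abbreviation "X b x \<equiv> (x - a) \<bullet> b"

abbreviation "h \<equiv> diameter T"
abbreviation "wt \<equiv> \<lambda>F x. (x - a) \<bullet> nrm F"

lemmas h_pos = diameter_pos

lemma a_mem: "a \<in> T" using ball \<kappa> h_pos by auto

lemma norm_bound_elem:
 assumes "x \<in> closure T" shows "norm (x - a) \<le> h"
proof -
 have "a \<in> closure T" using a_mem closure_subset by blast
 then have "dist x a \<le> diameter (closure T)"
  using assms elem(3)[OF T] by (intro diameter_bounded_bound bounded_closure)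
 then show ?thesis using elem(3)[OF T] by (simp add: diameter_closure dist_norm)
qed

lemma X_face: "F \<in> faces ==> x \<in> F ==> norm (x - a) \<le> h"
 by (rule norm_bound_elem) (auto simp: elem_faces_iff frontier_def)

lemma wt_weight:
 assumes "bsq \<phi>"
 shows "bsq (\<lambda>F x. wt F x * \<phi> F x)" "bn (\<lambda>F x. wt F x * \<phi> F x) \<le> h * bn \<phi>"
proof -
 have "\<bar>(x - a) \<bullet> nrm F\<bar> \<le> h" if "F \<in> faces" "x \<in> F" for F x
  by (rule order_trans[OF face_normal_bounds(2)[OF normal[OF T that(1)] ball mult_pos_pos[OF \<kappa> h_pos] that(2)] X_face[OF that]])
 then show "bsq (\<lambda>F x. wt F x * \<phi> F x)" "bn (\<lambda>F x. wt F x * \<phi> F x) \<le> h * bn \<phi>"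
  using weight[OF assms, of wt h, OF _ _ less_imp_le[OF h_pos]] by (simp_all add: continuous_intros)
qed

lemma X_weight:
 assumes "bsq \<phi>" "b \<in> Basis"
 shows "bsq (\<lambda>F x. X b x * \<phi> F x)" "bn (\<lambda>F x. X b x * \<phi> F x) \<le> h * bn \<phi>"
proof -
 have "\<bar>(x - a) \<bullet> b\<bar> \<le> h" if "F \<in> faces" "x \<in> F" for F x
  by (rule order_trans[OF Basis_le_norm[OF assms(2)] X_face[OF that]])
 then show "bsq (\<lambda>F x. X b x * \<phi> F x)" "bn (\<lambda>F x. X b x * \<phi> F x) \<le> h * bn \<phi>"
  using weight[OF assms(1), of "\<lambda>F x. (x - a) \<bullet> b" h, OF _ _ less_imp_le[OF h_pos]]
  by (simp_all add: continuous_intros)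
qed

lemma X_weight_domain:
 assumes f: "L2 L f" and b: "b \<in> Basis"
 shows "L2 L (\<lambda>x. X b x * f x)" "l2_norm L (\<lambda>x. X b x * f x) \<le> h * l2_norm L f"
proof -
 have w: "(\<lambda>x. (x - a) \<bullet> b) \<in> borel_measurable L"
  by (intro lebesgue_on_measurable_borel borel_measurable_continuous_onI continuous_intros)
 have le: "AE x in L. \<bar>(x - a) \<bullet> b\<bar> \<le> h"
 proof (rule AE_I2)
  fix x assume "x \<in> space L"
  then have "x \<in> closure T" using closure_subset by auto
  from order_trans[OF Basis_le_norm[OF b] norm_bound_elem[OF this]] show "\<bar>(x - a) \<bullet> b\<bar> \<le> h" .
 qed
 show "L2 L (\<lambda>x. X b x * f x)" by (rule L2_bounded_mult[OF f w le])
 show "l2_norm L (\<lambda>x. X b x * f x) \<le> h * l2_norm L f"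
  by (rule l2_norm_bounded_mult[OF f w le less_imp_le[OF h_pos]])
qed

lemma wt_lower: "bsq \<phi> ==> \<kappa> * h * (bn \<phi>)^2 \<le> bi (\<lambda>F x. wt F x * \<phi> F x) \<phi>"
 unfolding bn_sq unfolding bi_def sum_distrib_left l2_inner_real integral_mult_right_zero[symmetric]
proof (intro sum_mono integral_mono integrable_mult_right L2_mult)
 fix F x assume F: "F \<in> faces" and x: "x \<in> space (face_measure F)"
 have "\<kappa> * h \<le> wt F x" using face_normal_bounds(1)[OF normal[OF T F] ball mult_pos_pos[OF \<kappa> h_pos]] x by simp
 then show "\<kappa> * h * (\<phi> F x * \<phi> F x) \<le> wt F x * \<phi> F x * \<phi> F x"
  unfolding mult.assoc[of "wt F x"] by (rule mult_right_mono) simp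
qed (auto intro: bsqD wt_weight)

lemma wt_sum:
 assumes "bsq \<zeta>" "bsq \<phi>"
 shows "(\<Sum>b\<in>Basis. bi (nt b \<zeta>) (\<lambda>F x. X b x * \<phi> F x)) = bi (\<lambda>F x. wt F x * \<zeta> F x) \<phi>"
proof -
 have "(\<Sum>b\<in>Basis. bi (nt b \<zeta>) (\<lambda>F x. X b x * \<phi> F x)) = bi (\<lambda>F x. \<Sum>b\<in>Basis. X b x * nt b \<zeta> F x) \<phi>"
  unfolding bi_shift[symmetric]
  by (rule bi_sum_left[symmetric]) (intro finite_Basis X_weight(1) normal_weight(1) assms | assumption)+
 also have "(\<lambda>F x. \<Sum>b\<in>Basis. X b x * nt b \<zeta> F x) = (\<lambda>F x. wt F x * \<zeta> F x)"
  unfolding mult.assoc[symmetric] sum_distrib_right[symmetric] normal_sum_inner by (simp only: inner_commute)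
 finally show ?thesis .
qed

text \<open>This is the integral of div ((x - a) f^2) over T, split into its coordinates.\<close>

lemma pohozaev:
 assumes f: "smooth_fun f"
 shows "bi (\<lambda>F x. wt F x * f x) (\<lambda>F. f)
  = 2 * (\<Sum>b\<in>Basis. l2_inner L (\<lambda>x. X b x * partial b f x) f) + real DIM('a) * l2_inner L f f"
proof -
 have sX: "smooth_fun (X b)" for b by (rule smooth_poly[OF poly_shifted_coord])
 have sXf: "smooth_fun (\<lambda>x. X b x * f x)" for b by (rule smooth_mult[OF sX f])
 have "bi (nt b (\<lambda>F. f)) (\<lambda>F x. X b x * f x) = 2 * l2_inner L (\<lambda>x. X b x * partial b f x) f + l2_inner L f f"
  if b: "b \<in> Basis" for b
 proof -
  have dX: "partial b (X b) x = 1" for x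
   by (rule partial_eqI[of _ "\<lambda>v. v \<bullet> b", THEN trans]) (use b in \<open>auto intro!: derivative_eq_intros\<close>)
  have part: "partial b (\<lambda>x. X b x * f x) = (\<lambda>x. X b x * partial b f x + f x)"
   by (rule ext) (simp add: partial_mult smooth_differentiable sX f dX)
  have s: "L2 L (\<lambda>x. X b x * partial b f x)" "L2 L f"
   by (intro smooth_L2 smooth_mult sX smooth_partial f b)+
  show ?thesis
   using ibp_smooth[OF f sXf b, of b] l2_inner_shift[of L "X b" "partial b f" f]
   unfolding part l2_inner_add_right[OF s s(2)] by (simp add: l2_inner_commute)
 qed
 then show ?thesis
  unfolding wt_sum[OF bsq_smooth[OF f] bsq_smooth[OF f], symmetric] by (simp add: sum.distrib sum_distrib_left)
qed

end

section \<open>Traces on the faces of an element\<close>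

context element
begin

text \<open>In \<open>pohozaev\<close> the weight on the boundary is at least the radius of an
  inscribed ball, and the right-hand side is controlled by f and its derivatives. The constant may
  depend on T, as it only serves the existence and uniqueness of traces.\<close>

lemma trace_bound:
 "\<exists>C\<ge>0. \<forall>f. smooth_fun f \<longrightarrow> bn (\<lambda>F. f) \<le> C * (l2_norm L f + (\<Sum>b\<in>Basis. l2_norm L (partial b f)))"
proof -
 obtain a r where r: "0 < r" "ball a r \<subseteq> T" by (rule elem_ball)
 interpret pointed_element \<Omega> Th Fh T a "r / diameter T"
  by unfold_locales (use r diameter_pos in auto)
 define C where "C = sqrt (real DIM('a) * (2 * h + 1) / r)"
 show ?thesis
 proof (intro exI[of _ C] conjI allI impI)
  show "0 \<le> C" using h_pos r by (simp add: C_def)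
  fix f :: "'a => real" assume f: "smooth_fun f"
  define S where "S = l2_norm L f + (\<Sum>b\<in>Basis. l2_norm L (partial b f))"
  have fS: "l2_norm L f \<le> S" and S0: "0 \<le> S" by (simp_all add: S_def sum_nonneg)
  have vol: "l2_inner L (\<lambda>x. X b x * partial b f x) f \<le> h * S^2" if b: "b \<in> Basis" for b
  proof -
   note X = X_weight_domain[OF smooth_L2[OF smooth_partial[OF f b]] b]
   have "l2_norm L (partial b f) \<le> (\<Sum>b\<in>Basis. l2_norm L (partial b f))" by (rule member_le_sum[OF b]) auto
   then have "l2_norm L (partial b f) \<le> S" using l2_norm_nonneg[of L f] unfolding S_def by linarith
   then have "l2_norm L (\<lambda>x. X b x * partial b f x) \<le> h * S"
    using h_pos by (intro order_trans[OF X(2)] mult_left_mono) auto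
   from order_trans[OF abs_ge_self order_trans[OF l2_cauchy_schwarz[OF X(1) smooth_L2[OF f]] mult_mono[OF this fS]]]
   show ?thesis using h_pos S0 by (simp add: power2_eq_square mult.assoc)
  qed
  have "r * (bn (\<lambda>F. f))^2 \<le> bi (\<lambda>F x. wt F x * f x) (\<lambda>F. f)" using wt_lower[OF bsq_smooth[OF f]] h_pos by simp
  also have "... \<le> 2 * (\<Sum>b\<in>(Basis::'a set). h * S^2) + real DIM('a) * S^2"
   unfolding pohozaev[OF f] l2_norm_sq[symmetric] by (intro add_mono mult_left_mono sum_mono vol power_mono fS) auto
  also have "... = real DIM('a) * (2 * h + 1) * S^2" by (simp add: algebra_simps)
  finally have "(bn (\<lambda>F. f))^2 \<le> real DIM('a) * (2 * h + 1) / r * S^2" using r by (simp add: field_simps)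
  then have "bn (\<lambda>F. f) \<le> sqrt (real DIM('a) * (2 * h + 1) / r * S^2)" by (rule real_le_rsqrt)
  then show "bn (\<lambda>F. f) \<le> C * (l2_norm L f + (\<Sum>b\<in>Basis. l2_norm L (partial b f)))"
   using S0 by (simp only: C_def real_sqrt_mult real_sqrt_abs abs_of_nonneg S_def[symmetric])
 qed
qed

text \<open>With two members of one sequence this gives the Cauchy property on a face; with two
  sequences it gives independence of the approximation.\<close>

lemma trace_diff_bound:
 assumes v: "v \<in> sobolev 1 T"
 shows "\<exists>C\<ge>0. \<forall>f g F. smooth_fun f \<longrightarrow> smooth_fun g \<longrightarrow> F \<in> faces \<longrightarrow>
  l2_dist (face_measure F) f g \<le> C * (h1_dist T f v + h1_dist T g v)"
proof -
 obtain C where C: "0 \<le> C" "\<And>f. smooth_fun f ==> bn (\<lambda>F. f) \<le> C * (l2_norm L f + (\<Sum>b\<in>Basis. l2_norm L (partial b f)))"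
  using trace_bound by blast
 show ?thesis
 proof (intro exI[of _ "C * (real DIM('a) + 1)"] conjI allI impI)
  show "0 \<le> C * (real DIM('a) + 1)" using C(1) by simp
  fix f g :: "'a => real" and F assume f: "smooth_fun f" "smooth_fun g" and F: "F \<in> faces"
  define s where "s = h1_dist T f v + h1_dist T g v"
  have s0: "l2_dist L f g \<le> s"
   using l2_triangle_through[OF smooth_L2[OF f(1)] sobolev_1D(1)[OF v] smooth_L2[OF f(2)]]
    sobolev_norm_diff_ge(1)[OF v f(1)] sobolev_norm_diff_ge(1)[OF v f(2)] l2_norm_minus_commute[of L v g]
   by (simp add: s_def)
  have sb: "l2_norm L (partial b (\<lambda>x. f x - g x)) \<le> s" if b: "b \<in> Basis" for b
  proof -
   have "partial b (\<lambda>x. f x - g x) = (\<lambda>x. partial b f x - partial b g x)"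
    by (rule ext) (rule partial_diff[OF smooth_differentiable[OF f(1)] smooth_differentiable[OF f(2)]])
   then show ?thesis
    using l2_triangle_through[OF smooth_L2[OF smooth_partial[OF f(1) b]] has_weak_derivD(1)[OF sobolev_1D(2)[OF v b]] smooth_L2[OF smooth_partial[OF f(2) b]]]
     sobolev_norm_diff_ge(2)[OF v f(1) b] sobolev_norm_diff_ge(2)[OF v f(2) b] l2_norm_minus_commute[of L "weak_deriv T {#b#} v" "partial b g"]
    by (simp add: s_def)
  qed
  have "l2_dist (face_measure F) f g \<le> bn (\<lambda>F x. f x - g x)"
   unfolding bn_def by (rule real_le_rsqrt) (rule member_le_sum[OF F], auto simp: finite_elem_faces)
  also have "... \<le> C * (l2_dist L f g + (\<Sum>b\<in>Basis. l2_norm L (partial b (\<lambda>x. f x - g x))))"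
   by (rule C(2)[OF smooth_diff[OF f]])
  also have "... \<le> C * (s + (\<Sum>b\<in>(Basis::'a set). s))" by (intro mult_left_mono add_mono s0 sum_mono sb C(1))
  finally show "l2_dist (face_measure F) f g \<le> C * (real DIM('a) + 1) * (h1_dist T f v + h1_dist T g v)"
   unfolding s_def[symmetric] by (simp add: algebra_simps)
 qed
qed

text \<open>The subsequence k has errors below powers of 1/2, which makes the increments summable
  for \<open>l2_complete\<close>; the bound \<open>le\<close> carries the convergence back to the
  whole sequence.\<close>

lemma trace_cauchy:
 assumes v: "v \<in> sobolev 1 T" and F: "F \<in> faces" and f: "\<And>n. smooth_fun (f n)"
  and lim: "h1_lim T f v"
 shows "\<exists>g. L2 (face_measure F) g \<and> l2_lim (face_measure F) f g"
proof -
 let ?M = "face_measure F"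
 define e where "e n = h1_dist T (f n) v" for n
 obtain C where C: "0 \<le> C" "\<And>m n. l2_dist ?M (f m) (f n) \<le> C * (e m + e n)"
  using trace_diff_bound[OF v] F f unfolding e_def by blast
 have sf: "L2 ?M (f n)" for n by (rule face_L2[OF F f])
 have "\<exists>k. e k \<le> (1/2) ^ n" for n
 proof -
  obtain N where "\<forall>k\<ge>N. norm (e k - 0) < (1/2) ^ n"
   using LIMSEQ_D[OF lim[folded e_def], of "(1/2) ^ n"] by auto
  then have "\<bar>e N\<bar> < (1/2) ^ n" by simp
  then show ?thesis by (intro exI[of _ N]) linarith
 qed
 then obtain k where k: "\<And>n. e (k n) \<le> (1/2) ^ n" by metis
 have "summable (\<lambda>n. l2_dist ?M (f (k (Suc n))) (f (k n)))"
 proof (rule summable_comparison_test')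
  show "summable (\<lambda>n. C * (2 * (1/2) ^ n))" by (intro summable_mult summable_geometric) simp
  fix n :: nat
  have "(1/2) ^ Suc n \<le> (1/2 :: real) ^ n" by (rule power_decreasing) auto
  then have "e (k (Suc n)) + e (k n) \<le> 2 * (1/2) ^ n" using k[of n] k[of "Suc n"] by linarith
  then show "norm (l2_dist ?M (f (k (Suc n))) (f (k n))) \<le> C * (2 * (1/2) ^ n)"
   using C(2)[of "k (Suc n)" "k n"] mult_left_mono[OF _ C(1), of "e (k (Suc n)) + e (k n)" "2 * (1/2) ^ n"]
    l2_norm_nonneg[of ?M "\<lambda>x. f (k (Suc n)) x - f (k n) x"] unfolding real_norm_def by linarith
 qed
 then obtain g where g: "L2 ?M g" and kg: "(\<lambda>n. l2_dist ?M (f (k n)) g) \<longlonglongrightarrow> 0"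
  using l2_complete[of ?M "\<lambda>n. f (k n)", OF sf] by (elim exE conjE meta_impE)
 have le: "l2_dist ?M (f n) g \<le> C * e n" for n
 proof (rule LIMSEQ_le_const)
  show "(\<lambda>m. C * (e n + (1/2) ^ m) + l2_dist ?M (f (k m)) g) \<longlonglongrightarrow> C * e n"
  proof -
   have "(\<lambda>m. (1/2::real) ^ m) \<longlonglongrightarrow> 0" by (rule LIMSEQ_power_zero) simp
   from tendsto_add[OF tendsto_mult_left[OF tendsto_add[OF tendsto_const[of "e n"] this], of C] kg] show ?thesis by simp
  qed
  show "\<exists>N. \<forall>m\<ge>N. l2_dist ?M (f n) g \<le> C * (e n + (1/2) ^ m) + l2_dist ?M (f (k m)) g"
  proof (intro exI allI impI)
   fix m
   have "C * (e n + e (k m)) \<le> C * (e n + (1/2) ^ m)" using k[of m] C(1) by (intro mult_left_mono) auto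
   then show "l2_dist ?M (f n) g \<le> C * (e n + (1/2) ^ m) + l2_dist ?M (f (k m)) g"
    using l2_triangle_through[OF sf[of n] sf[of "k m"] g] C(2)[of n "k m"] by linarith
  qed
 qed
 have "l2_lim ?M f g"
  by (rule Lim_null_comparison[OF always_eventually[OF allI] tendsto_mult_right_zero[OF lim[folded e_def], of C]])
    (use le in simp)
 with g show ?thesis by (intro exI[of _ g] conjI)
qed

text \<open>\<open>has_trace\<close> provides one approximating sequence; here every other sequence
  is shown to have the same limit on the face.\<close>

lemma trace_limit:
 assumes v: "v \<in> sobolev 1 T" and F: "F \<in> faces" and f: "\<And>n. smooth_fun (f n)"
  and lim: "h1_lim T f v" and g: "has_trace T F v g"
 shows "l2_lim (face_measure F) f g"
proof -
 let ?M = "face_measure F"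
 obtain \<phi> where \<phi>: "\<And>n. smooth_fun (\<phi> n)" and l1: "h1_lim T \<phi> v"
  and l2: "l2_lim ?M \<phi> g" and sg: "L2 ?M g"
  by (rule has_traceE[OF g]) (rule that; assumption)
 obtain C where C: "\<And>n. l2_dist ?M (f n) (\<phi> n) \<le> C * (h1_dist T (f n) v + h1_dist T (\<phi> n) v)"
 proof -
  obtain C where "\<forall>f g F. smooth_fun f \<longrightarrow> smooth_fun g \<longrightarrow> F \<in> faces \<longrightarrow>
    l2_dist (face_measure F) f g \<le> C * (h1_dist T f v + h1_dist T g v)"
   using trace_diff_bound[OF v] by (elim exE conjE)
  from that[of C, OF this[rule_format, OF f \<phi> F]] show ?thesis .
 qed
 show ?thesis
 proof (rule Lim_null_comparison)
  show "(\<lambda>n. C * (h1_dist T (f n) v + h1_dist T (\<phi> n) v) + l2_dist ?M (\<phi> n) g) \<longlonglongrightarrow> 0"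
   by (rule tendsto_add_zero[OF tendsto_mult_right_zero[OF tendsto_add_zero[OF lim l1]] l2])
  show "\<forall>\<^sub>F n in sequentially. norm (l2_dist ?M (f n) g)
    \<le> C * (h1_dist T (f n) v + h1_dist T (\<phi> n) v) + l2_dist ?M (\<phi> n) g"
  proof (rule always_eventually, rule allI)
   fix n
   show "norm (l2_dist ?M (f n) g)
    \<le> C * (h1_dist T (f n) v + h1_dist T (\<phi> n) v) + l2_dist ?M (\<phi> n) g"
    using l2_triangle_through[OF face_L2[OF F f[of n]] face_L2[OF F \<phi>[of n]] sg] C[of n]
     l2_norm_nonneg[of ?M "\<lambda>x. f n x - g x"] unfolding real_norm_def by linarith
  qed
 qed
qed

lemma trace_unique:
 assumes v: "v \<in> sobolev 1 T" and F: "F \<in> faces" and g: "has_trace T F v g" "has_trace T F v g'"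
 shows "AE x in face_measure F. g x = g' x"
proof -
 obtain f where f: "\<And>n. smooth_fun (f n)" and lim: "h1_lim T f v"
  using smooth_dense[OF v] by blast
 show ?thesis
  by (rule l2_limit_unique[of _ f, OF face_L2[OF F f] _ _ trace_limit[OF v F f lim g(1)] trace_limit[OF v F f lim g(2)]])
    (use g[unfolded has_trace_def] in blast)+
qed

lemma trace_AE:
 assumes "v \<in> sobolev 1 T" "F \<in> faces" "has_trace T F v g"
 shows "AE x in face_measure F. trace T F v x = g x"
 by (rule trace_unique[OF assms(1,2) _ assms(3)]) (unfold trace_def, rule someI[of "has_trace T F v", OF assms(3)])

lemma has_traceI:
 "L2 (face_measure F) g ==> (\<And>n. smooth_fun (f n)) ==>
  h1_lim D f v ==>
  l2_lim (face_measure F) f g ==> has_trace D F v g"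
 unfolding has_trace_def by blast

lemma trace_exists:
 assumes v: "v \<in> sobolev 1 T" and F: "F \<in> faces"
 shows "has_trace T F v (trace T F v)"
proof -
 obtain f where f: "\<And>n. smooth_fun (f n)" and lim: "h1_lim T f v"
  using smooth_dense[OF v] by blast
 obtain g where "L2 (face_measure F) g" "l2_lim (face_measure F) f g"
  using trace_cauchy[OF v F f lim] by blast
 then have "has_trace T F v g" using f lim by (intro has_traceI[of F g f])
 then show ?thesis unfolding trace_def by (rule someI[of "has_trace T F v"])
qed

lemma trace_L2:
 assumes "v \<in> sobolev 1 T" "F \<in> faces"
 shows "L2 (face_measure F) (trace T F v)"
 using trace_exists[OF assms] unfolding has_trace_def ..

lemma trace_smooth:
 assumes F: "F \<in> faces" and f: "smooth_fun f"
 shows "AE x in face_measure F. trace T F f x = f x"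
proof -
 show ?thesis
 proof (rule trace_AE[OF smooth_sobolev[OF f] F has_traceI[of _ _ "\<lambda>_. f"]])
  show "(\<lambda>n. h1_dist T f f) \<longlonglongrightarrow> 0" unfolding sobolev_norm_diff_self[OF f] by (rule tendsto_const)
 qed (auto simp: f face_L2[OF F f])
qed

text \<open>A sequence approximating v on \<Omega> also approximates it on T, so the trace taken
  from T is the one taken from \<Omega>. Consequently the traces from the two sides of an interior
  face agree.\<close>

lemma trace_domain:
 assumes v: "v \<in> sobolev 1 \<Omega>" and F: "F \<in> faces"
 shows "v \<in> sobolev 1 T" "L2 (face_measure F) (trace \<Omega> F v)"
  and "AE x in face_measure F. trace T F v x = trace \<Omega> F v x"
proof -
 note dom = domain_\<Omega> domain_elem[OF T] elem_subset[OF T] v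
 show vT: "v \<in> sobolev 1 T" by (rule convex_domain_subdomain(1)[OF dom])
 obtain f where f: "\<And>n. smooth_fun (f n)" and lim: "h1_lim \<Omega> f v"
  using convex_domain.smooth_dense[OF domain_\<Omega> v] by blast
 have limT: "h1_lim T f v"
 proof (rule Lim_null_comparison[OF _ lim])
  have "0 \<le> sobolev_norm 1 T w" for w by (simp add: sobolev_norm_def sum_nonneg)
  then show "\<forall>\<^sub>F n in sequentially. norm (h1_dist T (f n) v) \<le> h1_dist \<Omega> (f n) v"
   using convex_domain_subdomain(3)[OF dom f] by simp
 qed
 obtain g where "L2 (face_measure F) g" "l2_lim (face_measure F) f g"
  using trace_cauchy[OF vT F f limT] by blast
 then have "has_trace \<Omega> F v g" using f lim by (intro has_traceI[of F g f])
 then have tr: "has_trace \<Omega> F v (trace \<Omega> F v)" unfolding trace_def by (rule someI[of "has_trace \<Omega> F v"])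
 then show "L2 (face_measure F) (trace \<Omega> F v)" unfolding has_trace_def ..
 show "AE x in face_measure F. trace T F v x = trace \<Omega> F v x"
  by (rule trace_AE[OF vT F has_trace_subdomain[OF dom tr]])
qed

text \<open>The test functions from the definition of \<open>sobolev_10\<close> are an admissible
  approximating sequence, and they vanish on the frontier of \<Omega>.\<close>

lemma trace_zero:
 assumes u: "u \<in> sobolev_10 \<Omega>" and F: "F \<in> faces" "F \<subseteq> frontier \<Omega>"
 shows "AE x in face_measure F. trace T F u x = 0"
proof -
 have u1: "u \<in> sobolev 1 \<Omega>" using u unfolding sobolev_10_def by blast
 obtain f where f: "\<And>n. test_function \<Omega> (f n)" and lim: "h1_lim \<Omega> f u"
  using u unfolding sobolev_10_def by blast
 note tr = trace_domain[OF u1 F(1)]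
 have "(\<lambda>n::nat. l2_norm (face_measure F) (\<lambda>x. 0)) \<longlonglongrightarrow> 0" by simp
 have eq: "f n x = 0" if x: "x \<in> F" for n x
 proof (rule test_function_zero[OF f])
  show "x \<notin> \<Omega>" using x F(2) open_polytopeD(1)[OF \<Omega>] by (auto simp: frontier_def interior_open)
 qed
 show ?thesis
 proof (rule trace_AE[OF tr(1) F(1) has_trace_subdomain[OF domain_\<Omega> domain_elem[OF T] elem_subset[OF T] u1 has_traceI[of _ _ f]]])
  show "L2 (face_measure F) (\<lambda>x. 0)" by simp
  show "smooth_fun (f n)" for n by (rule test_function_smooth[OF f])
  show "h1_lim \<Omega> f u" by (rule lim)
  have "l2_norm (face_measure F) (\<lambda>x. f n x - 0) = l2_norm (face_measure F) (\<lambda>x. 0::real)" for n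
   by (rule l2_norm_cong_AE[where M="face_measure F"])
     (rule AE_I2, simp_all add: eq L2_measurable[OF face_L2[OF F(1) test_function_smooth[OF f]]])
  then show "(\<lambda>n. l2_norm (face_measure F) (\<lambda>x. f n x - 0)) \<longlonglongrightarrow> 0" by simp
 qed
qed

lemma ibp_sobolev:
 assumes v: "v \<in> sobolev 1 T" and q: "smooth_fun q" and b: "b \<in> Basis"
 shows "l2_inner L (weak_deriv T {#b#} v) q = - l2_inner L v (partial b q)
  + (\<Sum>F\<in>faces. (nrm F \<bullet> b) * l2_inner (face_measure F) (trace T F v) q)"
proof -
 obtain f where f: "\<And>n. smooth_fun (f n)" and lim: "h1_lim T f v"
  using smooth_dense[OF v] by blast
 note c = sobolev_convergence[OF v f lim]
 have "(\<lambda>n. l2_inner L (partial b (f n)) q) \<longlonglongrightarrow> l2_inner L (weak_deriv T {#b#} v) q"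
  by (rule l2_inner_tendsto[OF smooth_L2[OF smooth_partial[OF f b]] has_weak_derivD(1)[OF sobolev_1D(2)[OF v b]] smooth_L2[OF q] c(2)[OF b]])
 moreover have "(\<lambda>n. l2_inner L (partial b (f n)) q) \<longlonglongrightarrow> - l2_inner L v (partial b q)
  + (\<Sum>F\<in>faces. (nrm F \<bullet> b) * l2_inner (face_measure F) (trace T F v) q)"
  unfolding ibp_smooth[OF f q b] bi_def l2_inner_cmult_left
 proof (intro tendsto_add tendsto_minus tendsto_sum tendsto_mult_left)
  show "(\<lambda>n. l2_inner L (f n) (partial b q)) \<longlonglongrightarrow> l2_inner L v (partial b q)"
   by (rule l2_inner_tendsto[OF smooth_L2[OF f] sobolev_1D(1)[OF v] smooth_L2[OF smooth_partial[OF q b]] c(1)])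
  show "(\<lambda>n. l2_inner (face_measure F) (f n) q) \<longlonglongrightarrow> l2_inner (face_measure F) (trace T F v) q"
   if F: "F \<in> faces" for F
   by (rule l2_inner_tendsto[OF face_L2[OF F f] trace_L2[OF v F] face_L2[OF F q] trace_limit[OF v F f lim trace_exists[OF v F]]])
 qed
 ultimately show ?thesis by (rule LIMSEQ_unique)
qed

text \<open>\<open>green v \<gamma> g\<close> records all that is used of a function \<open>v\<close> with trace \<open>\<gamma>\<close> and gradient \<open>g\<close>.\<close>

definition green :: "('a => real) => ('a set => 'a => real) => ('a => 'a => real) => bool" where
 "green v \<gamma> g \<longleftrightarrow> L2 L v \<and> bsq \<gamma> \<and> (\<forall>b\<in>Basis. L2 L (g b)) \<and>
   (\<forall>b\<in>Basis. \<forall>q. smooth_fun q \<longrightarrow> l2_inner L (g b) q = - l2_inner L v (partial b q) + bi (nt b \<gamma>) (\<lambda>F. q))"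

lemma greenD:
 assumes "green v \<gamma> g"
 shows "L2 L v" "bsq \<gamma>" "b \<in> Basis ==> L2 L (g b)"
  "b \<in> Basis ==> smooth_fun q ==>
   l2_inner L (g b) q = - l2_inner L v (partial b q) + bi (nt b \<gamma>) (\<lambda>F. q)"
 using assms unfolding green_def by simp_all

lemma green_smooth: "smooth_fun f ==> green f (\<lambda>F. f) (\<lambda>b. partial b f)"
 unfolding green_def bi_def
 by (auto simp: ibp_smooth[unfolded bi_def] smooth_L2 smooth_partial bsq_smooth)

lemma green_diff:
 assumes v: "green v \<gamma> g" and w: "green w \<gamma>' g'"
 shows "green (\<lambda>x. v x - w x) (\<lambda>F x. \<gamma> F x - \<gamma>' F x) (\<lambda>b x. g b x - g' b x)"
 unfolding green_def
proof (intro conjI ballI allI impI)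
 note [simp] = greenD(1-3)[OF v] greenD(1-3)[OF w]
 fix b :: 'a and q :: "'a => real" assume [simp]: "b \<in> Basis" and q [simp]: "smooth_fun q"
 have "bi (nt b (\<lambda>F x. \<gamma> F x - \<gamma>' F x)) (\<lambda>F. q)
   = bi (nt b \<gamma>) (\<lambda>F. q) - bi (nt b \<gamma>') (\<lambda>F. q)"
  unfolding right_diff_distrib by (intro bi_diff_left normal_weight bsq_smooth) auto
 then show "l2_inner L (\<lambda>x. g b x - g' b x) q = - l2_inner L (\<lambda>x. v x - w x) (partial b q)
   + bi (nt b (\<lambda>F x. \<gamma> F x - \<gamma>' F x)) (\<lambda>F. q)"
  by (simp add: l2_inner_diff_left smooth_L2 smooth_partial greenD(4)[OF v] greenD(4)[OF w])
qed (use greenD(1-3)[OF v] greenD(1-3)[OF w] in \<open>auto intro: L2_diff bsq_diff\<close>)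

lemma green_sobolev:
 assumes v: "v \<in> sobolev 1 T" and g: "\<And>b. b \<in> Basis ==> has_weak_deriv T {#b#} v (g b)"
 shows "green v (\<lambda>F. trace T F v) g"
 unfolding green_def
proof (intro conjI ballI allI impI)
 fix b :: 'a and q :: "'a => real" assume b: "b \<in> Basis" and q: "smooth_fun q"
 have "l2_inner L (g b) q = l2_inner L (weak_deriv T {#b#} v) q"
  using weak_deriv_AE[OF g[OF b]] has_weak_derivD(1)[OF g[OF b]] weak_deriv_L2[OF g[OF b]] smooth_L2[OF q]
  by (intro l2_inner_cong_AE) (auto dest: L2_measurable)
 then show "l2_inner L (g b) q = - l2_inner L v (partial b q) + bi (\<lambda>F x. (nrm F \<bullet> b) * trace T F v x) (\<lambda>F. q)"
  unfolding bi_def by (simp add: ibp_sobolev[OF v q b] l2_inner_cmult_left)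
qed (use sobolev_1D(1)[OF v] has_weak_derivD(1)[OF g] trace_L2[OF v] in \<open>auto simp: bsq_def\<close>)

section \<open>Green's formula for projection errors\<close>

lemma proj_poly: "L2 L v ==> l2_proj L j v \<in> poly_space j"
 by (rule l2_proj_poly[OF poly_measure_domain])

lemma poly_sq: "p \<in> poly_space j ==> L2 L p"
 by (rule poly_measureD[OF poly_measure_domain])

lemma proj_inner: "L2 L v ==> q \<in> poly_space j ==> l2_inner L (l2_proj L j v) q = l2_inner L v q"
 by (rule l2_proj_inner[OF poly_measure_domain])

text \<open>A derivative of q has degree at most j, so the projection error of v is orthogonal to it
  and the volume term of Green's formula vanishes. One degree is gained: q may have degree j +
  1.\<close>

lemma green_proj:
 assumes v: "green v \<gamma> g" and q: "q \<in> poly_space (Suc j)" and b: "b \<in> Basis"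
 shows "l2_inner L (\<lambda>x. g b x - partial b (l2_proj L j v) x) q
  = bi (nt b (\<lambda>F x. \<gamma> F x - l2_proj L j v x)) (\<lambda>F. q)"
proof -
 note p = proj_poly[OF greenD(1)[OF v], of j]
 have "l2_inner L (\<lambda>x. v x - l2_proj L j v x) (partial b q) = 0"
  using poly_partial[OF q, of b] by (intro l2_proj_orth[OF poly_measure_domain greenD(1)[OF v]]) simp
 then show ?thesis
  using greenD(4)[OF green_diff[OF v green_smooth[OF smooth_poly[OF p]]] b smooth_poly[OF q]] by simp
qed

end

context pointed_element
begin

text \<open>By Euler's identity (x - a) . grad p equals j p up to a polynomial of lower degree, to
  which e is orthogonal.\<close>

lemma euler_inner:
 assumes p: "p \<in> poly_space j" and e: "L2 L e" and orth: "\<And>q. q \<in> poly_space (j - 1) ==> l2_inner L q e = 0"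
 shows "(\<Sum>b\<in>Basis. l2_inner L (\<lambda>x. X b x * partial b p x) e) = real j * l2_inner L p e"
proof -
 have s: "L2 L (\<lambda>x. X b x * partial b p x)" if "b \<in> Basis" for b
  by (rule X_weight_domain(1)[OF poly_sq[OF poly_partial[OF p]] that])
 have "0 = l2_inner L (\<lambda>x. (\<Sum>b\<in>Basis. X b x * partial b p x) - real j * p x) e"
  by (rule orth[OF euler_identity[OF p], symmetric])
 also have "... = (\<Sum>b\<in>Basis. l2_inner L (\<lambda>x. X b x * partial b p x) e) - real j * l2_inner L p e"
  by (simp add: l2_inner_diff_left l2_inner_sum_left l2_inner_cmult_left s e L2_sum L2_cmult poly_sq[OF p])
 finally show ?thesis by simp
qed

text \<open>\<open>euler_inner\<close> with e = p evaluates the volume term of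
  \<open>pohozaev\<close> exactly.\<close>

lemma orth_boundary:
 assumes p: "p \<in> poly_space j" and orth: "\<And>q. q \<in> poly_space (j - 1) ==> l2_inner L q p = 0"
 shows "bi (\<lambda>F x. wt F x * p x) (\<lambda>F. p) = (2 * real j + real DIM('a)) * (l2_norm L p)^2"
 by (simp only: pohozaev[OF smooth_poly[OF p]] euler_inner[OF p poly_sq[OF p] orth] l2_norm_sq distrib_right mult.assoc)

text \<open>The boundary weight lies between \<kappa> h and h. For a polynomial orthogonal to lower
  degrees the squared norms on boundary and element are thus comparable with ratio of order k/h,
  instead of the k^2/h of a general discrete trace inequality.\<close>

lemma orth_norm_le:
 assumes p: "p \<in> poly_space j" and orth: "\<And>q. q \<in> poly_space (j - 1) ==> l2_inner L q p = 0"
 shows "(2 * real j + real DIM('a)) * (l2_norm L p)^2 \<le> h * (bn (\<lambda>F. p))^2"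
  and "\<kappa> * h * (bn (\<lambda>F. p))^2 \<le> (2 * real j + real DIM('a)) * (l2_norm L p)^2"
proof -
 note s = bsq_poly[OF p]
 have "bi (\<lambda>F x. wt F x * p x) (\<lambda>F. p) \<le> (h * bn (\<lambda>F. p)) * bn (\<lambda>F. p)"
  by (rule order_trans[OF abs_ge_self order_trans[OF bi_cs[OF wt_weight(1)[OF s] s] mult_right_mono[OF wt_weight(2)[OF s]]]]) simp
 then show "(2 * real j + real DIM('a)) * (l2_norm L p)^2 \<le> h * (bn (\<lambda>F. p))^2"
  by (simp only: orth_boundary[OF assms] power2_eq_square mult.assoc)
 show "\<kappa> * h * (bn (\<lambda>F. p))^2 \<le> (2 * real j + real DIM('a)) * (l2_norm L p)^2"
  using wt_lower[OF s] by (simp only: orth_boundary[OF assms])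
qed

text \<open>The increment of the projection is orthogonal to degree j, so
  \<open>orth_norm_le\<close> bounds it by its boundary values, which are a difference of two
  boundary errors.\<close>

lemma proj_step:
 assumes v: "L2 L v" and \<gamma>: "bsq \<gamma>"
 shows "2 * real (Suc j) * (l2_dist L (l2_proj L (Suc j) v) (l2_proj L j v))^2
  \<le> h * (bn (\<lambda>F x. \<gamma> F x - l2_proj L (Suc j) v x) + bn (\<lambda>F x. \<gamma> F x - l2_proj L j v x))^2"
proof -
 let ?p = "\<lambda>x. l2_proj L (Suc j) v x - l2_proj L j v x"
 note P = proj_poly[OF v, of "Suc j"] proj_poly[OF v, of j]
 have p: "?p \<in> poly_space (Suc j)" by (rule poly_diff[OF P(1) poly_le[OF P(2)]]) simp
 have orth: "l2_inner L q ?p = 0" if "q \<in> poly_space (Suc j - 1)" for q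
  using that poly_le[of q j "Suc j"]
  by (simp add: l2_inner_commute[of L q] l2_inner_diff_left poly_sq[OF P(1)] poly_sq[OF P(2)] poly_sq proj_inner[OF v])
 have "2 * real (Suc j) * (l2_norm L ?p)^2 \<le> (2 * real (Suc j) + real DIM('a)) * (l2_norm L ?p)^2"
  by (intro mult_right_mono) auto
 also have "... \<le> h * (bn (\<lambda>F. ?p))^2" by (rule orth_norm_le(1)[OF p orth])
 also have "... \<le> h * (bn (\<lambda>F x. \<gamma> F x - l2_proj L (Suc j) v x) + bn (\<lambda>F x. \<gamma> F x - l2_proj L j v x))^2"
  using bn_diff[OF bsq_diff[OF \<gamma> bsq_poly[OF P(2)]] bsq_diff[OF \<gamma> bsq_poly[OF P(1)]]] h_pos
  by (intro mult_left_mono power_mono) (simp_all add: add.commute)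
 finally show ?thesis .
qed

end

section \<open>The reconstructed potential of the interpolant\<close>

text \<open>An abstract smooth solution on one element: u with trace \<gamma>, gradient v with
  traces \<open>\<gamma>'\<close>, and Hessian w, where \<open>w l i\<close> is the derivative of
  \<open>v l\<close> in direction i. The gradient of p is the best approximation of the projected
  gradient among gradients of polynomials of degree k + 1.\<close>

locale potential = pointed_element +
 fixes k :: nat and u \<gamma> v \<gamma>' w p
 assumes k: "1 \<le> k" and u: "green u \<gamma> v" and v: "\<And>l. l \<in> Basis ==> green (v l) (\<gamma>' l) (w l)"
  and sym: "\<And>i l. i \<in> Basis ==> l \<in> Basis ==> AE x in L. w l i x = w i l x"
  and p: "p \<in> poly_space (Suc k)"
  and pot: "\<And>q. q \<in> poly_space (Suc k) ==>
   (\<Sum>b\<in>Basis. l2_inner L (partial b p) (partial b q)) = (\<Sum>b\<in>Basis. l2_inner L (l2_proj L k (v b)) (partial b q))"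
begin

text \<open>The field t of the overview, by components; \<open>\<eta>\<close> is the boundary error
  of the gradient.\<close>

definition "\<tau> b x = l2_proj L k (v b) x - partial b p x"
definition "\<eta> b F x = \<gamma>' b F x - l2_proj L k (v b) x"

text \<open>Boundary form of a component of the curl of the projected gradient: n_i \<eta>_l - n_l
  \<eta>_i tested with X_i \<tau>_l.\<close>

abbreviation "jump i l \<equiv> bi (nt i (\<eta> l)) (\<lambda>F x. X i x * \<tau> l x)
 - bi (nt l (\<eta> i)) (\<lambda>F x. X i x * \<tau> l x)"

lemma g_poly: "b \<in> Basis ==> l2_proj L k (v b) \<in> poly_space k"
 by (rule proj_poly[OF greenD(1)[OF v]])

lemma dp_poly: "partial b p \<in> poly_space k"
 using poly_partial[OF p] by simp

lemma tau_poly: "b \<in> Basis ==> \<tau> b \<in> poly_space k"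
 unfolding \<tau>_def[abs_def] by (rule poly_diff[OF g_poly dp_poly])

lemma tau_orth:
 assumes q: "q \<in> poly_space (Suc k)"
 shows "(\<Sum>b\<in>Basis. l2_inner L (partial b q) (\<tau> b)) = 0"
proof -
 have s: "L2 L (partial b q)" for b using poly_sq[OF poly_partial[OF q]] .
 have "(\<Sum>b\<in>Basis. l2_inner L (partial b q) (\<tau> b))
   = (\<Sum>b\<in>Basis. l2_inner L (l2_proj L k (v b)) (partial b q) - l2_inner L (partial b p) (partial b q))"
  unfolding \<tau>_def[abs_def]
  by (intro sum.cong refl) (simp add: l2_inner_commute[of L "partial _ q"] l2_inner_diff_left[OF poly_sq[OF g_poly] poly_sq[OF dp_poly] s])
 then show ?thesis by (simp add: sum_subtractf pot[OF q])
qed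

lemma tau_sq: "b \<in> Basis ==> L2 L (\<tau> b)"
 by (rule poly_sq[OF tau_poly])

lemma eta_bsq: "b \<in> Basis ==> bsq (\<eta> b)"
 unfolding \<eta>_def[abs_def] by (intro bsq_diff bsq_poly[OF g_poly] greenD(2)[OF v])

text \<open>\<tau> is orthogonal to the gradients of p and of Pi_k u. Its energy is therefore its
  inner product with grad u - grad Pi_k u, and \<open>green_proj\<close> turns this into the
  boundary error of u.\<close>

lemma tau_energy:
 "(\<Sum>b\<in>Basis. (l2_norm L (\<tau> b))^2)
  = (\<Sum>b\<in>Basis. bi (nt b (\<lambda>F x. \<gamma> F x - l2_proj L k u x)) (\<lambda>F. \<tau> b))"
proof -
 note A = proj_poly[OF greenD(1)[OF u], of k]
 have "bi (nt b (\<lambda>F x. \<gamma> F x - l2_proj L k u x)) (\<lambda>F. \<tau> b)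
   = (l2_norm L (\<tau> b))^2 + l2_inner L (partial b p) (\<tau> b) - l2_inner L (partial b (l2_proj L k u)) (\<tau> b)" if b: "b \<in> Basis" for b
 proof -
  have "bi (nt b (\<lambda>F x. \<gamma> F x - l2_proj L k u x)) (\<lambda>F. \<tau> b)
    = l2_inner L (v b) (\<tau> b) - l2_inner L (partial b (l2_proj L k u)) (\<tau> b)"
   using green_proj[OF u poly_le[OF tau_poly[OF b]] b, of k]
   by (simp add: l2_inner_diff_left[OF greenD(3)[OF u b] poly_sq[OF poly_partial[OF A]] tau_sq[OF b]])
  also have "l2_inner L (v b) (\<tau> b) = l2_inner L (l2_proj L k (v b)) (\<tau> b)"
   by (rule proj_inner[symmetric, OF greenD(3)[OF u b] tau_poly[OF b]])
  also have "... = (l2_norm L (\<tau> b))^2 + l2_inner L (partial b p) (\<tau> b)"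
   unfolding l2_norm_sq l2_inner_add_left[OF tau_sq[OF b] poly_sq[OF dp_poly] tau_sq[OF b], symmetric] by (simp add: \<tau>_def)
  finally show ?thesis .
 qed
 then show ?thesis
  using tau_orth[OF p] tau_orth[OF poly_le[OF A]] by (simp add: sum.distrib sum_subtractf)
qed

text \<open>The Hessians of u and of p are symmetric. Hence exchanging i and l in the derivative of
  \<tau> costs only the boundary terms of \<open>green_proj\<close>, whose test function X_i
  \<tau>_l has exactly the admissible degree k + 1.\<close>

lemma tau_curl:
 assumes i: "i \<in> Basis" and l: "l \<in> Basis"
 shows "l2_inner L (\<lambda>x. X i x * partial i (\<tau> l) x) (\<tau> l)
  = l2_inner L (\<lambda>x. X i x * partial l (\<tau> i) x) (\<tau> l) - jump i l"
proof -
 let ?q = "\<lambda>x. X i x * \<tau> l x" and ?g = "\<lambda>b. l2_proj L k (v b)"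
 have q: "?q \<in> poly_space (Suc k)" by (rule poly_coord_mult[OF tau_poly[OF l]])
 note sq = poly_sq[OF q]
 note s = greenD(3)[OF v[OF l] i] greenD(3)[OF v[OF i] l] poly_sq[OF poly_partial[OF g_poly[OF l]], of i]
  poly_sq[OF poly_partial[OF g_poly[OF i]], of l]
 have w: "l2_inner L (w l i) ?q = l2_inner L (w i l) ?q"
  using sym[OF i l] s sq by (intro l2_inner_cong_AE) (auto dest: L2_measurable)
 have "l2_inner L (w l i) ?q - l2_inner L (partial i (?g l)) ?q = bi (nt i (\<eta> l)) (\<lambda>F. ?q)"
  using green_proj[OF v[OF l] q i] by (simp add: l2_inner_diff_left[OF s(1,3) sq] \<eta>_def)
 moreover have "l2_inner L (w i l) ?q - l2_inner L (partial l (?g i)) ?q = bi (nt l (\<eta> i)) (\<lambda>F. ?q)"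
  using green_proj[OF v[OF i] q l] by (simp add: l2_inner_diff_left[OF s(2,4) sq] \<eta>_def)
 ultimately have g: "l2_inner L (partial i (?g l)) ?q = l2_inner L (partial l (?g i)) ?q - jump i l"
  using w by simp
 have d: "l2_inner L (partial c (\<tau> b)) ?q = l2_inner L (partial c (?g b)) ?q - l2_inner L (partial c (partial b p)) ?q"
  if b: "b \<in> Basis" for b c
 proof -
  have "partial c (\<tau> b) = (\<lambda>x. partial c (?g b) x - partial c (partial b p) x)"
   unfolding \<tau>_def[abs_def] by (rule ext) (rule partial_diff[OF poly_differentiable[OF g_poly[OF b]] poly_differentiable[OF dp_poly]])
  then show ?thesis
   by (simp add: l2_inner_diff_left[OF poly_sq[OF poly_partial[OF g_poly[OF b]]] poly_sq[OF poly_partial[OF dp_poly]] sq])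
 qed
 show ?thesis
  unfolding l2_inner_shift d[OF i] d[OF l] g partial_partial_commute[OF p, of i l] by simp
qed

text \<open>With Q = (x - a) . \<tau> the sum over i of X_i times the l-th derivative of \<tau>_i is
  the l-th derivative of Q minus \<tau>_l. Q has degree k + 1, so its gradient is orthogonal to
  \<tau>; the terms -\<tau>_l turn the dimension d into d - 2.\<close>

lemma tau_pohozaev:
 "(\<Sum>l\<in>Basis. bi (\<lambda>F x. wt F x * \<tau> l x) (\<lambda>F. \<tau> l))
  = (real DIM('a) - 2) * (\<Sum>l\<in>Basis. (l2_norm L (\<tau> l))^2) - 2 * (\<Sum>l\<in>Basis. \<Sum>i\<in>Basis. jump i l)"
proof -
 define Q where "Q x = (\<Sum>i\<in>Basis. X i x * \<tau> i x)" for x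
 have Q: "Q \<in> poly_space (Suc k)"
  unfolding Q_def[abs_def] by (intro poly_sum poly_coord_mult tau_poly)
 have div: "(\<Sum>i\<in>Basis. l2_inner L (\<lambda>x. X i x * partial l (\<tau> i) x) (\<tau> l))
   = l2_inner L (partial l Q) (\<tau> l) - (l2_norm L (\<tau> l))^2" if l: "l \<in> Basis" for l
 proof -
  have "partial l Q x = (\<Sum>i\<in>Basis. X i x * partial l (\<tau> i) x) + \<tau> l x" for x
  proof -
   have X: "(\<lambda>x. (x - a) \<bullet> i) differentiable (at x)" for i by (rule poly_differentiable[OF poly_shifted_coord])
   have dX: "partial l (\<lambda>x. (x - a) \<bullet> i) x = l \<bullet> i" for i
    by (rule partial_eqI[of _ "\<lambda>v. v \<bullet> i", THEN trans]) (auto intro!: derivative_eq_intros)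
   have "partial l Q x = (\<Sum>i\<in>Basis. partial l (\<lambda>x. X i x * \<tau> i x) x)"
    unfolding Q_def[abs_def] by (intro partial_sum poly_differentiable[OF poly_coord_mult[OF tau_poly]]) auto
   also have "... = (\<Sum>i\<in>Basis. X i x * partial l (\<tau> i) x + (l \<bullet> i) * \<tau> i x)"
    by (intro sum.cong refl) (simp only: partial_mult[OF X poly_differentiable[OF tau_poly]] dX)
   also have "... = (\<Sum>i\<in>Basis. X i x * partial l (\<tau> i) x) + \<tau> l x"
    using l by (simp add: sum.distrib inner_Basis if_distrib[of "\<lambda>c. c * _"] cong: if_cong)
   finally show ?thesis .
  qed
  then have "partial l Q = (\<lambda>x. (\<Sum>i\<in>Basis. X i x * partial l (\<tau> i) x) + \<tau> l x)" by (rule ext)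
  moreover have s: "L2 L (\<lambda>x. X i x * partial l (\<tau> i) x)" if "i \<in> Basis" for i
   by (rule X_weight_domain(1)[OF poly_sq[OF poly_partial[OF tau_poly[OF that]]] that])
  ultimately show ?thesis
   by (simp add: l2_inner_add_left[OF L2_sum[OF s] tau_sq[OF l] tau_sq[OF l]] l2_inner_sum_left[OF _ s tau_sq[OF l]] l2_norm_sq)
 qed
 have *: "(\<Sum>b\<in>Basis. l2_inner L (\<lambda>x. X b x * partial b (\<tau> l) x) (\<tau> l))
   = l2_inner L (partial l Q) (\<tau> l) - (l2_norm L (\<tau> l))^2 - (\<Sum>i\<in>Basis. jump i l)" if l: "l \<in> Basis" for l
  unfolding div[OF l, symmetric] sum_subtractf[symmetric] by (intro sum.cong refl tau_curl l)
 have "(\<Sum>l\<in>Basis. bi (\<lambda>F x. wt F x * \<tau> l x) (\<lambda>F. \<tau> l))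
   = (\<Sum>l\<in>Basis. 2 * (l2_inner L (partial l Q) (\<tau> l) - (l2_norm L (\<tau> l))^2 - (\<Sum>i\<in>Basis. jump i l)) + real DIM('a) * (l2_norm L (\<tau> l))^2)"
  by (intro sum.cong refl)
    (simp only: pohozaev[OF smooth_poly[OF tau_poly]] * l2_norm_sq)
 also have "... = 2 * (\<Sum>l\<in>Basis. l2_inner L (partial l Q) (\<tau> l)) - 2 * (\<Sum>l\<in>Basis. (l2_norm L (\<tau> l))^2)
   - 2 * (\<Sum>l\<in>Basis. \<Sum>i\<in>Basis. jump i l) + real DIM('a) * (\<Sum>l\<in>Basis. (l2_norm L (\<tau> l))^2)"
  by (simp add: sum.distrib sum_subtractf sum_distrib_left right_diff_distrib)
 finally show ?thesis unfolding tau_orth[OF Q] by (simp add: algebra_simps)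
qed

definition "e x = p x - l2_proj L k p x"

lemma e_poly: "e \<in> poly_space (Suc k)"
 unfolding e_def[abs_def] by (intro poly_diff p poly_le[OF proj_poly[OF poly_sq[OF p]]]) simp

lemma e_orth: "q \<in> poly_space k ==> l2_inner L q e = 0"
 unfolding l2_inner_commute[of L q] e_def[abs_def] by (rule l2_proj_orth[OF poly_measure_domain poly_sq[OF p]])

text \<open>Euler's identity writes (k + 1) |e|^2 as the sum of the inner products of the
  derivatives of p with X_b e. The derivative of p is Pi_k v_b - \<tau>_b. Testing with X_b e, of
  degree k + 2, replaces v_b by its projection of degree k + 2, and \<open>green_proj\<close>
  compares v_b with the derivative of Pi_(k+1) u. Euler's identity then treats that derivative in
  turn.\<close>

lemma e_identity:
 "real (Suc k) * (l2_norm L e)^2 = bi (\<lambda>F x. wt F x * (\<gamma> F x - l2_proj L (Suc k) u x)) (\<lambda>F. e)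
  + real (Suc k) * l2_inner L (\<lambda>x. l2_proj L (Suc k) u x - l2_proj L k u x) e
  - (\<Sum>b\<in>Basis. l2_inner L (\<lambda>x. l2_proj L (Suc (Suc k)) (v b) x - l2_proj L k (v b) x) (\<lambda>x. X b x * e x))
  - (\<Sum>b\<in>Basis. l2_inner L (\<tau> b) (\<lambda>x. X b x * e x))"
proof -
 let ?A = "l2_proj L (Suc k) u" and ?q = "\<lambda>b x. X b x * e x"
 note A = proj_poly[OF greenD(1)[OF u], of "Suc k"] proj_poly[OF greenD(1)[OF u], of k]
 note se = poly_sq[OF e_poly]
 have orth: "\<And>q. q \<in> poly_space (Suc k - 1) ==> l2_inner L q e = 0" using e_orth by simp
 have q: "?q b \<in> poly_space (Suc (Suc k))" for b by (rule poly_coord_mult[OF e_poly])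
 have z: "bsq (\<lambda>F x. \<gamma> F x - ?A x)" by (intro bsq_diff greenD(2)[OF u] bsq_poly[OF A(1)])
 have step: "l2_inner L (\<lambda>x. X b x * partial b p x) e
   = bi (nt b (\<lambda>F x. \<gamma> F x - ?A x)) (\<lambda>F. ?q b) + l2_inner L (\<lambda>x. X b x * partial b ?A x) e
   - l2_inner L (\<lambda>x. l2_proj L (Suc (Suc k)) (v b) x - l2_proj L k (v b) x) (?q b) - l2_inner L (\<tau> b) (?q b)" if b: "b \<in> Basis" for b
 proof -
  note s = poly_sq[OF q] poly_sq[OF g_poly[OF b]] poly_sq[OF dp_poly] greenD(3)[OF u b] poly_sq[OF poly_partial[OF A(1)]]
   poly_sq[OF proj_poly[OF greenD(3)[OF u b]]]
  have "l2_inner L (\<tau> b) (?q b) = l2_inner L (l2_proj L k (v b)) (?q b) - l2_inner L (partial b p) (?q b)"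
   unfolding \<tau>_def[abs_def] by (rule l2_inner_diff_left[OF s(2,3,1)])
  moreover have "l2_inner L (v b) (?q b) - l2_inner L (partial b ?A) (?q b) = bi (nt b (\<lambda>F x. \<gamma> F x - ?A x)) (\<lambda>F. ?q b)"
   using green_proj[OF u q b] by (simp only: l2_inner_diff_left[OF s(4,5,1)])
  ultimately show ?thesis
   by (simp only: l2_inner_shift l2_inner_diff_left[OF s(6,2,1)] proj_inner[OF s(4) q])
 qed
 note face = wt_sum[OF z bsq_poly[OF e_poly]]
 have "real (Suc k) * (l2_norm L e)^2 = real (Suc k) * l2_inner L p e"
 proof -
  have "l2_inner L e e = l2_inner L p e - l2_inner L (l2_proj L k p) e"
   by (subst (1) e_def[abs_def], rule l2_inner_diff_left[OF poly_sq[OF p] poly_sq[OF proj_poly[OF poly_sq[OF p]]] se])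
  then show ?thesis by (simp add: l2_norm_sq e_orth[OF proj_poly[OF poly_sq[OF p]]])
 qed
 also have "... = (\<Sum>b\<in>Basis. l2_inner L (\<lambda>x. X b x * partial b p x) e)"
  by (rule euler_inner[OF p se orth, symmetric])
 also have "... = bi (\<lambda>F x. wt F x * (\<gamma> F x - ?A x)) (\<lambda>F. e) + (\<Sum>b\<in>Basis. l2_inner L (\<lambda>x. X b x * partial b ?A x) e)
   - (\<Sum>b\<in>Basis. l2_inner L (\<lambda>x. l2_proj L (Suc (Suc k)) (v b) x - l2_proj L k (v b) x) (?q b)) - (\<Sum>b\<in>Basis. l2_inner L (\<tau> b) (?q b))"
  unfolding face[symmetric] sum.distrib[symmetric] sum_subtractf[symmetric] by (rule sum.cong[OF refl step])
 also have "(\<Sum>b\<in>Basis. l2_inner L (\<lambda>x. X b x * partial b ?A x) e) = real (Suc k) * l2_inner L ?A e"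
  by (rule euler_inner[OF A(1) se orth])
 also have "l2_inner L ?A e = l2_inner L (\<lambda>x. ?A x - l2_proj L k u x) e"
  by (simp add: l2_inner_diff_left[OF poly_sq[OF A(1)] poly_sq[OF A(2)] se] e_orth[OF A(2)])
 finally show ?thesis .
qed

end

text \<open>The scale s is sqrt (h / k). The errors of u are needed in degrees k and k + 1, those of
  the gradient up to degree k + 2, because \<open>e_identity\<close> involves these
  projections.\<close>

locale bounded_potential = potential +
 fixes s B :: real
 assumes s: "0 < s" "s^2 * real k = h" and B: "0 \<le> B"
  and Z: "\<And>j. j \<in> {k, Suc k} ==> bn (\<lambda>F x. \<gamma> F x - l2_proj L j u x) \<le> s * B"
  and E: "\<And>j l. j \<in> {k, Suc k, Suc (Suc k)} ==> l \<in> Basis ==> bn (\<lambda>F x. \<gamma>' l F x - l2_proj L j (v l) x) \<le> B / s"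
begin

lemma eta_le: "l \<in> Basis ==> bn (\<eta> l) \<le> B / s"
 using E[of k l] by (simp add: \<eta>_def[abs_def])

text \<open>Let S be the squared norm of \<tau> on T and t its norm on the boundary.
  \<open>tau_energy\<close> gives S <= d s B t, and \<open>tau_pohozaev\<close> gives \<kappa> h t^2
  <= d S + 4 d^2 (B / s) h t. Inserting the first into the second and cancelling s k t leaves
  \<kappa> s t <= 5 d^2 B, which returns a bound for S.\<close>

lemma tau_bound: "\<kappa> * (\<Sum>b\<in>Basis. (l2_norm L (\<tau> b))^2) \<le> 5 * real DIM('a) ^ 3 * B^2"
proof -
 define d where "d = real DIM('a)"
 define S where "S = (\<Sum>b\<in>Basis. (l2_norm L (\<tau> b))^2)"
 define t where "t = sqrt (\<Sum>b\<in>Basis. (bn (\<lambda>F. \<tau> b))^2)"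
 have d1: "1 \<le> d" using DIM_positive[where 'a='a] unfolding d_def by linarith
 have t0: "0 \<le> t" by (simp add: t_def sum_nonneg)
 have t2: "t^2 = (\<Sum>b\<in>Basis. (bn (\<lambda>F. \<tau> b))^2)" by (simp add: t_def sum_nonneg)
 have bt: "bn (\<lambda>F. \<tau> b) \<le> t" if "b \<in> Basis" for b
  unfolding t_def by (rule real_le_rsqrt) (rule member_le_sum[OF that], auto)
 note bs = bsq_poly[OF tau_poly]
 have sB: "0 \<le> s * B" "0 \<le> B / s" using s B by auto
 have z: "bsq (\<lambda>F x. \<gamma> F x - l2_proj L k u x)"
  by (intro bsq_diff greenD(2)[OF u] bsq_poly[OF proj_poly[OF greenD(1)[OF u]]])
 have "S \<le> (\<Sum>b\<in>(Basis::'a set). (s * B) * t)"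
  unfolding S_def tau_energy
 proof (rule sum_mono)
  fix b :: 'a assume b: "b \<in> Basis"
  show "bi (nt b (\<lambda>F x. \<gamma> F x - l2_proj L k u x)) (\<lambda>F. \<tau> b) \<le> (s * B) * t"
   by (rule order_trans[OF abs_ge_self order_trans[OF bi_cs[OF normal_weight(1)[OF z b] bs[OF b]] mult_mono[OF order_trans[OF normal_weight(2)[OF z b] Z] bt[OF b] sB(1)]]]) simp_all
 qed
 then have S: "S \<le> d * ((s * B) * t)" by (simp add: d_def)
 have jump: "\<bar>jump i l\<bar> \<le> 2 * (B / s * (h * t))" if i: "i \<in> Basis" and l: "l \<in> Basis" for i l
 proof -
  note X = X_weight[OF bs[OF l] i]
  have "\<bar>bi (nt b (\<eta> c)) (\<lambda>F x. X i x * \<tau> l x)\<bar> \<le> B / s * (h * t)"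
   if b: "b \<in> Basis" and c: "c \<in> Basis" for b c
  proof (rule order_trans[OF bi_cs[OF normal_weight(1)[OF eta_bsq[OF c] b] X(1)]], rule mult_mono)
   show "bn (nt b (\<eta> c)) \<le> B / s"
    by (rule order_trans[OF normal_weight(2)[OF eta_bsq[OF c] b] eta_le[OF c]])
   show "bn (\<lambda>F x. X i x * \<tau> l x) \<le> h * t"
    by (rule order_trans[OF X(2) mult_left_mono[OF bt[OF l] less_imp_le[OF h_pos]]])
  qed (use sB in auto)
  from this[OF i l] this[OF l i] show ?thesis by linarith
 qed
 have "\<bar>\<Sum>l\<in>Basis. \<Sum>i\<in>Basis. jump i l\<bar> \<le> (\<Sum>l\<in>(Basis::'a set). \<Sum>i\<in>(Basis::'a set). 2 * (B / s * (h * t)))"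
  by (intro order_trans[OF sum_abs] sum_mono order_trans[OF sum_abs] jump)
 also have "... = 2 * d^2 * (B / s * (h * t))" by (simp add: d_def power2_eq_square)
 finally have J: "\<bar>\<Sum>l\<in>Basis. \<Sum>i\<in>Basis. jump i l\<bar> \<le> 2 * d^2 * (B / s * (h * t))" .
 have "\<kappa> * h * t^2 \<le> (\<Sum>l\<in>Basis. bi (\<lambda>F x. wt F x * \<tau> l x) (\<lambda>F. \<tau> l))"
  unfolding t2 sum_distrib_left by (intro sum_mono wt_lower bs)
 also have "... \<le> d * S + 2 * (2 * d^2 * (B / s * (h * t)))"
 proof -
  have "0 \<le> S" by (simp add: S_def sum_nonneg)
  moreover have "(d - 2) * S = d * S - 2 * S" by (simp add: algebra_simps)
  ultimately show ?thesis unfolding tau_pohozaev S_def[symmetric] d_def[symmetric] using J by linarith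
 qed
 also have "... \<le> d * (d * ((s * B) * t)) + 2 * (2 * d^2 * (B / s * (h * t)))"
  using d1 by (intro add_right_mono mult_left_mono[OF S]) simp
 also have "... = (d^2 * s * B + 4 * d^2 * B * s * real k) * t"
  using s by (simp add: s(2)[symmetric] power2_eq_square field_simps)
 also have "... \<le> (5 * d^2 * B * s * real k) * t"
 proof (rule mult_right_mono[OF _ t0])
  \<comment> \<open>The two terms differ by a factor k; since k >= 1 the smaller one is absorbed,
    whence the 5.\<close>
  have "d^2 * s * B * 1 \<le> d^2 * s * B * real k" using k s B by (intro mult_left_mono) auto
  then show "d^2 * s * B + 4 * d^2 * B * s * real k \<le> 5 * d^2 * B * s * real k" by (simp add: algebra_simps)
 qed
 finally have "(s * real k * t) * (\<kappa> * s * t) \<le> (s * real k * t) * (5 * d^2 * B)"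
  unfolding s(2)[symmetric] by (simp add: power2_eq_square mult_ac)
 then have kt: "\<kappa> * s * t \<le> 5 * d^2 * B"
 proof (cases "t = 0")
  case False
  then have "0 < s * real k * t" using s(1) k t0 by simp
  then show ?thesis using \<open>(s * real k * t) * (\<kappa> * s * t) \<le> _\<close> by (simp only: mult_le_cancel_left_pos)
 qed (use B in simp)
 have "\<kappa> * S \<le> \<kappa> * (d * ((s * B) * t))" using S \<kappa> by (intro mult_left_mono) auto
 also have "... = d * B * (\<kappa> * s * t)" by (simp add: mult_ac)
 also have "... \<le> d * B * (5 * d^2 * B)" using kt d1 B by (intro mult_left_mono) auto
 also have "... = 5 * d ^ 3 * B^2" by (simp add: power2_eq_square power3_eq_cube)
 finally show ?thesis by (simp add: S_def d_def)
qed

lemma proj_step_le: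
 assumes "k \<le> j" "L2 L f" "bsq \<phi>" and Y: "0 \<le> Y"
  and "bn (\<lambda>F x. \<phi> F x - l2_proj L j f x) \<le> Y" "bn (\<lambda>F x. \<phi> F x - l2_proj L (Suc j) f x) \<le> Y"
 shows "l2_dist L (l2_proj L (Suc j) f) (l2_proj L j f) \<le> 2 * s * Y"
proof -
 let ?x = "l2_dist L (l2_proj L (Suc j) f) (l2_proj L j f)"
 have "real k * ?x^2 \<le> 2 * real (Suc j) * ?x^2" using assms(1) by (intro mult_right_mono) auto
 also have "... \<le> h * (bn (\<lambda>F x. \<phi> F x - l2_proj L (Suc j) f x) + bn (\<lambda>F x. \<phi> F x - l2_proj L j f x))^2"
  by (rule proj_step[OF assms(2,3)])
 also have "... \<le> h * (Y + Y)^2"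
  using h_pos by (intro mult_left_mono power_mono add_mono assms add_nonneg_nonneg) auto
 also have "... = real k * (2 * s * Y)^2" unfolding s(2)[symmetric] by (simp add: power2_eq_square algebra_simps)
 finally have "?x^2 \<le> (2 * s * Y)^2" using k by simp
 then show ?thesis by (rule power2_le_imp_le) (use s Y in auto)
qed

text \<open>\<open>K1\<close> comes from \<open>orth_norm_le\<close> in degree k + 1, using 2 (k +
  1) + d <= (4 + d) k; \<open>K2\<close> is the constant of \<open>tau_bound\<close> after division
  by \<kappa>.\<close>

definition "K1 = sqrt ((4 + real DIM('a)) / \<kappa>)"
definition "K2 = sqrt (5 * real DIM('a) ^ 3 / \<kappa>)"

lemma tau_le: "b \<in> Basis ==> l2_norm L (\<tau> b) \<le> K2 * B"
proof -
 assume b: "b \<in> Basis"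
 have "(l2_norm L (\<tau> b))^2 \<le> (\<Sum>b\<in>Basis. (l2_norm L (\<tau> b))^2)" by (rule member_le_sum[OF b]) auto
 also have "... \<le> 5 * real DIM('a) ^ 3 / \<kappa> * B^2" using tau_bound \<kappa> by (simp add: field_simps)
 also have "... = (K2 * B)^2" using \<kappa> by (simp add: K2_def power_mult_distrib)
 finally show ?thesis by (rule power2_le_imp_le) (use B \<kappa> in \<open>simp add: K2_def\<close>)
qed

text \<open>The boundary norm of e is at most K1 N / s with N its norm on T. In
  \<open>e_identity\<close> every term then has a factor N, and its remaining factor is of order k
  s^2 B up to constants, so N is at most s^2 B \<Lambda>; dividing by s gives the scale s B.\<close>

lemma potential_bound:
 "bn (\<lambda>F. e) \<le> K1 * (K1 + 2 + real DIM('a) * (4 + K2)) * (s * B)"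
proof -
 define d where "d = real DIM('a)"
 define N where "N = l2_norm L e"
 define \<Lambda> where "\<Lambda> = K1 + 2 + d * (4 + K2)"
 have N0: "0 \<le> N" by (simp add: N_def)
 have K: "0 \<le> K1" "0 \<le> K2" using \<kappa> by (auto simp: K1_def K2_def)
 have k0: "0 < real k" using k by simp
 note be = bsq_poly[OF e_poly] and se = poly_sq[OF e_poly]
 have "\<kappa> * h * (bn (\<lambda>F. e))^2 \<le> (2 * real (Suc k) + d) * N^2"
  unfolding N_def d_def by (rule orth_norm_le(2)[OF e_poly]) (use e_orth in simp)
 also have "... \<le> ((4 + d) * real k) * N^2"
 proof (rule mult_right_mono)
  have "d * 1 \<le> d * real k" using k by (intro mult_left_mono) (auto simp: d_def)
  then show "2 * real (Suc k) + d \<le> (4 + d) * real k" using k by (simp add: algebra_simps)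
 qed simp
 finally have "real k * (\<kappa> * (s * bn (\<lambda>F. e))^2) \<le> real k * ((4 + d) * N^2)"
  unfolding s(2)[symmetric] by (simp add: power_mult_distrib mult_ac)
 then have "\<kappa> * (s * bn (\<lambda>F. e))^2 \<le> (4 + d) * N^2" using k0 by (simp only: mult_le_cancel_left_pos)
 then have "(s * bn (\<lambda>F. e))^2 \<le> (4 + d) / \<kappa> * N^2" using \<kappa> by (simp add: pos_le_divide_eq mult.commute)
 also have "... = (K1 * N)^2" using \<kappa> by (simp add: K1_def d_def power_mult_distrib)
 finally have "s * bn (\<lambda>F. e) \<le> K1 * N" by (rule power2_le_imp_le) (use K N0 in simp)
 then have bnN: "bn (\<lambda>F. e) \<le> K1 * N / s" using s(1) by (simp add: field_simps)
 have "real k * N * N \<le> real k * N * (s^2 * B * \<Lambda>)"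
 proof -
  let ?A = "\<lambda>j. l2_proj L j u" and ?G = "\<lambda>j b. l2_proj L j (v b)"
  note A = poly_sq[OF proj_poly[OF greenD(1)[OF u]]]
  have z: "bsq (\<lambda>F x. \<gamma> F x - ?A (Suc k) x)"
   by (intro bsq_diff greenD(2)[OF u] bsq_poly[OF proj_poly[OF greenD(1)[OF u]]])
  have "bi (\<lambda>F x. wt F x * (\<gamma> F x - ?A (Suc k) x)) (\<lambda>F. e) \<le> (h * (s * B)) * (K1 * N / s)"
  proof (rule order_trans[OF abs_ge_self], rule order_trans[OF bi_cs[OF wt_weight(1)[OF z] be]], rule mult_mono[OF _ bnN])
   show "bn (\<lambda>F x. wt F x * (\<gamma> F x - ?A (Suc k) x)) \<le> h * (s * B)"
    by (rule order_trans[OF wt_weight(2)[OF z] mult_left_mono[OF Z less_imp_le[OF h_pos]]]) simp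
  qed (use h_pos s B in auto)
  also have "... = real k * N * (s^2 * B * K1)" unfolding s(2)[symmetric] using s(1) by (simp add: power2_eq_square field_simps)
  finally have t1: "bi (\<lambda>F x. wt F x * (\<gamma> F x - ?A (Suc k) x)) (\<lambda>F. e) \<le> real k * N * (s^2 * B * K1)" .
  have "l2_inner L (\<lambda>x. ?A (Suc k) x - ?A k x) e \<le> (2 * s * (s * B)) * N"
   unfolding N_def
   by (rule order_trans[OF abs_ge_self order_trans[OF l2_cauchy_schwarz[OF L2_diff[OF A A] se] mult_right_mono[OF proj_step_le[OF order_refl greenD(1,2)[OF u]]]]])
     (use s B Z in auto)
  then have t2: "real (Suc k) * l2_inner L (\<lambda>x. ?A (Suc k) x - ?A k x) e \<le> real (Suc k) * ((2 * s * (s * B)) * N)"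
   by (rule mult_left_mono) simp
  have t3: "- l2_inner L (\<lambda>x. ?G (Suc (Suc k)) b x - ?G k b x) (\<lambda>x. X b x * e x)
    - l2_inner L (\<tau> b) (\<lambda>x. X b x * e x) \<le> (4 + K2) * B * (h * N)" if b: "b \<in> Basis" for b
  proof -
   note X = X_weight_domain[OF se b] and G = poly_sq[OF proj_poly[OF greenD(3)[OF u b]]]
   have hN: "0 \<le> h * N" using h_pos N0 by simp
   have st: "l2_dist L (?G (Suc j) b) (?G j b) \<le> 2 * B" if "j \<in> {k, Suc k}" for j
    using proj_step_le[of j "v b" "\<gamma>' b" "B / s", OF _ greenD(1,2)[OF v[OF b]]] E[OF _ b] that s B by auto
   have "l2_dist L (?G (Suc (Suc k)) b) (?G k b) \<le> 4 * B"
    using l2_triangle_through[OF G[of "Suc (Suc k)"] G[of "Suc k"] G[of k]] st[of k] st[of "Suc k"] by simp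
   from order_trans[OF l2_cauchy_schwarz[OF L2_diff[OF G G] X(1)] mult_mono[OF this X(2)[folded N_def]]]
   have 1: "\<bar>l2_inner L (\<lambda>x. ?G (Suc (Suc k)) b x - ?G k b x) (\<lambda>x. X b x * e x)\<bar> \<le> 4 * B * (h * N)" using B by simp
   have 2: "\<bar>l2_inner L (\<tau> b) (\<lambda>x. X b x * e x)\<bar> \<le> K2 * B * (h * N)"
    by (rule order_trans[OF l2_cauchy_schwarz[OF tau_sq[OF b] X(1)] mult_mono[OF tau_le[OF b] X(2)[folded N_def]]]) (use B K in auto)
   have "(4 + K2) * B * (h * N) = 4 * B * (h * N) + K2 * B * (h * N)" by (simp add: algebra_simps)
   then show ?thesis using 1 2 by linarith
  qed
  have "(\<Sum>b\<in>Basis. - l2_inner L (\<lambda>x. ?G (Suc (Suc k)) b x - ?G k b x) (\<lambda>x. X b x * e x)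
    - l2_inner L (\<tau> b) (\<lambda>x. X b x * e x)) \<le> d * ((4 + K2) * B * (h * N))"
   using sum_mono[OF t3] by (simp add: d_def)
  then have t4: "- (\<Sum>b\<in>Basis. l2_inner L (\<lambda>x. ?G (Suc (Suc k)) b x - ?G k b x) (\<lambda>x. X b x * e x))
    - (\<Sum>b\<in>Basis. l2_inner L (\<tau> b) (\<lambda>x. X b x * e x)) \<le> real k * N * (s^2 * B * (d * (4 + K2)))"
   unfolding s(2)[symmetric] by (simp add: sum_subtractf sum_negf mult_ac)
  have "real (Suc k) * N^2 \<le> real k * N * (s^2 * B * K1) + real (Suc k) * ((2 * s * (s * B)) * N)
    + real k * N * (s^2 * B * (d * (4 + K2)))"
   using e_identity t1 t2 t4 unfolding N_def[symmetric] by linarith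
  then have *: "real (Suc k) * (N^2 - 2 * s^2 * B * N) \<le> real k * N * (s^2 * B * (K1 + d * (4 + K2)))"
   by (simp add: algebra_simps power2_eq_square)
  have nn: "0 \<le> real k * N * (s^2 * B * (K1 + d * (4 + K2)))" using K B N0 by (auto simp: d_def)
  \<comment> \<open>The term with factor k + 1 was moved to the left so that k + 1 may be lowered to
    k. This is monotone if the bracket is nonnegative, and otherwise the left side is negative
    already.\<close>
  have "real k * (N^2 - 2 * s^2 * B * N) \<le> real k * N * (s^2 * B * (K1 + d * (4 + K2)))"
  proof (cases "0 \<le> N^2 - 2 * s^2 * B * N")
   case True
   have "real k * (N^2 - 2 * s^2 * B * N) \<le> real (Suc k) * (N^2 - 2 * s^2 * B * N)" using True by (intro mult_right_mono) auto
   then show ?thesis using * by linarith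
  next
   case False
   then have "real k * (N^2 - 2 * s^2 * B * N) \<le> 0" by (intro mult_nonneg_nonpos) auto
   then show ?thesis using nn by linarith
  qed
  then show ?thesis by (simp add: \<Lambda>_def algebra_simps power2_eq_square)
 qed
 then have "N \<le> s^2 * B * \<Lambda>"
 proof (cases "N = 0")
  case False
  then have "0 < real k * N" using k0 N0 by simp
  then show ?thesis using \<open>real k * N * N \<le> _\<close> by (simp only: mult_le_cancel_left_pos)
 qed (use K B in \<open>simp add: \<Lambda>_def d_def\<close>)
 then have "K1 * N / s \<le> K1 * (s^2 * B * \<Lambda>) / s" using K s(1) by (intro divide_right_mono mult_left_mono) auto
 also have "... = K1 * \<Lambda> * (s * B)" using s(1) by (simp add: power2_eq_square)
 finally show ?thesis using bnN unfolding \<Lambda>_def d_def by linarith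
qed

end

section \<open>The reconstruction operators\<close>

lemma l2_inner_vec:
 fixes G :: "'b => 'a::euclidean_space"
 assumes "\<And>b. b \<in> Basis ==> L2 M (\<lambda>x. G x \<bullet> b)" "\<And>b. b \<in> Basis ==> L2 M (\<lambda>x. H x \<bullet> b)"
 shows "l2_inner M G H = (\<Sum>b\<in>Basis. l2_inner M (\<lambda>x. G x \<bullet> b) (\<lambda>x. H x \<bullet> b))"
proof -
 have "(\<lambda>x. G x \<bullet> H x) = (\<lambda>x. \<Sum>b\<in>Basis. (G x \<bullet> b) * (H x \<bullet> b))" by (rule ext) (rule euclidean_inner)
 then show ?thesis unfolding l2_inner_def by (simp add: integral_sum assms L2_mult)
qed

lemma vec_poly_inner: "G \<in> vec_poly_space k ==> b \<in> Basis ==> (\<lambda>x. G x \<bullet> b) \<in> poly_space k"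
 by (simp add: vec_poly_space_def)

locale hho_element = element +
 fixes k :: nat
 assumes k: "1 \<le> k"
begin

text \<open>The zero set has full measure in a ball of T, so by continuity the difference vanishes
  on the ball and then everywhere. The definite descriptions of the reconstructions need this
  equality of functions.\<close>

lemma poly_eqI:
 assumes p: "p \<in> poly_space j" and q: "q \<in> poly_space j" and eq: "l2_dist L p q = 0"
 shows "p = q"
proof
 fix y
 let ?d = "\<lambda>x. p x - q x"
 have d: "?d \<in> poly_space j" by (rule poly_diff[OF p q])
 obtain c r where r: "0 < r" "ball c r \<subseteq> T" by (rule elem_ball)
 have "AE x in L. ?d x = 0" by (rule l2_norm_zero_AE[OF poly_sq[OF d] eq])
 then have "AE x in lebesgue_on (ball c r). ?d x = 0" by (rule AE_subdomain[OF r(2) Dl, rotated]) simp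
 then have ae: "AE x in lebesgue. x \<in> ball c r \<longrightarrow> ?d x = 0" by (subst (asm) AE_restrict_space_iff) auto
 define N where "N = {x. \<not> (x \<in> ball c r \<longrightarrow> ?d x = 0)}"
 have "N = ball c r \<inter> {x. ?d x \<noteq> 0}" by (auto simp: N_def)
 then have N: "open N"
  by (simp only:) (intro open_Int open_ball open_Collect_neq smooth_continuous[OF smooth_poly[OF d]] continuous_on_const)
 have "negligible N"
  unfolding negligible_iff_null_sets
  using AE_iff_null[of lebesgue "\<lambda>x. x \<in> ball c r \<longrightarrow> ?d x = 0"] ae N unfolding N_def by simp
 then have "N = {}" using open_not_negligible[OF N] by (cases "N = {}") simp_all
 then have "?d x = 0" if "x \<in> ball c r" for x using that by (auto simp: N_def)
 from poly_zero_on_ball[OF d this r(1)] have "?d y = 0" .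
 then show "p y = q y" by simp
qed

text \<open>The right-hand side of the gradient reconstruction tested in direction b only, which
  splits the vector problem into scalar ones for \<open>poly_riesz\<close>.\<close>

definition R :: "('a => real) => ('a set => 'a => real) => 'a => ('a => real) => real" where
 "R v \<nu> b q = l2_inner L (partial b v) q + bi (nt b (\<lambda>F x. \<nu> F x - v x)) (\<lambda>F. q)"

lemma jump_bsq: "v \<in> poly_space j ==> bsq \<nu> ==> b \<in> Basis ==> bsq (nt b (\<lambda>F x. \<nu> F x - v x))"
 by (intro normal_weight bsq_diff bsq_poly)

lemma grad_rec_rhs:
 assumes v: "v \<in> poly_space j" and \<nu>: "bsq \<nu>" and t: "t \<in> vec_poly_space k"
 shows "l2_inner L (grad v) t + (\<Sum>F\<in>faces. l2_inner (face_measure F) (\<lambda>x. \<nu> F x - v x) (\<lambda>x. t x \<bullet> nrm F))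
  = (\<Sum>b\<in>Basis. R v \<nu> b (\<lambda>x. t x \<bullet> b))"
proof -
 note tp = vec_poly_inner[OF t]
 have "l2_inner L (grad v) t = (\<Sum>b\<in>Basis. l2_inner L (\<lambda>x. grad v x \<bullet> b) (\<lambda>x. t x \<bullet> b))"
  using poly_sq[OF poly_partial[OF v]] poly_sq[OF tp]
  by (intro l2_inner_vec) (auto simp: grad_inner_poly poly_differentiable[OF v])
 also have "... = (\<Sum>b\<in>Basis. l2_inner L (partial b v) (\<lambda>x. t x \<bullet> b))"
  by (intro sum.cong refl) (simp add: grad_inner_poly poly_differentiable[OF v])
 finally have 1: "l2_inner L (grad v) t = ..." .
 have "l2_inner (face_measure F) (\<lambda>x. \<nu> F x - v x) (\<lambda>x. t x \<bullet> nrm F)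
   = (\<Sum>b\<in>Basis. l2_inner (face_measure F) (\<lambda>x. (nrm F \<bullet> b) * (\<nu> F x - v x)) (\<lambda>x. t x \<bullet> b))" if F: "F \<in> faces" for F
 proof -
  have "l2_inner (face_measure F) (\<lambda>x. \<nu> F x - v x) (\<lambda>x. t x \<bullet> nrm F)
    = l2_inner (face_measure F) (\<lambda>x. \<nu> F x - v x) (\<lambda>x. \<Sum>b\<in>Basis. (nrm F \<bullet> b) * (t x \<bullet> b))"
   by (simp only: normal_sum_inner)
  also have "... = (\<Sum>b\<in>Basis. l2_inner (face_measure F) (\<lambda>x. \<nu> F x - v x) (\<lambda>x. (nrm F \<bullet> b) * (t x \<bullet> b)))"
   by (intro l2_inner_sum_right finite_Basis bsqD[OF bsq_diff[OF \<nu> bsq_poly[OF v]] F] L2_cmult bsqD[OF bsq_poly[OF tp] F])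
  finally show ?thesis by (simp only: l2_inner_shift)
 qed
 then show ?thesis
  unfolding 1 R_def bi_def sum.distrib by (simp add: sum.swap[of _ Basis])
qed

lemma grad_rec_unique:
 assumes v: "v \<in> poly_space j" and \<nu>: "bsq \<nu>" and G: "G \<in> vec_poly_space k"
  and eq: "\<And>b q. b \<in> Basis ==> q \<in> poly_space k ==> l2_inner L (\<lambda>x. G x \<bullet> b) q = R v \<nu> b q"
 shows "grad_rec k Fh T v \<nu> = G"
 unfolding grad_rec_def
proof (rule the_equality)
 have inner: "l2_inner L G t = (\<Sum>b\<in>Basis. R v \<nu> b (\<lambda>x. t x \<bullet> b))" if t: "t \<in> vec_poly_space k" for t
 proof (rule trans[OF l2_inner_vec sum.cong[OF refl eq]])
 qed (simp_all add: poly_sq[OF vec_poly_inner[OF G]] poly_sq[OF vec_poly_inner[OF t]] vec_poly_inner[OF t])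
 then show "G \<in> vec_poly_space k \<and> (\<forall>t\<in>vec_poly_space k. l2_inner L G t = l2_inner L (grad v) t +
   (\<Sum>F\<in>faces. l2_inner (face_measure F) (\<lambda>x. \<nu> F x - v x) (\<lambda>x. t x \<bullet> nrm F)))"
  using G by (simp add: grad_rec_rhs[OF v \<nu>])
 fix H assume H: "H \<in> vec_poly_space k \<and> (\<forall>t\<in>vec_poly_space k. l2_inner L H t = l2_inner L (grad v) t +
   (\<Sum>F\<in>faces. l2_inner (face_measure F) (\<lambda>x. \<nu> F x - v x) (\<lambda>x. t x \<bullet> nrm F)))"
 define D where "D x = H x - G x" for x
 have Dp: "(\<lambda>x. D x \<bullet> b) \<in> poly_space k" if "b \<in> Basis" for b
  unfolding D_def inner_diff_left by (intro poly_diff vec_poly_inner that G H[THEN conjunct1])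
 then have D: "D \<in> vec_poly_space k" by (simp add: vec_poly_space_def)
 note sq = poly_sq[OF vec_poly_inner[OF H[THEN conjunct1]]] poly_sq[OF vec_poly_inner[OF G]] poly_sq[OF Dp]
 have "l2_inner L H D = l2_inner L G D" using H D inner[OF D] grad_rec_rhs[OF v \<nu> D] by simp
 then have "(\<Sum>b\<in>Basis. l2_inner L (\<lambda>x. H x \<bullet> b - G x \<bullet> b) (\<lambda>x. D x \<bullet> b)) = 0"
  by (simp add: l2_inner_vec[of L H D, OF sq(1,3)] l2_inner_vec[of L G D, OF sq(2,3)] l2_inner_diff_left sq sum_subtractf cong: sum.cong)
 then have "(\<Sum>b\<in>Basis. (l2_norm L (\<lambda>x. H x \<bullet> b - G x \<bullet> b))^2) = 0"
  by (simp add: l2_norm_sq D_def inner_diff_left)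
 then have "l2_norm L (\<lambda>x. H x \<bullet> b - G x \<bullet> b) = 0" if "b \<in> Basis" for b
  using that by (simp add: sum_nonneg_eq_0_iff)
 then have HG: "(\<lambda>x. H x \<bullet> b) = (\<lambda>x. G x \<bullet> b)" if "b \<in> Basis" for b
  using that by (intro poly_eqI[OF vec_poly_inner[OF H[THEN conjunct1]] vec_poly_inner[OF G]])
 show "H = G" by (rule ext, rule euclidean_eqI) (rule fun_cong[OF HG])
qed

lemma
 assumes v: "v \<in> poly_space j" and \<nu>: "bsq \<nu>"
 shows grad_rec_poly: "grad_rec k Fh T v \<nu> \<in> vec_poly_space k"
  and grad_rec_inner: "b \<in> Basis ==> q \<in> poly_space k ==> l2_inner L (\<lambda>x. grad_rec k Fh T v \<nu> x \<bullet> b) q = R v \<nu> b q"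
proof -
 have "\<exists>g\<in>poly_space k. \<forall>q\<in>poly_space k. l2_inner L g q = R v \<nu> b q" if b: "b \<in> Basis" for b
 proof (rule poly_riesz)
  note sv = poly_sq[OF poly_partial[OF v]] and j = jump_bsq[OF v \<nu> b]
  show "R v \<nu> b (\<lambda>x. p x + q x) = R v \<nu> b p + R v \<nu> b q" if "p \<in> poly_space k" "q \<in> poly_space k" for p q
   by (simp add: R_def bi_commute[of "\<lambda>F x. (nrm F \<bullet> b) * (\<nu> F x - v x)"] bi_add_left j bsq_poly[OF that(1)] bsq_poly[OF that(2)]
     l2_inner_add_right sv poly_sq[OF that(1)] poly_sq[OF that(2)])
  show "R v \<nu> b (\<lambda>x. c * p x) = c * R v \<nu> b p" for c p
   by (simp add: R_def bi_commute[of "\<lambda>F x. (nrm F \<bullet> b) * (\<nu> F x - v x)"] bi_cmult_left l2_inner_cmult_right distrib_left)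
  show "R v \<nu> b p = 0" if p: "p \<in> poly_space k" "l2_inner L p p = 0" for p
  proof -
   have "p = (\<lambda>x. 0)" by (rule poly_eqI[OF p(1) poly_zero]) (simp add: l2_norm_def p(2))
   then show ?thesis by (simp add: R_def bi_def)
  qed
 qed (auto simp: l2_inner_add_left l2_inner_cmult_left poly_sq intro: l2_inner_commute)
 then have "\<forall>b\<in>Basis. \<exists>g. g \<in> poly_space k \<and> (\<forall>q\<in>poly_space k. l2_inner L g q = R v \<nu> b q)" by (intro ballI) (simp add: Bex_def)
 from bchoice[OF this] obtain g where "\<forall>b\<in>Basis. g b \<in> poly_space k \<and> (\<forall>q\<in>poly_space k. l2_inner L (g b) q = R v \<nu> b q)" ..
 then have g: "\<And>b. b \<in> Basis ==> g b \<in> poly_space k" "\<And>b q. b \<in> Basis ==> q \<in> poly_space k ==> l2_inner L (g b) q = R v \<nu> b q"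
  by simp_all
 define G where "G x = (\<Sum>b\<in>Basis. g b x *\<^sub>R b)" for x
 have Gb: "(\<lambda>x. G x \<bullet> b) = g b" if "b \<in> Basis" for b
  using that by (simp add: G_def fun_eq_iff inner_sum_left inner_Basis if_distrib cong: if_cong)
 then have G: "G \<in> vec_poly_space k" by (simp add: vec_poly_space_def g)
 have "grad_rec k Fh T v \<nu> = G" by (rule grad_rec_unique[OF v \<nu> G]) (simp add: Gb g)
 then show "grad_rec k Fh T v \<nu> \<in> vec_poly_space k"
  "b \<in> Basis ==> q \<in> poly_space k ==> l2_inner L (\<lambda>x. grad_rec k Fh T v \<nu> x \<bullet> b) q = R v \<nu> b q"
  using G Gb g by simp_all
qed

abbreviation "gr v \<nu> b \<equiv> \<lambda>x. grad_rec k Fh T v \<nu> x \<bullet> b"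
abbreviation "pr v \<nu> \<equiv> pot_rec k Fh T v \<nu>"

definition "is_pot G v p \<longleftrightarrow> p \<in> poly_space (Suc k) \<and>
 (\<forall>w\<in>poly_space (Suc k). (\<Sum>b\<in>Basis. l2_inner L (partial b p) (partial b w)) = (\<Sum>b\<in>Basis. l2_inner L (\<lambda>x. G x \<bullet> b) (partial b w))) \<and>
 (\<integral>x. p x \<partial>L) = (\<integral>x. v x \<partial>L)"

lemma is_potD:
 assumes "is_pot G v p"
 shows "p \<in> poly_space (Suc k)" "(\<integral>x. p x \<partial>L) = (\<integral>x. v x \<partial>L)"
  "w \<in> poly_space (Suc k) ==> (\<Sum>b\<in>Basis. l2_inner L (partial b p) (partial b w)) = (\<Sum>b\<in>Basis. l2_inner L (\<lambda>x. G x \<bullet> b) (partial b w))"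
 using assms unfolding is_pot_def by simp_all

lemma grad_poly_inner:
 assumes G: "\<And>b. b \<in> Basis ==> L2 L (\<lambda>x. G x \<bullet> b)" and w: "w \<in> poly_space j"
 shows "l2_inner L G (grad w) = (\<Sum>b\<in>Basis. l2_inner L (\<lambda>x. G x \<bullet> b) (partial b w))"
proof -
 have eq: "(\<lambda>x. grad w x \<bullet> b) = partial b w" if "b \<in> Basis" for b
  using that by (simp add: fun_eq_iff grad_inner_poly poly_differentiable[OF w])
 then have "l2_inner L G (grad w) = (\<Sum>b\<in>Basis. l2_inner L (\<lambda>x. G x \<bullet> b) (\<lambda>x. grad w x \<bullet> b))"
  using poly_sq[OF poly_partial[OF w]] by (intro l2_inner_vec G) simp_all
 then show ?thesis by (simp add: eq)
qed

lemma pot_rec_eq: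
 assumes v: "v \<in> poly_space j" and \<nu>: "bsq \<nu>"
 shows "pr v \<nu> = (THE p. is_pot (grad_rec k Fh T v \<nu>) v p)"
proof -
 have eq: "(\<lambda>x. grad p x \<bullet> b) = partial b p" if "p \<in> poly_space i" "b \<in> Basis" for p b i
  using that by (simp add: fun_eq_iff grad_inner_poly poly_differentiable[OF that(1)])
 have "l2_inner L (grad p) (grad w) = (\<Sum>b\<in>Basis. l2_inner L (partial b p) (partial b w))"
  if "p \<in> poly_space (Suc k)" "w \<in> poly_space (Suc k)" for p w
  by (subst grad_poly_inner[OF _ that(2)]) (simp_all add: eq[OF that(1)] poly_sq[OF poly_partial[OF that(1)]])
 moreover have "l2_inner L (grad_rec k Fh T v \<nu>) (grad w) = (\<Sum>b\<in>Basis. l2_inner L (gr v \<nu> b) (partial b w))"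
  if "w \<in> poly_space (Suc k)" for w
  by (rule grad_poly_inner[OF poly_sq[OF vec_poly_inner[OF grad_rec_poly[OF v \<nu>]]] that])
 ultimately show ?thesis
  unfolding pot_rec_def is_pot_def by (intro arg_cong[where f=The] ext) (auto simp: Suc_eq_plus1[symmetric])
qed

lemma mean_value: "f \<in> poly_space j ==> (\<integral>x. f x \<partial>L) = l2_inner L f (\<lambda>x. 1)"
 by (simp add: l2_inner_real)

text \<open>The difference of two solutions has zero gradient in L2 of T, hence is constant, and its
  mean value is zero.\<close>

lemma is_pot_unique:
 assumes p: "is_pot G v p" and q: "is_pot G v q" and v: "v \<in> poly_space j"
 shows "p = q"
proof (rule poly_eqI[OF is_potD(1)[OF p] is_potD(1)[OF q]])
 let ?d = "\<lambda>x. p x - q x"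
 note P = is_potD(1)[OF p] is_potD(1)[OF q]
 have d: "?d \<in> poly_space (Suc k)" by (rule poly_diff[OF P])
 note sd = poly_sq[OF poly_partial[OF d]]
 have pd: "partial b ?d = (\<lambda>x. partial b p x - partial b q x)" for b
  by (rule ext) (rule partial_diff[OF poly_differentiable[OF P(1)] poly_differentiable[OF P(2)]])
 have "(\<Sum>b\<in>Basis. (l2_norm L (partial b ?d))^2)
   = (\<Sum>b\<in>Basis. l2_inner L (partial b p) (partial b ?d) - l2_inner L (partial b q) (partial b ?d))"
  unfolding l2_norm_sq
  by (intro sum.cong refl, subst (1) pd, rule l2_inner_diff_left[OF poly_sq[OF poly_partial[OF P(1)]] poly_sq[OF poly_partial[OF P(2)]] sd])
 also have "... = 0" unfolding sum_subtractf using is_potD(3)[OF p d] is_potD(3)[OF q d] by simp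
 finally have "l2_norm L (partial b ?d) = 0" if "b \<in> Basis" for b using that by (simp add: sum_nonneg_eq_0_iff)
 then have "partial b ?d = (\<lambda>x. 0)" if "b \<in> Basis" for b
  using that by (intro poly_eqI[OF poly_partial[OF d] poly_zero]) simp
 then have "(?d has_derivative (\<lambda>x. 0)) (at x)" for x
  using smooth_has_derivative[OF poly_differentiable[OF d], of x] by simp
 then obtain c where c: "\<And>x. ?d x = c" using has_derivative_zero_constant[of UNIV ?d] by auto
 have "l2_inner L ?d (\<lambda>x. 1) = 0"
  using is_potD(2)[OF p] is_potD(2)[OF q]
  by (simp add: l2_inner_diff_left[OF poly_sq[OF P(1)] poly_sq[OF P(2)] poly_sq[OF poly_const]] mean_value[OF P(1), symmetric] mean_value[OF P(2), symmetric])
 then have "l2_inner L ?d ?d = 0"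
  unfolding l2_inner_cmult_right[of L ?d c "\<lambda>x. 1", simplified] c[abs_def] by (simp add: l2_inner_real)
 then show "l2_norm L ?d = 0" by (simp add: l2_norm_def)
qed

text \<open>The product of mean values is added to the gradient form, so that null vectors have zero
  gradient and zero mean and the right-hand side vanishes on them. Testing with the constant 1
  recovers the mean value condition, and the added terms cancel.\<close>

lemma pot_rec:
 assumes v: "v \<in> poly_space j" and \<nu>: "bsq \<nu>"
 shows "is_pot (grad_rec k Fh T v \<nu>) v (pr v \<nu>)"
proof -
 define E where "E p q = (\<Sum>b\<in>Basis. l2_inner L (partial b p) (partial b q))" for p q
 define H where "H q = (\<Sum>b\<in>Basis. l2_inner L (gr v \<nu> b) (partial b q))" for q
 define m where "m p = l2_inner L p (\<lambda>x. 1)" for p :: "'a => real"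
 note sg = poly_sq[OF vec_poly_inner[OF grad_rec_poly[OF v \<nu>]]] and s1 = poly_sq[OF poly_const]
 note s = poly_sq[OF poly_partial] poly_sq
 have d: "partial b (\<lambda>x. p x + q x) = (\<lambda>x. partial b p x + partial b q x)"
  if "p \<in> poly_space (Suc k)" "q \<in> poly_space (Suc k)" for p q b
  using that[THEN poly_differentiable] by (simp add: fun_eq_iff partial_add)
 have dc: "partial b (\<lambda>x. c * p x) = (\<lambda>x. c * partial b p x)" if "p \<in> poly_space (Suc k)" for p b c
  using that[THEN poly_differentiable] by (simp add: fun_eq_iff partial_cmult)
 have lin: "E (\<lambda>x. p x + q x) r = E p r + E q r" "H (\<lambda>x. p x + q x) = H p + H q" "m (\<lambda>x. p x + q x) = m p + m q"
  if p: "p \<in> poly_space (Suc k)" and q: "q \<in> poly_space (Suc k)" and r: "r \<in> poly_space (Suc k)" for p q r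
  unfolding E_def H_def m_def sum.distrib[symmetric] d[OF p q]
  by (intro sum.cong refl l2_inner_add_left l2_inner_add_right s(1)[OF p] s(1)[OF q] s(1)[OF r] sg s(2)[OF p] s(2)[OF q] s1; assumption)+
 have scal: "E (\<lambda>x. c * p x) r = c * E p r" "H (\<lambda>x. c * p x) = c * H p" "m (\<lambda>x. c * p x) = c * m p"
  if p: "p \<in> poly_space (Suc k)" for p r c
  unfolding E_def H_def m_def sum_distrib_left dc[OF p] by (intro sum.cong refl l2_inner_cmult_left l2_inner_cmult_right)+
 have "\<exists>p\<in>poly_space (Suc k). \<forall>q\<in>poly_space (Suc k). E p q + m p * m q = H q + m v * m q"
 proof (rule poly_riesz)
  fix p q r :: "'a => real" and c assume p: "p \<in> poly_space (Suc k)"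
  show "E (\<lambda>x. c * p x) r + m (\<lambda>x. c * p x) * m r = c * (E p r + m p * m r)"
   "H (\<lambda>x. c * p x) + m v * m (\<lambda>x. c * p x) = c * (H p + m v * m p)"
   by (simp_all add: scal[OF p] algebra_simps)
  have E0: "0 \<le> E p p" unfolding E_def by (intro sum_nonneg l2_inner_self_nonneg)
  then show "0 \<le> E p p + m p * m p" by simp
  { assume "E p p + m p * m p = 0"
   then have z: "E p p = 0" "m p = 0" using E0 zero_le_square[of "m p"] by (linarith, auto simp: add_nonneg_eq_0_iff)
   then have "l2_norm L (partial b p) = 0" if "b \<in> Basis" for b
    using that by (simp add: sum_nonneg_eq_0_iff l2_norm_def E_def)
   then have "l2_inner L (gr v \<nu> b) (partial b p) = 0" if "b \<in> Basis" for b
    using that l2_cauchy_schwarz[OF sg[OF that] s(1)[OF p, of b]] by simp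
   then show "H p + m v * m p = 0" by (simp add: H_def z) }
  assume q: "q \<in> poly_space (Suc k)"
  show "E p q + m p * m q = E q p + m q * m p"
   unfolding E_def by (intro arg_cong2[where f="(+)"] sum.cong refl l2_inner_commute mult.commute)
  show "H (\<lambda>x. p x + q x) + m v * m (\<lambda>x. p x + q x) = (H p + m v * m p) + (H q + m v * m q)"
   by (simp add: lin[OF p q q] algebra_simps)
  assume r: "r \<in> poly_space (Suc k)"
  show "E (\<lambda>x. p x + q x) r + m (\<lambda>x. p x + q x) * m r = (E p r + m p * m r) + (E q r + m q * m r)"
   by (simp add: lin[OF p q r] algebra_simps)
 qed
 then obtain p where p: "p \<in> poly_space (Suc k)" and eq: "\<forall>q\<in>poly_space (Suc k). E p q + m p * m q = H q + m v * m q"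
  by (elim bexE) (rule that)
 have "0 < measure L (space L)"
  using open_not_negligible[OF dom(1,4)] measure_nonneg[of lebesgue T] Dl bounded_set_imp_lmeasurable[OF dom(3) Dl]
  by (auto simp: measure_restrict_space negligible_iff_measure less_le)
 then have "m (\<lambda>x. 1) \<noteq> 0" by (simp add: l2_inner_real m_def)
 moreover have "E p (\<lambda>x. 1) = 0" "H (\<lambda>x. 1) = 0" by (simp_all add: E_def H_def)
 ultimately have m: "m p = m v" using eq[rule_format, OF poly_const[of 1]] by simp
 then have ip: "is_pot (grad_rec k Fh T v \<nu>) v p"
  using eq unfolding is_pot_def mean_value[OF p] mean_value[OF v] E_def[symmetric] H_def[symmetric] m_def[symmetric]
  by (intro conjI p ballI m) simp
 show ?thesis unfolding pot_rec_eq[OF v \<nu>]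
  by (rule theI[of "is_pot (grad_rec k Fh T v \<nu>) v", OF ip]) (rule is_pot_unique[OF _ ip v])
qed

lemma R_diff:
 assumes "v \<in> poly_space j" "v' \<in> poly_space j" "bsq \<nu>" "bsq \<nu>'" and b: "b \<in> Basis" and q: "q \<in> poly_space k"
 shows "R (\<lambda>x. v x - v' x) (\<lambda>F x. \<nu> F x - \<nu>' F x) b q = R v \<nu> b q - R v' \<nu>' b q"
proof -
 have "partial b (\<lambda>x. v x - v' x) = (\<lambda>x. partial b v x - partial b v' x)"
  by (rule ext) (rule partial_diff[OF poly_differentiable[OF assms(1)] poly_differentiable[OF assms(2)]])
 moreover have "(\<lambda>F x. (nrm F \<bullet> b) * ((\<nu> F x - \<nu>' F x) - (v x - v' x)))
   = (\<lambda>F x. (nrm F \<bullet> b) * (\<nu> F x - v x) - (nrm F \<bullet> b) * (\<nu>' F x - v' x))"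
  by (simp add: fun_eq_iff algebra_simps)
 ultimately show ?thesis
  unfolding R_def
  by (simp only: bi_diff_left[OF jump_bsq[OF assms(1,3) b] jump_bsq[OF assms(2,4) b] bsq_poly[OF q]]
    l2_inner_diff_left[OF poly_sq[OF poly_partial[OF assms(1)]] poly_sq[OF poly_partial[OF assms(2)]] poly_sq[OF q]])
qed

lemma rec_diff:
 assumes v: "v \<in> poly_space j" "v' \<in> poly_space j" and \<nu>: "bsq \<nu>" "bsq \<nu>'"
 shows "gr (\<lambda>x. v x - v' x) (\<lambda>F x. \<nu> F x - \<nu>' F x) b = (\<lambda>x. gr v \<nu> b x - gr v' \<nu>' b x)"
  and "pr (\<lambda>x. v x - v' x) (\<lambda>F x. \<nu> F x - \<nu>' F x) = (\<lambda>x. pr v \<nu> x - pr v' \<nu>' x)"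
proof -
 let ?v = "\<lambda>x. v x - v' x" and ?\<nu> = "\<lambda>F x. \<nu> F x - \<nu>' F x"
 note vd = poly_diff[OF v] and \<nu>d = bsq_diff[OF \<nu>]
 note gp = vec_poly_inner[OF grad_rec_poly[OF v(1) \<nu>(1)]] vec_poly_inner[OF grad_rec_poly[OF v(2) \<nu>(2)]]
 have G: "grad_rec k Fh T ?v ?\<nu> = (\<lambda>x. grad_rec k Fh T v \<nu> x - grad_rec k Fh T v' \<nu>' x)"
 proof (rule grad_rec_unique[OF vd \<nu>d])
  show "(\<lambda>x. grad_rec k Fh T v \<nu> x - grad_rec k Fh T v' \<nu>' x) \<in> vec_poly_space k"
   unfolding vec_poly_space_def by (simp add: inner_diff_left poly_diff gp)
 qed (simp add: inner_diff_left l2_inner_diff_left[OF poly_sq[OF gp(1)] poly_sq[OF gp(2)] poly_sq]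
   grad_rec_inner[OF v(1) \<nu>(1)] grad_rec_inner[OF v(2) \<nu>(2)] R_diff[OF v \<nu>])
 then show "gr ?v ?\<nu> b = (\<lambda>x. gr v \<nu> b x - gr v' \<nu>' b x)" by (simp add: inner_diff_left)
 note P = pot_rec[OF v(1) \<nu>(1)] pot_rec[OF v(2) \<nu>(2)]
 note pp = is_potD(1)[OF P(1)] is_potD(1)[OF P(2)]
 have d: "partial b (\<lambda>x. pr v \<nu> x - pr v' \<nu>' x) = (\<lambda>x. partial b (pr v \<nu>) x - partial b (pr v' \<nu>') x)" for b
  by (rule ext) (rule partial_diff[OF poly_differentiable[OF pp(1)] poly_differentiable[OF pp(2)]])
 have "is_pot (grad_rec k Fh T ?v ?\<nu>) ?v (\<lambda>x. pr v \<nu> x - pr v' \<nu>' x)"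
  unfolding is_pot_def
 proof (intro conjI ballI)
  show "(\<lambda>x. pr v \<nu> x - pr v' \<nu>' x) \<in> poly_space (Suc k)" by (rule poly_diff[OF pp])
  then show "(\<integral>x. pr v \<nu> x - pr v' \<nu>' x \<partial>L) = (\<integral>x. ?v x \<partial>L)"
   using is_potD(2)[OF P(1)] is_potD(2)[OF P(2)]
   by (simp add: mean_value[OF vd] mean_value mean_value[OF v(1)] mean_value[OF v(2)] mean_value[OF pp(1)] mean_value[OF pp(2)]
     l2_inner_diff_left[OF poly_sq[OF v(1)] poly_sq[OF v(2)] poly_sq[OF poly_const]]
     l2_inner_diff_left[OF poly_sq[OF pp(1)] poly_sq[OF pp(2)] poly_sq[OF poly_const]])
  fix w :: "'a => real" assume w: "w \<in> poly_space (Suc k)"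
  note sw = poly_sq[OF poly_partial[OF w]]
  show "(\<Sum>b\<in>Basis. l2_inner L (partial b (\<lambda>x. pr v \<nu> x - pr v' \<nu>' x)) (partial b w)) = (\<Sum>b\<in>Basis. l2_inner L (gr ?v ?\<nu> b) (partial b w))"
   by (simp cong: sum.cong add: d G inner_diff_left sum_subtractf is_potD(3)[OF P(1) w] is_potD(3)[OF P(2) w]
     l2_inner_diff_left[OF poly_sq[OF gp(1)] poly_sq[OF gp(2)] sw]
     l2_inner_diff_left[OF poly_sq[OF poly_partial[OF pp(1)]] poly_sq[OF poly_partial[OF pp(2)]] sw])
 qed
 from is_pot_unique[OF pot_rec[OF vd \<nu>d] this vd]
 show "pr ?v ?\<nu> = (\<lambda>x. pr v \<nu> x - pr v' \<nu>' x)" .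
qed

end

section \<open>Consistency of the bilinear form\<close>

context hho_element
begin

text \<open>Face unknowns matter only up to null sets of the faces. This is needed because the
  interpolant vanishes on boundary faces only almost everywhere.\<close>

lemma rec_cong:
 assumes v: "v \<in> poly_space j" and \<nu>: "bsq \<nu>" "bsq \<nu>'" and eq: "\<And>F. F \<in> faces ==> AE x in face_measure F. \<nu> F x = \<nu>' F x"
 shows "grad_rec k Fh T v \<nu> = grad_rec k Fh T v \<nu>'" "pr v \<nu> = pr v \<nu>'"
proof -
 have "R v \<nu>' b q = R v \<nu> b q" if "b \<in> Basis" "q \<in> poly_space k" for b q
  unfolding R_def
 proof (intro arg_cong2[where f="(+)"] refl bi_cong_AE jump_bsq[OF v] \<nu> that bsq_poly[OF that(2)])
  show "AE x in face_measure F. (nrm F \<bullet> b) * (\<nu>' F x - v x) = (nrm F \<bullet> b) * (\<nu> F x - v x)" if "F \<in> faces" for F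
   using eq[OF that] by eventually_elim simp
 qed
 then show g: "grad_rec k Fh T v \<nu> = grad_rec k Fh T v \<nu>'"
  by (intro grad_rec_unique[OF v \<nu>(1) grad_rec_poly[OF v \<nu>(2)]]) (simp add: grad_rec_inner[OF v \<nu>(2)])
 show "pr v \<nu> = pr v \<nu>'" unfolding pot_rec_def g ..
qed

abbreviation "St v \<nu> \<equiv> \<lambda>F x. delta_face k Fh T v \<nu> F x - delta_elem k Fh T v \<nu> x"

lemma face_proj_bsq: "bsq \<phi> ==> bsq (\<lambda>F. l2_proj (face_measure F) k (\<phi> F))"
 unfolding bsq_def by (auto intro!: poly_measureD[OF poly_measure_face l2_proj_poly[OF poly_measure_face]])

lemma pr_poly: "v \<in> poly_space j ==> bsq \<nu> ==> pr v \<nu> \<in> poly_space (Suc k)"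
 by (rule is_potD(1)[OF pot_rec])

lemma pr_proj:
 assumes "v \<in> poly_space j" "bsq \<nu>"
 shows "bsq (\<lambda>F. l2_proj (face_measure F) k (pr v \<nu>))" "l2_proj L k (pr v \<nu>) \<in> poly_space k"
 using pr_poly[OF assms] by (intro face_proj_bsq proj_poly; rule bsq_poly poly_sq)+

lemma St_bsq: "v \<in> poly_space j ==> bsq \<nu> ==> bsq (St v \<nu>)"
 unfolding delta_face_def delta_elem_def by (intro bsq_diff pr_proj(1) bsq_poly[OF pr_proj(2)]) (auto intro: bsq_poly)

lemma form_eq:
 assumes "x \<in> poly_space j" "bsq \<mu>" "y \<in> poly_space j" "bsq \<nu>"
 shows "local_form k Fh T x \<mu> y \<nu> = (\<Sum>b\<in>Basis. l2_inner L (gr x \<mu> b) (gr y \<nu> b)) + real k / diameter T * bi (St x \<mu>) (St y \<nu>)"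
 unfolding local_form_def stab_def bi_def
 by (subst l2_inner_vec) (auto intro: poly_sq vec_poly_inner grad_rec_poly assms)

lemma form_commute: "local_form k Fh T x \<mu> y \<nu> = local_form k Fh T y \<nu> x \<mu>"
 unfolding local_form_def stab_def l2_inner_def
 by (intro arg_cong2[where f="(+)"] arg_cong2[where f="(*)"] sum.cong refl Bochner_Integration.integral_cong inner_commute)

lemma form_cong:
 assumes x: "x \<in> poly_space j" "bsq \<mu>" "bsq \<mu>'" and y: "y \<in> poly_space j" "bsq \<nu>" and eq: "\<And>F. F \<in> faces ==> AE z in face_measure F. \<mu> F z = \<mu>' F z"
 shows "local_form k Fh T x \<mu> y \<nu> = local_form k Fh T x \<mu>' y \<nu>"
proof -
 have "bi (St x \<mu>) (St y \<nu>) = bi (St x \<mu>') (St y \<nu>)"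
 proof (rule bi_cong_AE)
  show "AE z in face_measure F. St x \<mu> F z = St x \<mu>' F z" if "F \<in> faces" for F
   using eq[OF that] by eventually_elim (simp add: delta_face_def delta_elem_def rec_cong[OF x eq])
 qed (rule St_bsq[OF x(1,2)] St_bsq[OF x(1,3)] St_bsq[OF y])+
 then show ?thesis by (simp add: form_eq[OF x(1,2) y] form_eq[OF x(1,3) y] rec_cong[OF x eq])
qed

lemma proj_diff:
 assumes "L2 L f" "L2 L g"
 shows "l2_proj L k (\<lambda>x. f x - g x) = (\<lambda>x. l2_proj L k f x - l2_proj L k g x)" (is "?p = ?q")
proof (rule poly_eqI)
 show p: "?p \<in> poly_space k" "?q \<in> poly_space k" by (intro proj_poly poly_diff L2_diff assms)+
 show "l2_dist L ?p ?q = 0"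
  using l2_norm_cong_AE[of "\<lambda>x. ?p x - ?q x" "\<lambda>x. 0" L] l2_proj_diff_AE[OF poly_measure_domain assms, of k]
   L2_measurable[OF poly_sq[OF poly_diff[OF p]]] by simp
qed

lemma form_diff:
 assumes x: "x \<in> poly_space j" "x' \<in> poly_space j" and \<mu>: "bsq \<mu>" "bsq \<mu>'" and y: "y \<in> poly_space j" "bsq \<nu>"
 shows "local_form k Fh T (\<lambda>z. x z - x' z) (\<lambda>F z. \<mu> F z - \<mu>' F z) y \<nu> = local_form k Fh T x \<mu> y \<nu> - local_form k Fh T x' \<mu>' y \<nu>"
proof -
 let ?x = "\<lambda>z. x z - x' z" and ?\<mu> = "\<lambda>F z. \<mu> F z - \<mu>' F z"
 note d = poly_diff[OF x] bsq_diff[OF \<mu>]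
 note P = pr_poly[OF x(1) \<mu>(1)] pr_poly[OF x(2) \<mu>(2)]
 have "bi (St ?x ?\<mu>) (St y \<nu>) = bi (\<lambda>F z. St x \<mu> F z - St x' \<mu>' F z) (St y \<nu>)"
 proof (rule bi_cong_AE)
  fix F assume F: "F \<in> faces"
  have "AE z in face_measure F. l2_proj (face_measure F) k (pr ?x ?\<mu>) z
    = l2_proj (face_measure F) k (pr x \<mu>) z - l2_proj (face_measure F) k (pr x' \<mu>') z"
   unfolding rec_diff(2)[OF x \<mu>] by (intro l2_proj_diff_AE poly_measure_face[OF F] bsqD[OF bsq_poly[OF P(1)] F] bsqD[OF bsq_poly[OF P(2)] F])
  then show "AE z in face_measure F. St ?x ?\<mu> F z = St x \<mu> F z - St x' \<mu>' F z"
   by eventually_elim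
     (simp add: delta_face_def delta_elem_def rec_diff(2)[OF x \<mu>] proj_diff[OF poly_sq[OF P(1)] poly_sq[OF P(2)]])
 qed (intro bsq_diff St_bsq[OF d] St_bsq[OF x(1) \<mu>(1)] St_bsq[OF x(2) \<mu>(2)] St_bsq[OF y])+
 also have "... = bi (St x \<mu>) (St y \<nu>) - bi (St x' \<mu>') (St y \<nu>)"
  by (intro bi_diff_left St_bsq[OF x(1) \<mu>(1)] St_bsq[OF x(2) \<mu>(2)] St_bsq[OF y])
 finally have s: "bi (St ?x ?\<mu>) (St y \<nu>) = ..." .
 have g: "l2_inner L (gr ?x ?\<mu> b) (gr y \<nu> b) = l2_inner L (gr x \<mu> b) (gr y \<nu> b) - l2_inner L (gr x' \<mu>' b) (gr y \<nu> b)" if "b \<in> Basis" for b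
  unfolding rec_diff(1)[OF x \<mu>]
  by (intro l2_inner_diff_left poly_sq[OF vec_poly_inner[OF grad_rec_poly[OF x(1) \<mu>(1)]]]
    poly_sq[OF vec_poly_inner[OF grad_rec_poly[OF x(2) \<mu>(2)]]] poly_sq[OF vec_poly_inner[OF grad_rec_poly[OF y]]] that)
 have "(\<Sum>b\<in>Basis. l2_inner L (gr ?x ?\<mu> b) (gr y \<nu> b))
   = (\<Sum>b\<in>Basis. l2_inner L (gr x \<mu> b) (gr y \<nu> b)) - (\<Sum>b\<in>Basis. l2_inner L (gr x' \<mu>' b) (gr y \<nu> b))"
  unfolding sum_subtractf[symmetric] by (rule sum.cong[OF refl g])
 then show ?thesis
  unfolding form_eq[OF d y] form_eq[OF x(1) \<mu>(1) y] form_eq[OF x(2) \<mu>(2) y] s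
  by (simp only: algebra_simps)
qed

text \<open>On the face q is its own projection, so the left side is the norm of a projection of the
  difference on the right.\<close>

lemma face_proj_le:
 assumes \<phi>: "bsq \<phi>" and q: "q \<in> poly_space k"
 shows "bn (\<lambda>F x. l2_proj (face_measure F) k (\<phi> F) x - q x) \<le> bn (\<lambda>F x. \<phi> F x - q x)"
proof (rule bn_mono)
 fix F assume F: "F \<in> faces"
 let ?M = "face_measure F" and ?r = "\<lambda>x. l2_proj (face_measure F) k (\<phi> F) x - q x"
 note M = poly_measure_face[OF F] and s = bsqD[OF \<phi> F]
 note P = l2_proj_poly[OF M s, of k]
 have r: "?r \<in> poly_space k" by (rule poly_diff[OF P q])
 note S = poly_measureD[OF M P] poly_measureD[OF M q] poly_measureD[OF M r]
 have "(l2_norm ?M ?r)^2 = l2_inner ?M (\<lambda>x. \<phi> F x - q x) ?r"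
  by (simp only: l2_norm_sq l2_inner_diff_left[OF S] l2_inner_diff_left[OF s S(2,3)] l2_proj_inner[OF M s r])
 also have "... \<le> l2_dist ?M (\<phi> F) q * l2_norm ?M ?r"
  using l2_cauchy_schwarz[OF L2_diff[OF s S(2)] S(3)] by linarith
 finally show "l2_norm ?M ?r \<le> l2_dist ?M (\<phi> F) q"
  by (cases "l2_norm ?M ?r = 0") (use l2_norm_nonneg[of ?M ?r] in \<open>simp_all add: power2_eq_square\<close>)
qed

end

text \<open>To the data of \<open>bounded_potential\<close> it adds the constant \<open>C1\<close>
  of the boundary error of polynomials of degree k + 1, which is applied to the potential of a test
  function.\<close>

locale hho_estimate = hho_element \<Omega> Th Fh T k + pointed_element \<Omega> Th Fh T a \<kappa>
 for \<Omega> :: "'a::euclidean_space set" and Th Fh T k a \<kappa> +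
 fixes u \<gamma> v \<gamma>' w and s B C1 :: real
 assumes u: "green u \<gamma> v" and v: "\<And>l. l \<in> Basis ==> green (v l) (\<gamma>' l) (w l)" and sym: "\<And>i l. w l i = w i l"
  and s: "0 < s" "s^2 * real k = h" and B: "0 \<le> B"
  and Z: "\<And>j. j \<in> {k, Suc k} ==> bn (\<lambda>F x. \<gamma> F x - l2_proj L j u x) \<le> s * B"
  and E: "\<And>j l. j \<in> {k, Suc k, Suc (Suc k)} ==> l \<in> Basis ==> bn (\<lambda>F x. \<gamma>' l F x - l2_proj L j (v l) x) \<le> B / s"
  and C1: "0 \<le> C1" "\<And>p. p \<in> poly_space (Suc k) ==>
   bn (\<lambda>F x. p x - l2_proj L k p x) \<le> C1 * s * sqrt (\<Sum>b\<in>Basis. (l2_norm L (partial b p))^2)"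
begin

abbreviation "A \<equiv> l2_proj L k u"
abbreviation "\<nu>I \<equiv> \<lambda>F. l2_proj (face_measure F) k (\<gamma> F)"

lemma A: "A \<in> poly_space k" by (rule proj_poly[OF greenD(1)[OF u]])

lemma \<nu>I: "bsq \<nu>I" by (rule face_proj_bsq[OF greenD(2)[OF u]])

lemma R_interpolant:
 assumes b: "b \<in> Basis" and q: "q \<in> poly_space k"
 shows "R A \<nu>I b q = l2_inner L (v b) q"
proof -
 have "bi (nt b (\<lambda>F x. \<nu>I F x - A x)) (\<lambda>F. q) = bi (nt b (\<lambda>F x. \<gamma> F x - A x)) (\<lambda>F. q)"
  unfolding bi_def
 proof (rule sum.cong[OF refl])
  fix F assume F: "F \<in> faces"
  note M = poly_measure_face[OF F] and g = bsqD[OF greenD(2)[OF u] F] and f = bsqD[OF \<nu>I F] bsqD[OF bsq_poly[OF A] F] bsqD[OF bsq_poly[OF q] F]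
  show "l2_inner (face_measure F) (\<lambda>x. (nrm F \<bullet> b) * (\<nu>I F x - A x)) q = l2_inner (face_measure F) (\<lambda>x. (nrm F \<bullet> b) * (\<gamma> F x - A x)) q"
   by (simp only: l2_inner_cmult_left l2_inner_diff_left[OF f] l2_inner_diff_left[OF g f(2,3)] l2_proj_inner[OF M g q])
 qed
 also have "... = l2_inner L (v b) q - l2_inner L (partial b A) q"
  using green_proj[OF u poly_le[OF q] b, of k]
  by (simp add: l2_inner_diff_left[OF greenD(3)[OF u b] poly_sq[OF poly_partial[OF A]] poly_sq[OF q]])
 finally show ?thesis by (simp add: R_def)
qed

text \<open>Commuting property: in the definition of the reconstruction the face and element
  projections are tested only with degree k and may be dropped, and Green's formula leaves the
  gradient of u. It supplies the hypothesis \<open>pot\<close> for the potential of the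
  interpolant.\<close>

lemma gr_interpolant: "b \<in> Basis ==> gr A \<nu>I b = l2_proj L k (v b)"
proof (rule poly_eqI)
 assume b: "b \<in> Basis"
 show p: "gr A \<nu>I b \<in> poly_space k" "l2_proj L k (v b) \<in> poly_space k"
  by (intro vec_poly_inner grad_rec_poly[OF A \<nu>I] b proj_poly greenD(3)[OF u b])+
 have "AE x in L. gr A \<nu>I b x = l2_proj L k (v b) x"
  by (rule l2_proj_unique[OF poly_measure_domain p])
    (simp add: grad_rec_inner[OF A \<nu>I b] R_interpolant[OF b] proj_inner[OF greenD(3)[OF u b]])
 then show "l2_dist L (gr A \<nu>I b) (l2_proj L k (v b)) = 0"
  using l2_norm_cong_AE[of "\<lambda>x. gr A \<nu>I b x - l2_proj L k (v b) x" "\<lambda>x. 0" L]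
   L2_measurable[OF poly_sq[OF poly_diff[OF p]]] by simp
qed

sublocale potential: bounded_potential \<Omega> Th Fh T a \<kappa> k u \<gamma> v \<gamma>' w "pr A \<nu>I" s B
proof unfold_locales
 show "(\<Sum>b\<in>Basis. l2_inner L (partial b (pr A \<nu>I)) (partial b q)) = (\<Sum>b\<in>Basis. l2_inner L (l2_proj L k (v b)) (partial b q))"
  if "q \<in> poly_space (Suc k)" for q
  using is_potD(3)[OF pot_rec[OF A \<nu>I] that] by (simp add: gr_interpolant cong: sum.cong)
qed (use k u v sym s B Z E pr_poly[OF A \<nu>I] in simp_all)

definition "C2 = 1 + potential.K1 * (potential.K1 + 2 + real DIM('a) * (4 + potential.K2))"

text \<open>The stabilization residual is a difference of two terms, each a face projection minus an
  element projection. \<open>face_proj_le\<close> removes the face projections, leaving the boundary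
  error of u and the boundary norm of p - Pi_k p.\<close>

lemma St_interpolant: "bn (St A \<nu>I) \<le> C2 * (s * B)"
proof -
 let ?p = "pr A \<nu>I"
 note P = pr_poly[OF A \<nu>I] and Q = pr_proj[OF A \<nu>I]
 have "bn (St A \<nu>I) = bn (\<lambda>F x. (\<nu>I F x - A x) - (l2_proj (face_measure F) k ?p x - l2_proj L k ?p x))"
  by (simp add: delta_face_def delta_elem_def algebra_simps)
 also have "... \<le> bn (\<lambda>F x. \<nu>I F x - A x) + bn (\<lambda>F x. l2_proj (face_measure F) k ?p x - l2_proj L k ?p x)"
  by (intro bn_diff bsq_diff \<nu>I Q(1) bsq_poly[OF A] bsq_poly[OF Q(2)])
 also have "... \<le> bn (\<lambda>F x. \<gamma> F x - A x) + bn (\<lambda>F x. ?p x - l2_proj L k ?p x)"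
  by (intro add_mono face_proj_le greenD(2)[OF u] A bsq_poly[OF P] Q(2))
 also have "... \<le> s * B + potential.K1 * (potential.K1 + 2 + real DIM('a) * (4 + potential.K2)) * (s * B)"
  using Z[of k] potential.potential_bound by (intro add_mono) (simp_all add: potential.e_def[abs_def])
 finally show ?thesis by (simp add: C2_def algebra_simps)
qed

text \<open>Since grad y has degree at most k, pairing the reconstructed gradients gives the pairing
  of grad y with grad u plus a boundary term. Subtracting Green's formula for grad u leaves only the
  boundary error of grad u against \<nu> - y, and that jump has norm of order s times the energy
  norm, which compensates B / s.\<close>

lemma consistency:
 assumes y: "y \<in> poly_space k" and \<nu>: "bsq \<nu>"
 shows "(\<Sum>b\<in>Basis. - l2_inner L (w b b) y) + (\<Sum>b\<in>Basis. bi (nt b (\<gamma>' b)) \<nu>) - local_form k Fh T A \<nu>I y \<nu>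
  \<le> (real DIM('a) * (1 + C1) + C2) * B * sqrt (local_form k Fh T y \<nu> y \<nu>)"
proof -
 define \<alpha> where "\<alpha> = sqrt (local_form k Fh T y \<nu> y \<nu>)"
 define G where "G = (\<Sum>b\<in>Basis. (l2_norm L (gr y \<nu> b))^2)"
 let ?p = "pr y \<nu>" and ?g = "\<lambda>b. l2_proj L k (v b)"
 note P = pr_poly[OF y \<nu>] and Q = pr_proj[OF y \<nu>] and S = St_bsq[OF y \<nu>] and SI = St_bsq[OF A \<nu>I]
 note gp = proj_poly[OF greenD(3)[OF u]] and gb = bsq_poly[OF proj_poly[OF greenD(3)[OF u]]] and yb = bsq_poly[OF y]
 note gy = poly_sq[OF vec_poly_inner[OF grad_rec_poly[OF y \<nu>]]]
 have kh: "real k / h = 1 / s^2" using s(1) k unfolding s(2)[symmetric] by simp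
 have G0: "0 \<le> G" by (simp add: G_def sum_nonneg)
 have form: "local_form k Fh T y \<nu> y \<nu> = G + (bn (St y \<nu>) / s)^2"
  unfolding form_eq[OF y \<nu> y \<nu>] kh G_def by (simp add: l2_norm_sq bn_sq power_divide)
 have f0: "0 \<le> G + (bn (St y \<nu>) / s)^2" using G0 by simp
 have \<alpha>: "0 \<le> \<alpha>" "\<alpha>^2 = G + (bn (St y \<nu>) / s)^2"
  unfolding \<alpha>_def form using f0 by (rule real_sqrt_ge_zero, rule real_sqrt_pow2)
 have "(bn (St y \<nu>) / s)^2 \<le> \<alpha>^2" unfolding \<alpha>(2) using G0 by linarith
 then have "bn (St y \<nu>) / s \<le> \<alpha>" by (rule power2_le_imp_le[OF _ \<alpha>(1)])
 then have aS: "bn (St y \<nu>) \<le> s * \<alpha>" using s(1) by (simp add: field_simps)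
 \<comment> \<open>The gradient of the potential is a projection of the reconstructed gradient;
   Young's inequality on the defining identity bounds it without a constant.\<close>
 have "(\<Sum>b\<in>Basis. (l2_norm L (partial b ?p))^2) \<le> (\<Sum>b\<in>Basis. ((l2_norm L (gr y \<nu> b))^2 + (l2_norm L (partial b ?p))^2) / 2)"
  unfolding l2_norm_sq[of L "partial _ ?p"] is_potD(3)[OF pot_rec[OF y \<nu>] P]
 proof (rule sum_mono)
  fix b :: 'a assume b: "b \<in> Basis"
  show "l2_inner L (gr y \<nu> b) (partial b ?p) \<le> ((l2_norm L (gr y \<nu> b))^2 + l2_inner L (partial b ?p) (partial b ?p)) / 2"
   using l2_cauchy_schwarz[OF gy[OF b] poly_sq[OF poly_partial[OF P, of b]]]
    sum_squares_bound[of "l2_norm L (gr y \<nu> b)" "l2_norm L (partial b ?p)"] by (simp add: l2_norm_sq[of L "partial b ?p"])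
 qed
 also have "... = (G + (\<Sum>b\<in>Basis. (l2_norm L (partial b ?p))^2)) / 2" by (simp add: G_def sum.distrib sum_divide_distrib[symmetric])
 finally have "(\<Sum>b\<in>Basis. (l2_norm L (partial b ?p))^2) \<le> G" by simp
 also have "... \<le> \<alpha>^2" unfolding \<alpha>(2) by simp
 finally have "(\<Sum>b\<in>Basis. (l2_norm L (partial b ?p))^2) \<le> \<alpha>^2" .
 then have "sqrt (\<Sum>b\<in>Basis. (l2_norm L (partial b ?p))^2) \<le> \<alpha>" using \<alpha>(1) by (simp add: real_le_lsqrt)
 then have pa: "bn (\<lambda>F x. ?p x - l2_proj L k ?p x) \<le> C1 * s * \<alpha>"
  by (rule order_trans[OF C1(2)[OF P] mult_left_mono]) (use C1(1) s(1) in simp)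
 \<comment> \<open>The jump is the stabilization residual plus the face projection minus the element
   projection of the potential. The first is part of the energy norm, the second is bounded through
   \<open>C1\<close>.\<close>
 have "bn (\<lambda>F x. \<nu> F x - y x) = bn (\<lambda>F x. St y \<nu> F x + (l2_proj (face_measure F) k ?p x - l2_proj L k ?p x))"
  by (simp add: delta_face_def delta_elem_def)
 also have "... \<le> bn (St y \<nu>) + bn (\<lambda>F x. l2_proj (face_measure F) k ?p x - l2_proj L k ?p x)"
  by (intro bn_add S bsq_diff Q(1) bsq_poly[OF Q(2)])
 also have "... \<le> s * \<alpha> + C1 * s * \<alpha>"
  by (intro add_mono aS order_trans[OF face_proj_le[OF bsq_poly[OF P] Q(2)] pa])
 finally have jump: "bn (\<lambda>F x. \<nu> F x - y x) \<le> (1 + C1) * s * \<alpha>" by (simp add: algebra_simps)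
 have face: "bi (nt b (potential.\<eta> b)) (\<lambda>F x. \<nu> F x - y x) \<le> (1 + C1) * B * \<alpha>" if b: "b \<in> Basis" for b
 proof -
  note e = potential.eta_bsq[OF b]
  have "bi (nt b (potential.\<eta> b)) (\<lambda>F x. \<nu> F x - y x) \<le> (B / s) * ((1 + C1) * s * \<alpha>)"
   by (rule order_trans[OF abs_ge_self order_trans[OF bi_cs[OF normal_weight(1)[OF e b] bsq_diff[OF \<nu> yb]]
     mult_mono[OF order_trans[OF normal_weight(2)[OF e b] potential.eta_le[OF b]] jump]]]) (use B s(1) in simp_all)
  then show ?thesis using s(1) by (simp add: mult_ac)
 qed
 have stab: "- (real k / h * bi (St A \<nu>I) (St y \<nu>)) \<le> C2 * B * \<alpha>"
 proof -
  have "\<bar>bi (St A \<nu>I) (St y \<nu>)\<bar> \<le> (C2 * (s * B)) * (s * \<alpha>)"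
   by (rule order_trans[OF bi_cs[OF SI S] mult_mono[OF St_interpolant aS order_trans[OF bn_nonneg St_interpolant]]]) simp
  then have "- bi (St A \<nu>I) (St y \<nu>) \<le> s^2 * (C2 * B * \<alpha>)" by (simp add: power2_eq_square mult_ac)
  then show ?thesis using s(1) unfolding kh by (simp add: field_simps)
 qed
 have split: "- l2_inner L (w b b) y + bi (nt b (\<gamma>' b)) \<nu> - l2_inner L (gr A \<nu>I b) (gr y \<nu> b)
   = bi (nt b (potential.\<eta> b)) (\<lambda>F x. \<nu> F x - y x)" if b: "b \<in> Basis" for b
 proof -
  let ?n = "\<lambda>F x. (nrm F \<bullet> b) * \<gamma>' b F x" and ?m = "\<lambda>F x. (nrm F \<bullet> b) * ?g b x"
  note n = normal_weight(1)[OF greenD(2)[OF v[OF b]] b] normal_weight(1)[OF gb[OF b] b]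
  have "l2_inner L (gr A \<nu>I b) (gr y \<nu> b) = R y \<nu> b (?g b)"
   by (simp add: gr_interpolant[OF b] l2_inner_commute[of L "?g b"] grad_rec_inner[OF y \<nu> b gp[OF b]])
  also have "... = l2_inner L (v b) (partial b y) + bi ?m (\<lambda>F x. \<nu> F x - y x)"
   unfolding R_def l2_inner_commute[of L "partial b y"] bi_shift bi_commute[of "\<lambda>F x. \<nu> F x - y x"]
   using proj_inner[OF greenD(3)[OF u b] poly_le[OF poly_partial[OF y]], of k b] by simp
  also have "bi ?m (\<lambda>F x. \<nu> F x - y x) = bi ?n (\<lambda>F x. \<nu> F x - y x) - bi (nt b (potential.\<eta> b)) (\<lambda>F x. \<nu> F x - y x)"
   unfolding potential.\<eta>_def right_diff_distrib[of "_ \<bullet> _" "\<gamma>' _ _ _"] bi_diff_left[OF n bsq_diff[OF \<nu> yb]] by simp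
  also have "bi ?n (\<lambda>F x. \<nu> F x - y x) = bi ?n \<nu> - bi ?n (\<lambda>F. y)"
   unfolding bi_commute[of ?n] by (rule bi_diff_left[OF \<nu> yb n(1)])
  finally show ?thesis using greenD(4)[OF v[OF b] b smooth_poly[OF y]] by simp
 qed
 have "(\<Sum>b\<in>Basis. - l2_inner L (w b b) y + bi (nt b (\<gamma>' b)) \<nu> - l2_inner L (gr A \<nu>I b) (gr y \<nu> b)) \<le> (\<Sum>b\<in>(Basis::'a set). (1 + C1) * B * \<alpha>)"
  by (rule sum_mono) (simp only: split face)
 then have "(\<Sum>b\<in>Basis. - l2_inner L (w b b) y) + (\<Sum>b\<in>Basis. bi (nt b (\<gamma>' b)) \<nu>) - local_form k Fh T A \<nu>I y \<nu>
   \<le> real DIM('a) * ((1 + C1) * B * \<alpha>) + C2 * B * \<alpha>"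
  unfolding form_eq[OF A \<nu>I y \<nu>] sum.distrib sum_subtractf sum_constant using stab by linarith
 then show ?thesis unfolding \<alpha>_def[symmetric] by (simp only: algebra_simps)
qed

end

section \<open>The error estimate\<close>

lemma weak_grad_inner: "b \<in> Basis ==> weak_grad D v x \<bullet> b = weak_deriv D {#b#} v x"
 by (simp add: weak_grad_def inner_sum_left inner_Basis if_distrib cong: if_cong)

lemma (in convex_domain) weak_grad_l2_inner:
 assumes "\<And>b. b \<in> Basis ==> has_weak_deriv D {#b#} v (g b)" "\<And>b. b \<in> Basis ==> has_weak_deriv D {#b#} w (g' b)"
 shows "l2_inner L (weak_grad D v) (weak_grad D w) = (\<Sum>b\<in>Basis. l2_inner L (g b) (g' b))"
proof -
 note s = weak_deriv_L2[OF assms(1)] weak_deriv_L2[OF assms(2)]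
 have "l2_inner L (weak_grad D v) (weak_grad D w) = (\<Sum>b\<in>Basis. l2_inner L (\<lambda>x. weak_grad D v x \<bullet> b) (\<lambda>x. weak_grad D w x \<bullet> b))"
  by (intro l2_inner_vec) (simp_all add: weak_grad_inner s)
 also have "... = (\<Sum>b\<in>Basis. l2_inner L (g b) (g' b))"
  using weak_deriv_AE[OF assms(1)] weak_deriv_AE[OF assms(2)] s has_weak_derivD(1)[OF assms(1)] has_weak_derivD(1)[OF assms(2)]
  by (intro sum.cong refl l2_inner_cong_AE) (simp_all add: weak_grad_inner L2_measurable)
 finally show ?thesis .
qed

lemma (in convex_domain) sobolev_2D:
 assumes u: "u \<in> sobolev 2 D" and i: "i \<in> Basis" and l: "l \<in> Basis"
 shows "has_weak_deriv D {#l#} u (weak_deriv D {#l#} u)" "weak_deriv D {#l#} u \<in> sobolev 1 D"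
  and "has_weak_deriv D {#i#} (weak_deriv D {#l#} u) (weak_deriv D {#l, i#} u)"
proof -
 have w: "has_weak_deriv D \<alpha> u (weak_deriv D \<alpha> u)" if "\<alpha> \<in> multi_indices 2" for \<alpha>
  using u that has_weak_deriv_weak_deriv unfolding sobolev_def by blast
 show h: "has_weak_deriv D {#l#} u (weak_deriv D {#l#} u)" by (rule w) (use l in \<open>simp add: multi_indices_def\<close>)
 show "weak_deriv D {#l#} u \<in> sobolev 1 D"
  by (rule sobolev_partial(1)[OF _ h l]) (use u in \<open>simp add: numeral_2_eq_2\<close>)
 show "has_weak_deriv D {#i#} (weak_deriv D {#l#} u) (weak_deriv D {#l, i#} u)"
  by (rule weak_deriv_deriv[OF w h l]) (use i l in \<open>auto simp: multi_indices_def\<close>)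
qed

lemma test_function_sobolev_10:
 assumes "test_function D \<phi>" "convex_domain D" shows "\<phi> \<in> sobolev_10 D"
proof -
 interpret convex_domain D by fact
 note sm = test_function_smooth[OF assms(1)]
 have "(\<lambda>n::nat. h1_dist D \<phi> \<phi>) \<longlonglongrightarrow> 0"
  unfolding sobolev_norm_diff_self[OF sm] by (rule tendsto_const)
 then show ?thesis unfolding sobolev_10_def using assms(1) smooth_sobolev[OF sm] by (intro CollectI conjI exI[of _ "\<lambda>_. \<phi>"]) simp_all
qed

text \<open>For u in H^2 the gradient can be differentiated weakly once more, so testing the
  equation with test functions identifies f pointwise.\<close>

lemma weak_solution_laplacian:
 assumes D: "convex_domain D" and f: "L2 (lebesgue_on D) f" and u: "weak_solution D f u" "u \<in> sobolev 2 D"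
 shows "AE x in lebesgue_on D. f x = (\<Sum>b\<in>Basis. - weak_deriv D {#b, b#} u x)"
proof -
 interpret convex_domain D by fact
 let ?w = "\<lambda>b. weak_deriv D {#b, b#} u" and ?v = "\<lambda>b. weak_deriv D {#b#} u"
 note d = sobolev_2D[OF u(2)]
 have w: "L2 L (\<lambda>x. - ?w b x)" if "b \<in> Basis" for b
  by (intro L2_minus has_weak_derivD(1)[OF d(3)[OF that that]])
 have "AE x in L. f x - (\<Sum>b\<in>Basis. - ?w b x) = 0"
 proof (rule fundamental_lemma)
  show "L2 L (\<lambda>x. f x - (\<Sum>b\<in>Basis. - ?w b x))" by (intro L2_diff L2_sum f w)
  fix \<phi> assume \<phi>: "test_function D \<phi>"
  note sm = test_function_smooth[OF \<phi>]
  have "l2_inner L f \<phi> = l2_inner L (weak_grad D u) (weak_grad D \<phi>)"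
   using u(1) test_function_sobolev_10[OF \<phi> D] unfolding weak_solution_def by simp
  also have "... = (\<Sum>b\<in>Basis. l2_inner L (?v b) (partial b \<phi>))"
   by (intro weak_grad_l2_inner d(1) has_weak_deriv_smooth[OF sm])
  also have "... = (\<Sum>b\<in>Basis. l2_inner L (\<lambda>x. - ?w b x) \<phi>)"
  proof (rule sum.cong[OF refl])
   fix b :: 'a assume b: "b \<in> Basis"
   show "l2_inner L (?v b) (partial b \<phi>) = l2_inner L (\<lambda>x. - ?w b x) \<phi>"
    using has_weak_derivD(2)[OF d(3)[OF b b] \<phi>, of "[b]"] by (simp add: iter_deriv_Cons_partial)
  qed
  finally show "l2_inner L (\<lambda>x. f x - (\<Sum>b\<in>Basis. - ?w b x)) \<phi> = 0"
   by (simp add: l2_inner_diff_left[OF f L2_sum[OF w] test_L2[OF \<phi>]]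
     l2_inner_sum_left[OF finite_Basis w test_L2[OF \<phi>]] del: l2_inner_minus_left)
 qed
 then show ?thesis by simp
qed

text \<open>The inequality for r is strict because the supremum in \<open>inradius\<close> is not
  shown to be attained.\<close>

lemma inradius_ball:
 assumes T: "open T" "convex T" and S: "S \<noteq> {}" "S \<subseteq> closure T" and r: "r < inradius S"
 shows "\<exists>a. ball a r \<subseteq> T"
proof -
 obtain x where "x \<in> S" using S(1) by blast
 then have ne: "{r. 0 \<le> r \<and> (\<exists>x. cball x r \<subseteq> S)} \<noteq> {}" by (auto intro!: exI[of _ 0] exI[of _ x])
 obtain t a where t: "cball a t \<subseteq> S" "r < t" using less_cSupD[OF ne r[unfolded inradius_def]] by blast
 have "ball a r \<subseteq> closure T" using t S(2) by (auto simp: subset_iff)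
 then have "ball a r \<subseteq> interior (closure T)" by (rule interior_maximal) simp
 then show ?thesis using convex_interior_closure[OF T(2)] T(1) by (auto simp: interior_open)
qed

context mesh
begin

text \<open>Any simplex S of the submesh that meets T lies in its closure and has inradius at least
  \<rho> h_S, hence at least \<rho>^2 h_T. The factor 1/2 makes the strict inequality of
  \<open>inradius_ball\<close> available.\<close>

lemma regular_ball:
 assumes reg: "regular_mesh \<rho> \<Omega> Th Fh" and \<rho>: "0 < \<rho>" and T: "T \<in> Th"
 shows "\<exists>a. ball a (\<rho>^2 / 2 * diameter T) \<subseteq> T"
proof -
 interpret pe: element \<Omega> Th Fh T by unfold_locales (rule T)
 from reg obtain Sh where cov: "\<Union>Sh = closure \<Omega>" and uni: "\<forall>S\<in>Sh. \<exists>!T. T \<in> Th \<and> S \<subseteq> closure T"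
  and ir: "\<forall>S\<in>Sh. \<rho> * diameter S \<le> inradius S" and di: "\<forall>S\<in>Sh. \<forall>T\<in>Th. S \<subseteq> closure T \<longrightarrow> \<rho> * diameter T \<le> diameter S"
  unfolding regular_mesh_def by (elim conjE exE) (rule that)
 obtain x where x: "x \<in> T" using elem(4)[OF T] by blast
 then have "x \<in> \<Union>Sh" using elem_subset[OF T] closure_subset unfolding cov by blast
 then obtain S where S: "S \<in> Sh" "x \<in> S" by blast
 obtain T' where T': "T' \<in> Th" "S \<subseteq> closure T'" using uni S(1) by blast
 have "T' = T"
 proof (rule ccontr)
  assume "T' \<noteq> T"
  then have "T \<inter> closure T' = {}" using elem_disjoint[OF T T'(1)] open_Int_closure_eq_empty[OF elem(1)[OF T]] by blast
  then show False using x S T'(2) by blast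
 qed
 then have ST: "S \<subseteq> closure T" using T'(2) by simp
 have h: "0 < diameter T" by (rule pe.diameter_pos)
 have "\<rho>^2 / 2 * diameter T < \<rho> * (\<rho> * diameter T)" using \<rho> h by (simp add: power2_eq_square)
 also have "... \<le> \<rho> * diameter S" using di S(1) T ST \<rho> by (intro mult_left_mono) auto
 also have "... \<le> inradius S" using ir S(1) by blast
 finally show ?thesis using S(2) ST elem(1,2)[OF T] by (intro inradius_ball) auto
qed

lemma glue_inner:
 assumes f: "L2 (lebesgue_on \<Omega>) f" and y: "\<And>T. T \<in> Th ==> smooth_fun (y T)"
 shows "l2_inner (lebesgue_on \<Omega>) f (glue Th y) = (\<Sum>T\<in>Th. l2_inner (lebesgue_on T) f (y T))"
proof -
 interpret O: convex_domain \<Omega> by (rule domain_\<Omega>)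
 have sq: "L2 O.L (\<lambda>x. indicat_real T x * y T x)" if T: "T \<in> Th" for T
 proof (rule L2_bounded_mult[OF O.smooth_L2[OF y[OF T]]])
  show "indicat_real T \<in> borel_measurable O.L"
   using elem(1)[OF T] by (intro lebesgue_on_measurable_borel borel_measurable_indicator) auto
  show "AE x in O.L. \<bar>indicat_real T x\<bar> \<le> 1" by (simp add: indicator_def)
 qed
 have "l2_inner O.L f (\<lambda>x. indicat_real T x * y T x) = l2_inner (lebesgue_on T) f (y T)" if T: "T \<in> Th" for T
 proof -
  note D = convex_domain.Dl[OF domain_elem[OF T]]
  have "l2_inner O.L f (\<lambda>x. indicat_real T x * y T x) = l2_inner (lebesgue_on T) f (\<lambda>x. indicat_real T x * y T x)"
   by (rule l2_inner_subdomain[OF elem_subset[OF T] O.Dl D]) simp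
  also have "... = l2_inner (lebesgue_on T) f (y T)"
   unfolding l2_inner_real by (rule Bochner_Integration.integral_cong) auto
  finally show ?thesis .
 qed
 then show ?thesis unfolding glue_def by (subst l2_inner_sum_right) (simp_all add: finite_Th sq f)
qed

text \<open>After exchanging the sums an interior face occurs twice, with opposite normals and the
  same g and \<nu>; on a boundary face \<nu> is zero. Here g is single-valued because the traces are
  taken from \<Omega>.\<close>

lemma normal_flux_cancel:
 fixes \<nu> :: "'a set => 'a => real"
 assumes \<nu>: "\<And>F. F \<in> Fh ==> F \<subseteq> frontier \<Omega> ==> \<nu> F = (\<lambda>x. 0)"
 shows "(\<Sum>T\<in>Th. \<Sum>F\<in>elem_faces Fh T. (outward_normal T F \<bullet> b) * l2_inner (face_measure F) (g F) (\<nu> F)) = (0::real)"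
proof -
 let ?f = "\<lambda>T F. (outward_normal T F \<bullet> b) * l2_inner (face_measure F) (g F) (\<nu> F)"
 have "(\<Sum>T\<in>Th. \<Sum>F\<in>elem_faces Fh T. ?f T F) = (\<Sum>T\<in>Th. \<Sum>F\<in>{F\<in>Fh. F \<in> elem_faces Fh T}. ?f T F)"
  by (intro sum.cong refl) (auto simp: elem_faces_iff)
 also have "... = (\<Sum>F\<in>Fh. \<Sum>T\<in>{T\<in>Th. F \<in> elem_faces Fh T}. ?f T F)"
  by (rule sum.swap_restrict[OF finite_Th finite_Fh])
 also have "... = 0"
 proof (rule sum.neutral, rule ballI)
  fix F assume F: "F \<in> Fh"
  show "(\<Sum>T\<in>{T\<in>Th. F \<in> elem_faces Fh T}. ?f T F) = 0"
  proof (cases rule: face_cases[OF F])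
   case (1 T1 T2)
   then show ?thesis by (simp only: 1(4) sum.insert finite.intros) (simp add: 1(5) 1(3))
  next
   case (2 T1)
   then show ?thesis using \<nu>[OF F 2(3)] by (simp only: 2(2)) simp
  qed
 qed
 finally show ?thesis .
qed

end

context element
begin

lemma bn_cong_AE:
 assumes "\<And>F. F \<in> faces ==> AE x in face_measure F. \<phi> F x = \<psi> F x" "bsq \<phi>" "bsq \<psi>"
 shows "bn \<phi> = bn \<psi>"
 unfolding bn_def
 by (intro arg_cong[where f=sqrt] sum.cong refl arg_cong[where f="\<lambda>t. t^2"] l2_norm_cong_AE)
   (use assms in \<open>auto dest: bsqD L2_measurable\<close>)

lemma domain_trace:
 assumes v: "v \<in> sobolev 1 \<Omega>"
 shows "bsq (\<lambda>F. trace \<Omega> F v)" "v \<in> sobolev 1 T" "bsq (\<lambda>F. trace T F v)"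
  and "F \<in> faces ==> AE x in face_measure F. trace T F v x = trace \<Omega> F v x"
  and "bn (\<lambda>F x. trace \<Omega> F v x - l2_proj L j v x) = bd_proj_error Fh T j v"
proof -
 show vT: "v \<in> sobolev 1 T" by (rule convex_domain_subdomain(1)[OF domain_\<Omega> domain_elem[OF T] elem_subset[OF T] v])
 show b: "bsq (\<lambda>F. trace \<Omega> F v)" "bsq (\<lambda>F. trace T F v)"
  using trace_domain(2)[OF v] trace_L2[OF vT] by (simp_all add: bsq_def)
 show ae: "F \<in> faces ==> AE x in face_measure F. trace T F v x = trace \<Omega> F v x" for F by (rule trace_domain(3)[OF v])
 have "bn (\<lambda>F x. trace \<Omega> F v x - l2_proj L j v x) = bn (\<lambda>F x. trace T F v x - l2_proj L j v x)"
 proof (rule bn_cong_AE)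
  show "AE x in face_measure F. trace \<Omega> F v x - l2_proj L j v x = trace T F v x - l2_proj L j v x" if "F \<in> faces" for F
   using ae[OF that] by eventually_elim simp
 qed (intro bsq_diff b bsq_poly[OF proj_poly[OF sobolev_1D(1)[OF vT]]])+
 then show "bn (\<lambda>F x. trace \<Omega> F v x - l2_proj L j v x) = bd_proj_error Fh T j v" by (simp add: bn_def bd_proj_error_def)
qed

lemma green_domain:
 assumes v: "v \<in> sobolev 1 \<Omega>" and g: "\<And>b. b \<in> Basis ==> has_weak_deriv \<Omega> {#b#} v (g b)"
 shows "green v (\<lambda>F. trace \<Omega> F v) g"
proof -
 note d = domain_trace[OF v]
 have "green v (\<lambda>F. trace T F v) g"
  by (intro green_sobolev d(2) has_weak_deriv_subdomain[OF elem_subset[OF T] convex_domain.Dl[OF domain_\<Omega>] Dl g]) auto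
 moreover have "bi (\<lambda>F x. (nrm F \<bullet> b) * trace T F v x) (\<lambda>F. q) = bi (\<lambda>F x. (nrm F \<bullet> b) * trace \<Omega> F v x) (\<lambda>F. q)"
  if b: "b \<in> Basis" and q: "smooth_fun q" for b q
 proof (rule bi_cong_AE)
  show "AE x in face_measure F. (nrm F \<bullet> b) * trace T F v x = (nrm F \<bullet> b) * trace \<Omega> F v x" if "F \<in> faces" for F
   using d(4)[OF that] by eventually_elim simp
 qed (intro normal_weight d b bsq_smooth q)+
 ultimately show ?thesis unfolding green_def using d(1) by simp
qed

text \<open>The gradient form of the trace assumption at m = 1, which bears only on the gradient and
  so fits the energy norm.\<close>

lemma trace_approx_poly:
 assumes C: "trace_approximation C Fh T" and k: "1 \<le> k" and p: "p \<in> poly_space j"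
 shows "bn (\<lambda>F x. p x - l2_proj L k p x) \<le> \<bar>C 1\<bar> * sqrt (diameter T / real k) * sqrt (\<Sum>b\<in>Basis. (l2_norm L (partial b p))^2)"
proof -
 note sm = smooth_poly[OF p]
 note sp = smooth_sobolev[OF sm]
 have "bn (\<lambda>F x. p x - l2_proj L k p x) = bn (\<lambda>F x. trace T F p x - l2_proj L k p x)"
 proof (rule bn_cong_AE)
  show "AE x in face_measure F. p x - l2_proj L k p x = trace T F p x - l2_proj L k p x" if "F \<in> faces" for F
   using trace_smooth[OF that sm] by eventually_elim simp
  have "bsq (\<lambda>F. trace T F p)" by (simp add: bsq_def trace_L2[OF sp])
  then show "bsq (\<lambda>F x. p x - l2_proj L k p x)" "bsq (\<lambda>F x. trace T F p x - l2_proj L k p x)"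
   by (intro bsq_diff bsq_poly[OF proj_poly[OF poly_sq[OF p]]] bsq_poly[OF p]; assumption)+
 qed
 also have "... = bd_proj_error Fh T k p" by (simp add: bn_def bd_proj_error_def)
 also have "... \<le> C 1 * (diameter T / real k) powr (1/2) * l2_norm L (weak_grad T p)"
  using C k sp unfolding trace_approximation_def by fastforce
 also have "... \<le> \<bar>C 1\<bar> * (diameter T / real k) powr (1/2) * l2_norm L (weak_grad T p)"
  by (intro mult_right_mono) auto
 also have "l2_norm L (weak_grad T p) = sqrt (\<Sum>b\<in>Basis. (l2_norm L (partial b p))^2)"
  by (simp only: l2_norm_def[of L "weak_grad T p"] l2_norm_sq weak_grad_l2_inner[OF has_weak_deriv_smooth[OF sm] has_weak_deriv_smooth[OF sm]])
 finally show ?thesis using elem(3)[OF T] by (simp add: powr_half_sqrt diameter_ge_0)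
qed

text \<open>Allows projection degrees j above k at the price of h/k in place of h/j. Absolute values
  appear because nothing is assumed about the sign of \<open>C\<close>.\<close>

lemma trace_approx_sobolev:
 assumes C: "trace_approximation C Fh T" and k: "1 \<le> k" "k \<le> j" and \<mu>: "1 \<le> \<mu>" "\<mu> \<le> k + 1" and v: "v \<in> sobolev \<mu> T"
 shows "bd_proj_error Fh T j v \<le> \<bar>C \<mu>\<bar> * (diameter T / real k) powr (real \<mu> - 1/2) * sobolev_norm \<mu> T v"
proof -
 have n: "0 \<le> sobolev_norm \<mu> T v" by (simp add: sobolev_norm_def sum_nonneg)
 have h: "0 \<le> diameter T" using elem(3)[OF T] by (rule diameter_ge_0)
 have "bd_proj_error Fh T j v \<le> C \<mu> * (diameter T / real j) powr (real \<mu> - 1/2) * sobolev_norm \<mu> T v"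
  using C k \<mu> v unfolding trace_approximation_def by fastforce
 also have "... \<le> \<bar>C \<mu>\<bar> * (diameter T / real k) powr (real \<mu> - 1/2) * sobolev_norm \<mu> T v"
  using k \<mu> h n by (intro mult_right_mono mult_mono powr_mono2 divide_left_mono) auto
 finally show ?thesis .
qed

end

lemma sobolev_2_1: "u \<in> sobolev 2 D ==> u \<in> sobolev 1 D"
 unfolding sobolev_def by (auto simp: multi_indices_def)

text \<open>B is of order (h/k)^(m - 1) times the H^m norm on T. The trace assumption with m gives
  exponent m - 1/2 for u, that is s B, and with m - 1 it gives exponent m - 3/2 for the gradient,
  that is B / s.\<close>

lemma (in mesh) hho_estimate_regular:
 assumes T: "T \<in> Th" and C: "trace_approximation C Fh T" and \<kappa>: "0 < \<kappa>" "ball a (\<kappa> * diameter T) \<subseteq> T"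
  and m: "2 \<le> m" "m \<le> k + 1" and u: "u \<in> sobolev 2 \<Omega>" "u \<in> sobolev m T"
 shows "hho_estimate \<Omega> Th Fh T k a \<kappa> u (\<lambda>F. trace \<Omega> F u) (\<lambda>b. weak_deriv \<Omega> {#b#} u)
  (\<lambda>l F. trace \<Omega> F (weak_deriv \<Omega> {#l#} u)) (\<lambda>l i. weak_deriv \<Omega> {#l, i#} u) (sqrt (diameter T / real k))
  ((\<bar>C m\<bar> + \<bar>C (m - 1)\<bar>) * (diameter T / real k) ^ (m - 1) * sobolev_norm m T u) \<bar>C 1\<bar>"
proof -
 interpret element \<Omega> Th Fh T by unfold_locales (rule T)
 interpret O: convex_domain \<Omega> by (rule domain_\<Omega>)
 define \<theta> where "\<theta> = diameter T / real k"
 define U where "U = sobolev_norm m T u"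
 have k: "1 \<le> k" using m by simp
 have \<theta>: "0 < \<theta>" using diameter_pos k by (simp add: \<theta>_def)
 have U: "0 \<le> U" by (simp add: U_def sobolev_norm_def sum_nonneg)
 note d = O.sobolev_2D[OF u(1)] and u1 = sobolev_2_1[OF u(1)]
 have "real m - 1/2 = 1/2 + real (m - 1)" using m by (simp add: of_nat_diff)
 then have pm: "\<theta> powr (real m - 1/2) = sqrt \<theta> * \<theta> ^ (m - 1)"
  using \<theta> by (simp only: powr_add powr_half_sqrt[OF less_imp_le] powr_realpow)
 have pm': "\<theta> powr (real (m - 1) - 1/2) = \<theta> ^ (m - 1) / sqrt \<theta>"
  using \<theta> by (simp only: powr_diff powr_half_sqrt[OF less_imp_le] powr_realpow)
 have v: "weak_deriv \<Omega> {#l#} u \<in> sobolev (m - 1) T" "sobolev_norm (m - 1) T (weak_deriv \<Omega> {#l#} u) \<le> U" if l: "l \<in> Basis" for l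
 proof -
  have "has_weak_deriv T {#l#} u (weak_deriv \<Omega> {#l#} u)"
   by (rule has_weak_deriv_subdomain[OF elem_subset[OF T] O.Dl Dl d(1)[OF l l]]) (use l in simp)
  with u(2) show "weak_deriv \<Omega> {#l#} u \<in> sobolev (m - 1) T" "sobolev_norm (m - 1) T (weak_deriv \<Omega> {#l#} u) \<le> U"
   unfolding U_def using sobolev_partial[of u "m - 1" l] m l by simp_all
 qed
 show ?thesis
  unfolding \<theta>_def[symmetric] U_def[symmetric]
 proof unfold_locales
  show "1 \<le> k" "0 < \<kappa>" "ball a (\<kappa> * diameter T) \<subseteq> T" "0 < sqrt \<theta>" "0 \<le> \<bar>C 1\<bar>" using k \<kappa> \<theta> by auto
  show "(sqrt \<theta>)^2 * real k = diameter T" using \<theta> k by (simp add: \<theta>_def)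
  show "0 \<le> (\<bar>C m\<bar> + \<bar>C (m - 1)\<bar>) * \<theta> ^ (m - 1) * U" using \<theta> U by simp
  show "green u (\<lambda>F. trace \<Omega> F u) (\<lambda>b. weak_deriv \<Omega> {#b#} u)" by (intro green_domain u1 d(1))
  \<comment> \<open>Both orders of differentiation are the same multiset, so the same weak
    derivative is chosen.\<close>
  show "weak_deriv \<Omega> {#l, i#} u = weak_deriv \<Omega> {#i, l#} u" for l i by (simp add: add_mset_commute)
  show "bn (\<lambda>F x. p x - l2_proj L k p x) \<le> \<bar>C 1\<bar> * sqrt \<theta> * sqrt (\<Sum>b\<in>Basis. (l2_norm L (partial b p))^2)"
   if "p \<in> poly_space (Suc k)" for p unfolding \<theta>_def by (rule trace_approx_poly[OF C k that])
  { fix j assume "j \<in> {k, Suc k}"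
   then have j: "k \<le> j" by auto
   have "bn (\<lambda>F x. trace \<Omega> F u x - l2_proj L j u x) \<le> \<bar>C m\<bar> * (sqrt \<theta> * \<theta> ^ (m - 1)) * U"
    using trace_approx_sobolev[OF C k j _ _ u(2)] m by (simp add: domain_trace(5)[OF u1] \<theta>_def[symmetric] pm U_def)
   also have "... = sqrt \<theta> * (\<bar>C m\<bar> * \<theta> ^ (m - 1) * U)" by (simp only: mult_ac)
   also have "... \<le> sqrt \<theta> * ((\<bar>C m\<bar> + \<bar>C (m - 1)\<bar>) * \<theta> ^ (m - 1) * U)"
    using \<theta> U by (intro mult_left_mono mult_right_mono) auto
   finally show "bn (\<lambda>F x. trace \<Omega> F u x - l2_proj L j u x) \<le> sqrt \<theta> * ((\<bar>C m\<bar> + \<bar>C (m - 1)\<bar>) * \<theta> ^ (m - 1) * U)" . }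
  fix l :: 'a assume l: "l \<in> Basis"
  show "green (weak_deriv \<Omega> {#l#} u) (\<lambda>F. trace \<Omega> F (weak_deriv \<Omega> {#l#} u)) (\<lambda>i. weak_deriv \<Omega> {#l, i#} u)"
   by (rule green_domain[OF d(2)[OF l l] d(3)[OF _ l]])
  fix j assume "j \<in> {k, Suc k, Suc (Suc k)}"
  then have j: "k \<le> j" by auto
  have "bn (\<lambda>F x. trace \<Omega> F (weak_deriv \<Omega> {#l#} u) x - l2_proj L j (weak_deriv \<Omega> {#l#} u) x)
    \<le> \<bar>C (m - 1)\<bar> * (\<theta> ^ (m - 1) / sqrt \<theta>) * sobolev_norm (m - 1) T (weak_deriv \<Omega> {#l#} u)"
   using trace_approx_sobolev[OF C k j _ _ v(1)[OF l]] m unfolding domain_trace(5)[OF d(2)[OF l l]] \<theta>_def[symmetric] pm' by simp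
  also have "... \<le> (\<bar>C m\<bar> + \<bar>C (m - 1)\<bar>) * (\<theta> ^ (m - 1) / sqrt \<theta>) * U"
   using \<theta> U v(2)[OF l] by (intro mult_mono) (auto simp: sobolev_norm_def sum_nonneg)
  finally show "bn (\<lambda>F x. trace \<Omega> F (weak_deriv \<Omega> {#l#} u) x - l2_proj L j (weak_deriv \<Omega> {#l#} u) x)
    \<le> (\<bar>C m\<bar> + \<bar>C (m - 1)\<bar>) * \<theta> ^ (m - 1) * U / sqrt \<theta>" by simp
 qed
qed

lemma (in hho_element) form_nonneg:
 assumes "y \<in> poly_space j" "bsq \<nu>" shows "0 \<le> local_form k Fh T y \<nu> y \<nu>"
 unfolding form_eq[OF assms assms] bn_sq[symmetric] using diameter_pos by (intro add_nonneg_nonneg sum_nonneg) auto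

context hho_estimate
begin

lemma C2_eq: "C2 = 1 + sqrt ((4 + real DIM('a)) / \<kappa>) * (sqrt ((4 + real DIM('a)) / \<kappa>) + 2 + real DIM('a) * (4 + sqrt (5 * real DIM('a) ^ 3 / \<kappa>)))"
 unfolding C2_def potential.K1_def potential.K2_def ..

text \<open>\<open>\<nu>\<close> stands for the error on the faces in a form that is an admissible
  test function: it agrees with the difference of face unknowns almost everywhere but may vanish
  pointwise on boundary faces. The energy of the error is tested with this representative.\<close>

lemma error_bound:
 assumes y: "y \<in> poly_space k" and \<mu>: "bsq \<mu>" and \<nu>: "bsq \<nu>"
  and eq: "\<And>F. F \<in> faces ==> AE x in face_measure F. \<mu> F x - \<nu>I F x = \<nu> F x"
 defines "e \<equiv> \<lambda>x. y x - A x"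
 defines "en \<equiv> local_form k Fh T e (\<lambda>F x. \<mu> F x - \<nu>I F x) e (\<lambda>F x. \<mu> F x - \<nu>I F x)"
 shows "0 \<le> en" and "en \<le> local_form k Fh T y \<mu> e \<nu> - (\<Sum>b\<in>Basis. - l2_inner L (w b b) e)
   - (\<Sum>b\<in>Basis. bi (nt b (\<gamma>' b)) \<nu>) + (real DIM('a) * (1 + C1) + C2) * B * sqrt en"
proof -
 have e: "e \<in> poly_space k" unfolding e_def by (rule poly_diff[OF y A])
 note d = bsq_diff[OF \<mu> \<nu>I]
 show "0 \<le> en" unfolding en_def by (rule form_nonneg[OF e d])
 have en: "en = local_form k Fh T e (\<lambda>F x. \<mu> F x - \<nu>I F x) e \<nu>"
  unfolding en_def form_commute[of e _ e \<nu>] by (rule form_cong[OF e d \<nu> e d eq])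
 also have "... = local_form k Fh T y \<mu> e \<nu> - local_form k Fh T A \<nu>I e \<nu>"
  unfolding e_def by (rule form_diff[OF y A \<mu> \<nu>I e[unfolded e_def] \<nu>])
 finally have split: "en = ..." .
 have "en = local_form k Fh T e \<nu> e \<nu>" unfolding en by (rule form_cong[OF e d \<nu> e \<nu> eq])
 with consistency[OF e \<nu>] split show "en \<le> local_form k Fh T y \<mu> e \<nu> - (\<Sum>b\<in>Basis. - l2_inner L (w b b) e)
   - (\<Sum>b\<in>Basis. bi (nt b (\<gamma>' b)) \<nu>) + (real DIM('a) * (1 + C1) + C2) * B * sqrt en" by simp
qed

end

lemma (in element) interpolant_boundary:
 assumes u: "u \<in> sobolev_10 \<Omega>" and F: "F \<in> faces" "F \<subseteq> frontier \<Omega>"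
 shows "AE x in face_measure F. l2_proj (face_measure F) k (trace \<Omega> F u) x = 0"
proof -
 have u1: "u \<in> sobolev 1 \<Omega>" using u unfolding sobolev_10_def by blast
 let ?M = "face_measure F"
 note M = poly_measure_face[OF F(1)] and t = trace_domain[OF u1 F(1)]
 have "AE x in ?M. trace \<Omega> F u x = 0" using trace_zero[OF u F] t(3) by eventually_elim simp
 then have "l2_norm ?M (trace \<Omega> F u) = 0"
  using l2_norm_cong_AE[of "trace \<Omega> F u" "\<lambda>x. 0" ?M] L2_measurable[OF t(2)] by simp
 then have "l2_norm ?M (l2_proj ?M k (trace \<Omega> F u)) = 0"
  using l2_proj_norm_le[OF M t(2), of k] l2_norm_nonneg[of ?M "l2_proj ?M k (trace \<Omega> F u)"] by linarith
 then show ?thesis by (intro l2_norm_zero_AE poly_measureD[OF M l2_proj_poly[OF M t(2)]])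
qed

theorem theorem3p3:
  fixes \<Omega> :: "'a::euclidean_space set"
    and \<rho> C\<^sub>q\<^sub>u C\<^sub>e\<^sub>l\<^sub>l :: real and C\<^sub>t\<^sub>r :: "nat \<Rightarrow> real" and m :: nat
  assumes "DIM('a) = 2 \<or> DIM('a) = 3"
    and "open_polytope \<Omega>"
    and "0 < \<rho>" and "\<rho> < 1"
    and "elliptic_regularity C\<^sub>e\<^sub>l\<^sub>l \<Omega>"
    and "2 \<le> m"
  shows "\<exists>C>0. \<forall>k\<ge>m-1. \<forall>Th Fh.
    regular_mesh \<rho> \<Omega> Th Fh \<and> quasi_uniform C\<^sub>q\<^sub>u Th \<and>
    (\<forall>T\<in>Th. trace_approximation C\<^sub>t\<^sub>r Fh T \<and> elliptic_regularity C\<^sub>e\<^sub>l\<^sub>l T) \<longrightarrow>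
    (\<forall>f u u\<^sub>h \<mu>\<^sub>h.
       square_integrable (lebesgue_on \<Omega>) f \<and> weak_solution \<Omega> f u \<and>
       hho_solution k \<Omega> Th Fh f u\<^sub>h \<mu>\<^sub>h \<and> u \<in> broken_sobolev m \<Omega> Th \<longrightarrow>
       hho_norm k Th Fh (\<lambda>T x. u\<^sub>h T x - proj_elems k u T x, \<lambda>F x. \<mu>\<^sub>h F x - proj_faces k \<Omega> u F x)
         \<le> C * (mesh_size Th / real k) ^ (m - 1) * broken_norm m Th u)"
proof -
 \<comment> \<open>The relative radius from \<open>regular_ball\<close>, common to all elements and
   meshes.\<close>
 define \<kappa> where "\<kappa> = \<rho>^2 / 2"
 define d where "d = real DIM('a)"
 \<comment> \<open>The constant of \<open>consistency\<close> with \<open>C2\<close> written out as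
   in \<open>C2_eq\<close>, so that it visibly depends neither on the mesh nor on k.\<close>
 define K where "K = d * (1 + \<bar>C\<^sub>t\<^sub>r 1\<bar>) + (1 + sqrt ((4 + d) / \<kappa>) * (sqrt ((4 + d) / \<kappa>) + 2 + d * (4 + sqrt (5 * d ^ 3 / \<kappa>))))"
 define C0 where "C0 = \<bar>C\<^sub>t\<^sub>r m\<bar> + \<bar>C\<^sub>t\<^sub>r (m - 1)\<bar>"
 have \<kappa>: "0 < \<kappa>" using \<open>0 < \<rho>\<close> by (simp add: \<kappa>_def)
 have K: "0 \<le> K" using \<kappa> by (simp add: K_def d_def)
 have C0: "0 \<le> C0" by (simp add: C0_def)
 show ?thesis
 \<comment> \<open>The summand 1 only makes the constant positive.\<close>
 proof (intro exI[of _ "K * C0 + 1"] conjI allI impI; (elim conjE)?)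
  show "0 < K * C0 + 1" using K C0 by (simp add: add_nonneg_pos)
  fix k Th Fh f u u\<^sub>h \<mu>\<^sub>h
  assume k: "m - 1 \<le> k" and reg: "regular_mesh \<rho> \<Omega> Th Fh"
   and tr: "\<forall>T\<in>Th. trace_approximation C\<^sub>t\<^sub>r Fh T \<and> elliptic_regularity C\<^sub>e\<^sub>l\<^sub>l T"
   and f: "L2 (lebesgue_on \<Omega>) f" and sol: "weak_solution \<Omega> f u"
   and hho: "hho_solution k \<Omega> Th Fh f u\<^sub>h \<mu>\<^sub>h" and um: "u \<in> broken_sobolev m \<Omega> Th"
  interpret mesh \<Omega> Th Fh
   by unfold_locales (use assms(2) reg in \<open>simp_all add: regular_mesh_def\<close>)
  have u2: "u \<in> sobolev 2 \<Omega>" using assms(5) f sol unfolding elliptic_regularity_def by blast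
  have u10: "u \<in> sobolev_10 \<Omega>" using sol unfolding weak_solution_def by blast
  note u1 = sobolev_2_1[OF u2]
  let ?w = "\<lambda>b. weak_deriv \<Omega> {#b, b#} u"
  define B where "B T = C0 * (diameter T / real k) ^ (m - 1) * sobolev_norm m T u" for T
  define \<nu>I where "\<nu>I = proj_faces k \<Omega> u"
  define e where "e T x = u\<^sub>h T x - proj_elems k u T x" for T x
  \<comment> \<open>The face space requires zero at every point of a boundary face, whereas the
    chosen projection of the zero trace is zero only almost everywhere.\<close>
  define \<nu> where "\<nu> F = (if F \<subseteq> frontier \<Omega> then (\<lambda>x. 0) else (\<lambda>x. \<mu>\<^sub>h F x - \<nu>I F x))" for F
  define en where "en T = local_form k Fh T (e T) (\<lambda>F x. \<mu>\<^sub>h F x - \<nu>I F x) (e T) (\<lambda>F x. \<mu>\<^sub>h F x - \<nu>I F x)" for T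
  define flux where "flux T = (\<Sum>b\<in>Basis. \<Sum>F\<in>elem_faces Fh T. (outward_normal T F \<bullet> b) *
   l2_inner (face_measure F) (trace \<Omega> F (weak_deriv \<Omega> {#b#} u)) (\<nu> F))" for T
  have uh: "u\<^sub>h T \<in> poly_space k" if "T \<in> Th" for T using hho that by (simp add: hho_solution_def elem_space_def)
  have \<mu>h: "\<mu>\<^sub>h F \<in> poly_space k" if "F \<in> Fh" for F using hho that by (simp add: hho_solution_def face_space_def)
  have elem_of: "\<exists>T\<in>Th. F \<in> elem_faces Fh T" if "F \<in> Fh" for F using face_alternatives[OF that] that by (auto simp: elem_faces_iff)
  have \<nu>I: "\<nu>I F \<in> poly_space k" if F: "F \<in> Fh" for F
  proof -
   obtain T where T: "T \<in> Th" "F \<in> elem_faces Fh T" using elem_of[OF F] by blast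
   show ?thesis unfolding \<nu>I_def proj_faces_def by (rule l2_proj_poly[OF poly_measure_face[OF T(2)] element.trace_domain(2)[OF _ u1 T(2)]]) (unfold_locales, rule T)
  qed
  have \<nu>: "\<nu> F \<in> poly_space k" if "F \<in> Fh" for F using \<nu>I[OF that] \<mu>h[OF that] by (simp add: \<nu>_def poly_diff)
  have step: "e T \<in> poly_space k \<and> 0 \<le> en T \<and>
    en T \<le> local_form k Fh T (u\<^sub>h T) \<mu>\<^sub>h (e T) \<nu> - l2_inner (lebesgue_on T) f (e T) - flux T + K * B T * sqrt (en T)" if T: "T \<in> Th" for T
  proof -
   obtain a where a: "ball a (\<kappa> * diameter T) \<subseteq> T" using regular_ball[OF reg \<open>0 < \<rho>\<close> T] unfolding \<kappa>_def ..
   interpret hho_estimate \<Omega> Th Fh T k a \<kappa> u "\<lambda>F. trace \<Omega> F u" "\<lambda>b. weak_deriv \<Omega> {#b#} u"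
    "\<lambda>l F. trace \<Omega> F (weak_deriv \<Omega> {#l#} u)" "\<lambda>l i. weak_deriv \<Omega> {#l, i#} u" "sqrt (diameter T / real k)" "B T" "\<bar>C\<^sub>t\<^sub>r 1\<bar>"
    unfolding B_def C0_def by (rule hho_estimate_regular[OF T _ \<kappa> a \<open>2 \<le> m\<close> _ u2]) (use tr T um k in \<open>auto simp: broken_sobolev_def\<close>)
   have e_eq: "e T = (\<lambda>x. u\<^sub>h T x - A x)" by (simp add: e_def[abs_def] proj_elems_def)
   have \<nu>I_eq: "\<nu>I = (\<lambda>F. l2_proj (face_measure F) k (trace \<Omega> F u))" by (simp add: \<nu>I_def proj_faces_def[abs_def])
   have b: "bsq \<mu>\<^sub>h" "bsq \<nu>"
    unfolding bsq_def by (auto simp: elem_faces_iff intro!: poly_measureD[OF poly_measure_face] \<mu>h \<nu>)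
   have ae: "AE x in face_measure F. \<mu>\<^sub>h F x - \<nu>I F x = \<nu> F x" if F: "F \<in> faces" for F
   proof (cases "F \<subseteq> frontier \<Omega>")
    case True
    have "F \<in> Fh" using F by (simp add: elem_faces_iff)
    then have z: "\<forall>x\<in>F. \<mu>\<^sub>h F x = 0" using hho True by (simp add: hho_solution_def face_space_def)
    have "AE x in face_measure F. \<mu>\<^sub>h F x = 0" by (rule AE_I2) (use z in simp)
    then show ?thesis using interpolant_boundary[OF u10 F True, of k] unfolding \<nu>I_eq by eventually_elim (simp add: \<nu>_def True)
   qed (simp add: \<nu>_def)
   have fe: "(\<Sum>b\<in>Basis. - l2_inner L (?w b) (e T)) = l2_inner L f (e T)"
   proof -
    have e: "e T \<in> poly_space k" unfolding e_eq by (rule poly_diff[OF uh[OF T] A])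
    note D = elem_subset[OF T] convex_domain.Dl[OF domain_\<Omega>] Dl
    have w: "L2 L (\<lambda>x. - ?w b x)" if "b \<in> Basis" for b
     by (intro L2_minus greenD(3)[OF v[OF that] that])
    have "l2_inner L f (e T) = l2_inner L (\<lambda>x. \<Sum>b\<in>Basis. - ?w b x) (e T)"
     using AE_subdomain[OF D weak_solution_laplacian[OF domain_\<Omega> f sol u2]] L2_subdomain(1)[OF D f]
     by (intro l2_inner_cong_AE) (auto intro!: L2_measurable L2_sum w poly_sq[OF e])
    also have "... = (\<Sum>b\<in>Basis. - l2_inner L (?w b) (e T))"
     by (subst l2_inner_sum_left) (auto simp: w poly_sq[OF e])
    finally show ?thesis ..
   qed
   have "flux T = (\<Sum>b\<in>Basis. bi (\<lambda>F x. (nrm F \<bullet> b) * trace \<Omega> F (weak_deriv \<Omega> {#b#} u) x) \<nu>)"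
    unfolding flux_def bi_def by (simp only: l2_inner_cmult_left)
   moreover have "K = real DIM('a) * (1 + \<bar>C\<^sub>t\<^sub>r 1\<bar>) + C2" unfolding K_def d_def C2_eq ..
   ultimately show ?thesis
    using error_bound[OF uh[OF T] b, OF ae[unfolded \<nu>I_eq]] poly_diff[OF uh[OF T] A] fe unfolding en_def e_eq \<nu>I_eq by simp
  qed
  define N where "N = sqrt (\<Sum>T\<in>Th. en T)"
  have N2: "N^2 = (\<Sum>T\<in>Th. en T)" using step by (simp add: N_def sum_nonneg)
  have N0: "0 \<le> N" using step by (simp add: N_def sum_nonneg)
  have flux: "(\<Sum>T\<in>Th. flux T) = 0"
   unfolding flux_def by (subst sum.swap, rule sum.neutral, rule ballI, rule normal_flux_cancel) (simp add: \<nu>_def)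
  have galerkin: "(\<Sum>T\<in>Th. local_form k Fh T (u\<^sub>h T) \<mu>\<^sub>h (e T) \<nu>) = (\<Sum>T\<in>Th. l2_inner (lebesgue_on T) f (e T))"
  proof -
   have "e \<in> elem_space k Th" "\<nu> \<in> face_space k \<Omega> Fh" using step \<nu> by (simp_all add: elem_space_def face_space_def \<nu>_def)
   then have "hho_form k Th Fh (u\<^sub>h, \<mu>\<^sub>h) (e, \<nu>) = l2_inner (lebesgue_on \<Omega>) f (glue Th e)" using hho by (simp add: hho_solution_def)
   also have "... = (\<Sum>T\<in>Th. l2_inner (lebesgue_on T) f (e T))" by (rule glue_inner[OF f]) (use step smooth_poly in blast)
   finally show ?thesis by (simp add: hho_form_def)
  qed
  \<comment> \<open>After summation the discrete equation cancels the first two terms and the fluxes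
    cancel across faces; the consistency terms remain, and a discrete Cauchy-Schwarz inequality lets
    one factor N be divided out.\<close>
  have "N^2 \<le> (\<Sum>T\<in>Th. local_form k Fh T (u\<^sub>h T) \<mu>\<^sub>h (e T) \<nu> - l2_inner (lebesgue_on T) f (e T) - flux T + K * B T * sqrt (en T))"
   unfolding N2 by (rule sum_mono) (use step in blast)
  also have "... = K * (\<Sum>T\<in>Th. B T * sqrt (en T))"
   by (simp add: sum.distrib sum_subtractf galerkin flux sum_distrib_left mult.assoc)
  also have "... \<le> K * (\<Sum>T\<in>Th. \<bar>B T\<bar> * \<bar>sqrt (en T)\<bar>)"
   by (intro mult_left_mono sum_mono K) (simp add: abs_mult[symmetric])
  also have "... \<le> K * (L2_set B Th * L2_set (\<lambda>T. sqrt (en T)) Th)" by (intro mult_left_mono L2_set_mult_ineq K)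
  also have "L2_set (\<lambda>T. sqrt (en T)) Th = N" using step by (simp add: L2_set_def N_def cong: sum.cong)
  finally have "N * N \<le> (K * L2_set B Th) * N" by (simp add: power2_eq_square mult.assoc)
  then have NB: "N \<le> K * L2_set B Th" using N0 K L2_set_nonneg[of B Th] by (cases "N = 0") auto
  define H where "H = (mesh_size Th / real k) ^ (m - 1)"
  have diam: "0 \<le> diameter T" "diameter T \<le> mesh_size Th" if "T \<in> Th" for T
   using that finite_Th elem(3)[OF that] by (auto simp: mesh_size_def diameter_ge_0)
  \<comment> \<open>A mesh of a nonempty domain has an element; without one,
    \<open>mesh_size\<close> would be the maximum of an empty set and its sign unknown.\<close>
  obtain T0 where "T0 \<in> Th" using cover open_polytopeD(4)[OF \<Omega>] closure_subset[of \<Omega>] by fastforce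
  then have H0: "0 \<le> H" using diam[of T0] unfolding H_def by (intro zero_le_power divide_nonneg_nonneg) auto
  have sn: "0 \<le> sobolev_norm m T u" for T by (simp add: sobolev_norm_def sum_nonneg)
  have "L2_set B Th \<le> L2_set (\<lambda>T. (C0 * H) * sobolev_norm m T u) Th"
   unfolding B_def H_def
   by (intro L2_set_mono mult_right_mono mult_left_mono power_mono divide_right_mono mult_nonneg_nonneg C0 zero_le_power divide_nonneg_nonneg sn diam) auto
  also have "... = (C0 * H) * broken_norm m Th u"
   unfolding broken_norm_def L2_set_def[symmetric] using C0 H0 by (intro L2_set_right_distrib[symmetric]) simp
  finally have "N \<le> K * ((C0 * H) * broken_norm m Th u)" by (intro order_trans[OF NB] mult_left_mono K)
  also have "... \<le> (K * C0 + 1) * H * broken_norm m Th u"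
  proof -
   have "0 \<le> H * broken_norm m Th u" using H0 by (simp add: broken_norm_def sum_nonneg)
   then show ?thesis by (simp add: algebra_simps)
  qed
  also have "N = hho_norm k Th Fh (\<lambda>T x. u\<^sub>h T x - proj_elems k u T x, \<lambda>F x. \<mu>\<^sub>h F x - proj_faces k \<Omega> u F x)"
   by (simp add: N_def hho_norm_def hho_form_def en_def[abs_def] e_def[abs_def] \<nu>I_def)
  finally show "hho_norm k Th Fh (\<lambda>T x. u\<^sub>h T x - proj_elems k u T x, \<lambda>F x. \<mu>\<^sub>h F x - proj_faces k \<Omega> u F x)
     \<le> (K * C0 + 1) * (mesh_size Th / real k) ^ (m - 1) * broken_norm m Th u" by (simp only: H_def)
 qed
qed

end
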